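(* Let $\sigma>0$ and assume that $\sigma<4/(N-4)$ if $N\ge5$, $\alpha>0$ and $\beta>2\sqrt{\alpha}$. Then any solution $u$ to the minimization problem $$\overline m=\inf_{u\in\overline M}J_{1,\beta,\alpha}(u)$$ (i.e. any $u\in\overline M$ with $J_{1,\beta,\alpha}(u)=\overline m$) has the form $e^{i\tau}U$, for some $\tau\in\mathbb{R}$, where $U$ is real-valued and does not change sign. Moreover, assuming (without loss of generality) $U>0$ and $U(0)=\max_{\mathbb{R}^N}U$, we have $U=U^*$ and $\partial_rU(x)<0$ for every $x\ne0$.
   Context: $\overline M=\{u\in H^2(\mathbb{R}^N;\mathbb{C}):\int_{\mathbb{R}^N}|u|^{2\sigma+2}\,dx=1\}$ and $$J_{1,\beta,\alpha}(u)=\int_{\mathbb{R}^N}|\Delta u|^2\,dx+\beta\int_{\mathbb{R}^N}|\nabla u|^2\,dx+\alpha\int_{\mathbb{R}^N}|u|^2\,dx .$$ For a nonnegative measurable function $f$ on $\mathbb{R}^N$ vanishing at infinity, $f^*$ denotes its Schwarz symmetrization: the radially symmetric, radially non-increasing function equimeasurable with $f$. $\partial_r$ is the radial derivative. *)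

theory Defs
  imports "HOL-Analysis.Analysis"
begin

section \<open>Test functions and weak derivatives\<close>

definition pderiv_at :: "'n \<Rightarrow> (real ^ 'n \<Rightarrow> real) \<Rightarrow> real ^ 'n \<Rightarrow> real" where
  "pderiv_at i f x = frechet_derivative f (at x) (axis i 1)"

primrec Ck :: "nat \<Rightarrow> (real ^ 'n \<Rightarrow> real) \<Rightarrow> bool" where
  "Ck 0 f \<longleftrightarrow> continuous_on UNIV f"
| "Ck (Suc k) f \<longleftrightarrow> (\<forall>x. f differentiable at x) \<and> (\<forall>i. Ck k (pderiv_at i f))"

definition test_function :: "(real ^ 'n \<Rightarrow> real) \<Rightarrow> bool" where
  "test_function \<phi> \<longleftrightarrow> (\<forall>k. Ck k \<phi>) \<and> compact (closure {x. \<phi> x \<noteq> 0})"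

definition locally_integrable :: "(real ^ 'n \<Rightarrow> complex) \<Rightarrow> bool" where
  "locally_integrable f \<longleftrightarrow>
     f \<in> borel_measurable lborel \<and> (\<forall>K. compact K \<longrightarrow> set_integrable lborel K f)"

text \<open>Real-valued test functions suffice for complex-valued \<open>f\<close>, since the identity is
  complex-linear in the test function.\<close>

definition is_weak_pderiv ::
    "'n \<Rightarrow> (real ^ 'n \<Rightarrow> complex) \<Rightarrow> (real ^ 'n \<Rightarrow> complex) \<Rightarrow> bool" where
  "is_weak_pderiv i f g \<longleftrightarrow> locally_integrable f \<and> locally_integrable g \<and>
     (\<forall>\<phi>. test_function \<phi> \<longrightarrow>
        (LINT x|lborel. pderiv_at i \<phi> x *\<^sub>R f x) = - (LINT x|lborel. \<phi> x *\<^sub>R g x))"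

text \<open>Weak derivatives are unique only up to null sets; \<open>weak_pderiv\<close> picks a representative.
  It is meaningful only when a weak derivative exists.\<close>

definition weak_pderiv :: "'n \<Rightarrow> (real ^ 'n \<Rightarrow> complex) \<Rightarrow> real ^ 'n \<Rightarrow> complex" where
  "weak_pderiv i f = (SOME g. is_weak_pderiv i f g)"

definition weak_laplacian :: "(real ^ 'n \<Rightarrow> complex) \<Rightarrow> real ^ 'n \<Rightarrow> complex" where
  "weak_laplacian f x = (\<Sum>i\<in>UNIV. weak_pderiv i (weak_pderiv i f) x)"

definition weak_grad_sq :: "(real ^ 'n \<Rightarrow> complex) \<Rightarrow> real ^ 'n \<Rightarrow> real" where
  "weak_grad_sq f x = (\<Sum>i\<in>UNIV. (norm (weak_pderiv i f x))\<^sup>2)"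

section \<open>The Sobolev space and the minimization problem\<close>

definition square_integrable :: "(real ^ 'n \<Rightarrow> complex) \<Rightarrow> bool" where
  "square_integrable f \<longleftrightarrow>
     f \<in> borel_measurable lborel \<and> integrable lborel (\<lambda>x. (norm (f x))\<^sup>2)"

text \<open>Elements of \<open>H\<^sup>k\<close> are represented by (Borel measurable) functions, not by classes modulo
  null sets.\<close>

primrec sobolev_H :: "nat \<Rightarrow> (real ^ 'n \<Rightarrow> complex) \<Rightarrow> bool" where
  "sobolev_H 0 u \<longleftrightarrow> square_integrable u"
| "sobolev_H (Suc k) u \<longleftrightarrow>
     square_integrable u \<and> (\<forall>i. \<exists>g. is_weak_pderiv i u g \<and> sobolev_H k g)"

definition Mbar :: "real \<Rightarrow> (real ^ 'n \<Rightarrow> complex) set" where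
  "Mbar \<sigma> = {u. sobolev_H 2 u \<and>
     has_bochner_integral lborel (\<lambda>x. norm (u x) powr (2 * \<sigma> + 2)) 1}"

definition J1 :: "real \<Rightarrow> real \<Rightarrow> (real ^ 'n \<Rightarrow> complex) \<Rightarrow> real" where
  "J1 \<beta> \<alpha> u = (LINT x|lborel. (norm (weak_laplacian u x))\<^sup>2)
             + \<beta> * (LINT x|lborel. weak_grad_sq u x)
             + \<alpha> * (LINT x|lborel. (norm (u x))\<^sup>2)"

definition is_minimizer :: "real \<Rightarrow> real \<Rightarrow> real \<Rightarrow> (real ^ 'n \<Rightarrow> complex) \<Rightarrow> bool" where
  "is_minimizer \<sigma> \<beta> \<alpha> u \<longleftrightarrow>
     u \<in> Mbar \<sigma> \<and> J1 \<beta> \<alpha> u = (INF v\<in>(Mbar \<sigma> :: (real ^ 'n \<Rightarrow> complex) set). J1 \<beta> \<alpha> v)"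

section \<open>Schwarz symmetrization and the radial derivative\<close>

text \<open>The open ball centred at the origin that has the same volume as \<open>A\<close>
  (see \<open>emeasure_ball_rearrangement\<close>).\<close>

definition ball_rearrangement :: "(real ^ 'n) set \<Rightarrow> (real ^ 'n) set" where
  "ball_rearrangement A = {x. emeasure lborel (ball (0 :: real ^ 'n) (norm x)) < emeasure lborel A}"

text \<open>The layer-cake definition, which selects the lower semicontinuous representative. The value
  lies in \<open>ennreal\<close> because the symmetrization of an unbounded function is infinite at the origin.
  The defining properties (radial, radially non-increasing, equimeasurable) are derived below.\<close>

definition schwarz_symmetrization :: "(real ^ 'n \<Rightarrow> real) \<Rightarrow> real ^ 'n \<Rightarrow> ennreal" where
  "schwarz_symmetrization f x =
     (SUP t\<in>{t. 0 \<le> t \<and> x \<in> ball_rearrangement {y. t < f y}}. ennreal t)"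

lemma ball_rearrangement_cases:
  fixes A :: "(real ^ 'n) set"
  obtains "emeasure lborel A = \<infinity>" "ball_rearrangement A = UNIV"
  | r where "0 \<le> r" "emeasure lborel (ball (0 :: real ^ 'n) r) = emeasure lborel A"
      "ball_rearrangement A = ball 0 r"
proof (cases "emeasure lborel A = \<infinity>")
  case True
  have "ball_rearrangement A = UNIV"
    unfolding ball_rearrangement_def True
    by (auto simp: emeasure_ball ennreal_less_top)
  with True that(1) show ?thesis by blast
next
  case False
  let ?n = "CARD('n)"
  let ?c = "unit_ball_vol (real ?n)"
  obtain m where m: "0 \<le> m" "emeasure lborel A = ennreal m"
    using False by (cases "emeasure lborel A") auto
  have c: "?c > 0" by simp
  define r where "r = root ?n (m / ?c)"
  have r: "0 \<le> r" using m c by (simp add: r_def)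
  have "0 \<le> m / ?c" using m c by (intro divide_nonneg_pos)
  hence "r ^ ?n = m / ?c" unfolding r_def by (intro real_root_pow_pos2) auto
  moreover have "?c * (m / ?c) = m" using less_imp_neq[OF c] by (metis nonzero_mult_div_cancel_left times_divide_eq_right)
  ultimately have rn: "?c * r ^ ?n = m" by simp
  have e1: "emeasure lborel (ball (0 :: real ^ 'n) s) = ennreal (?c * s ^ ?n)" if "0 \<le> s" for s
    using that by (simp add: emeasure_ball)
  have "x \<in> ball_rearrangement A \<longleftrightarrow> norm x < r" for x
  proof -
    have "x \<in> ball_rearrangement A \<longleftrightarrow> ?c * norm x ^ ?n < ?c * r ^ ?n"
      unfolding ball_rearrangement_def using m r c by (simp add: e1 ennreal_less_iff flip: rn)
    also have "\<dots> \<longleftrightarrow> norm x ^ ?n < r ^ ?n" using c by simp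
    also have "\<dots> \<longleftrightarrow> norm x < r"
      using r by (metis norm_ge_zero power_less_imp_less_base power_strict_mono zero_less_card_finite)
    finally show ?thesis .
  qed
  hence "ball_rearrangement A = ball 0 r" by (simp add: set_eq_iff)
  moreover have "emeasure lborel (ball (0 :: real ^ 'n) r) = emeasure lborel A"
    unfolding e1[OF r] rn m(2) ..
  ultimately show ?thesis using that(2)[OF r] by blast
qed

lemma emeasure_ball_rearrangement:
  fixes A :: "(real ^ 'n) set"
  shows "emeasure lborel (ball_rearrangement A) = emeasure lborel A"
proof (cases A rule: ball_rearrangement_cases)
  case 1 then show ?thesis by (simp add: emeasure_lborel_UNIV)
next
  case (2 r) then show ?thesis by simp
qed

lemma less_schwarz_symmetrization_iff:
  fixes f :: "real ^ 'n \<Rightarrow> real"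
  assumes f: "f \<in> borel_measurable borel" and t: "0 \<le> t"
  shows "ennreal t < schwarz_symmetrization f x \<longleftrightarrow> x \<in> ball_rearrangement {y. t < f y}"
proof
  have meas [measurable]: "{y. s < f y} \<in> sets lborel" for s
    using f by measurable
  {
    assume "ennreal t < schwarz_symmetrization f x"
    then obtain s where s: "0 \<le> s" "x \<in> ball_rearrangement {y. s < f y}" "ennreal t < ennreal s"
      unfolding schwarz_symmetrization_def less_SUP_iff by auto
    hence "{y. s < f y} \<subseteq> {y. t < f y}" using t by (auto simp: ennreal_less_iff)
    hence "emeasure lborel {y. s < f y} \<le> emeasure lborel {y. t < f y}"
      by (intro emeasure_mono meas)
    with s(2) show "x \<in> ball_rearrangement {y. t < f y}"
      by (auto simp: ball_rearrangement_def)
  }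
  assume x: "x \<in> ball_rearrangement {y. t < f y}"
  let ?A = "\<lambda>n::nat. {y. t + inverse (real (Suc n)) < f y}"
  have U: "(\<Union>n. ?A n) = {y. t < f y}"
  proof (intro equalityI subsetI)
    fix y assume "y \<in> {y. t < f y}"
    then obtain n where "inverse (real (Suc n)) < f y - t"
      using reals_Archimedean[of "f y - t"] by auto
    thus "y \<in> (\<Union>n. ?A n)" by (auto intro!: exI[of _ n])
  next
    fix y assume "y \<in> (\<Union>n. ?A n)"
    then obtain n where "t + inverse (real (Suc n)) < f y" by auto
    moreover have "0 < inverse (real (Suc n))" by simp
    ultimately have "t < f y" by linarith
    thus "y \<in> {y. t < f y}" by simp
  qed
  have "incseq ?A"
  proof (intro monoI subsetI)
    fix m n :: nat and y assume "m \<le> n" "y \<in> ?A m"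
    moreover from \<open>m \<le> n\<close> have "inverse (real (Suc n)) \<le> inverse (real (Suc m))"
      by (intro le_imp_inverse_le) auto
    moreover have "t + inverse (real (Suc m)) < f y" using \<open>y \<in> ?A m\<close> by simp
    ultimately have "t + inverse (real (Suc n)) < f y" by linarith
    thus "y \<in> ?A n" by simp
  qed
  moreover have "range ?A \<subseteq> sets lborel" using meas by blast
  ultimately have "(SUP n. emeasure lborel (?A n)) = emeasure lborel {y. t < f y}"
    unfolding U[symmetric] by (intro SUP_emeasure_incseq)
  with x have "emeasure lborel (ball (0 :: real ^ 'n) (norm x)) < (SUP n. emeasure lborel (?A n))"
    by (simp add: ball_rearrangement_def)
  then obtain n where n: "x \<in> ball_rearrangement (?A n)"
    unfolding less_SUP_iff ball_rearrangement_def by auto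
  let ?s = "t + inverse (real (Suc n))"
  have s: "t < ?s" by simp
  hence "ennreal t < ennreal ?s" using t by (subst ennreal_less_iff) auto
  also have "ennreal ?s \<le> schwarz_symmetrization f x"
    unfolding schwarz_symmetrization_def using n s t by (intro SUP_upper) (auto simp del: of_nat_Suc)
  finally show "ennreal t < schwarz_symmetrization f x" .
qed

lemma schwarz_symmetrization_antimono:
  assumes "norm x \<le> norm y"
  shows "schwarz_symmetrization f y \<le> schwarz_symmetrization f x"
proof -
  have "ball (0 :: real ^ 'n) (norm x) \<subseteq> ball 0 (norm y)" using assms by auto
  hence "emeasure lborel (ball (0 :: real ^ 'n) (norm x)) \<le> emeasure lborel (ball (0 :: real ^ 'n) (norm y))"
    by (intro emeasure_mono) auto
  thus ?thesis
    unfolding schwarz_symmetrization_def ball_rearrangement_def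
    by (intro SUP_subset_mono) (auto intro: le_less_trans)
qed

lemma schwarz_symmetrization_radial:
  "norm x = norm y \<Longrightarrow> schwarz_symmetrization f x = schwarz_symmetrization f y"
  by (intro antisym schwarz_symmetrization_antimono) auto

lemma schwarz_symmetrization_equimeasurable:
  fixes f :: "real ^ 'n \<Rightarrow> real"
  assumes "f \<in> borel_measurable borel" "0 \<le> t"
  shows "emeasure lborel {x. ennreal t < schwarz_symmetrization f x} = emeasure lborel {x. t < f x}"
  using assms by (simp add: less_schwarz_symmetrization_iff emeasure_ball_rearrangement)

text \<open>Here \<open>sgn x = x / norm x\<close>.\<close>

definition has_radial_derivative :: "(real ^ 'n \<Rightarrow> real) \<Rightarrow> real \<Rightarrow> real ^ 'n \<Rightarrow> bool" where
  "has_radial_derivative U D x \<longleftrightarrow>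
     ((\<lambda>r. U (r *\<^sub>R sgn x)) has_real_derivative D) (at (norm x))"

text \<open>The normalization \<open>U > 0\<close>, \<open>U(0) = max U\<close> of the real profile of \<open>u\<close>, reached by changing
  the phase by \<open>\<pi>\<close> if necessary and translating. Pointwise properties of \<open>U\<close> refer
  to its continuous representative.\<close>

definition normalized_profile ::
    "(real ^ 'n \<Rightarrow> complex) \<Rightarrow> real \<Rightarrow> real ^ 'n \<Rightarrow> (real ^ 'n \<Rightarrow> real) \<Rightarrow> bool" where
  "normalized_profile u \<tau> x\<^sub>0 U \<longleftrightarrow>
     continuous_on UNIV U \<and>
     (AE x in lborel. u x = exp (\<i> * of_real \<tau>) * of_real (U (x - x\<^sub>0))) \<and>
     (\<forall>x. 0 < U x) \<and> (\<forall>x. U x \<le> U 0)"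

end

theory Submission
  imports Defs "HOL-Probability.Distributions"
begin

text \<open>With \<open>b = \<beta> / 2\<close> and \<open>\<gamma> = b\<^sup>2 - \<alpha> > 0\<close> the functional is the square norm of \<open>(b - \<Delta>) u\<close>
  minus \<open>\<gamma>\<close> times the square norm of \<open>u\<close>. Substituting \<open>u = k * g\<close>, where \<open>k\<close> is the kernel of the inverse
  of \<open>b - \<Delta>\<close>, turns the problem into one for \<open>g\<close> in \<open>L\<^sup>2\<close>. Since \<open>k\<close> is positive, replacing
  \<open>g\<close> by its modulus keeps the square norm of \<open>g\<close> and enlarges \<open>k * g\<close> pointwise; equality forces a constant phase.

  For symmetry the real profile \<open>U = k * F\<close> with \<open>F = k * h(U)\<close>, \<open>h\<close> increasing, is compared
  with its polarization in a hyperplane. As \<open>k\<close> is strictly radially decreasing, polarizing \<open>F\<close> does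
  not increase the dual functional, so equality holds in the polarization inequality. This makes the
  differences of \<open>U\<close> and of \<open>F\<close> with their reflections of one sign on each half space, and the positive
  kernel makes this sign strict unless both functions are symmetric. A hyperplane that does not
  contain a maximum point cannot be one of symmetry, since \<open>U\<close> would become periodic, although it
  vanishes at infinity. Taking bisecting hyperplanes, \<open>U\<close> and \<open>F\<close> are strictly radially decreasing
  about a maximum point, and differentiating \<open>k * F\<close> shows that the radial derivative is negative.\<close>

section \<open>Square integrable functions and convolution kernels\<close>

text \<open>The hypothesis on \<open>\<beta>\<close> is exactly \<open>\<gamma> > 0\<close>, and the
  sign matters: enlarging the square norm of \<open>k * g\<close> lowers the functional, and
  enlarging its constraint integral helps through homogeneity, so rearranging \<open>g\<close> at
  fixed square norm pays on both counts. Taking the modulus of \<open>u\<close> or polarizing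
  \<open>u\<close> itself need not stay in H^2; therefore all comparisons are made on
  \<open>g\<close>, which merely has to lie in L^2.

  The kernel is a time integral of heat kernels, so that positivity, strict radial decrease, the
  inverse property and the gradient bound can be read off at each time. Convolutions of the kernel
  with test functions have explicit weak derivatives; the variational inequality is proved for them
  and extended to L^2 by density. The bound on \<open>\<sigma>\<close> enters through boundedness of
  \<open>U\<close>: two applications of the kernel tolerate a time singularity of order less than 2.
  Boundedness makes \<open>U\<close> and \<open>F\<close> continuous, and this turns the almost
  everywhere information of the equality cases into pointwise statements.\<close>

lemma integrable_mult_of_square:
  fixes f g :: "'a \<Rightarrow> real"
  assumes [measurable]: "f \<in> borel_measurable M" "g \<in> borel_measurable M"
    and "integrable M (\<lambda>x. (f x)\<^sup>2)" "integrable M (\<lambda>x. (g x)\<^sup>2)"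
  shows "integrable M (\<lambda>x. f x * g x)"
proof (rule Bochner_Integration.integrable_bound)
  show "integrable M (\<lambda>x. (f x)\<^sup>2 + (g x)\<^sup>2)" using assms by simp
  show "AE x in M. norm (f x * g x) \<le> norm ((f x)\<^sup>2 + (g x)\<^sup>2)"
  proof (intro AE_I2)
    fix x
    have "0 \<le> (\<bar>f x\<bar> - \<bar>g x\<bar>)\<^sup>2" "0 \<le> (f x)\<^sup>2" "0 \<le> (g x)\<^sup>2" by simp_all
    moreover have "(\<bar>f x\<bar> - \<bar>g x\<bar>)\<^sup>2 = (f x)\<^sup>2 + (g x)\<^sup>2 - 2 * \<bar>f x * g x\<bar>"
      by (simp add: power2_diff abs_mult)
    ultimately show "norm (f x * g x) \<le> norm ((f x)\<^sup>2 + (g x)\<^sup>2)"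
      unfolding real_norm_def by (smt (verit))
  qed
qed measurable

lemma integral_Cauchy_Schwarz:
  fixes f g :: "'a \<Rightarrow> real"
  assumes fm [measurable]: "f \<in> borel_measurable M" and gm [measurable]: "g \<in> borel_measurable M"
    and f: "integrable M (\<lambda>x. (f x)\<^sup>2)" and g: "integrable M (\<lambda>x. (g x)\<^sup>2)"
  shows "(LINT x|M. f x * g x)\<^sup>2 \<le> (LINT x|M. (f x)\<^sup>2) * (LINT x|M. (g x)\<^sup>2)"
proof -
  define A B C where "A = (LINT x|M. (f x)\<^sup>2)" and "B = (LINT x|M. (g x)\<^sup>2)"
    and "C = (LINT x|M. f x * g x)"
  have fg: "integrable M (\<lambda>x. f x * g x)" by (rule integrable_mult_of_square) fact+
  have q: "0 \<le> A + 2 * s * C + s\<^sup>2 * B" for s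
  proof -
    have "0 \<le> (LINT x|M. (f x + s * g x)\<^sup>2)" by simp
    also have "(\<lambda>x. (f x + s * g x)\<^sup>2) = (\<lambda>x. (f x)\<^sup>2 + 2 * s * (f x * g x) + s\<^sup>2 * (g x)\<^sup>2)"
      by (auto simp: power2_sum power_mult_distrib)
    also have "(LINT x|M. (f x)\<^sup>2 + 2 * s * (f x * g x) + s\<^sup>2 * (g x)\<^sup>2) = A + 2 * s * C + s\<^sup>2 * B"
      using f g fg by (simp add: A_def B_def C_def)
    finally show ?thesis .
  qed
  have B: "0 \<le> B" unfolding B_def by simp
  show ?thesis
  proof (cases "B = 0")
    case True
    have "C = 0"
    proof (rule ccontr)
      assume "C \<noteq> 0"
      \<comment> \<open>With \<open>B = 0\<close> the form is affine in \<open>s\<close>, and this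
        choice gives it the value -1.\<close>
      with q[of "- (A + 1) / (2 * C)"] True show False by (simp add: field_simps)
    qed
    then show ?thesis using True by (simp flip: A_def B_def C_def)
  next
    case False
    then have "0 < B" using B by simp
    with q[of "- C / B"] have "C\<^sup>2 \<le> A * B"
      by (simp add: field_simps power2_eq_square)
    then show ?thesis by (simp flip: A_def B_def C_def)
  qed
qed

definition sq_integrable :: "('a::euclidean_space \<Rightarrow> real) \<Rightarrow> bool" where
  "sq_integrable f \<longleftrightarrow> f \<in> borel_measurable borel \<and> integrable lborel (\<lambda>x. (f x)\<^sup>2)"

lemma sq_integrableD [measurable_dest]: "sq_integrable f \<Longrightarrow> f \<in> borel_measurable borel"
  by (simp add: sq_integrable_def)

lemma sq_integrable_mult: "sq_integrable f \<Longrightarrow> sq_integrable g \<Longrightarrow> integrable lborel (\<lambda>x. f x * g x)"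
  by (rule integrable_mult_of_square) (auto simp: sq_integrable_def)

lemma sq_integrable_square: "sq_integrable f \<Longrightarrow> integrable lborel (\<lambda>x. (f x)\<^sup>2)"
  by (simp add: sq_integrable_def)

lemma sq_integrable_Cauchy_Schwarz:
  "sq_integrable f \<Longrightarrow> sq_integrable g \<Longrightarrow>
    (LINT x|lborel. f x * g x)\<^sup>2 \<le> (LINT x|lborel. (f x)\<^sup>2) * (LINT x|lborel. (g x)\<^sup>2)"
  by (rule integral_Cauchy_Schwarz) (auto simp: sq_integrable_def)

lemma sq_integrable_cmult: "sq_integrable f \<Longrightarrow> sq_integrable (\<lambda>x. c * f x)"
  by (auto simp: sq_integrable_def power_mult_distrib)

lemma sq_integrable_bound:
  assumes "sq_integrable f" "g \<in> borel_measurable borel" "AE x in lborel. \<bar>g x\<bar> \<le> C * \<bar>f x\<bar>"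
  shows "sq_integrable g"
proof -
  have "integrable lborel (\<lambda>x. (g x)\<^sup>2)"
  proof (rule Bochner_Integration.integrable_bound)
    show "integrable lborel (\<lambda>x. (C * f x)\<^sup>2)"
      using sq_integrable_cmult[OF assms(1)] by (simp add: sq_integrable_def)
    show "(\<lambda>x. (g x)\<^sup>2) \<in> borel_measurable lborel" using assms(2) by measurable
    show "AE x in lborel. norm ((g x)\<^sup>2) \<le> norm ((C * f x)\<^sup>2)"
      using assms(3)
    proof eventually_elim
      case (elim x)
      have "C * \<bar>f x\<bar> \<le> \<bar>C * f x\<bar>" by (simp add: abs_mult mult_right_mono)
      with elim have "\<bar>g x\<bar>\<^sup>2 \<le> \<bar>C * f x\<bar>\<^sup>2" by (intro power_mono) auto
      then show ?case by simp
    qed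
  qed
  with assms show ?thesis by (simp add: sq_integrable_def)
qed

lemma sq_integrable_add:
  assumes "sq_integrable f" "sq_integrable g" shows "sq_integrable (\<lambda>x. f x + g x)"
  using assms sq_integrable_mult[OF assms] by (auto simp: sq_integrable_def power2_sum mult.assoc)

lemma sq_integrable_uminus: "sq_integrable f \<Longrightarrow> sq_integrable (\<lambda>x. - f x)"
  using sq_integrable_cmult[of f "-1"] by simp

lemma sq_integrable_diff:
  "sq_integrable f \<Longrightarrow> sq_integrable g \<Longrightarrow> sq_integrable (\<lambda>x. f x - g x)"
  using sq_integrable_add[OF _ sq_integrable_uminus, of f g] by simp

lemma sq_integrable_sum:
  "(\<And>i. i \<in> I \<Longrightarrow> sq_integrable (f i)) \<Longrightarrow> sq_integrable (\<lambda>x. \<Sum>i\<in>I. f i x)"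
  by (induction I rule: infinite_finite_induct) (auto intro: sq_integrable_add simp: sq_integrable_def[of "\<lambda>x. 0"])

lemma sq_integrable_cong_AE:
  "sq_integrable f \<Longrightarrow> g \<in> borel_measurable borel \<Longrightarrow> AE x in lborel. g x = f x \<Longrightarrow> sq_integrable g"
  by (rule sq_integrable_bound[where C = 1 and f = f]) auto

section \<open>Translations and point reflections of Lebesgue measure\<close>

lemma distr_lborel_plus: "distr lborel borel (\<lambda>x. a + x) = (lborel :: 'a::euclidean_space measure)"
  using lborel_affine[of 1 a] by (simp add: density_1)

lemma distr_lborel_minus: "distr lborel borel (\<lambda>x. a - x) = (lborel :: 'a::euclidean_space measure)"
  using lborel_affine[of "-1" a] by (simp add: density_1)

lemma nn_integral_lborel_plus:
  fixes f :: "'a::euclidean_space \<Rightarrow> ennreal"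
  assumes "f \<in> borel_measurable borel"
  shows "(\<integral>\<^sup>+x. f (a + x) \<partial>lborel) = (\<integral>\<^sup>+x. f x \<partial>lborel)"
  using assms by (subst distr_lborel_plus[of a, symmetric]) (simp add: nn_integral_distr)

lemma nn_integral_lborel_minus:
  fixes f :: "'a::euclidean_space \<Rightarrow> ennreal"
  assumes "f \<in> borel_measurable borel"
  shows "(\<integral>\<^sup>+x. f (a - x) \<partial>lborel) = (\<integral>\<^sup>+x. f x \<partial>lborel)"
  using assms by (subst distr_lborel_minus[of a, symmetric]) (simp add: nn_integral_distr)

lemma integral_lborel_plus:
  fixes f :: "'a::euclidean_space \<Rightarrow> 'b::{banach, second_countable_topology}"
  assumes "f \<in> borel_measurable borel"
  shows "(LINT x|lborel. f (a + x)) = (LINT x|lborel. f x)"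
  using assms by (subst distr_lborel_plus[of a, symmetric]) (simp add: integral_distr)

lemma integral_lborel_minus:
  fixes f :: "'a::euclidean_space \<Rightarrow> 'b::{banach, second_countable_topology}"
  assumes "f \<in> borel_measurable borel"
  shows "(LINT x|lborel. f (a - x)) = (LINT x|lborel. f x)"
  using assms by (subst distr_lborel_minus[of a, symmetric]) (simp add: integral_distr)

lemma integrable_lborel_plus:
  fixes f :: "'a::euclidean_space \<Rightarrow> 'b::{banach, second_countable_topology}"
  assumes "integrable lborel f"
  shows "integrable lborel (\<lambda>x. f (a + x))"
proof (rule integrable_distr[where M' = borel and f = f and T = "\<lambda>x. a + x"])
  show "integrable (distr lborel borel ((+) a)) f" using assms by (simp add: distr_lborel_plus)
qed simp

lemma integrable_lborel_minus:
  fixes f :: "'a::euclidean_space \<Rightarrow> 'b::{banach, second_countable_topology}"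
  assumes "integrable lborel f"
  shows "integrable lborel (\<lambda>x. f (a - x))"
proof (rule integrable_distr[where M' = borel and f = f and T = "\<lambda>x. a - x"])
  show "integrable (distr lborel borel ((-) a)) f" using assms by (simp add: distr_lborel_minus)
qed simp

text \<open>Where the integrand is not integrable the Bochner integral is 0 by convention. Hence
  additivity holds only almost everywhere for square integrable arguments
  (\<open>AE_conv_add\<close>), while scaling and changes on null sets (\<open>conv_cmult\<close>,
  \<open>conv_cong_AE\<close>) are harmless at every point.\<close>

definition conv :: "('a::euclidean_space \<Rightarrow> real) \<Rightarrow> ('a \<Rightarrow> real) \<Rightarrow> 'a \<Rightarrow> real" where
  "conv k g x = (LINT y|lborel. k (x - y) * g y)"

text \<open>The properties that make convolution a bounded, self-adjoint and positivity preserving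
  operator on L^2.\<close>

locale even_kernel =
  fixes k :: "'a::euclidean_space \<Rightarrow> real"
  assumes k_meas [measurable]: "k \<in> borel_measurable borel"
    and k_nonneg: "0 \<le> k x"
    and k_int: "integrable lborel k"
    and k_even: "k (- x) = k x"
begin

lemma k_commute: "k (x - y) = k (y - x)"
  using k_even[of "x - y"] by simp

lemma k_shift_int: "integrable lborel (\<lambda>y. k (x - y))"
  by (rule integrable_lborel_minus) (rule k_int)

lemma conv_meas [measurable]:
  assumes [measurable]: "g \<in> borel_measurable borel"
  shows "conv k g \<in> borel_measurable borel"
  unfolding conv_def by measurable

lemma k_shift_integral: "(LINT y|lborel. k (x - y)) = integral\<^sup>L lborel k"
  by (rule integral_lborel_minus) simp

lemma kernel_integrable:
  assumes "integrable lborel a"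
  shows "integrable (lborel \<Otimes>\<^sub>M lborel) (\<lambda>(x, y). k (x - y) * a y)" (is ?a)
    and "integrable (lborel \<Otimes>\<^sub>M lborel) (\<lambda>(x, y). k (x - y) * a x)" (is ?b)
proof -
  have [measurable]: "a \<in> borel_measurable borel" using assms by simp
  have "(\<integral>\<^sup>+y. ennreal (norm (a y)) \<partial>lborel) < \<infinity>" using assms by (simp add: integrable_iff_bounded)
  moreover have "(\<integral>\<^sup>+y. ennreal (k y) \<partial>lborel) < \<infinity>"
    using k_int by (simp add: integrable_iff_bounded k_nonneg)
  ultimately have fin: "(\<integral>\<^sup>+y. ennreal (k y) \<partial>lborel) * (\<integral>\<^sup>+y. ennreal (norm (a y)) \<partial>lborel) < \<infinity>"
    by (simp add: ennreal_mult_less_top)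
  have s: "(\<integral>\<^sup>+x. ennreal (k (x - y)) \<partial>lborel) = (\<integral>\<^sup>+x. ennreal (k x) \<partial>lborel)" for y
    using nn_integral_lborel_minus[of "\<lambda>x. ennreal (k x)" y] by (simp add: k_commute)
  have "(\<integral>\<^sup>+z. ennreal (norm (case z of (x, y) \<Rightarrow> k (x - y) * a y)) \<partial>(lborel \<Otimes>\<^sub>M lborel))
      = (\<integral>\<^sup>+y. \<integral>\<^sup>+x. ennreal (k (x - y)) * ennreal (norm (a y)) \<partial>lborel \<partial>lborel)"
    by (subst lborel_pair.nn_integral_snd[symmetric]) (auto simp: abs_mult ennreal_mult k_nonneg)
  also have "\<dots> = (\<integral>\<^sup>+y. ennreal (k y) \<partial>lborel) * (\<integral>\<^sup>+y. ennreal (norm (a y)) \<partial>lborel)"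
    by (simp add: nn_integral_multc nn_integral_cmult s)
  finally show ?a using fin by (intro integrableI_bounded) (auto simp: less_top)
  have "(\<integral>\<^sup>+z. ennreal (norm (case z of (x, y) \<Rightarrow> k (x - y) * a x)) \<partial>(lborel \<Otimes>\<^sub>M lborel))
      = (\<integral>\<^sup>+x. \<integral>\<^sup>+y. ennreal (k (y - x)) * ennreal (norm (a x)) \<partial>lborel \<partial>lborel)"
    by (subst lborel.nn_integral_fst[symmetric]) (auto simp: abs_mult ennreal_mult k_nonneg k_commute)
  also have "\<dots> = (\<integral>\<^sup>+y. ennreal (k y) \<partial>lborel) * (\<integral>\<^sup>+y. ennreal (norm (a y)) \<partial>lborel)"
    by (simp add: nn_integral_multc nn_integral_cmult s)
  finally show ?b using fin by (intro integrableI_bounded) (auto simp: less_top)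
qed

text \<open>Since \<open>\<bar>g\<bar> \<le> 1 + g\<^sup>2\<close>, both claims follow from
  integrability of the kernel and of \<open>k (x - y) * (g y)\<^sup>2\<close>; the latter holds for
  almost every \<open>x\<close> by Fubini, as the square of \<open>g\<close> is integrable.\<close>

lemma AE_conv_integrable:
  assumes g: "sq_integrable g"
  shows "AE x in lborel. integrable lborel (\<lambda>y. k (x - y) * g y) \<and> integrable lborel (\<lambda>y. k (x - y) * (g y)\<^sup>2)"
proof -
  have [measurable]: "g \<in> borel_measurable borel" using g by measurable
  have "AE x in lborel. integrable lborel (\<lambda>y. k (x - y) * (g y)\<^sup>2)"
    using lborel_pair.AE_integrable_fst'[OF kernel_integrable(1)[OF sq_integrable_square[OF g]]] by simp
  then show ?thesis
  proof eventually_elim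
    case (elim x)
    have "integrable lborel (\<lambda>y. k (x - y) * g y)"
    proof (rule Bochner_Integration.integrable_bound)
      show "integrable lborel (\<lambda>y. k (x - y) + k (x - y) * (g y)\<^sup>2)"
        using elim k_shift_int by simp
      show "AE y in lborel. norm (k (x - y) * g y) \<le> norm (k (x - y) + k (x - y) * (g y)\<^sup>2)"
      proof (intro AE_I2)
        fix y
        have "\<bar>g y\<bar> \<le> 1 + (g y)\<^sup>2"
        proof (cases "\<bar>g y\<bar> \<le> 1")
          case True
          then show ?thesis using zero_le_power2[of "g y"] by linarith
        next
          case False
          then have "\<bar>g y\<bar> * 1 \<le> \<bar>g y\<bar> * \<bar>g y\<bar>" by (intro mult_left_mono) auto
          then show ?thesis by (simp add: power2_eq_square flip: abs_mult)
        qed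
        then have "k (x - y) * \<bar>g y\<bar> \<le> k (x - y) * (1 + (g y)\<^sup>2)" by (intro mult_left_mono k_nonneg)
        then show "norm (k (x - y) * g y) \<le> norm (k (x - y) + k (x - y) * (g y)\<^sup>2)"
          using k_nonneg[of "x - y"] by (simp add: abs_mult algebra_simps)
      qed
    qed measurable
    with elim show ?case by simp
  qed
qed

text \<open>Cauchy-Schwarz for the measure with density \<open>k (x - y)\<close>, obtained by
  splitting the kernel into two square roots.\<close>

lemma conv_square_le:
  assumes g: "sq_integrable g" and i: "integrable lborel (\<lambda>y. k (x - y) * (g y)\<^sup>2)"
  shows "(conv k g x)\<^sup>2 \<le> integral\<^sup>L lborel k * conv k (\<lambda>y. (g y)\<^sup>2) x"
proof -
  have [measurable]: "g \<in> borel_measurable borel" using g by measurable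
  have "(LINT y|lborel. sqrt (k (x - y)) * (sqrt (k (x - y)) * g y))\<^sup>2
      \<le> (LINT y|lborel. (sqrt (k (x - y)))\<^sup>2) * (LINT y|lborel. (sqrt (k (x - y)) * g y)\<^sup>2)"
    using i k_shift_int by (intro integral_Cauchy_Schwarz) (auto simp: power_mult_distrib k_nonneg)
  moreover have "(\<lambda>y. sqrt (k (x - y)) * (sqrt (k (x - y)) * g y)) = (\<lambda>y. k (x - y) * g y)"
    using k_nonneg by (auto simp flip: mult.assoc)
  ultimately show ?thesis
    using k_nonneg by (simp add: conv_def power_mult_distrib k_shift_integral)
qed

text \<open>Young's inequality for an L^1 kernel acting on L^2: the pointwise bound
  \<open>conv_square_le\<close> is integrated with Fubini.\<close>

lemma sq_integrable_conv:
  assumes g: "sq_integrable g"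
  shows "sq_integrable (conv k g)"
    and "(LINT x|lborel. (conv k g x)\<^sup>2) \<le> (integral\<^sup>L lborel k)\<^sup>2 * (LINT x|lborel. (g x)\<^sup>2)"
proof -
  have [measurable]: "g \<in> borel_measurable borel" using g by measurable
  let ?K = "integral\<^sup>L lborel k"
  note ki = kernel_integrable(1)[OF sq_integrable_square[OF g]]
  have ci: "integrable lborel (conv k (\<lambda>y. (g y)\<^sup>2))"
    using lborel_pair.integrable_fst'[OF ki] by (simp add: conv_def[abs_def])
  have le: "AE x in lborel. (conv k g x)\<^sup>2 \<le> ?K * conv k (\<lambda>y. (g y)\<^sup>2) x"
    using AE_conv_integrable[OF g] by eventually_elim (use conv_square_le[OF g] in auto)
  have int: "integrable lborel (\<lambda>x. (conv k g x)\<^sup>2)"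
  proof (rule Bochner_Integration.integrable_bound)
    show "integrable lborel (\<lambda>x. ?K * conv k (\<lambda>y. (g y)\<^sup>2) x)" using ci by simp
    show "AE x in lborel. norm ((conv k g x)\<^sup>2) \<le> norm (?K * conv k (\<lambda>y. (g y)\<^sup>2) x)"
      using le by eventually_elim auto
  qed measurable
  then show "sq_integrable (conv k g)" by (simp add: sq_integrable_def)
  have "(LINT x|lborel. (conv k g x)\<^sup>2) \<le> (LINT x|lborel. ?K * conv k (\<lambda>y. (g y)\<^sup>2) x)"
    using int ci le by (intro integral_mono_AE) auto
  also have "\<dots> = ?K * (LINT x|lborel. LINT y|lborel. k (x - y) * (g y)\<^sup>2)"
    using ci by (simp add: conv_def)
  also have "(LINT x|lborel. LINT y|lborel. k (x - y) * (g y)\<^sup>2)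
      = (LINT y|lborel. LINT x|lborel. k (x - y) * (g y)\<^sup>2)"
    using lborel_pair.Fubini_integral[of "\<lambda>x y. k (x - y) * (g y)\<^sup>2"] ki by simp
  also have "\<dots> = (LINT y|lborel. LINT x|lborel. k (y - x) * (g y)\<^sup>2)"
    by (simp add: k_commute)
  also have "\<dots> = ?K * (LINT y|lborel. (g y)\<^sup>2)"
    by (simp add: k_shift_integral)
  finally show "(LINT x|lborel. (conv k g x)\<^sup>2) \<le> ?K\<^sup>2 * (LINT x|lborel. (g x)\<^sup>2)"
    by (simp add: power2_eq_square mult.assoc)
qed

lemma kernel_form_integrable:
  assumes g: "sq_integrable g" and f: "sq_integrable f"
  shows "integrable (lborel \<Otimes>\<^sub>M lborel) (\<lambda>(x, y). k (x - y) * (f x * g y))"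
proof (rule Bochner_Integration.integrable_bound)
  have [measurable]: "g \<in> borel_measurable borel" "f \<in> borel_measurable borel" using g f by measurable
  show "integrable (lborel \<Otimes>\<^sub>M lborel)
      (\<lambda>z. (case z of (x, y) \<Rightarrow> k (x - y) * (f x)\<^sup>2) + (case z of (x, y) \<Rightarrow> k (x - y) * (g y)\<^sup>2))"
    using kernel_integrable sq_integrable_square f g by (intro Bochner_Integration.integrable_add) auto
  show "(\<lambda>(x, y). k (x - y) * (f x * g y)) \<in> borel_measurable (lborel \<Otimes>\<^sub>M lborel)" by measurable
  have "\<bar>f x * g y\<bar> \<le> (f x)\<^sup>2 + (g y)\<^sup>2" for x y
  proof -
    have "0 \<le> (\<bar>f x\<bar> - \<bar>g y\<bar>)\<^sup>2" "0 \<le> (f x)\<^sup>2" "0 \<le> (g y)\<^sup>2" by simp_all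
    moreover have "(\<bar>f x\<bar> - \<bar>g y\<bar>)\<^sup>2 = (f x)\<^sup>2 + (g y)\<^sup>2 - 2 * \<bar>f x * g y\<bar>"
      by (simp add: power2_diff abs_mult)
    ultimately show ?thesis by (smt (verit))
  qed
  then have "k (x - y) * \<bar>f x * g y\<bar> \<le> k (x - y) * ((f x)\<^sup>2 + (g y)\<^sup>2)" for x y
    by (intro mult_left_mono k_nonneg)
  then show "AE z in lborel \<Otimes>\<^sub>M lborel. norm (case z of (x, y) \<Rightarrow> k (x - y) * (f x * g y))
     \<le> norm ((case z of (x, y) \<Rightarrow> k (x - y) * (f x)\<^sup>2) + (case z of (x, y) \<Rightarrow> k (x - y) * (g y)\<^sup>2))"
    by (intro AE_I2) (auto simp: k_nonneg abs_mult algebra_simps)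
qed

text \<open>The second identity is self-adjointness, a consequence of evenness of the kernel. It
  serves to move the kernel onto whichever factor can absorb derivatives.\<close>

lemma integral_conv_eq:
  assumes g: "sq_integrable g" and f: "sq_integrable f"
  shows "(LINT x|lborel. f x * conv k g x)
    = (LINT z|(lborel \<Otimes>\<^sub>M lborel). (case z of (x, y) \<Rightarrow> k (x - y) * (f x * g y)))"
    (is ?a)
    and "(LINT x|lborel. f x * conv k g x) = (LINT x|lborel. conv k f x * g x)" (is ?b)
proof -
  note i = kernel_form_integrable[OF g f]
  have 1: "f x * conv k g x = (LINT y|lborel. k (x - y) * (f x * g y))" for x
    unfolding conv_def by (subst integral_mult_right_zero[symmetric]) (simp add: mult_ac)
  have 2: "conv k f y * g y = (LINT x|lborel. k (x - y) * (f x * g y))" for y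
    unfolding conv_def by (subst integral_mult_left_zero[symmetric]) (simp add: mult_ac k_commute)
  show ?a unfolding 1 using lborel_pair.integral_fst'[OF i] by simp
  show ?b unfolding 1 2
    using lborel_pair.Fubini_integral[of "\<lambda>x y. k (x - y) * (f x * g y)"] i by simp
qed

lemma conv_cmult: "conv k (\<lambda>y. c * g y) = (\<lambda>x. c * conv k g x)"
proof
  fix x
  show "conv k (\<lambda>y. c * g y) x = c * conv k g x"
    unfolding conv_def by (subst integral_mult_right_zero[symmetric]) (simp add: mult_ac)
qed

lemma AE_conv_add:
  assumes "sq_integrable g" "sq_integrable h"
  shows "AE x in lborel. conv k (\<lambda>y. g y + h y) x = conv k g x + conv k h x"
  using AE_conv_integrable[OF assms(1)] AE_conv_integrable[OF assms(2)]
  by eventually_elim (simp add: conv_def distrib_left)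

lemma AE_conv_diff:
  assumes "sq_integrable g" "sq_integrable h"
  shows "AE x in lborel. conv k (\<lambda>y. g y - h y) x = conv k g x - conv k h x"
  using AE_conv_integrable[OF assms(1)] AE_conv_integrable[OF assms(2)]
  by eventually_elim (simp add: conv_def right_diff_distrib)

lemma conv_cong_AE:
  assumes [measurable]: "g \<in> borel_measurable borel" "h \<in> borel_measurable borel"
    and "AE x in lborel. g x = h x"
  shows "conv k g = conv k h"
proof
  fix x
  show "conv k g x = conv k h x"
    unfolding conv_def by (rule integral_cong_AE) (use assms(3) in auto)
qed

lemma conv_bounded_integrable:
  assumes [measurable]: "g \<in> borel_measurable borel" and "\<And>x. \<bar>g x\<bar> \<le> M"
  shows "integrable lborel (\<lambda>y. k (x - y) * g y)"
proof (rule Bochner_Integration.integrable_bound)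
  show "integrable lborel (\<lambda>y. M * k (x - y))" using k_shift_int by simp
  show "AE y in lborel. norm (k (x - y) * g y) \<le> norm (M * k (x - y))"
  proof (intro AE_I2)
    fix y
    have "\<bar>g y\<bar> \<le> \<bar>M\<bar>" using assms(2)[of y] by linarith
    then show "norm (k (x - y) * g y) \<le> norm (M * k (x - y))"
      using k_nonneg[of "x - y"] by (simp add: abs_mult mult.commute mult_right_mono)
  qed
qed measurable

lemma conv_bounded:
  assumes [measurable]: "g \<in> borel_measurable borel" and "\<And>x. \<bar>g x\<bar> \<le> M"
  shows "\<bar>conv k g x\<bar> \<le> M * integral\<^sup>L lborel k"
proof -
  have "\<bar>conv k g x\<bar> \<le> (LINT y|lborel. \<bar>k (x - y) * g y\<bar>)"
    unfolding conv_def by (rule integral_abs_bound)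
  also have "\<dots> \<le> (LINT y|lborel. M * k (x - y))"
  proof (rule integral_mono)
    show "integrable lborel (\<lambda>y. \<bar>k (x - y) * g y\<bar>)" using conv_bounded_integrable[of g M] assms by auto
    show "integrable lborel (\<lambda>y. M * k (x - y))" using k_shift_int by simp
    show "\<bar>k (x - y) * g y\<bar> \<le> M * k (x - y)" for y
      using k_nonneg[of "x - y"] assms(2)[of y] by (simp add: abs_mult mult.commute mult_right_mono)
  qed
  also have "\<dots> = M * integral\<^sup>L lborel k" by (simp add: k_shift_integral)
  finally show ?thesis .
qed

end

section \<open>The heat kernel and the Bessel kernel\<close>

text \<open>Source of the strict inequalities below: a nonnegative integrand with zero integral
  vanishes almost everywhere, which is impossible on a set of positive measure where it is
  positive.\<close>

lemma integral_pos_of_pos_on: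
  fixes f :: "'a \<Rightarrow> real"
  assumes f: "integrable M f" and nn: "AE x in M. 0 \<le> f x"
    and A: "A \<in> sets M" "emeasure M A \<noteq> 0" and pos: "\<And>x. x \<in> A \<Longrightarrow> 0 < f x"
  shows "0 < integral\<^sup>L M f"
proof -
  have "integral\<^sup>L M f \<noteq> 0"
  proof
    assume "integral\<^sup>L M f = 0"
    then have "AE x in M. f x = 0" using integral_nonneg_eq_0_iff_AE[OF f nn] by simp
    then have "AE x in M. x \<notin> A" by eventually_elim (use pos in force)
    then have "emeasure M A = 0" using A(1)
      by (subst (asm) AE_iff_measurable[where N = A]) (auto dest: sets.sets_into_space)
    then show False using A by simp
  qed
  moreover have "0 \<le> integral\<^sup>L M f" using nn by (rule integral_nonneg_AE)
  ultimately show ?thesis by simp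
qed

definition heat :: "real \<Rightarrow> 'a::euclidean_space \<Rightarrow> real" where
  "heat t x = exp (- (norm x)\<^sup>2 / (4 * t)) / sqrt (4 * pi * t) ^ DIM('a)"

lemma heat_meas [measurable (raw)]:
  assumes [measurable]: "f \<in> borel_measurable M" "g \<in> borel_measurable M"
  shows "(\<lambda>x. heat (f x) (g x)) \<in> borel_measurable M"
  unfolding heat_def by measurable

lemma heat_pos: "t > 0 \<Longrightarrow> 0 < heat t x"
  unfolding heat_def by simp

lemma heat_nonneg: "t > 0 \<Longrightarrow> 0 \<le> heat t x"
  using heat_pos[of t x] by simp

text \<open>A product of centred normal densities of variance \<open>2 * t\<close>. Total mass and
  semigroup law thus reduce to one dimension, where the latter says that variances add under
  convolution.\<close>

lemma heat_prod:
  fixes x :: "'a::euclidean_space"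
  assumes t: "0 < t"
  shows "heat t x = (\<Prod>b\<in>Basis. normal_density 0 (sqrt (2 * t)) (x \<bullet> b))"
proof -
  have n: "(norm x)\<^sup>2 = (\<Sum>b\<in>Basis. (x \<bullet> b)\<^sup>2)"
    by (subst power2_norm_eq_inner, subst euclidean_inner) (simp add: power2_eq_square)
  have "(\<Prod>b\<in>Basis. normal_density 0 (sqrt (2 * t)) (x \<bullet> b))
      = (\<Prod>b\<in>Basis. exp (- (x \<bullet> b)\<^sup>2 / (4 * t)) / sqrt (4 * pi * t))"
    using t by (simp add: normal_density_def mult_ac)
  also have "\<dots> = exp (\<Sum>b\<in>Basis. - (x \<bullet> b)\<^sup>2 / (4 * t)) / sqrt (4 * pi * t) ^ DIM('a)"
    by (simp add: prod_dividef exp_sum)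
  also have "(\<Sum>b\<in>Basis. - (x \<bullet> b)\<^sup>2 / (4 * t)) = - (norm x)\<^sup>2 / (4 * t)"
    by (simp add: n sum_divide_distrib sum_negf)
  finally show ?thesis by (simp add: heat_def)
qed

lemma nn_integral_heat:
  assumes t: "0 < t"
  shows "(\<integral>\<^sup>+x. ennreal (heat t x) \<partial>lborel) = 1"
proof -
  have 1: "(\<integral>\<^sup>+y. ennreal (normal_density 0 (sqrt (2 * t)) y) \<partial>lborel) = 1"
    using t by (simp add: nn_integral_eq_integral)
  have "(\<integral>\<^sup>+x. ennreal (heat t (x::'a)) \<partial>lborel)
     = (\<integral>\<^sup>+x. (\<Prod>b\<in>Basis. ennreal (normal_density 0 (sqrt (2 * t)) ((x::'a) \<bullet> b))) \<partial>lborel)"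
    using t by (simp add: heat_prod prod_ennreal)
  also have "\<dots> = 1"
    by (subst nn_integral_lborel_prod) (simp_all add: 1)
  finally show ?thesis .
qed

lemma heat_integrable: "0 < t \<Longrightarrow> integrable lborel (heat t :: 'a::euclidean_space \<Rightarrow> real)"
  using nn_integral_heat[of t, where 'a='a] by (intro integrableI_bounded) (auto simp: heat_nonneg)

lemma integral_heat:
  assumes t: "0 < t"
  shows "(LINT x|lborel. heat t x) = 1"
  using nn_integral_heat[OF t] t by (subst integral_eq_nn_integral) (auto simp: heat_nonneg)

lemma heat_semigroup:
  fixes x :: "'a::euclidean_space"
  assumes s: "0 < s" and t: "0 < t"
  shows "(\<integral>\<^sup>+y. ennreal (heat s (x - y)) * ennreal (heat t y) \<partial>lborel) = ennreal (heat (s + t) x)"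
proof -
  have "(\<lambda>a. \<integral>\<^sup>+y. ennreal (normal_density 0 (sqrt (2 * s)) (a - y) * normal_density 0 (sqrt (2 * t)) y) \<partial>lborel)
    = normal_density 0 (sqrt ((sqrt (2 * s))\<^sup>2 + (sqrt (2 * t))\<^sup>2))"
    using s t by (intro conv_normal_density_zero_mean) auto
  then have 1: "(\<integral>\<^sup>+y. ennreal (normal_density 0 (sqrt (2 * s)) (a - y) * normal_density 0 (sqrt (2 * t)) y) \<partial>lborel)
    = normal_density 0 (sqrt (2 * (s + t))) a" for a
    using s t by (simp add: fun_eq_iff algebra_simps)
  have "(\<integral>\<^sup>+y. ennreal (heat s (x - y)) * ennreal (heat t y) \<partial>lborel)
     = (\<integral>\<^sup>+y. (\<Prod>b\<in>Basis. (\<lambda>b r. ennreal (normal_density 0 (sqrt (2 * s)) (x \<bullet> b - r) * normal_density 0 (sqrt (2 * t)) r)) b (y \<bullet> b)) \<partial>lborel)"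
    using s t by (simp add: heat_prod inner_diff_left prod.distrib prod_ennreal ennreal_mult prod_nonneg)
  also have "\<dots> = (\<Prod>b\<in>Basis. ennreal (normal_density 0 (sqrt (2 * (s + t))) (x \<bullet> b)))"
    by (subst nn_integral_lborel_prod) (simp_all add: 1)
  also have "\<dots> = ennreal (heat (s + t) x)"
    using s t by (simp add: heat_prod prod_ennreal)
  finally show ?thesis .
qed

lemma heat_le: 
  assumes "0 < t" shows "heat t (x::'a::euclidean_space) \<le> 1 / sqrt (4 * pi * t) ^ DIM('a)"
  unfolding heat_def using assms by (intro divide_right_mono) auto

lemma heat_less_iff:
  fixes x y :: "'a::euclidean_space"
  assumes "0 < t"
  shows "heat t y < heat t x \<longleftrightarrow> norm x < norm y"
proof -
  have "0 < sqrt (4 * pi * t) ^ DIM('a)" using assms by simp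
  then have "heat t y < heat t x \<longleftrightarrow> exp (- (norm y)\<^sup>2 / (4 * t)) < exp (- (norm x)\<^sup>2 / (4 * t))"
    unfolding heat_def by (meson divide_strict_right_mono divide_right_mono less_imp_le not_less)
  also have "\<dots> \<longleftrightarrow> (norm x)\<^sup>2 < (norm y)\<^sup>2"
    using assms by (simp add: field_simps)
  also have "\<dots> \<longleftrightarrow> norm x < norm y"
    by (metis norm_ge_zero power_less_imp_less_base power_strict_mono pos2)
  finally show ?thesis .
qed

lemma heat_le_iff:
  fixes x y :: "'a::euclidean_space"
  assumes "0 < t"
  shows "heat t y \<le> heat t x \<longleftrightarrow> norm x \<le> norm y"
  using heat_less_iff[OF assms, where x = y and y = x] by (simp add: not_less[symmetric])

text \<open>Integrand of the Laplace transform that represents the inverse of \<open>b\<close> minus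
  the Laplacian as the integral of \<open>exp (- (b * t))\<close> times the heat semigroup. The
  indicator extends it by zero, so that time integrals can run over the whole line.\<close>

definition res_heat :: "real \<Rightarrow> real \<Rightarrow> 'a::euclidean_space \<Rightarrow> real" where
  "res_heat b t x = indicator {0<..} t * (exp (- (b * t)) * heat t x)"

lemma res_heat_meas [measurable (raw)]:
  assumes [measurable]: "f \<in> borel_measurable M" "g \<in> borel_measurable M"
  shows "(\<lambda>x. res_heat b (f x) (g x)) \<in> borel_measurable M"
  unfolding res_heat_def by measurable

lemma res_heat_nonneg: "0 \<le> res_heat b t x"
  using heat_pos[of t x] by (auto simp: res_heat_def indicator_def)

lemma nn_integral_exp_decay:
  assumes b: "0 < b"
  shows "(\<integral>\<^sup>+t. ennreal (indicator {0<..} t * exp (- (b * t))) \<partial>lborel) = ennreal (1 / b)"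
proof -
  interpret prob_space "density lborel (exponential_density b)"
    by (rule prob_space_exponential_density) fact
  have "(\<integral>\<^sup>+t. ennreal (exponential_density b t) \<partial>lborel) = 1"
    using emeasure_space_1 by (simp add: emeasure_density)
  moreover have "(\<integral>\<^sup>+t. ennreal (exponential_density b t) \<partial>lborel)
      = (\<integral>\<^sup>+t. ennreal b * ennreal (indicator {0<..} t * exp (- (b * t))) \<partial>lborel)"
  proof (rule nn_integral_cong_AE)
    show "AE t in lborel. ennreal (exponential_density b t) = ennreal b * ennreal (indicator {0<..} t * exp (- (b * t)))"
      \<comment> \<open>At time 0 the exponential density equals \<open>b\<close> while the
        indicator vanishes, so this point is discarded.\<close>
      using AE_lborel_singleton[of "0::real"] 
      by eventually_elim (use b in \<open>auto simp: exponential_density_def indicator_def ennreal_mult[symmetric] mult_ac\<close>)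
  qed
  ultimately have "ennreal b * (\<integral>\<^sup>+t. ennreal (indicator {0<..} t * exp (- (b * t))) \<partial>lborel) = 1"
    by (simp add: nn_integral_cmult)
  then have "ennreal (1 / b) * (ennreal b * (\<integral>\<^sup>+t. ennreal (indicator {0<..} t * exp (- (b * t))) \<partial>lborel)) = ennreal (1 / b)"
    by simp
  then show ?thesis using b by (simp add: mult.assoc[symmetric] ennreal_mult[symmetric])
qed

lemma nn_integral_res_heat_fst:
  "(\<integral>\<^sup>+x. ennreal (res_heat b t (x::'a::euclidean_space)) \<partial>lborel) = ennreal (indicator {0<..} t * exp (- (b * t)))"
proof (cases "0 < t")
  case True
  then show ?thesis
    using nn_integral_heat[of t, where 'a='a]
    by (simp add: res_heat_def ennreal_mult heat_nonneg nn_integral_cmult)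
qed (simp add: res_heat_def)

lemma nn_integral_res_heat:
  assumes "0 < b"
  shows "(\<integral>\<^sup>+x. \<integral>\<^sup>+t. ennreal (res_heat b t x) \<partial>lborel \<partial>lborel) = ennreal (1 / b)"
proof -
  have "(\<integral>\<^sup>+x. \<integral>\<^sup>+t. ennreal (res_heat b t (x::'a)) \<partial>lborel \<partial>lborel)
      = (\<integral>\<^sup>+t. \<integral>\<^sup>+x. ennreal (res_heat b t (x::'a)) \<partial>lborel \<partial>lborel)"
    by (rule lborel_pair.Fubini') measurable
  then show ?thesis using nn_integral_exp_decay[OF assms] by (simp add: nn_integral_res_heat_fst)
qed

lemma res_heat_integrable:
  assumes "0 < b"
  shows "integrable (lborel \<Otimes>\<^sub>M lborel) (\<lambda>z. res_heat b (fst z) (snd z::'a::euclidean_space))"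
proof (rule integrableI_bounded)
  have "(\<integral>\<^sup>+z. ennreal (norm (res_heat b (fst z) (snd z::'a))) \<partial>(lborel \<Otimes>\<^sub>M lborel))
     = (\<integral>\<^sup>+t. \<integral>\<^sup>+x. ennreal (res_heat b t (x::'a)) \<partial>lborel \<partial>lborel)"
    by (subst lborel.nn_integral_fst[symmetric]) (auto simp: res_heat_nonneg)
  then show "(\<integral>\<^sup>+z. ennreal (norm (res_heat b (fst z) (snd z::'a))) \<partial>(lborel \<Otimes>\<^sub>M lborel)) < \<infinity>"
    using nn_integral_exp_decay[OF assms] by (simp add: nn_integral_res_heat_fst)
qed measurable

text \<open>In dimension at least two the time integral diverges at the origin, and the value there
  is the default 0 instead of infinity. This is why monotonicity and positivity below exclude the
  origin.\<close>

definition bessel :: "real \<Rightarrow> 'a::euclidean_space \<Rightarrow> real" where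
  "bessel b x = (LINT t|lborel. res_heat b t x)"

lemma bessel_meas [measurable]: "bessel b \<in> borel_measurable borel"
  unfolding bessel_def by measurable

lemma bessel_nonneg: "0 \<le> bessel b x"
  unfolding bessel_def by (simp add: res_heat_nonneg)

lemma res_heat_antimono:
  fixes x y :: "'a::euclidean_space"
  shows "norm x \<le> norm y \<Longrightarrow> res_heat b t y \<le> res_heat b t x"
  unfolding res_heat_def by (auto simp: indicator_def heat_le_iff)

lemma AE_res_heat_integrable:
  assumes "0 < b"
  shows "AE x in lborel. integrable lborel (\<lambda>t. res_heat b t (x::'a::euclidean_space))"
  using lborel_pair.AE_integrable_snd[of "\<lambda>t x. res_heat b t (x::'a)"] res_heat_integrable[OF assms]
  by (simp add: case_prod_beta')

text \<open>Fubini gives integrability only at almost every point, hence at some point closer to the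
  origin than \<open>x\<close>; there the integrand dominates the one at \<open>x\<close>.\<close>

lemma res_heat_integrable_time:
  fixes x :: "'a::euclidean_space"
  assumes b: "0 < b" and x: "x \<noteq> 0"
  shows "integrable lborel (\<lambda>t. res_heat b t x)"
proof -
  have "\<exists>y::'a. integrable lborel (\<lambda>t. res_heat b t y) \<and> norm y < norm x"
  proof (rule ccontr)
    assume n: "\<not> ?thesis"
    have "AE y in lborel. y \<notin> ball (0::'a) (norm x)"
      using AE_res_heat_integrable[OF b, where 'a='a] by eventually_elim (use n in auto)
    then have "emeasure lborel (ball (0::'a) (norm x)) = 0" 
      by (subst (asm) AE_iff_measurable[where N = "ball (0::'a) (norm x)"]) auto
    moreover have "0 < unit_ball_vol (real DIM('a)) * norm x ^ DIM('a)" using x by simp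
    ultimately show False by (simp add: emeasure_ball ennreal_eq_0_iff)
  qed
  then obtain y where y: "integrable lborel (\<lambda>t. res_heat b t y)" "norm (y::'a) < norm x" by blast
  show ?thesis
    by (rule Bochner_Integration.integrable_bound[OF y(1)])
       (use y(2) res_heat_antimono[of y x b] in \<open>auto simp: res_heat_nonneg\<close>)
qed

lemma bessel_antimono:
  fixes x y :: "'a::euclidean_space"
  assumes b: "0 < b" and x: "x \<noteq> 0" and le: "norm x \<le> norm y"
  shows "bessel b y \<le> bessel b x"
proof -
  have "y \<noteq> 0" using x le by auto
  then show ?thesis unfolding bessel_def
    using res_heat_integrable_time[OF b] x le by (intro integral_mono) (auto intro: res_heat_antimono)
qed

text \<open>Strictness is already present in the heat kernel at each positive time and survives
  integration over a time interval of positive length.\<close>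

lemma bessel_strict_antimono:
  fixes x y :: "'a::euclidean_space"
  assumes b: "0 < b" and x: "x \<noteq> 0" and le: "norm x < norm y"
  shows "bessel b y < bessel b x"
proof -
  have "y \<noteq> 0" using x le by auto
  have "res_heat b t y < res_heat b t x" if "0 < t" for t
    using that le by (simp add: res_heat_def heat_less_iff)
  moreover note i = res_heat_integrable_time[OF b, of x] res_heat_integrable_time[OF b, of y]
  ultimately have "0 < (LINT t|lborel. res_heat b t x - res_heat b t y)"
    using x \<open>y \<noteq> 0\<close> le
    by (intro integral_pos_of_pos_on[where A = "{0<..<1}"]) (auto intro!: res_heat_antimono AE_I2)
  then show ?thesis unfolding bessel_def
    using i x \<open>y \<noteq> 0\<close> by simp
qed

lemma bessel_pos:
  fixes x :: "'a::euclidean_space"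
  assumes b: "0 < b" and x: "x \<noteq> 0"
  shows "0 < bessel b x"
proof -
  have "norm x < norm (2 *\<^sub>R x)" using x by simp
  from bessel_strict_antimono[OF b x this] show ?thesis
    using bessel_nonneg[of b "2 *\<^sub>R x"] by linarith
qed

lemma bessel_cong_norm:
  fixes x y :: "'a::euclidean_space"
  shows "norm x = norm y \<Longrightarrow> bessel b x = bessel b y"
  by (simp add: bessel_def res_heat_def heat_def)

lemma ennreal_bessel:
  fixes x :: "'a::euclidean_space"
  assumes b: "0 < b" and x: "x \<noteq> 0"
  shows "ennreal (bessel b x) = (\<integral>\<^sup>+t. ennreal (res_heat b t x) \<partial>lborel)"
  unfolding bessel_def
  using res_heat_integrable_time[OF b x] by (subst nn_integral_eq_integral) (auto simp: res_heat_nonneg)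

lemma bessel_integrable:
  assumes b: "0 < b"
  shows "integrable lborel (bessel b :: 'a::euclidean_space \<Rightarrow> real)"
    and "(LINT x|lborel. bessel b (x::'a)) = 1 / b"
proof -
  have n: "(\<integral>\<^sup>+x. ennreal (bessel b (x::'a)) \<partial>lborel) = ennreal (1 / b)"
    unfolding nn_integral_res_heat[OF b, where 'a='a, symmetric]
    by (rule nn_integral_cong_AE, rule AE_mp[OF AE_lborel_singleton[of "0::'a"]])
       (simp add: ennreal_bessel[OF b])
  then show "integrable lborel (bessel b :: 'a \<Rightarrow> real)"
    by (intro integrableI_bounded) (auto simp: bessel_nonneg)
  show "(LINT x|lborel. bessel b (x::'a)) = 1 / b"
    using n b by (subst integral_eq_nn_integral) (auto simp: bessel_nonneg)
qed

lemma even_kernel_bessel: "0 < b \<Longrightarrow> even_kernel (bessel b)"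
  by unfold_locales (auto simp: bessel_nonneg bessel_integrable intro: bessel_cong_norm)

text \<open>In space-time the kernel is smooth for positive times, so derivatives of the convolution
  are computed in this form and not on the singular kernel itself.\<close>

lemma conv_bessel_bounded:
  fixes g :: "'a::euclidean_space \<Rightarrow> real"
  assumes b: "0 < b" and g [measurable]: "g \<in> borel_measurable borel" and M: "\<And>x. \<bar>g x\<bar> \<le> M"
  shows "integrable (lborel \<Otimes>\<^sub>M lborel) (\<lambda>z. res_heat b (fst z) (snd z) * g (x - snd z))"
    and "conv (bessel b) g x = (LINT z|(lborel \<Otimes>\<^sub>M lborel). res_heat b (fst z) (snd z) * g (x - snd z))"
proof -
  show i: "integrable (lborel \<Otimes>\<^sub>M lborel) (\<lambda>z. res_heat b (fst z) (snd z) * g (x - snd z))"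
  proof (rule Bochner_Integration.integrable_bound)
    show "integrable (lborel \<Otimes>\<^sub>M lborel) (\<lambda>z. M * res_heat b (fst z) (snd z::'a))"
      using res_heat_integrable[OF b, where 'a='a] by simp
    have "\<bar>g y\<bar> \<le> \<bar>M\<bar>" for y using M[of y] by linarith
    then show "AE z in lborel \<Otimes>\<^sub>M lborel. norm (res_heat b (fst z) (snd z) * g (x - snd z)) \<le> norm (M * res_heat b (fst z) (snd z))"
      by (intro AE_I2) (auto simp: abs_mult mult.commute[of _ "\<bar>g _\<bar>"] intro!: mult_right_mono)
  qed measurable
  have "conv (bessel b) g x = (LINT y|lborel. bessel b (x - (x - y)) * g (x - y))"
    unfolding conv_def
    by (rule integral_lborel_minus[symmetric, where f = "\<lambda>y. bessel b (x - y) * g y"]) simp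
  also have "\<dots> = (LINT y|lborel. LINT t|lborel. res_heat b t y * g (x - y))"
    by (simp add: bessel_def)
  also have "\<dots> = (LINT z|(lborel \<Otimes>\<^sub>M lborel). res_heat b (fst z) (snd z) * g (x - snd z))"
    using lborel_pair.integral_snd[of "\<lambda>t y. res_heat b t y * g (x - y)"] i by (simp add: case_prod_beta')
  finally show "conv (bessel b) g x = (LINT z|(lborel \<Otimes>\<^sub>M lborel). res_heat b (fst z) (snd z) * g (x - snd z))" .
qed

section \<open>The Bessel kernel inverts the shifted Laplacian\<close>

text \<open>One-dimensional differentiability along lines is what the mean value theorem and
  integration by parts in a fixed direction require.\<close>

definition dir_deriv :: "'a::real_normed_vector \<Rightarrow> ('a \<Rightarrow> real) \<Rightarrow> ('a \<Rightarrow> real) \<Rightarrow> bool" where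
  "dir_deriv e f f' \<longleftrightarrow> (\<forall>x. ((\<lambda>s. f (x + s *\<^sub>R e)) has_real_derivative f' x) (at 0))"

lemma dir_derivD:
  assumes "dir_deriv e f f'"
  shows "((\<lambda>s. f (x + s *\<^sub>R e)) has_real_derivative f' (x + s *\<^sub>R e)) (at s)"
proof -
  have "((\<lambda>r. f ((x + s *\<^sub>R e) + r *\<^sub>R e)) has_real_derivative f' (x + s *\<^sub>R e)) (at 0)"
    using assms unfolding dir_deriv_def by blast
  then have "((\<lambda>r. f (x + (r + s) *\<^sub>R e)) has_real_derivative f' (x + s *\<^sub>R e)) (at 0)"
    by (simp add: algebra_simps)
  then show ?thesis
    using DERIV_shift[of "\<lambda>s. f (x + s *\<^sub>R e)" "f' (x + s *\<^sub>R e)" 0 s] by (simp add: add.commute)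
qed

lemma dir_deriv_mult:
  assumes "dir_deriv e f f'" "dir_deriv e g g'"
  shows "dir_deriv e (\<lambda>x. f x * g x) (\<lambda>x. f x * g' x + f' x * g x)"
  using assms unfolding dir_deriv_def by (auto intro!: derivative_eq_intros)

lemma dir_deriv_diff:
  assumes "dir_deriv e f f'" "dir_deriv e g g'"
  shows "dir_deriv e (\<lambda>x. f x - g x) (\<lambda>x. f' x - g' x)"
  using assms unfolding dir_deriv_def by (auto intro!: derivative_eq_intros)

lemma dir_deriv_reflect:
  assumes "dir_deriv e f f'"
  shows "dir_deriv e (\<lambda>x. f (a - x)) (\<lambda>x. - f' (a - x))"
  unfolding dir_deriv_def
proof
  fix x
  have "((\<lambda>s. f ((a - x) + (- s) *\<^sub>R e)) has_real_derivative f' ((a - x) + (- 0) *\<^sub>R e) * (- 1)) (at 0)"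
    by (rule DERIV_chain'[where g = "\<lambda>s. f ((a - x) + s *\<^sub>R e)" and f = uminus, OF _ dir_derivD[OF assms]])
       (auto intro!: derivative_eq_intros)
  then show "((\<lambda>s. f (a - (x + s *\<^sub>R e))) has_real_derivative - f' (a - x)) (at 0)"
    by (simp add: algebra_simps)
qed

section \<open>Compactly supported functions and integration by parts\<close>

definition compactly_supported :: "('a::euclidean_space \<Rightarrow> real) \<Rightarrow> bool" where
  "compactly_supported f \<longleftrightarrow> continuous_on UNIV f \<and> (\<exists>R. \<forall>x. R < norm x \<longrightarrow> f x = 0)"

lemma compactly_supported_mult:
  "compactly_supported f \<Longrightarrow> continuous_on UNIV g \<Longrightarrow> compactly_supported (\<lambda>x. g x * f x)"
  unfolding compactly_supported_def by (auto intro!: continuous_intros)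

lemma compactly_supported_diff:
  assumes "compactly_supported f" "compactly_supported g"
  shows "compactly_supported (\<lambda>x. f x - g x)"
proof -
  obtain R S where "\<forall>x. R < norm x \<longrightarrow> f x = 0" "\<forall>x. S < norm x \<longrightarrow> g x = 0"
    using assms unfolding compactly_supported_def by blast
  then have "\<forall>x. max R S < norm x \<longrightarrow> f x - g x = 0" by auto
  then show ?thesis
    using assms unfolding compactly_supported_def by (blast intro: continuous_on_diff)
qed

lemma compactly_supported_uminus: "compactly_supported f \<Longrightarrow> compactly_supported (\<lambda>x. - f x)"
  unfolding compactly_supported_def by (auto intro!: continuous_intros)

lemma compactly_supported_add:
  "compactly_supported f \<Longrightarrow> compactly_supported g \<Longrightarrow> compactly_supported (\<lambda>x. f x + g x)"
  using compactly_supported_diff[OF _ compactly_supported_uminus, of f g] by simp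

lemma compactly_supported_sum:
  "(\<And>i. i \<in> I \<Longrightarrow> compactly_supported (f i)) \<Longrightarrow> compactly_supported (\<lambda>x. \<Sum>i\<in>I. f i x)"
  by (induction I rule: infinite_finite_induct)
     (auto intro: compactly_supported_add simp: compactly_supported_def[of "\<lambda>x. 0"])

lemma compactly_supported_reflect:
  assumes "compactly_supported f"
  shows "compactly_supported (\<lambda>x. f (a - x))"
proof -
  obtain R where R: "\<And>x. R < norm x \<Longrightarrow> f x = 0" using assms unfolding compactly_supported_def by blast
  have "f (a - x) = 0" if "norm a + R < norm x" for x
  proof -
    have "norm x \<le> norm a + norm (a - x)" using norm_triangle_sub[of x a] by (simp add: norm_minus_commute)
    then show ?thesis using that by (intro R) simp
  qed
  moreover have "continuous_on UNIV (\<lambda>x. f (a - x))"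
    using assms unfolding compactly_supported_def
    by (intro continuous_on_compose2[of UNIV f UNIV "\<lambda>x. a - x"]) (auto intro!: continuous_intros)
  ultimately show ?thesis unfolding compactly_supported_def by blast
qed

lemma compactly_supported_bounded:
  assumes "compactly_supported f"
  obtains M where "0 \<le> M" "\<And>x. \<bar>f x\<bar> \<le> M"
proof -
  obtain R where R: "\<And>x. R < norm x \<Longrightarrow> f x = 0" using assms unfolding compactly_supported_def by blast
  have "compact (f ` cball 0 R)"
    using assms unfolding compactly_supported_def by (intro compact_continuous_image) (auto intro: continuous_on_subset)
  then have "bounded (f ` cball 0 R)" by (rule compact_imp_bounded)
  then obtain M where M: "\<forall>x\<in>cball 0 R. \<bar>f x\<bar> \<le> M"
    unfolding bounded_iff by auto
  have "\<bar>f x\<bar> \<le> \<bar>M\<bar>" for x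
    using M R[of x] by (cases "norm x \<le> R") (force, auto)
  then show ?thesis using that[of "\<bar>M\<bar>"] by simp
qed

lemma compactly_supported_meas [measurable_dest]:
  "compactly_supported f \<Longrightarrow> f \<in> borel_measurable borel"
  unfolding compactly_supported_def by (simp add: borel_measurable_continuous_onI)

lemma compactly_supported_integrable:
  assumes "compactly_supported f"
  shows "integrable lborel f"
proof -
  obtain R where R: "\<And>x. R < norm x \<Longrightarrow> f x = 0" using assms unfolding compactly_supported_def by blast
  have "integrable lborel (\<lambda>x. indicator (cball 0 R) x *\<^sub>R f x)"
    using assms unfolding compactly_supported_def
    by (intro borel_integrable_compact) (auto intro: continuous_on_subset)
  moreover have "(\<lambda>x. indicator (cball 0 R) x *\<^sub>R f x) = f"
    using R by (auto simp: indicator_def fun_eq_iff not_le)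
  ultimately show ?thesis by simp
qed

lemma compactly_supported_sq_integrable:
  assumes "compactly_supported f" shows "sq_integrable f"
proof -
  have "compactly_supported (\<lambda>x. f x * f x)"
    using assms by (intro compactly_supported_mult) (auto simp: compactly_supported_def)
  from compactly_supported_integrable[OF this] show ?thesis
    using assms by (auto simp: sq_integrable_def power2_eq_square)
qed

text \<open>The difference quotients integrate to zero by translation invariance.\<close>

lemma integral_dir_deriv_eq_0:
  fixes F :: "'a::euclidean_space \<Rightarrow> real"
  assumes d: "dir_deriv e F F'" and F: "compactly_supported F" and F': "compactly_supported F'"
  shows "(LINT x|lborel. F' x) = 0"
proof -
  have [measurable]: "F \<in> borel_measurable borel" "F' \<in> borel_measurable borel" using F F' by measurable
  obtain M where M: "0 \<le> M" "\<And>x. \<bar>F' x\<bar> \<le> M" using compactly_supported_bounded[OF F'] by blast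
  obtain R where R: "\<And>x. R < norm x \<Longrightarrow> F' x = 0" using F' unfolding compactly_supported_def by blast
  define h where "h k = inverse (real (Suc k))" for k
  define q where "q k x = (F (x + h k *\<^sub>R e) - F x) / h k" for k x
  have h: "0 < h k" "h k \<le> 1" for k by (auto simp: h_def inverse_le_1_iff)
  have qz: "(LINT x|lborel. q k x) = 0" for k
  proof -
    have "(LINT x|lborel. F (h k *\<^sub>R e + x)) = (LINT x|lborel. F x)"
      by (rule integral_lborel_plus) simp
    moreover have "integrable lborel (\<lambda>x. F (h k *\<^sub>R e + x))"
      by (rule integrable_lborel_plus) (rule compactly_supported_integrable[OF F])
    ultimately show ?thesis
      using compactly_supported_integrable[OF F] by (simp add: q_def add.commute)
  qed
  \<comment> \<open>By the mean value theorem a quotient is a value of \<open>F'\<close> on the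
    segment from \<open>x\<close> to \<open>x + h k *\<^sub>R e\<close>. As
    \<open>h k \<le> 1\<close>, enlarging the support radius by \<open>norm e\<close> gives one
    dominating function for all \<open>k\<close>.\<close>
  have qb: "norm (q k x) \<le> M * indicator (cball 0 (R + norm e)) x" for k x
  proof -
    obtain s where s: "0 < s" "s < h k" "F (x + h k *\<^sub>R e) - F (x + 0 *\<^sub>R e) = (h k - 0) * F' (x + s *\<^sub>R e)"
      using MVT2[of 0 "h k" "\<lambda>s. F (x + s *\<^sub>R e)" "\<lambda>s. F' (x + s *\<^sub>R e)"] h dir_derivD[OF d] by blast
    then have q: "q k x = F' (x + s *\<^sub>R e)" using h[of k] by (simp add: q_def)
    show ?thesis
    proof (cases "norm x \<le> R + norm e")
      case True then show ?thesis using q M by simp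
    next
      case False
      have "norm x \<le> norm (x + s *\<^sub>R e) + norm (s *\<^sub>R e)"
        using norm_triangle_ineq4[of "x + s *\<^sub>R e" "s *\<^sub>R e"] by simp
      moreover have "norm (s *\<^sub>R e) \<le> norm e"
        using s h[of k] by (simp add: mult_left_le_one_le)
      ultimately have "R < norm (x + s *\<^sub>R e)" using False by linarith
      then show ?thesis using q R False by simp
    qed
  qed
  have "(\<lambda>k. LINT x|lborel. q k x) \<longlonglongrightarrow> (LINT x|lborel. F' x)"
  proof (rule integral_dominated_convergence)
    show "integrable lborel (\<lambda>x::'a. M * indicator (cball 0 (R + norm e)) x)"
      by (intro integrable_mult_right integrable_real_indicator)
         (simp_all add: emeasure_lborel_cball_finite[unfolded infinity_ennreal_def])
    show "AE x in lborel. (\<lambda>k. q k x) \<longlonglongrightarrow> F' x"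
    proof (intro AE_I2)
      fix x
      have "(\<lambda>s. (F (x + (0 + s) *\<^sub>R e) - F (x + 0 *\<^sub>R e)) / s) \<midarrow>0\<rightarrow> F' (x + 0 *\<^sub>R e)"
        using dir_derivD[OF d, of x 0] unfolding DERIV_def .
      moreover have "filterlim h (at 0) sequentially"
        using LIMSEQ_inverse_real_of_nat h(1) by (auto simp: filterlim_at h_def[abs_def] simp del: of_nat_Suc)
      ultimately have "(\<lambda>k. (F (x + (0 + h k) *\<^sub>R e) - F (x + 0 *\<^sub>R e)) / h k) \<longlonglongrightarrow> F' (x + 0 *\<^sub>R e)"
        by (rule filterlim_compose)
      then show "(\<lambda>k. q k x) \<longlonglongrightarrow> F' x" by (simp add: q_def)
    qed
    show "AE x in lborel. norm (q k x) \<le> M * indicator (cball 0 (R + norm e)) x" for k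
      using qb by simp
  qed (auto simp: q_def)
  then show ?thesis using qz LIMSEQ_unique by (metis (lifting) ext tendsto_const)
qed

lemma dir_deriv_heat:
  fixes b :: "'a::euclidean_space"
  assumes t: "0 < t" and b: "norm b = 1"
  shows "dir_deriv b (heat t) (\<lambda>x. - (x \<bullet> b) / (2 * t) * heat t x)"
    and "dir_deriv b (\<lambda>x. - (x \<bullet> b) / (2 * t) * heat t x)
          (\<lambda>x. ((x \<bullet> b)\<^sup>2 / (4 * t\<^sup>2) - 1 / (2 * t)) * heat t x)"
proof -
  have n: "(norm (x + s *\<^sub>R b))\<^sup>2 = (norm x)\<^sup>2 + 2 * s * (x \<bullet> b) + s\<^sup>2" for x s
    unfolding power2_norm_eq_inner using b unfolding norm_eq_1
    by (simp add: inner_add_left inner_add_right inner_commute power2_eq_square algebra_simps del: power2_norm_eq_inner flip: dot_square_norm)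
  have e: "((\<lambda>s. exp (- (A + 2 * s * p + s\<^sup>2) / (4 * t)) / C) has_real_derivative
      - p / (2 * t) * (exp (- A / (4 * t)) / C)) (at 0)" for A p C :: real
  proof -
    have "((\<lambda>s. - (A + 2 * s * p + s\<^sup>2) / (4 * t)) has_real_derivative - p / (2 * t)) (at 0)"
      using t by (auto intro!: derivative_eq_intros)
    from DERIV_cdivide[OF DERIV_fun_exp[OF this], of C] show ?thesis by (simp add: mult.commute)
  qed
  show 1: "dir_deriv b (heat t) (\<lambda>x. - (x \<bullet> b) / (2 * t) * heat t x)"
    unfolding dir_deriv_def heat_def n by (intro allI e)
  have "dir_deriv b (\<lambda>x. - (x \<bullet> b) / (2 * t)) (\<lambda>x. - 1 / (2 * t))"
    unfolding dir_deriv_def using t b unfolding norm_eq_1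
    by (auto intro!: derivative_eq_intros simp: inner_add_left)
  from dir_deriv_mult[OF this 1]
  show "dir_deriv b (\<lambda>x. - (x \<bullet> b) / (2 * t) * heat t x)
          (\<lambda>x. ((x \<bullet> b)\<^sup>2 / (4 * t\<^sup>2) - 1 / (2 * t)) * heat t x)"
    by (rule back_subst[where P = "dir_deriv b _"]) (simp add: fun_eq_iff algebra_simps power2_eq_square)
qed

text \<open>The factor in front of \<open>heat t x\<close> reappears in
  \<open>integral_heat_laplacian\<close> as the one produced by the Laplacian; this agreement is the
  heat equation.\<close>

lemma heat_time_deriv:
  fixes x :: "'a::euclidean_space"
  assumes t: "0 < t"
  shows "((\<lambda>t. heat t x) has_real_derivative ((norm x)\<^sup>2 / (4 * t\<^sup>2) - DIM('a) / (2 * t)) * heat t x) (at t)"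
proof -
  have e: "heat s x = exp (- (norm x)\<^sup>2 / (4 * s)) * (4 * pi * s) powr (- (DIM('a) / 2))" if "0 < s" for s
  proof -
    have "sqrt (4 * pi * s) ^ DIM('a) = (4 * pi * s) powr (DIM('a) / 2)"
      using that by (simp add: powr_half_sqrt[symmetric] powr_powr powr_realpow[symmetric])
    then show ?thesis by (simp only: heat_def powr_minus divide_inverse)
  qed
  define a where "a = - (real DIM('a) / 2)"
  have "((\<lambda>s. - A / (4 * s)) has_real_derivative A / (4 * t\<^sup>2)) (at t)" for A :: real
  proof -
    have "((\<lambda>s. - A / 4 * inverse s) has_real_derivative - A / 4 * - (inverse t ^ Suc (Suc 0))) (at t)"
      using t by (intro DERIV_cmult DERIV_inverse) simp
    then show ?thesis using t by (simp add: field_simps power2_eq_square)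
  qed
  then have 1: "((\<lambda>s. exp (- (norm x)\<^sup>2 / (4 * s))) has_real_derivative
      exp (- (norm x)\<^sup>2 / (4 * t)) * ((norm x)\<^sup>2 / (4 * t\<^sup>2))) (at t)"
    by (rule DERIV_fun_exp)
  have 2: "((\<lambda>s. (4 * pi * s) powr a) has_real_derivative a * (4 * pi * t) powr (a - 1) * (4 * pi)) (at t)"
    using t by (auto intro!: derivative_eq_intros)
  have "a * (4 * pi * t) powr (a - 1) * (4 * pi) = a / t * (4 * pi * t) powr a"
    using t by (simp add: powr_diff)
  with 2 have 3: "((\<lambda>s. (4 * pi * s) powr a) has_real_derivative a / t * (4 * pi * t) powr a) (at t)" by simp
  have "exp (- (norm x)\<^sup>2 / (4 * t)) * ((norm x)\<^sup>2 / (4 * t\<^sup>2)) * (4 * pi * t) powr a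
      + a / t * (4 * pi * t) powr a * exp (- (norm x)\<^sup>2 / (4 * t))
    = ((norm x)\<^sup>2 / (4 * t\<^sup>2) - DIM('a) / (2 * t)) * heat t x"
    unfolding e[OF t] a_def[symmetric] by (simp add: a_def algebra_simps)
  with DERIV_mult[OF 1 3] have "((\<lambda>s. exp (- (norm x)\<^sup>2 / (4 * s)) * (4 * pi * s) powr a)
      has_real_derivative ((norm x)\<^sup>2 / (4 * t\<^sup>2) - DIM('a) / (2 * t)) * heat t x) (at t)" by simp
  then show ?thesis
    by (rule has_field_derivative_transform_within_open[where S = "{0<..}"]) (use t e in \<open>auto simp: a_def\<close>)
qed

text \<open>Green's identity: both derivatives move from the test function to the heat kernel, and
  summing the second derivatives of the kernel over the basis gives the factor of
  \<open>heat_time_deriv\<close>.\<close>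

lemma integral_heat_laplacian:
  fixes \<phi> :: "'a::euclidean_space \<Rightarrow> real"
  assumes t: "0 < t"
    and d: "\<And>b. b \<in> Basis \<Longrightarrow> dir_deriv b \<phi> (\<phi>1 b)" "\<And>b. b \<in> Basis \<Longrightarrow> dir_deriv b (\<phi>1 b) (\<phi>2 b)"
    and c: "compactly_supported \<phi>" "\<And>b. b \<in> Basis \<Longrightarrow> compactly_supported (\<phi>1 b)"
      "\<And>b. b \<in> Basis \<Longrightarrow> compactly_supported (\<phi>2 b)"
  shows "(LINT x|lborel. heat t x * (\<Sum>b\<in>Basis. \<phi>2 b x))
    = (LINT x|lborel. ((norm x)\<^sup>2 / (4 * t\<^sup>2) - DIM('a) / (2 * t)) * heat t x * \<phi> x)"
proof -
  have ch: "continuous_on UNIV (heat t :: 'a \<Rightarrow> real)"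
    unfolding heat_def using t by (auto intro!: continuous_intros)
  define g1 g2 where "g1 b x = - (x \<bullet> b) / (2 * t) * heat t x"
    and "g2 b x = ((x \<bullet> b)\<^sup>2 / (4 * t\<^sup>2) - 1 / (2 * t)) * heat t x" for b x :: 'a
  have cg: "continuous_on UNIV (g1 b)" "continuous_on UNIV (g2 b)" for b
    unfolding g1_def g2_def using t by (auto intro!: continuous_intros ch)
  have eq: "(LINT x|lborel. heat t x * \<phi>2 b x) = (LINT x|lborel. g2 b x * \<phi> x)" if b: "b \<in> Basis" for b
  proof -
    note dh = dir_deriv_heat[OF t norm_Basis[OF b], folded g1_def g2_def]
    \<comment> \<open>The first-order terms cancel in the derivative of this combination, so its
      vanishing integral is two integrations by parts at once.\<close>
    have "dir_deriv b (\<lambda>x. heat t x * \<phi>1 b x - g1 b x * \<phi> x)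
       (\<lambda>x. (heat t x * \<phi>2 b x + g1 b x * \<phi>1 b x) - (g1 b x * \<phi>1 b x + g2 b x * \<phi> x))"
      by (intro dir_deriv_diff dir_deriv_mult dh d b)
    then have "dir_deriv b (\<lambda>x. heat t x * \<phi>1 b x - g1 b x * \<phi> x) (\<lambda>x. heat t x * \<phi>2 b x - g2 b x * \<phi> x)"
      by simp
    then have "(LINT x|lborel. heat t x * \<phi>2 b x - g2 b x * \<phi> x) = 0"
      by (rule integral_dir_deriv_eq_0) (intro compactly_supported_diff compactly_supported_mult c cg ch b)+
    moreover have "integrable lborel (\<lambda>x. heat t x * \<phi>2 b x)" "integrable lborel (\<lambda>x. g2 b x * \<phi> x)"
      by (intro compactly_supported_integrable compactly_supported_mult c cg ch b)+
    ultimately show ?thesis by simp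
  qed
  have "(LINT x|lborel. heat t x * (\<Sum>b\<in>Basis. \<phi>2 b x)) = (\<Sum>b\<in>Basis. LINT x|lborel. heat t x * \<phi>2 b x)"
    unfolding sum_distrib_left
    by (intro Bochner_Integration.integral_sum compactly_supported_integrable compactly_supported_mult c ch)
  also have "\<dots> = (\<Sum>b\<in>Basis. LINT x|lborel. g2 b x * \<phi> x)" using eq by simp
  also have "\<dots> = (LINT x|lborel. (\<Sum>b\<in>Basis. g2 b x * \<phi> x))"
    by (intro Bochner_Integration.integral_sum[symmetric] compactly_supported_integrable compactly_supported_mult c cg)
  also have "(\<lambda>x. \<Sum>b\<in>Basis. g2 b x * \<phi> x) = (\<lambda>x. ((norm x)\<^sup>2 / (4 * t\<^sup>2) - DIM('a) / (2 * t)) * heat t x * \<phi> x)"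
  proof
    fix x :: 'a
    have "(norm x)\<^sup>2 = (\<Sum>b\<in>Basis. (x \<bullet> b)\<^sup>2)"
      by (subst power2_norm_eq_inner, subst euclidean_inner) (simp add: power2_eq_square)
    then have "(\<Sum>b\<in>Basis. (x \<bullet> b)\<^sup>2 / (4 * t\<^sup>2) - 1 / (2 * t)) = (norm x)\<^sup>2 / (4 * t\<^sup>2) - DIM('a) / (2 * t)"
      by (simp add: sum_subtractf sum_divide_distrib)
    then show "(\<Sum>b\<in>Basis. g2 b x * \<phi> x) = ((norm x)\<^sup>2 / (4 * t\<^sup>2) - DIM('a) / (2 * t)) * heat t x * \<phi> x"
      by (simp add: g2_def sum_distrib_right[symmetric])
  qed
  finally show ?thesis .
qed

lemma integral_lborel_scale:
  fixes f :: "'a::euclidean_space \<Rightarrow> real"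
  assumes c: "0 < c" and [measurable]: "f \<in> borel_measurable borel"
  shows "(LINT x|lborel. f x) = c ^ DIM('a) * (LINT x|lborel. f (c *\<^sub>R x))"
  using c by (subst lborel_affine[of c 0]) (simp_all add: integral_density integral_distr)

lemma heat_scale:
  fixes x :: "'a::euclidean_space"
  assumes t: "0 < t"
  shows "sqrt t ^ DIM('a) * heat t (sqrt t *\<^sub>R x) = heat 1 x"
  using t by (simp add: heat_def real_sqrt_mult power_mult_distrib)

text \<open>Rescaling space by the square root of time freezes the kernel at time 1 and moves the
  limit into the continuous function \<open>\<phi>\<close>, where dominated convergence
  applies.\<close>

lemma integral_heat_tendsto:
  fixes \<phi> :: "'a::euclidean_space \<Rightarrow> real"
  assumes c: "compactly_supported \<phi>"
    and h: "h \<longlonglongrightarrow> 0" "\<And>k::nat. 0 < h k"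
  shows "(\<lambda>k. LINT x|lborel. heat (h k) x * \<phi> x) \<longlonglongrightarrow> \<phi> 0"
proof -
  have [measurable]: "\<phi> \<in> borel_measurable borel" using c by measurable
  obtain M where M: "0 \<le> M" "\<And>x. \<bar>\<phi> x\<bar> \<le> M" using compactly_supported_bounded[OF c] by blast
  have "(\<lambda>k. LINT x|lborel. heat 1 x * \<phi> (sqrt (h k) *\<^sub>R x)) \<longlonglongrightarrow> (LINT x|lborel. heat 1 (x::'a) * \<phi> 0)"
  proof (rule integral_dominated_convergence)
    show "integrable lborel (\<lambda>x::'a. heat 1 x * M)" using heat_integrable[of 1, where 'a='a] by simp
    show "AE x in lborel. norm (heat 1 x * \<phi> (sqrt (h k) *\<^sub>R x)) \<le> heat 1 x * M" for k
      using M by (auto simp: abs_mult heat_nonneg intro!: mult_left_mono)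
    have "isCont \<phi> 0" using c unfolding compactly_supported_def by (simp add: continuous_on_eq_continuous_at)
    moreover have "(\<lambda>k. sqrt (h k) *\<^sub>R x) \<longlonglongrightarrow> 0" for x :: 'a
      using tendsto_scaleR[OF tendsto_real_sqrt[OF h(1)] tendsto_const[of x]] by simp
    ultimately have "(\<lambda>k. \<phi> (sqrt (h k) *\<^sub>R x)) \<longlonglongrightarrow> \<phi> 0" for x :: 'a
      by (rule isCont_tendsto_compose)
    then show "AE x in lborel. (\<lambda>k. heat 1 x * \<phi> (sqrt (h k) *\<^sub>R x)) \<longlonglongrightarrow> heat 1 x * \<phi> 0"
      by (intro AE_I2 tendsto_intros)
  qed auto
  moreover have "(LINT x|lborel. heat 1 (x::'a) * \<phi> 0) = \<phi> 0"
    by (simp add: integral_heat[of 1, simplified])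
  moreover have "(LINT x|lborel. heat (h k) x * \<phi> x) = (LINT x|lborel. heat 1 x * \<phi> (sqrt (h k) *\<^sub>R x))" for k
    using h(2)[of k]
    by (subst integral_lborel_scale[of "sqrt (h k)"])
       (simp_all flip: integral_mult_right_zero mult.assoc add: heat_scale)
  ultimately show ?thesis by (simp only:)
qed

text \<open>After integration in space the integrand is minus the time derivative of the pairing of
  \<open>\<kappa> t\<close> with \<open>\<phi>\<close>. The time integral telescopes to the limit at
  time zero, which is \<open>\<phi> 0\<close> because the heat kernel concentrates, minus the limit
  0 at infinity.\<close>

lemma integral_res_heat_resolvent:
  fixes \<phi> :: "'a::euclidean_space \<Rightarrow> real"
  assumes b: "0 < b"
    and d: "\<And>e. e \<in> Basis \<Longrightarrow> dir_deriv e \<phi> (\<phi>1 e)" "\<And>e. e \<in> Basis \<Longrightarrow> dir_deriv e (\<phi>1 e) (\<phi>2 e)"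
    and c: "compactly_supported \<phi>" "\<And>e. e \<in> Basis \<Longrightarrow> compactly_supported (\<phi>1 e)"
      "\<And>e. e \<in> Basis \<Longrightarrow> compactly_supported (\<phi>2 e)"
  shows "(LINT z|(lborel \<Otimes>\<^sub>M lborel). res_heat b (fst z) (snd z) * (b * \<phi> (snd z) - (\<Sum>e\<in>Basis. \<phi>2 e (snd z)))) = \<phi> 0"
proof -
  define \<psi> where "\<psi> x = b * \<phi> x - (\<Sum>e\<in>Basis. \<phi>2 e x)" for x
  define \<kappa> where "\<kappa> t x = exp (- (b * t)) * heat t x" for t and x :: 'a
  define \<kappa>' where "\<kappa>' t x = ((norm x)\<^sup>2 / (4 * t\<^sup>2) - DIM('a) / (2 * t) - b) * \<kappa> t x" for t and x :: 'a
  have c\<psi>: "compactly_supported \<psi>" unfolding \<psi>_def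
    by (intro compactly_supported_diff compactly_supported_mult[where g = "\<lambda>_. b"] compactly_supported_sum c continuous_intros)
  have [measurable]: "\<phi> \<in> borel_measurable borel" "\<psi> \<in> borel_measurable borel" using c c\<psi> by measurable
  have [measurable]: "\<kappa> t \<in> borel_measurable borel" for t unfolding \<kappa>_def by measurable
  obtain M where M: "0 \<le> M" "\<And>x. \<bar>\<psi> x\<bar> \<le> M" using compactly_supported_bounded[OF c\<psi>] by blast
  obtain M0 where M0: "0 \<le> M0" "\<And>x. \<bar>\<phi> x\<bar> \<le> M0" using compactly_supported_bounded[OF c(1)] by blast
  obtain R where R: "\<And>x. R < norm x \<Longrightarrow> \<phi> x = 0" using c(1) unfolding compactly_supported_def by blast
  define Q where "Q t = (LINT x|lborel. res_heat b t x * \<psi> x)" for t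
  have int\<psi>: "integrable (lborel \<Otimes>\<^sub>M lborel) (\<lambda>z. res_heat b (fst z) (snd z) * \<psi> (snd z))"
    using conv_bessel_bounded(1)[OF b, of "\<lambda>x. \<psi> (- x)" M 0] M by simp
  have intQ: "integrable lborel Q"
    using lborel_pair.integrable_fst'[OF int\<psi>] by (simp add: Q_def[abs_def])
  have cont\<kappa>: "continuous_on UNIV (\<kappa> t)" "continuous_on UNIV (\<kappa>' t)" if "0 < t" for t
    unfolding \<kappa>'_def \<kappa>_def heat_def using that by (auto intro!: continuous_intros)
  \<comment> \<open>\<open>\<kappa>'\<close> is the time derivative of \<open>\<kappa>\<close>; the
    spatial Laplacian in \<open>\<psi>\<close> has been exchanged for it by the heat
    equation.\<close>
  have Q': "Q t = - (LINT x|lborel. \<kappa>' t x * \<phi> x)" if t: "0 < t" for t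
  proof -
    have ch: "continuous_on UNIV (heat t :: 'a \<Rightarrow> real)"
      unfolding heat_def using t by (auto intro!: continuous_intros)
    have i1: "integrable lborel (\<lambda>x. heat t x * \<phi> x)"
      and i2: "integrable lborel (\<lambda>x. heat t x * (\<Sum>e\<in>Basis. \<phi>2 e x))"
      and i3: "integrable lborel (\<lambda>x. ((norm x)\<^sup>2 / (4 * t\<^sup>2) - DIM('a) / (2 * t)) * heat t x * \<phi> x)"
      using t by (auto intro!: compactly_supported_integrable compactly_supported_mult compactly_supported_sum c ch continuous_intros)
    have "(LINT x|lborel. heat t x * \<psi> x) = (LINT x|lborel. b * (heat t x * \<phi> x) - heat t x * (\<Sum>e\<in>Basis. \<phi>2 e x))"
      by (simp add: \<psi>_def algebra_simps)
    also have "\<dots> = b * (LINT x|lborel. heat t x * \<phi> x) - (LINT x|lborel. heat t x * (\<Sum>e\<in>Basis. \<phi>2 e x))"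
      using i1 i2 by simp
    also have "\<dots> = b * (LINT x|lborel. heat t x * \<phi> x) - (LINT x|lborel. ((norm x)\<^sup>2 / (4 * t\<^sup>2) - DIM('a) / (2 * t)) * heat t x * \<phi> x)"
      using integral_heat_laplacian[OF t d c] by simp
    also have "\<dots> = (LINT x|lborel. b * (heat t x * \<phi> x) - ((norm x)\<^sup>2 / (4 * t\<^sup>2) - DIM('a) / (2 * t)) * heat t x * \<phi> x)"
      using i1 i3 by simp
    finally have eq: "(LINT x|lborel. heat t x * \<psi> x) = \<dots>" .
    have "Q t = exp (- (b * t)) * (LINT x|lborel. heat t x * \<psi> x)"
      unfolding Q_def res_heat_def using t by (simp add: mult.assoc flip: integral_mult_right_zero)
    also have "\<dots> = - (LINT x|lborel. \<kappa>' t x * \<phi> x)"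
      unfolding eq by (simp flip: integral_mult_right_zero integral_minus add: \<kappa>'_def \<kappa>_def algebra_simps)
    finally show ?thesis .
  qed
  \<comment> \<open>On a compact time interval away from zero the integrand is continuous with
    compact support, so Fubini and the fundamental theorem of calculus apply.\<close>
  have FTC: "(LINT x|lborel. \<kappa> s x * \<phi> x) - (LINT x|lborel. \<kappa> r x * \<phi> x) = (LINT t|lborel. indicator {s..r} t * Q t)"
    if s: "0 < s" "s \<le> r" for s r
  proof -
    have 1: "(LINT t|lborel. \<kappa>' t x * indicator {s..r} t) = \<kappa> r x - \<kappa> s x" for x
    proof (rule integral_FTC_Icc_real)
      fix t assume t: "s \<le> t" "t \<le> r"
      then have "0 < t" using s by simp
      have "((\<lambda>t. exp (- (b * t))) has_real_derivative exp (- (b * t)) * - b) (at t)"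
        by (auto intro!: derivative_eq_intros)
      from DERIV_mult[OF this heat_time_deriv[OF \<open>0 < t\<close>, of x]]
      show "((\<lambda>t. \<kappa> t x) has_real_derivative \<kappa>' t x) (at t)"
        unfolding \<kappa>_def \<kappa>'_def by (rule DERIV_cong) (simp add: algebra_simps)
      show "isCont (\<lambda>t. \<kappa>' t x) t"
        unfolding \<kappa>_def \<kappa>'_def heat_def using \<open>0 < t\<close> by (intro continuous_intros) auto
    qed (use s in auto)
    have i: "integrable (lborel \<Otimes>\<^sub>M lborel) (\<lambda>(t, x). indicator {s..r} t * (\<kappa>' t x * \<phi> x))"
    proof -
      have "compact ({s..r} \<times> cball (0::'a) R)" by (intro compact_Times) auto
      moreover have "continuous_on ({s..r} \<times> cball (0::'a) R) (\<lambda>z. \<kappa>' (fst z) (snd z) * \<phi> (snd z))"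
      proof (intro continuous_on_mult)
        show "continuous_on ({s..r} \<times> cball 0 R) (\<lambda>z. \<kappa>' (fst z) (snd z::'a))"
          unfolding \<kappa>'_def \<kappa>_def heat_def by (intro continuous_intros) (use s in auto)
        show "continuous_on ({s..r} \<times> cball 0 R) (\<lambda>z. \<phi> (snd z))"
          using c(1) unfolding compactly_supported_def
          by (auto intro!: continuous_on_compose2[of UNIV \<phi> _ snd] continuous_on_snd continuous_on_id)
      qed
      ultimately have "integrable lborel (\<lambda>z. indicator ({s..r} \<times> cball (0::'a) R) z *\<^sub>R (\<kappa>' (fst z) (snd z) * \<phi> (snd z)))"
        by (rule borel_integrable_compact)
      moreover have "(\<lambda>z. indicator ({s..r} \<times> cball (0::'a) R) z *\<^sub>R (\<kappa>' (fst z) (snd z) * \<phi> (snd z)))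
        = (\<lambda>(t, x). indicator {s..r} t * (\<kappa>' t x * \<phi> x))"
      proof (intro ext, clarify)
        fix t and x :: 'a
        show "indicator ({s..r} \<times> cball (0::'a) R) (t, x) *\<^sub>R (\<kappa>' (fst (t, x)) (snd (t, x)) * \<phi> (snd (t, x)))
          = indicator {s..r} t * (\<kappa>' t x * \<phi> x)"
          by (cases "norm x \<le> R") (simp_all add: indicator_times R)
      qed
      ultimately show ?thesis by (simp add: lborel_prod)
    qed
    have "(LINT t|lborel. indicator {s..r} t * Q t) = (LINT t|lborel. - (LINT x|lborel. indicator {s..r} t * (\<kappa>' t x * \<phi> x)))"
      using s by (intro Bochner_Integration.integral_cong refl) (auto simp: Q' indicator_def)
    also have "\<dots> = - (LINT t|lborel. LINT x|lborel. indicator {s..r} t * (\<kappa>' t x * \<phi> x))" by simp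
    also have "(LINT t|lborel. LINT x|lborel. indicator {s..r} t * (\<kappa>' t x * \<phi> x))
        = (LINT x|lborel. LINT t|lborel. indicator {s..r} t * (\<kappa>' t x * \<phi> x))"
      using lborel_pair.Fubini_integral[of "\<lambda>t x. indicator {s..r} t * (\<kappa>' t x * \<phi> x)"] i by simp
    also have "\<dots> = (LINT x|lborel. (\<kappa> r x - \<kappa> s x) * \<phi> x)"
    proof -
      have "(\<lambda>t. indicator {s..r} t * (\<kappa>' t x * \<phi> x)) = (\<lambda>t. \<kappa>' t x * indicator {s..r} t * \<phi> x)" for x
        by (simp add: fun_eq_iff mult_ac)
      then show ?thesis unfolding 1[symmetric] by (simp only: integral_mult_left_zero)
    qed
    also have "- \<dots> = (LINT x|lborel. \<kappa> s x * \<phi> x - \<kappa> r x * \<phi> x)"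
      by (subst Bochner_Integration.integral_minus[symmetric]) (simp add: algebra_simps)
    also have "\<dots> = (LINT x|lborel. \<kappa> s x * \<phi> x) - (LINT x|lborel. \<kappa> r x * \<phi> x)"
      using s by (intro Bochner_Integration.integral_diff compactly_supported_integrable compactly_supported_mult cont\<kappa> c) auto
    finally show ?thesis by simp
  qed
  define h where "h k = inverse (real (Suc k))" for k
  have h: "0 < h k" "h k \<le> 1" for k by (auto simp: h_def inverse_le_1_iff)
  have hl: "h \<longlonglongrightarrow> 0" unfolding h_def[abs_def] by (rule LIMSEQ_inverse_real_of_nat)
  have m\<kappa>: "(LINT x|lborel. \<kappa> t x * \<phi> x) = exp (- (b * t)) * (LINT x|lborel. heat t x * \<phi> x)" for t
    unfolding \<kappa>_def by (simp add: mult.assoc)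
  have L1: "(\<lambda>k. LINT x|lborel. \<kappa> (h k) x * \<phi> x) \<longlonglongrightarrow> \<phi> 0"
  proof -
    have "(\<lambda>k. exp (- (b * h k))) \<longlonglongrightarrow> exp (- (b * 0))" by (intro tendsto_intros hl)
    from tendsto_mult[OF this integral_heat_tendsto[OF c(1) hl h(1)]]
    show ?thesis by (simp add: m\<kappa>)
  qed
  \<comment> \<open>The heat kernel has mass one and \<open>\<phi>\<close> is bounded, so the factor
    \<open>exp (- (b * t))\<close> alone forces the limit.\<close>
  have L2: "(\<lambda>k. LINT x|lborel. \<kappa> (real (Suc k)) x * \<phi> x) \<longlonglongrightarrow> 0"
  proof (rule tendsto_rabs_zero_cancel, rule tendsto_sandwich[OF _ _ tendsto_const])
    show "\<forall>\<^sub>F k in sequentially. \<bar>LINT x|lborel. \<kappa> (real (Suc k)) x * \<phi> x\<bar> \<le> M0 * exp (- (b * real (Suc k)))"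
    proof (intro always_eventually allI)
      fix k
      have "\<bar>LINT x|lborel. heat (real (Suc k)) x * \<phi> x\<bar> \<le> (LINT x|lborel. \<bar>heat (real (Suc k)) x * \<phi> x\<bar>)"
        by (rule integral_abs_bound)
      also have "\<dots> \<le> (LINT x|lborel. heat (real (Suc k)) (x::'a) * M0)"
      proof (rule integral_mono)
        have "integrable lborel (\<lambda>x. heat (real (Suc k)) x * \<phi> x)"
          by (rule compactly_supported_integrable, rule compactly_supported_mult[OF c(1)])
             (auto simp: heat_def intro!: continuous_intros simp del: of_nat_Suc)
        then show "integrable lborel (\<lambda>x. \<bar>heat (real (Suc k)) x * \<phi> x\<bar>)" by simp
        show "integrable lborel (\<lambda>x::'a. heat (real (Suc k)) x * M0)"
          using heat_integrable[of "real (Suc k)", where 'a='a] by simp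
      qed (use M0 in \<open>auto simp: abs_mult heat_nonneg intro!: mult_left_mono simp del: of_nat_Suc\<close>)
      also have "\<dots> = M0" using integral_heat[of "real (Suc k)", where 'a='a] by simp
      finally have "\<bar>LINT x|lborel. heat (real (Suc k)) x * \<phi> x\<bar> \<le> M0" .
      then show "\<bar>LINT x|lborel. \<kappa> (real (Suc k)) x * \<phi> x\<bar> \<le> M0 * exp (- (b * real (Suc k)))"
        unfolding m\<kappa> abs_mult by (simp add: mult.commute mult_right_mono)
    qed
    have "filterlim (\<lambda>k. b * real (Suc k)) at_top sequentially"
      by (rule filterlim_tendsto_pos_mult_at_top[OF tendsto_const b])
         (rule filterlim_compose[OF filterlim_real_sequentially filterlim_Suc])
    then have "(\<lambda>k. exp (- (b * real (Suc k)))) \<longlonglongrightarrow> 0"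
      by (intro filterlim_compose[OF exp_at_bot]) (simp add: filterlim_uminus_at_top)
    then show "(\<lambda>k. M0 * exp (- (b * real (Suc k)))) \<longlonglongrightarrow> 0"
      by (rule tendsto_mult_right_zero)
  qed auto
  have L3: "(\<lambda>k. LINT t|lborel. indicator {h k..real (Suc k)} t * Q t) \<longlonglongrightarrow> (LINT t|lborel. Q t)"
  proof (rule integral_dominated_convergence)
    show "integrable lborel (\<lambda>t. \<bar>Q t\<bar>)" using intQ by simp
    show "AE t in lborel. norm (indicator {h k..real (Suc k)} t * Q t) \<le> \<bar>Q t\<bar>" for k
      by (auto simp: indicator_def)
    show "AE t in lborel. (\<lambda>k. indicator {h k..real (Suc k)} t * Q t) \<longlonglongrightarrow> Q t"
    proof (intro AE_I2)
      fix t :: real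
      show "(\<lambda>k. indicator {h k..real (Suc k)} t * Q t) \<longlonglongrightarrow> Q t"
      proof (cases "0 < t")
        case True
        have "eventually (\<lambda>k. h k < t) sequentially" using hl True by (rule order_tendstoD)
        moreover have "eventually (\<lambda>k. t \<le> real k) sequentially"
          using filterlim_real_sequentially unfolding filterlim_at_top by blast
        ultimately have "eventually (\<lambda>k. indicator {h k..real (Suc k)} t * Q t = Q t) sequentially"
          by eventually_elim (auto simp: indicator_def)
        then show ?thesis by (rule tendsto_eventually)
      next
        case False
        then have "Q t = 0" by (simp add: Q_def res_heat_def)
        then show ?thesis by simp
      qed
    qed
  qed (use intQ in measurable)
  have "(\<lambda>k. LINT t|lborel. indicator {h k..real (Suc k)} t * Q t) \<longlonglongrightarrow> \<phi> 0 - 0"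
  proof -
    have "h k \<le> real (Suc k)" for k using h(2)[of k] by simp
    then show ?thesis using tendsto_diff[OF L1 L2] FTC[OF h(1)] by simp
  qed
  with L3 have "(LINT t|lborel. Q t) = \<phi> 0" by (auto intro: LIMSEQ_unique)
  moreover have "(LINT t|lborel. Q t) = (LINT z|(lborel \<Otimes>\<^sub>M lborel). res_heat b (fst z) (snd z) * \<psi> (snd z))"
    using lborel_pair.integral_fst'[OF int\<psi>] by (simp add: Q_def)
  ultimately show ?thesis by (simp add: \<psi>_def)
qed

text \<open>The identity at the origin is applied to \<open>\<lambda>z. \<psi> (x - z)\<close>; the
  first derivatives change sign under this reflection and the second ones do not.\<close>

theorem conv_bessel_resolvent:
  fixes \<psi> :: "'a::euclidean_space \<Rightarrow> real"
  assumes b: "0 < b"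
    and d: "\<And>e. e \<in> Basis \<Longrightarrow> dir_deriv e \<psi> (\<psi>1 e)" "\<And>e. e \<in> Basis \<Longrightarrow> dir_deriv e (\<psi>1 e) (\<psi>2 e)"
    and c: "compactly_supported \<psi>" "\<And>e. e \<in> Basis \<Longrightarrow> compactly_supported (\<psi>1 e)"
      "\<And>e. e \<in> Basis \<Longrightarrow> compactly_supported (\<psi>2 e)"
  shows "conv (bessel b) (\<lambda>y. b * \<psi> y - (\<Sum>e\<in>Basis. \<psi>2 e y)) x = \<psi> x"
proof -
  define g where "g y = b * \<psi> y - (\<Sum>e\<in>Basis. \<psi>2 e y)" for y
  have cg: "compactly_supported g" unfolding g_def
    by (intro compactly_supported_diff compactly_supported_mult[where g = "\<lambda>_. b"] compactly_supported_sum c continuous_intros)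
  obtain M where M: "\<And>x. \<bar>g x\<bar> \<le> M" using compactly_supported_bounded[OF cg] by blast
  have "conv (bessel b) g x = (LINT z|(lborel \<Otimes>\<^sub>M lborel). res_heat b (fst z) (snd z) * g (x - snd z))"
    by (rule conv_bessel_bounded(2)[OF b _ M]) (use cg in measurable)
  also have "\<dots> = \<psi> (x - 0)"
    unfolding g_def
  proof (rule integral_res_heat_resolvent[OF b])
    fix e :: 'a assume e: "e \<in> Basis"
    show "dir_deriv e (\<lambda>z. \<psi> (x - z)) (\<lambda>z. - \<psi>1 e (x - z))"
      by (rule dir_deriv_reflect) (rule d(1)[OF e])
    have "dir_deriv e (\<lambda>z. 0 - \<psi>1 e (x - z)) (\<lambda>z. 0 - - \<psi>2 e (x - z))"
      by (rule dir_deriv_diff[OF _ dir_deriv_reflect[OF d(2)[OF e]]]) (simp add: dir_deriv_def)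
    then show "dir_deriv e (\<lambda>z. - \<psi>1 e (x - z)) (\<lambda>z. \<psi>2 e (x - z))" by simp
    show "compactly_supported (\<lambda>z. - \<psi>1 e (x - z))"
      by (intro compactly_supported_uminus compactly_supported_reflect c e)
    show "compactly_supported (\<lambda>z. \<psi>2 e (x - z))"
      by (intro compactly_supported_reflect c e)
  qed (intro compactly_supported_reflect c)
  finally show ?thesis by (simp add: g_def[abs_def])
qed

section \<open>Derivatives of convolutions with the Bessel kernel\<close>

text \<open>A Gamma integral. It is used with exponent -1/2 for the gradient of the kernel, and with
  \<open>- (d / 2)\<close>, \<open>d < 2\<close>, for the smoothing by two kernels.\<close>

lemma power_exp_integrable:
  fixes a b :: real
  assumes a: "-1 < a" and b: "0 < b"
  shows "integrable lborel (\<lambda>t. indicator {0<..} t * (t powr a * exp (- (b * t))))"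
proof -
  have "(\<lambda>t. complex_of_real t powr (complex_of_real (a + 1) - 1) / of_real (exp (b * t))) absolutely_integrable_on {0<..}"
    using a b by (intro absolutely_integrable_Gamma_integral) auto
  then have "integrable lebesgue (\<lambda>t. norm (indicator {0<..} t *\<^sub>R (complex_of_real t powr complex_of_real a / of_real (exp (b * t)))))"
    unfolding set_integrable_def by (intro integrable_norm) simp
  also have "(\<lambda>t. norm (indicator {0<..} t *\<^sub>R (complex_of_real t powr complex_of_real a / of_real (exp (b * t)))))
     = (\<lambda>t. indicator {0<..} t * (t powr a * exp (- (b * t))))"
    by (auto simp: fun_eq_iff indicator_def norm_mult norm_inverse powr_of_real exp_minus divide_inverse)
  finally show ?thesis
    by (subst (asm) integrable_completion) measurable
qed

definition grad_heat :: "real \<Rightarrow> 'a::euclidean_space \<Rightarrow> real \<times> 'a \<Rightarrow> real" where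
  "grad_heat b e z = - (snd z \<bullet> e) / (2 * fst z) * res_heat b (fst z) (snd z)"

text \<open>The factor \<open>norm x / sqrt t\<close> of the gradient is absorbed by doubling the
  time in the Gaussian, at the price of \<open>sqrt 2 ^ DIM('a)\<close>. What remains is the
  singularity \<open>t powr (-1/2)\<close>, integrable at zero.\<close>

definition grad_major :: "real \<Rightarrow> real \<times> 'a::euclidean_space \<Rightarrow> real" where
  "grad_major b z = sqrt 2 ^ DIM('a) * (indicator {0<..} (fst z) * (fst z powr (-1/2) * exp (- (b * fst z)))) * heat (2 * fst z) (snd z)"

lemma grad_heat_meas [measurable]: "grad_heat b e \<in> borel_measurable (borel \<Otimes>\<^sub>M borel)"
  unfolding grad_heat_def[abs_def] by simp

lemma grad_major_integrable:
  assumes b: "0 < b"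
  shows "integrable (lborel \<Otimes>\<^sub>M lborel) (grad_major b :: real \<times> 'a::euclidean_space \<Rightarrow> real)"
proof (rule integrableI_bounded)
  show "grad_major b \<in> borel_measurable (lborel \<Otimes>\<^sub>M (lborel :: 'a measure))"
    unfolding grad_major_def[abs_def] by measurable
  let ?p = "\<lambda>t. indicator {0<..} t * (t powr (-1/2) * exp (- (b * t))) :: real"
  have p: "integrable lborel ?p" using b by (intro power_exp_integrable) auto
  have p0: "0 \<le> ?p t" for t by simp
  have h: "(\<integral>\<^sup>+x. ennreal (norm (grad_major b (t, x::'a))) \<partial>lborel) = ennreal (sqrt 2 ^ DIM('a)) * ennreal (?p t)" for t
  proof (cases "0 < t")
    case True
    have "(\<integral>\<^sup>+x. ennreal (norm (grad_major b (t, x::'a))) \<partial>lborel)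
      = (\<integral>\<^sup>+x. ennreal (sqrt 2 ^ DIM('a) * ?p t) * ennreal (heat (2 * t) (x::'a)) \<partial>lborel)"
      using True by (intro nn_integral_cong) (simp add: grad_major_def abs_mult heat_nonneg flip: ennreal_mult)
    also have "\<dots> = ennreal (sqrt 2 ^ DIM('a) * ?p t)"
      using True nn_integral_heat[of "2 * t", where 'a='a] by (subst nn_integral_cmult) auto
    finally show ?thesis by (simp add: ennreal_mult)
  qed (simp add: grad_major_def)
  have "(\<integral>\<^sup>+z. ennreal (norm (grad_major b (z :: real \<times> 'a))) \<partial>(lborel \<Otimes>\<^sub>M lborel))
    = (\<integral>\<^sup>+t. \<integral>\<^sup>+x. ennreal (norm (grad_major b (t, x::'a))) \<partial>lborel \<partial>lborel)"
    by (rule lborel.nn_integral_fst[symmetric]) (unfold grad_major_def[abs_def], measurable)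
  also have "\<dots> = ennreal (sqrt 2 ^ DIM('a)) * (\<integral>\<^sup>+t. ennreal (?p t) \<partial>lborel)"
    unfolding h by (rule nn_integral_cmult) measurable
  also have "\<dots> < \<infinity>"
    using p by (simp add: integrable_iff_bounded ennreal_mult_less_top)
  finally show "(\<integral>\<^sup>+z. ennreal (norm (grad_major b (z :: real \<times> 'a))) \<partial>(lborel \<Otimes>\<^sub>M lborel)) < \<infinity>" .
qed

lemma grad_heat_le_major:
  fixes e :: "'a::euclidean_space"
  assumes e: "norm e = 1"
  shows "\<bar>grad_heat b e z\<bar> \<le> grad_major b z"
proof (cases "0 < fst z")
  case True
  define t x where "t = fst z" and "x = snd z"
  have t: "0 < t" using True by (simp add: t_def)
  define r where "r = norm x / sqrt t"
  have xr: "norm x = r * sqrt t" using t by (simp add: r_def)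
  \<comment> \<open>Half of the Gaussian decay \<open>exp (- (r\<^sup>2 / 4))\<close> is spent on
    the linear factor \<open>r\<close>. The inequality combines
    \<open>(r / sqrt 8 - 1)\<^sup>2 \<ge> 0\<close> with the tangent bound for
    \<open>exp\<close>.\<close>
  have "r \<le> sqrt 2 * exp (r\<^sup>2 / 8)"
  proof -
    have "0 \<le> (r / sqrt 8 - 1)\<^sup>2" by simp
    then have "2 * (r / sqrt 8) \<le> 1 + r\<^sup>2 / 8" by (simp add: power2_diff power_divide)
    also have "\<dots> \<le> exp (r\<^sup>2 / 8)" by (rule exp_ge_add_one_self)
    finally have "sqrt 2 * (2 * (r / sqrt 8)) \<le> sqrt 2 * exp (r\<^sup>2 / 8)" by (rule mult_left_mono) simp
    moreover have "sqrt 2 * (2 * (r / sqrt 8)) = r"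
    proof -
      have "sqrt 8 = 2 * sqrt (2::real)" using real_sqrt_mult[of 4 2] by simp
      then show ?thesis by simp
    qed
    ultimately show ?thesis by simp
  qed
  then have "r * exp (- (r\<^sup>2 / 8)) \<le> sqrt 2"
    by (simp add: exp_minus field_simps)
  then have 1: "r * exp (- (r\<^sup>2 / 8)) / 2 \<le> 1"
    using real_sqrt_le_mono[of 2 4] by simp
  have rt: "(norm x)\<^sup>2 = r\<^sup>2 * t" using t by (simp add: xr power_mult_distrib)
  have h: "heat t x = exp (- (r\<^sup>2 / 8)) * (sqrt 2 ^ DIM('a) * heat (2 * t) x)"
  proof -
    have "heat t x = (exp (- (r\<^sup>2 / 8)) * exp (- (r\<^sup>2 / 8))) / sqrt (4 * pi * t) ^ DIM('a)"
      unfolding heat_def rt exp_add[symmetric] using t by simp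
    moreover have "heat (2 * t) x = exp (- (r\<^sup>2 / 8)) / (sqrt 2 ^ DIM('a) * sqrt (4 * pi * t) ^ DIM('a))"
      unfolding heat_def rt power_mult_distrib[symmetric] real_sqrt_mult[symmetric] using t by simp
    ultimately show ?thesis by simp
  qed
  have "\<bar>x \<bullet> e\<bar> \<le> norm x" using Cauchy_Schwarz_ineq2[of x e] e by simp
  then have "\<bar>grad_heat b e z\<bar> \<le> norm x / (2 * t) * (exp (- (b * t)) * heat t x)"
    using t by (simp add: grad_heat_def t_def[symmetric] x_def[symmetric] res_heat_def abs_mult heat_nonneg
        divide_right_mono mult_right_mono)
  also have "\<dots> = (r * exp (- (r\<^sup>2 / 8)) / 2) * (sqrt t / t * (sqrt 2 ^ DIM('a) * exp (- (b * t)) * heat (2 * t) x))"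
    unfolding h xr by (simp add: mult_ac)
  also have "\<dots> \<le> 1 * (sqrt t / t * (sqrt 2 ^ DIM('a) * exp (- (b * t)) * heat (2 * t) x))"
    using t 1 by (intro mult_right_mono) (auto intro!: mult_nonneg_nonneg simp: heat_nonneg)
  also have "sqrt t / t = t powr (-1/2)"
    using t by (simp add: sqrt_divide_self_eq powr_minus powr_half_sqrt)
  finally show ?thesis
    using t by (simp add: grad_major_def t_def[symmetric] x_def[symmetric] mult_ac)
qed (simp add: grad_heat_def grad_major_def res_heat_def)

lemma grad_heat_integrable:
  fixes e :: "'a::euclidean_space"
  assumes "norm e = 1" "0 < b"
  shows "integrable (lborel \<Otimes>\<^sub>M lborel) (grad_heat b e)"
  using grad_heat_le_major[OF assms(1), of b]
  by (intro Bochner_Integration.integrable_bound[OF grad_major_integrable[OF assms(2)]]) (auto intro!: AE_I2 order_trans[OF _ abs_ge_self] simp del: abs_le_iff)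

text \<open>Candidate for the derivative of the convolution in direction \<open>e\<close>, written
  in space-time because the gradient is dominated there by \<open>grad_major\<close>.\<close>

definition grad_conv :: "real \<Rightarrow> 'a::euclidean_space \<Rightarrow> ('a \<Rightarrow> real) \<Rightarrow> 'a \<Rightarrow> real" where
  "grad_conv b e f x = (LINT z|(lborel \<Otimes>\<^sub>M lborel). grad_heat b e z * f (x - snd z))"

lemma grad_conv_integrable:
  fixes e :: "'a::euclidean_space"
  assumes e: "norm e = 1" "0 < b" and fm [measurable]: "f \<in> borel_measurable borel" and M: "\<And>x. \<bar>f x\<bar> \<le> M"
  shows "integrable (lborel \<Otimes>\<^sub>M lborel) (\<lambda>z. grad_heat b e z * f (x - snd z))"
proof (rule Bochner_Integration.integrable_bound)
  show "integrable (lborel \<Otimes>\<^sub>M lborel) (\<lambda>z. M * grad_heat b e z)"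
    using grad_heat_integrable[OF e] by simp
  have "\<bar>f y\<bar> \<le> \<bar>M\<bar>" for y using M[of y] by linarith
  then show "AE z in lborel \<Otimes>\<^sub>M lborel. norm (grad_heat b e z * f (x - snd z)) \<le> norm (M * grad_heat b e z)"
    by (intro AE_I2) (auto simp: abs_mult mult.commute[of _ "\<bar>f _\<bar>"] intro!: mult_right_mono)
qed measurable

lemma grad_conv_bounded:
  fixes e :: "'a::euclidean_space"
  assumes e: "norm e = 1" "0 < b" and fm [measurable]: "f \<in> borel_measurable borel" and M: "\<And>x. \<bar>f x\<bar> \<le> M"
  shows "\<bar>grad_conv b e f x\<bar> \<le> M * (LINT z|(lborel \<Otimes>\<^sub>M lborel). grad_major b (z :: real \<times> 'a))"
proof -
  have M0: "0 \<le> M" using M[of 0] by linarith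
  have "\<bar>grad_conv b e f x\<bar> \<le> (LINT z|(lborel \<Otimes>\<^sub>M lborel). \<bar>grad_heat b e z * f (x - snd z)\<bar>)"
    unfolding grad_conv_def by (rule integral_abs_bound)
  also have "\<dots> \<le> (LINT z|(lborel \<Otimes>\<^sub>M lborel). M * grad_major b (z :: real \<times> 'a))"
  proof (rule integral_mono)
    show "integrable (lborel \<Otimes>\<^sub>M lborel) (\<lambda>z. \<bar>grad_heat b e z * f (x - snd z)\<bar>)"
      by (rule integrable_abs, rule grad_conv_integrable[OF assms])
    show "integrable (lborel \<Otimes>\<^sub>M lborel) (\<lambda>z. M * grad_major b (z :: real \<times> 'a))"
      using grad_major_integrable[OF e(2), where 'a='a] by simp
    show "\<bar>grad_heat b e z * f (x - snd z)\<bar> \<le> M * grad_major b z" for z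
      unfolding abs_mult mult.commute[of M]
      by (intro mult_mono grad_heat_le_major e M) (auto intro: order_trans[OF abs_ge_zero grad_heat_le_major[OF e(1)]])
  qed
  finally show ?thesis by simp
qed

text \<open>The triple integral over the segment, time and space is computed in two orders:
  integrating along the segment first gives increments of the heat kernel, integrating over
  space-time first gives \<open>grad_conv\<close>. In this way bounded measurable \<open>f\<close>
  are covered.\<close>

lemma conv_bessel_increment:
  fixes e :: "'a::euclidean_space"
  assumes e: "norm e = 1" and b: "0 < b" and fm [measurable]: "f \<in> borel_measurable borel" and M: "\<And>x. \<bar>f x\<bar> \<le> M"
    and h: "0 \<le> h"
  shows "integrable lborel (\<lambda>s. indicator {0..h} s * grad_conv b e f (x + s *\<^sub>R e))"
    and "conv (bessel b) f (x + h *\<^sub>R e) - conv (bessel b) f x = (LINT s|lborel. indicator {0..h} s * grad_conv b e f (x + s *\<^sub>R e))"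
proof -
  let ?P = "lborel \<Otimes>\<^sub>M (lborel :: 'a measure)"
  interpret P: pair_sigma_finite "lborel :: real measure" ?P
    unfolding lborel_prod ..
  have sf: "sigma_finite_measure ?P"
    unfolding lborel_prod by (rule lborel.sigma_finite_measure_axioms)
  have M0: "0 \<le> M" using M[of 0] by linarith
  define g where "g s z = indicator {0..h} s * (grad_heat b e (fst z, snd z + s *\<^sub>R e) * f (x - snd z))" for s and z :: "real \<times> 'a"
  have g_meas: "(\<lambda>(s, z). g s z) \<in> borel_measurable (lborel \<Otimes>\<^sub>M ?P)"
    unfolding g_def by measurable
  \<comment> \<open>Translation in space moves the displacement from the kernel to the argument of
    \<open>f\<close>; the norm of the shifted gradient stays the same for all
    \<open>s\<close>.\<close>
  have shift: "(LINT z|?P. grad_heat b e (fst z, snd z + s *\<^sub>R e) * f (x - snd z)) = grad_conv b e f (x + s *\<^sub>R e)"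
    and shift_i: "integrable ?P (\<lambda>z. grad_heat b e (fst z, snd z + s *\<^sub>R e) * f (x - snd z))"
    and shift_n: "(\<integral>\<^sup>+z. ennreal \<bar>grad_heat b e (fst z, snd z + s *\<^sub>R e)\<bar> \<partial>?P) = (\<integral>\<^sup>+z. ennreal \<bar>grad_heat b e z\<bar> \<partial>?P)" for s
  proof -
    have 1: "(\<integral>\<^sup>+y. ennreal \<bar>grad_heat b e (t, y + s *\<^sub>R e)\<bar> \<partial>lborel) = (\<integral>\<^sup>+y. ennreal \<bar>grad_heat b e (t, y)\<bar> \<partial>lborel)" for t
      using nn_integral_lborel_plus[of "\<lambda>y. ennreal \<bar>grad_heat b e (t, y)\<bar>" "s *\<^sub>R e"] by (simp add: add.commute)
    have "(\<integral>\<^sup>+z. ennreal \<bar>grad_heat b e (fst z, snd z + s *\<^sub>R e)\<bar> \<partial>?P)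
        = (\<integral>\<^sup>+t. \<integral>\<^sup>+y. ennreal \<bar>grad_heat b e (t, y + s *\<^sub>R e)\<bar> \<partial>lborel \<partial>lborel)"
      by (subst lborel.nn_integral_fst[symmetric]) auto
    also have "\<dots> = (\<integral>\<^sup>+z. ennreal \<bar>grad_heat b e z\<bar> \<partial>?P)"
      unfolding 1 by (subst lborel.nn_integral_fst) auto
    finally show n: "(\<integral>\<^sup>+z. ennreal \<bar>grad_heat b e (fst z, snd z + s *\<^sub>R e)\<bar> \<partial>?P) = (\<integral>\<^sup>+z. ennreal \<bar>grad_heat b e z\<bar> \<partial>?P)" .
    have "integrable ?P (\<lambda>z. grad_heat b e (fst z, snd z + s *\<^sub>R e))"
      using n grad_heat_integrable[OF e b] by (simp add: integrable_iff_bounded)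
    then show i: "integrable ?P (\<lambda>z. grad_heat b e (fst z, snd z + s *\<^sub>R e) * f (x - snd z))"
    proof (rule Bochner_Integration.integrable_bound[OF integrable_mult_right[of M]])
      have "\<bar>f y\<bar> \<le> \<bar>M\<bar>" for y using M[of y] by linarith
      then show "AE z in ?P. norm (grad_heat b e (fst z, snd z + s *\<^sub>R e) * f (x - snd z)) \<le> norm (M * grad_heat b e (fst z, snd z + s *\<^sub>R e))"
        by (intro AE_I2) (auto simp: abs_mult mult.commute[of _ "\<bar>f _\<bar>"] intro!: mult_right_mono)
    qed measurable
    have "(LINT z|?P. grad_heat b e (fst z, snd z + s *\<^sub>R e) * f (x - snd z))
        = (LINT t|lborel. LINT y|lborel. grad_heat b e (t, y + s *\<^sub>R e) * f (x - y))"
      using lborel_pair.integral_fst'[OF i] by simp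
    also have "\<dots> = (LINT t|lborel. LINT y|lborel. grad_heat b e (t, y) * f (x + s *\<^sub>R e - y))"
    proof (rule Bochner_Integration.integral_cong[OF refl])
      fix t
      show "(LINT y|lborel. grad_heat b e (t, y + s *\<^sub>R e) * f (x - y)) = (LINT y|lborel. grad_heat b e (t, y) * f (x + s *\<^sub>R e - y))"
        using integral_lborel_plus[of "\<lambda>y. grad_heat b e (t, y) * f (x + s *\<^sub>R e - y)" "s *\<^sub>R e"]
        by (simp add: add.commute)
    qed
    also have "\<dots> = grad_conv b e f (x + s *\<^sub>R e)"
      unfolding grad_conv_def
      using lborel_pair.integral_fst'[OF grad_conv_integrable[OF e b fm M, where x = "x + s *\<^sub>R e"]] by simp
    finally show "(LINT z|?P. grad_heat b e (fst z, snd z + s *\<^sub>R e) * f (x - snd z)) = grad_conv b e f (x + s *\<^sub>R e)" .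
  qed
  have int: "integrable (lborel \<Otimes>\<^sub>M ?P) (\<lambda>(s, z). g s z)"
  proof (rule integrableI_bounded[OF g_meas])
    have "(\<integral>\<^sup>+w. ennreal (norm (case w of (s, z) \<Rightarrow> g s z)) \<partial>(lborel \<Otimes>\<^sub>M ?P)) = (\<integral>\<^sup>+s. \<integral>\<^sup>+z. ennreal \<bar>g s z\<bar> \<partial>?P \<partial>lborel)"
      using g_meas by (subst sigma_finite_measure.nn_integral_fst[OF sf, symmetric]) auto
    also have "\<dots> \<le> (\<integral>\<^sup>+s. ennreal (M * indicator {0..h} s) * (\<integral>\<^sup>+z. ennreal \<bar>grad_heat b e z\<bar> \<partial>?P) \<partial>lborel)"
    proof (rule nn_integral_mono)
      fix s
      have "(\<integral>\<^sup>+z. ennreal \<bar>g s z\<bar> \<partial>?P) \<le> (\<integral>\<^sup>+z. ennreal (M * indicator {0..h} s) * ennreal \<bar>grad_heat b e (fst z, snd z + s *\<^sub>R e)\<bar> \<partial>?P)"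
      proof (rule nn_integral_mono)
        fix z :: "real \<times> 'a"
        have "\<bar>g s z\<bar> \<le> M * indicator {0..h} s * \<bar>grad_heat b e (fst z, snd z + s *\<^sub>R e)\<bar>"
          using M[of "x - snd z"] by (auto simp: g_def abs_mult indicator_def mult.commute[of M] intro!: mult_left_mono)
        then show "ennreal \<bar>g s z\<bar> \<le> ennreal (M * indicator {0..h} s) * ennreal \<bar>grad_heat b e (fst z, snd z + s *\<^sub>R e)\<bar>"
          using M0 by (subst ennreal_mult[symmetric]) (auto intro: ennreal_leI)
      qed
      also have "\<dots> = ennreal (M * indicator {0..h} s) * (\<integral>\<^sup>+z. ennreal \<bar>grad_heat b e z\<bar> \<partial>?P)"
        by (subst nn_integral_cmult) (auto simp: shift_n)
      finally show "(\<integral>\<^sup>+z. ennreal \<bar>g s z\<bar> \<partial>?P) \<le> ennreal (M * indicator {0..h} s) * (\<integral>\<^sup>+z. ennreal \<bar>grad_heat b e z\<bar> \<partial>?P)" .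
    qed
    also have "\<dots> = (\<integral>\<^sup>+s. ennreal (M * indicator {0..h} s) \<partial>lborel) * (\<integral>\<^sup>+z. ennreal \<bar>grad_heat b e z\<bar> \<partial>?P)"
      by (rule nn_integral_multc) simp
    also have "(\<integral>\<^sup>+s. ennreal (M * indicator {0..h} s) \<partial>lborel) = ennreal (LINT s|lborel. M * indicator {0..h} s)"
      using h M0 by (intro nn_integral_eq_integral) auto
    also have "\<dots> * (\<integral>\<^sup>+z. ennreal \<bar>grad_heat b e z\<bar> \<partial>?P) < \<infinity>"
      using grad_heat_integrable[OF e b] by (auto simp: integrable_iff_bounded ennreal_mult_less_top)
    finally show "(\<integral>\<^sup>+w. ennreal (norm (case w of (s, z) \<Rightarrow> g s z)) \<partial>(lborel \<Otimes>\<^sub>M ?P)) < \<infinity>" .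
  qed
  have gs: "(LINT z|?P. g s z) = indicator {0..h} s * grad_conv b e f (x + s *\<^sub>R e)" for s
    unfolding g_def by (simp add: shift)
  show "integrable lborel (\<lambda>s. indicator {0..h} s * grad_conv b e f (x + s *\<^sub>R e))"
    using P.integrable_fst'[OF int] by (simp add: gs)
  \<comment> \<open>For fixed positive time this is the fundamental theorem along the segment; at
    other times both sides vanish by the indicator in \<open>res_heat\<close>.\<close>
  have FTC: "(LINT s|lborel. g s z) = (res_heat b (fst z) (snd z + h *\<^sub>R e) - res_heat b (fst z) (snd z)) * f (x - snd z)" for z
  proof (cases "0 < fst z")
    case True
    have d: "((\<lambda>s. res_heat b (fst z) (snd z + s *\<^sub>R e)) has_real_derivative grad_heat b e (fst z, snd z + s *\<^sub>R e)) (at s)" for s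
      using DERIV_cmult[OF dir_derivD[OF dir_deriv_heat(1)[OF True e], of "snd z" s], of "exp (- (b * fst z))"] True
      by (simp add: res_heat_def grad_heat_def mult_ac)
    have "(LINT s|lborel. grad_heat b e (fst z, snd z + s *\<^sub>R e) * indicator {0..h} s)
        = res_heat b (fst z) (snd z + h *\<^sub>R e) - res_heat b (fst z) (snd z + 0 *\<^sub>R e)"
    proof (rule integral_FTC_Icc_real[OF h d])
      fix s
      show "isCont (\<lambda>s. grad_heat b e (fst z, snd z + s *\<^sub>R e)) s"
        unfolding grad_heat_def res_heat_def heat_def using True by (intro continuous_intros) auto
    qed
    then have "(LINT s|lborel. grad_heat b e (fst z, snd z + s *\<^sub>R e) * indicator {0..h} s * f (x - snd z))
        = (res_heat b (fst z) (snd z + h *\<^sub>R e) - res_heat b (fst z) (snd z)) * f (x - snd z)"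
      by (subst integral_mult_left_zero) simp
    then show ?thesis by (simp add: g_def mult_ac)
  qed (simp add: g_def grad_heat_def res_heat_def)
  note cb = conv_bessel_bounded[OF b fm M]
  have "(LINT s|lborel. indicator {0..h} s * grad_conv b e f (x + s *\<^sub>R e)) = (LINT s|lborel. LINT z|?P. g s z)"
    by (simp add: gs)
  also have "\<dots> = (LINT z|?P. LINT s|lborel. g s z)"
    using P.Fubini_integral[OF int] by simp
  also have "\<dots> = (LINT z|?P. (res_heat b (fst z) (snd z + h *\<^sub>R e) * f (x - snd z)) - res_heat b (fst z) (snd z) * f (x - snd z))"
    unfolding FTC by (simp add: left_diff_distrib)
  finally have eq: "(LINT s|lborel. indicator {0..h} s * grad_conv b e f (x + s *\<^sub>R e)) = \<dots>" .
  have sh2: "integrable ?P (\<lambda>z. res_heat b (fst z) (snd z + h *\<^sub>R e) * f (x - snd z))"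
  proof -
    have "integrable ?P (\<lambda>z. LINT s|lborel. g s z)" using P.integrable_snd[OF int] by simp
    from Bochner_Integration.integrable_add[OF this cb(1)[where x = x]] show ?thesis
      unfolding FTC by (simp add: left_diff_distrib)
  qed
  have "(LINT z|?P. res_heat b (fst z) (snd z + h *\<^sub>R e) * f (x - snd z))
      = (LINT t|lborel. LINT y|lborel. res_heat b t (y + h *\<^sub>R e) * f (x - y))"
    using lborel_pair.integral_fst'[OF sh2] by simp
  also have "\<dots> = (LINT t|lborel. LINT y|lborel. res_heat b t y * f (x + h *\<^sub>R e - y))"
  proof (rule Bochner_Integration.integral_cong[OF refl])
    fix t
    show "(LINT y|lborel. res_heat b t (y + h *\<^sub>R e) * f (x - y)) = (LINT y|lborel. res_heat b t y * f (x + h *\<^sub>R e - y))"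
      using integral_lborel_plus[of "\<lambda>y. res_heat b t y * f (x + h *\<^sub>R e - y)" "h *\<^sub>R e"]
      by (simp add: add.commute)
  qed
  also have "\<dots> = conv (bessel b) f (x + h *\<^sub>R e)"
    using lborel_pair.integral_fst'[OF cb(1)[where x = "x + h *\<^sub>R e"]] cb(2)[where x = "x + h *\<^sub>R e"] by simp
  finally show "conv (bessel b) f (x + h *\<^sub>R e) - conv (bessel b) f x = (LINT s|lborel. indicator {0..h} s * grad_conv b e f (x + s *\<^sub>R e))"
    unfolding eq using sh2 cb(1)[where x = x] cb(2)[where x = x] by simp
qed

text \<open>One increment along the segment from \<open>x\<close> to \<open>y\<close>, with
  \<open>grad_conv\<close> bounded uniformly by the mass of \<open>grad_major\<close>.\<close>

lemma conv_bessel_Lipschitz: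
  fixes f :: "'a::euclidean_space \<Rightarrow> real"
  assumes b: "0 < b" and fm [measurable]: "f \<in> borel_measurable borel" and M: "\<And>x. \<bar>f x\<bar> \<le> M"
  shows "\<bar>conv (bessel b) f y - conv (bessel b) f x\<bar> \<le> M * (LINT z|(lborel \<Otimes>\<^sub>M lborel). grad_major b (z :: real \<times> 'a)) * norm (y - x)"
    (is "_ \<le> ?L * _")
proof (cases "y = x")
  case False
  define e h where "e = sgn (y - x)" and "h = norm (y - x)"
  have e: "norm e = 1" and h: "0 \<le> h" and y: "x + h *\<^sub>R e = y"
    using False by (auto simp: e_def h_def norm_sgn sgn_div_norm)
  note ci = conv_bessel_increment[OF e b fm M h, where x = x]
  have "\<bar>conv (bessel b) f y - conv (bessel b) f x\<bar> \<le> (LINT s|lborel. \<bar>indicator {0..h} s * grad_conv b e f (x + s *\<^sub>R e)\<bar>)"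
    using ci(2) unfolding y by simp
  also have "\<dots> \<le> (LINT s|lborel. ?L * indicator {0..h} s)"
  proof (rule integral_mono)
    show "integrable lborel (\<lambda>s. \<bar>indicator {0..h} s * grad_conv b e f (x + s *\<^sub>R e)\<bar>)"
      by (rule integrable_abs, rule ci(1))
    show "integrable lborel (\<lambda>s. ?L * indicator {0..h} s)" using h by simp
    show "\<bar>indicator {0..h} s * grad_conv b e f (x + s *\<^sub>R e)\<bar> \<le> ?L * indicator {0..h} s" for s
      using grad_conv_bounded[OF e b fm M, where x = "x + s *\<^sub>R e"] by (auto simp: indicator_def)
  qed
  also have "\<dots> = ?L * h" using h by simp
  finally show ?thesis by (simp add: h_def)
qed simp

lemma conv_bessel_continuous:
  fixes f :: "'a::euclidean_space \<Rightarrow> real"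
  assumes b: "0 < b" and f: "f \<in> borel_measurable borel" and M: "\<And>x. \<bar>f x\<bar> \<le> M"
  shows "uniformly_continuous_on UNIV (conv (bessel b) f)"
proof -
  define L where "L = M * (LINT z|(lborel \<Otimes>\<^sub>M lborel). grad_major b (z :: real \<times> 'a))"
  have "L-lipschitz_on UNIV (conv (bessel b) f)"
  proof (rule lipschitz_onI)
    show "dist (conv (bessel b) f x) (conv (bessel b) f y) \<le> L * dist x y" for x y
      using conv_bessel_Lipschitz[OF b f M, where x = y and y = x] by (simp add: L_def dist_norm)
    have "0 \<le> M" using M[of 0] by linarith
    then show "0 \<le> L" unfolding L_def
      by (intro mult_nonneg_nonneg integral_nonneg_AE AE_I2) (auto simp: grad_major_def heat_nonneg indicator_def)
  qed
  then show ?thesis by (rule lipschitz_on_uniformly_continuous)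
qed

lemma grad_conv_continuous:
  fixes e :: "'a::euclidean_space"
  assumes e: "norm e = 1" and b: "0 < b" and c: "continuous_on UNIV f" and M: "\<And>x. \<bar>f x\<bar> \<le> M"
  shows "continuous_on UNIV (grad_conv b e f)"
proof -
  have [measurable]: "f \<in> borel_measurable borel" using c by (rule borel_measurable_continuous_onI)
  have fl: "(\<lambda>n. f (u n)) \<longlonglongrightarrow> f l" if "u \<longlonglongrightarrow> l" for u l
    using c that by (metis continuous_on_eq_continuous_at isCont_tendsto_compose open_UNIV UNIV_I)
  show ?thesis
  proof (rule continuous_on_sequentiallyI)
    fix u and x :: 'a
    assume u: "u \<longlonglongrightarrow> x"
    show "(\<lambda>n. grad_conv b e f (u n)) \<longlonglongrightarrow> grad_conv b e f x"
      unfolding grad_conv_def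
    proof (rule integral_dominated_convergence)
      show "integrable (lborel \<Otimes>\<^sub>M lborel) (\<lambda>z. \<bar>M * grad_heat b e z\<bar>)"
        using grad_heat_integrable[OF e b] by simp
      show "AE z in lborel \<Otimes>\<^sub>M lborel. (\<lambda>n. grad_heat b e z * f (u n - snd z)) \<longlonglongrightarrow> grad_heat b e z * f (x - snd z)"
        by (intro AE_I2 tendsto_mult tendsto_const fl tendsto_diff u)
      have "\<bar>f y\<bar> \<le> \<bar>M\<bar>" for y using M[of y] by linarith
      then show "AE z in lborel \<Otimes>\<^sub>M lborel. norm (grad_heat b e z * f (u n - snd z)) \<le> \<bar>M * grad_heat b e z\<bar>" for n
        by (intro AE_I2) (auto simp: abs_mult mult.commute[of _ "\<bar>f _\<bar>"] intro!: mult_right_mono)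
    qed measurable
  qed
qed

text \<open>For continuous \<open>f\<close> the integrand of \<open>conv_bessel_increment\<close> is
  continuous along the ray, so the integral formula can be differentiated.\<close>

lemma conv_bessel_deriv:
  fixes e :: "'a::euclidean_space"
  assumes e: "norm e = 1" and b: "0 < b" and c: "continuous_on UNIV f" and M: "\<And>x. \<bar>f x\<bar> \<le> M"
    and r: "0 < r"
  shows "((\<lambda>s. conv (bessel b) f (s *\<^sub>R e)) has_real_derivative grad_conv b e f (r *\<^sub>R e)) (at r)"
proof -
  have fm: "f \<in> borel_measurable borel" using c by (rule borel_measurable_continuous_onI)
  define g where "g s = grad_conv b e f (s *\<^sub>R e)" for s
  have cg: "continuous_on {0..r + 1} g"
    unfolding g_def
    by (rule continuous_on_compose2[OF grad_conv_continuous[OF e b c M]]) (auto intro!: continuous_intros)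
  have eq: "conv (bessel b) f (s *\<^sub>R e) = conv (bessel b) f 0 + integral {0..s} g" if s: "0 \<le> s" for s
  proof -
    note ci = conv_bessel_increment[OF e b fm M s, where x = 0]
    have "set_integrable lborel {0..s} g"
      using ci(1) by (simp add: set_integrable_def g_def)
    then have "(LINT t:{0..s}|lborel. g t) = integral {0..s} g"
      by (rule set_borel_integral_eq_integral)
    then show ?thesis using ci(2) by (simp add: set_lebesgue_integral_def g_def)
  qed
  have "((\<lambda>s. integral {0..s} g) has_real_derivative g r) (at r within {0..r + 1})"
    by (rule integral_has_real_derivative[OF cg]) (use r in auto)
  then have "((\<lambda>s. integral {0..s} g) has_real_derivative g r) (at r within {0<..<r + 1})"
    by (rule DERIV_subset) auto
  then have "((\<lambda>s. integral {0..s} g) has_real_derivative g r) (at r)"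
    using r by (subst (asm) at_within_open) auto
  then have "((\<lambda>s. conv (bessel b) f 0 + integral {0..s} g) has_real_derivative g r) (at r)"
    by (auto intro!: derivative_eq_intros)
  then have "((\<lambda>s. conv (bessel b) f (s *\<^sub>R e)) has_real_derivative g r) (at r)"
    by (rule has_field_derivative_transform_within_open[where S = "{0<..}"]) (use r eq in auto)
  then show ?thesis by (simp add: g_def)
qed

section \<open>Test functions and their density\<close>

lemma pderiv_at_has_derivative:
  assumes "(f has_derivative D) (at x)"
  shows "pderiv_at i f x = D (axis i 1)"
  using frechet_derivative_at[OF assms] by (simp add: pderiv_at_def)

lemma differentiable_has_derivative:
  assumes "f differentiable at x"
  shows "(f has_derivative frechet_derivative f (at x)) (at x)"
  using assms frechet_derivative_works by blast

lemma Ck_continuous: "Ck k f \<Longrightarrow> continuous_on UNIV f"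
  by (cases k) (auto intro: differentiable_imp_continuous_on simp: differentiable_on_def differentiable_at_withinI)

lemma Ck_const: "Ck k (\<lambda>x. c)"
proof (induction k arbitrary: c)
  case (Suc k)
  have "pderiv_at i (\<lambda>x. c) = (\<lambda>x. 0)" for i :: 'a
    by (auto simp: fun_eq_iff pderiv_at_has_derivative[OF has_derivative_const])
  then show ?case using Suc by simp
qed simp

lemma Ck_add:
  assumes "Ck k f" "Ck k g"
  shows "Ck k (\<lambda>x. f x + g x)"
  using assms
proof (induction k arbitrary: f g)
  case (Suc k)
  have "pderiv_at i (\<lambda>x. f x + g x) = (\<lambda>x. pderiv_at i f x + pderiv_at i g x)" for i
  proof
    fix x
    show "pderiv_at i (\<lambda>x. f x + g x) x = pderiv_at i f x + pderiv_at i g x"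
      using Suc.prems differentiable_has_derivative[of f x] differentiable_has_derivative[of g x]
      by (subst pderiv_at_has_derivative[OF has_derivative_add]) (auto simp: pderiv_at_def)
  qed
  then show ?case using Suc by (auto intro!: derivative_intros)
qed (auto intro!: continuous_intros)

lemma Ck_Suc_imp: "Ck (Suc k) f \<Longrightarrow> Ck k f"
proof (induction k arbitrary: f)
  case 0
  then show ?case using Ck_continuous by fastforce
next
  case (Suc k)
  then show ?case by (metis Ck.simps(2))
qed

lemma Ck_mult:
  assumes "Ck k f" "Ck k g"
  shows "Ck k (\<lambda>x. f x * g x)"
  using assms
proof (induction k arbitrary: f g)
  case (Suc k)
  have "pderiv_at i (\<lambda>x. f x * g x) = (\<lambda>x. f x * pderiv_at i g x + pderiv_at i f x * g x)" for i
  proof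
    fix x
    show "pderiv_at i (\<lambda>x. f x * g x) x = f x * pderiv_at i g x + pderiv_at i f x * g x"
      using Suc.prems differentiable_has_derivative[of f x] differentiable_has_derivative[of g x]
      by (subst pderiv_at_has_derivative[OF has_derivative_mult]) (auto simp: pderiv_at_def)
  qed
  moreover have "Ck k (\<lambda>x. f x * pderiv_at i g x + pderiv_at i f x * g x)" for i
    using Suc.prems Suc.prems[THEN Ck_Suc_imp] by (intro Ck_add Suc.IH) auto
  ultimately show ?case using Suc.prems by (auto intro!: derivative_intros)
qed (auto intro!: continuous_intros)

lemma Ck_prod: "(\<And>i. i \<in> I \<Longrightarrow> Ck k (f i)) \<Longrightarrow> Ck k (\<lambda>x. \<Prod>i\<in>I. f i x)"
  by (induction I rule: infinite_finite_induct) (auto intro: Ck_const Ck_mult)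

lemma Ck_shift: "Ck k f \<Longrightarrow> Ck k (\<lambda>x. f (x + a))"
proof (induction k arbitrary: f)
  case 0
  then show ?case
    by (auto intro!: continuous_on_compose2[of UNIV f _ "\<lambda>x. x + a"] continuous_intros)
next
  case (Suc k)
  have d: "((\<lambda>x. f (x + a)) has_derivative frechet_derivative f (at (x + a))) (at x)" for x
  proof -
    have "(f has_derivative frechet_derivative f (at (x + a))) (at (x + a))"
      using Suc.prems by (auto intro: differentiable_has_derivative)
    then have "((\<lambda>x. f (x + a)) has_derivative (\<lambda>h. frechet_derivative f (at (x + a)) (h + 0))) (at x)"
      by (intro has_derivative_compose[of "\<lambda>x. x + a" "\<lambda>h. h + 0" x UNIV f]) (auto intro!: derivative_eq_intros)
    then show ?thesis by simp
  qed
  then have "pderiv_at i (\<lambda>x. f (x + a)) = (\<lambda>x. pderiv_at i f (x + a))" for i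
    by (auto simp: fun_eq_iff pderiv_at_has_derivative[OF d] pderiv_at_def)
  then show ?case using Suc d by (auto simp: differentiable_def)
qed

lemma Ck_dir_deriv:
  assumes "Ck (Suc k) f"
  shows "dir_deriv (axis i 1) f (pderiv_at i f)"
  unfolding dir_deriv_def
proof
  fix x
  have "(f has_derivative frechet_derivative f (at x)) (at (x + 0 *\<^sub>R axis i 1))"
    using assms by (auto intro: differentiable_has_derivative)
  then have "((\<lambda>s. f (x + s *\<^sub>R axis i 1)) has_derivative (\<lambda>h. frechet_derivative f (at x) (h *\<^sub>R axis i 1))) (at 0)"
    by (intro has_derivative_compose[of "\<lambda>s. x + s *\<^sub>R axis i 1" "\<lambda>h. h *\<^sub>R axis i 1" 0 UNIV f]) (auto intro!: derivative_eq_intros)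
  moreover have "frechet_derivative f (at x) (h *\<^sub>R axis i 1) = h *\<^sub>R frechet_derivative f (at x) (axis i 1)" for h
    using assms by (intro linear_cmul linear_frechet_derivative) auto
  ultimately show "((\<lambda>s. f (x + s *\<^sub>R axis i 1)) has_real_derivative pderiv_at i f x) (at 0)"
    by (simp add: has_field_derivative_def pderiv_at_def mult_commute_abs)
qed

lemma test_function_Ck: "test_function \<phi> \<Longrightarrow> Ck k \<phi>"
  by (simp add: test_function_def)

lemma compact_closure_subset:
  assumes "compact (closure A)" "B \<subseteq> closure A" shows "compact (closure B)"
proof -
  have "closure B \<subseteq> closure A" using assms(2) by (simp add: closure_minimal)
  then have "closure A \<inter> closure B = closure B" by blast
  then show ?thesis using compact_Int_closed[OF assms(1) closed_closure[of B]] by simp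
qed

lemma test_functionI:
  assumes "\<And>k. Ck k f" "bounded {x. f x \<noteq> 0}" shows "test_function f"
  using assms by (simp add: test_function_def compact_closure)

lemma test_function_bounded: "test_function f \<Longrightarrow> bounded {x. f x \<noteq> 0}"
  by (simp add: test_function_def compact_closure)

lemma test_function_compactly_supported:
  assumes "test_function \<phi>" shows "compactly_supported \<phi>"
proof -
  obtain R where "\<forall>x\<in>{x. \<phi> x \<noteq> 0}. norm x \<le> R"
    using test_function_bounded[OF assms] unfolding bounded_iff by blast
  then have "\<forall>x. R < norm x \<longrightarrow> \<phi> x = 0" by force
  then show ?thesis
    using Ck_continuous[OF test_function_Ck[OF assms, of 0]] unfolding compactly_supported_def by blast
qed

lemma test_function_add: "test_function f \<Longrightarrow> test_function g \<Longrightarrow> test_function (\<lambda>x. f x + g x)"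
proof (rule test_functionI)
  assume a: "test_function f" "test_function g"
  then show "Ck k (\<lambda>x. f x + g x)" for k by (intro Ck_add test_function_Ck)
  have "{x. f x + g x \<noteq> 0} \<subseteq> {x. f x \<noteq> 0} \<union> {x. g x \<noteq> 0}" by auto
  then show "bounded {x. f x + g x \<noteq> 0}"
    using a[THEN test_function_bounded] by (meson bounded_Un bounded_subset)
qed

lemma test_function_cmult: "test_function f \<Longrightarrow> test_function (\<lambda>x. c * f x)"
proof (rule test_functionI)
  assume a: "test_function f"
  then show "Ck k (\<lambda>x. c * f x)" for k by (intro Ck_mult Ck_const test_function_Ck)
  have "{x. c * f x \<noteq> 0} \<subseteq> {x. f x \<noteq> 0}" by auto
  then show "bounded {x. c * f x \<noteq> 0}"
    using a[THEN test_function_bounded] by (meson bounded_subset)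
qed

lemma test_function_shift: "test_function f \<Longrightarrow> test_function (\<lambda>x. f (x + a))"
proof (rule test_functionI)
  assume a: "test_function f"
  then show "Ck k (\<lambda>x. f (x + a))" for k by (intro Ck_shift test_function_Ck)
  have "{x. f (x + a) \<noteq> 0} = (\<lambda>x. - a + x) ` {x. f x \<noteq> 0}"
    by (auto simp: image_iff intro!: exI[of _ "_ + a"])
  then show "bounded {x. f (x + a) \<noteq> 0}"
    using bounded_translation[OF test_function_bounded[OF a], of "- a"] by simp
qed

lemma test_function_pderiv_at:
  assumes a: "test_function f" shows "test_function (pderiv_at i f)"
  unfolding test_function_def
proof
  show "\<forall>k. Ck k (pderiv_at i f)" using test_function_Ck[OF a] by (metis Ck.simps(2))
  have "{x. pderiv_at i f x \<noteq> 0} \<subseteq> closure {x. f x \<noteq> 0}"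
  proof (rule subsetI, rule ccontr)
    fix x assume x: "x \<in> {x. pderiv_at i f x \<noteq> 0}" "x \<notin> closure {x. f x \<noteq> 0}"
    have "((\<lambda>x. 0) has_derivative (\<lambda>h. 0)) (at x)" by simp
    then have "(f has_derivative (\<lambda>h. 0)) (at x)"
    proof (rule has_derivative_transform_within_open)
      show "open (- closure {x. f x \<noteq> 0})" by (rule open_Compl[OF closed_closure])
      show "0 = f y" if "y \<in> - closure {x. f x \<noteq> 0}" for y
        using that closure_subset[of "{x. f x \<noteq> 0}"] by auto
    qed (use x in auto)
    then show False using x pderiv_at_has_derivative by fastforce
  qed
  then show "compact (closure {x. pderiv_at i f x \<noteq> 0})"
    using a compact_closure_subset unfolding test_function_def by blast
qed

lemma pderiv_at_shift:
  assumes "test_function f"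
  shows "pderiv_at i (\<lambda>x. f (x + a)) x = pderiv_at i f (x + a)"
proof -
  have "(f has_derivative frechet_derivative f (at (x + a))) (at (x + a))"
    using test_function_Ck[OF assms, of 1] by (auto intro: differentiable_has_derivative)
  then have "((\<lambda>x. f (x + a)) has_derivative (\<lambda>h. frechet_derivative f (at (x + a)) (h + 0))) (at x)"
    by (intro has_derivative_compose[of "\<lambda>x. x + a" "\<lambda>h. h + 0" x UNIV f]) (auto intro!: derivative_eq_intros)
  from pderiv_at_has_derivative[OF this] show ?thesis by (simp add: pderiv_at_def)
qed

lemma test_function_dir_deriv: "test_function f \<Longrightarrow> dir_deriv (axis i 1) f (pderiv_at i f)"
  using Ck_dir_deriv[OF test_function_Ck] .

lemma test_function_sq_integrable: "test_function f \<Longrightarrow> sq_integrable f"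
  by (intro compactly_supported_sq_integrable test_function_compactly_supported)

lemma test_function_meas [measurable_dest]: "test_function f \<Longrightarrow> f \<in> borel_measurable borel"
  by (rule compactly_supported_meas) (rule test_function_compactly_supported)

lemma integral_pderiv_at_by_parts:
  assumes f: "test_function f" and g: "test_function g"
  shows "(LINT x|lborel. pderiv_at i f x * g x) = - (LINT x|lborel. f x * pderiv_at i g x)"
proof -
  note cs = f[THEN test_function_compactly_supported] g[THEN test_function_compactly_supported]
    f[THEN test_function_pderiv_at, THEN test_function_compactly_supported, of i]
    g[THEN test_function_pderiv_at, THEN test_function_compactly_supported, of i]
  have co: "compactly_supported (\<lambda>x. u x * v x)" if "compactly_supported u" "compactly_supported v" for u v :: "real ^ 'a \<Rightarrow> real"
    using compactly_supported_mult[OF that(2)] that(1) by (simp add: compactly_supported_def)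
  have "(LINT x|lborel. f x * pderiv_at i g x + pderiv_at i f x * g x) = 0"
    by (rule integral_dir_deriv_eq_0[OF dir_deriv_mult[OF test_function_dir_deriv[OF f] test_function_dir_deriv[OF g]]])
       (intro compactly_supported_add co cs)+
  moreover have "integrable lborel (\<lambda>x. f x * pderiv_at i g x)" "integrable lborel (\<lambda>x. pderiv_at i f x * g x)"
    by (intro compactly_supported_integrable co cs)+
  ultimately show ?thesis by simp
qed

section \<open>Smooth bump functions on boxes\<close>

definition exp_bump :: "real poly \<Rightarrow> real \<Rightarrow> real" where
  "exp_bump p s = (if 0 < s then poly p (1 / s) * exp (- (1 / s)) else 0)"

lemma poly_div_exp_tendsto: "((\<lambda>y. poly p y / exp y) \<longlongrightarrow> (0::real)) at_top"
proof -
  have "((\<lambda>y. \<Sum>i\<le>degree p. coeff p i * (y ^ i / exp y)) \<longlongrightarrow> (\<Sum>i\<le>degree p. coeff p i * 0)) at_top"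
    by (intro tendsto_intros tendsto_power_div_exp_0)
  then show ?thesis by (simp add: poly_altdef sum_divide_distrib)
qed

text \<open>The functions \<open>p(1/s) * exp(-1/s)\<close>, extended by zero, are closed under
  differentiation, the new polynomial being X^2 (p - p'). All orders of smoothness then follow by
  one induction over arbitrary \<open>p\<close>.\<close>

lemma exp_bump_deriv: "(exp_bump p has_real_derivative exp_bump ([:0, 0, 1:] * (p - pderiv p)) s) (at s)"
proof -
  consider "0 < s" | "s < 0" | "s = 0" by linarith
  then show ?thesis
  proof cases
    case 1
    have "((\<lambda>s. poly p (1 / s) * exp (- (1 / s))) has_real_derivative
        (poly (pderiv p) (1 / s) * (- (1 / s\<^sup>2))) * exp (- (1 / s)) + poly p (1 / s) * (exp (- (1 / s)) * (1 / s\<^sup>2))) (at s)"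
      using 1 by (auto intro!: derivative_eq_intros DERIV_chain2[OF poly_DERIV] simp: power2_eq_square)
    moreover have "(poly (pderiv p) (1 / s) * (- (1 / s\<^sup>2))) * exp (- (1 / s)) + poly p (1 / s) * (exp (- (1 / s)) * (1 / s\<^sup>2))
        = exp_bump ([:0, 0, 1:] * (p - pderiv p)) s"
      using 1 by (simp add: exp_bump_def field_simps power2_eq_square)
    ultimately have "((\<lambda>s. poly p (1 / s) * exp (- (1 / s))) has_real_derivative exp_bump ([:0, 0, 1:] * (p - pderiv p)) s) (at s)" by simp
    then show ?thesis
      by (rule has_field_derivative_transform_within_open[where S = "{0<..}"]) (use 1 in \<open>auto simp: exp_bump_def\<close>)
  next
    case 2
    have "((\<lambda>s. 0) has_real_derivative exp_bump ([:0, 0, 1:] * (p - pderiv p)) s) (at s)"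
      using 2 by (simp add: exp_bump_def)
    then show ?thesis
      by (rule has_field_derivative_transform_within_open[where S = "{..<0}"]) (use 2 in \<open>auto simp: exp_bump_def\<close>)
  next
    case 3
    have r: "((\<lambda>h. exp_bump p h / h) \<longlongrightarrow> 0) (at_right 0)"
    proof -
      \<comment> \<open>Division by \<open>h\<close> multiplies the polynomial in
        \<open>1 / h\<close> by its variable, and the exponential still dominates.\<close>
      have "((\<lambda>h. poly ([:0, 1:] * p) (inverse h) / exp (inverse h)) \<longlongrightarrow> 0) (at_right 0)"
        by (rule filterlim_compose[OF poly_div_exp_tendsto filterlim_inverse_at_top_right])
      then show ?thesis
      proof (rule Lim_transform_eventually)
        show "\<forall>\<^sub>F h in at_right 0. poly ([:0, 1:] * p) (inverse h) / exp (inverse h) = exp_bump p h / h"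
          unfolding eventually_at_right_field
          by (auto simp: exp_bump_def exp_minus field_simps intro!: exI[of _ 1])
      qed
    qed
    have l: "((\<lambda>h. exp_bump p h / h) \<longlongrightarrow> 0) (at_left 0)"
      by (rule tendsto_eventually) (auto simp: eventually_at_left_field exp_bump_def intro!: exI[of _ "-1"])
    have "((\<lambda>h. exp_bump p h / h) \<longlongrightarrow> 0) (at 0)"
      using filterlim_split_at[OF l r] by simp
    then show ?thesis unfolding 3 DERIV_def by (simp add: exp_bump_def)
  qed
qed

lemma Ck_exp_bump: "Ck k (\<lambda>x. c * exp_bump p (a * x $ i + d))"
proof (induction k arbitrary: c p)
  case 0
  have "continuous_on UNIV (exp_bump p)"
    using DERIV_isCont[OF exp_bump_deriv] by (simp add: continuous_at_imp_continuous_on)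
  then show ?case
    by (auto intro!: continuous_intros continuous_on_compose2[of UNIV "exp_bump p" _ "\<lambda>x. a * x $ i + d"])
next
  case (Suc k)
  let ?q = "[:0, 0, 1:] * (p - pderiv p)"
  have d: "((\<lambda>x. c * exp_bump p (a * x $ i + d)) has_derivative (\<lambda>h. c * (a * h $ i * exp_bump ?q (a * x $ i + d)))) (at x)" for x
  proof -
    have "((\<lambda>x. a * x $ i + d) has_derivative (\<lambda>h. a * h $ i)) (at x)"
      by (auto intro!: derivative_eq_intros bounded_linear.has_derivative[OF bounded_linear_vec_nth])
    from has_derivative_compose[OF this exp_bump_deriv[unfolded has_field_derivative_def]]
    have "((\<lambda>x. exp_bump p (a * x $ i + d)) has_derivative (\<lambda>h. exp_bump ?q (a * x $ i + d) * (a * h $ i))) (at x)" .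
    from has_derivative_mult_right[OF this, of c] show ?thesis by (simp add: mult_ac)
  qed
  have "pderiv_at j (\<lambda>x. c * exp_bump p (a * x $ i + d)) = (\<lambda>x. (if i = j then c * a else 0) * exp_bump ?q (a * x $ i + d))" for j
    by (auto simp: fun_eq_iff pderiv_at_has_derivative[OF d] axis_def)
  moreover have "(\<lambda>x. c * exp_bump p (a * x $ i + d)) differentiable at x" for x
    unfolding differentiable_def by (rule exI, rule d)
  ultimately show ?case using Suc by simp
qed

text \<open>Each one-dimensional factor is \<open>exp (- 1 / (k * s))\<close> at distance
  \<open>s\<close> inside a face and 0 outside. As \<open>k\<close> grows the products converge to
  the indicator of the open box while staying below it.\<close>

definition box_bump :: "nat \<Rightarrow> real ^ 'n \<Rightarrow> real ^ 'n \<Rightarrow> real ^ 'n \<Rightarrow> real" where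
  "box_bump k a b x = (\<Prod>i\<in>UNIV. exp_bump 1 (real k * (x $ i - a $ i)) * exp_bump 1 (real k * (b $ i - x $ i)))"

lemma exp_bump_1_bounds: "0 \<le> exp_bump 1 s" "exp_bump 1 s \<le> 1"
  by (auto simp: exp_bump_def)

lemma box_bump_bounds: "0 \<le> box_bump k a b x" "box_bump k a b x \<le> indicator (box a b) x"
proof -
  show nn: "0 \<le> box_bump k a b x"
    unfolding box_bump_def by (intro prod_nonneg ballI mult_nonneg_nonneg exp_bump_1_bounds)
  show "box_bump k a b x \<le> indicator (box a b) x"
  proof (cases "x \<in> box a b")
    case True
    have "box_bump k a b x \<le> (\<Prod>i\<in>(UNIV::'a set). 1)"
      unfolding box_bump_def by (intro prod_mono conjI mult_nonneg_nonneg mult_le_one exp_bump_1_bounds)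
    then show ?thesis using True by simp
  next
    case False
    then obtain i where "x $ i \<le> a $ i \<or> b $ i \<le> x $ i" by (auto simp: mem_box_cart not_less)
    then have "exp_bump 1 (real k * (x $ i - a $ i)) * exp_bump 1 (real k * (b $ i - x $ i)) = 0"
      by (auto simp: exp_bump_def zero_less_mult_iff)
    then have "box_bump k a b x = 0" unfolding box_bump_def by (intro prod_zero) auto
    then show ?thesis by simp
  qed
qed

lemma test_function_box_bump: "test_function (box_bump k a b)"
proof (rule test_functionI)
  have 1: "exp_bump 1 (real k * (x $ i - a $ i)) = 1 * exp_bump 1 (real k * x $ i + - real k * a $ i)"
    and 2: "exp_bump 1 (real k * (b $ i - x $ i)) = 1 * exp_bump 1 (- real k * x $ i + real k * b $ i)" for x i
    by (simp_all add: algebra_simps)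
  show "Ck m (box_bump k a b)" for m
    unfolding box_bump_def[abs_def] 1 2 by (intro Ck_prod Ck_mult Ck_exp_bump)
  have "{x. box_bump k a b x \<noteq> 0} \<subseteq> box a b"
  proof
    fix x assume "x \<in> {x. box_bump k a b x \<noteq> 0}"
    then show "x \<in> box a b" using box_bump_bounds[of k a b x] by (cases "x \<in> box a b") auto
  qed
  then show "bounded {x. box_bump k a b x \<noteq> 0}" using bounded_box bounded_subset by blast
qed

lemma box_bump_tendsto: "(\<lambda>k. box_bump k a b x) \<longlonglongrightarrow> indicator (box a b) x"
proof (cases "x \<in> box a b")
  case True
  have e: "(\<lambda>k. exp_bump 1 (real k * s)) \<longlonglongrightarrow> 1" if s: "0 < s" for s
  proof -
    have "filterlim (\<lambda>k. s * real k) at_top sequentially"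
      by (rule filterlim_tendsto_pos_mult_at_top[OF tendsto_const s filterlim_real_sequentially])
    then have "(\<lambda>k. inverse (real k * s)) \<longlonglongrightarrow> 0"
      by (intro tendsto_inverse_0_at_top) (simp add: mult.commute)
    then have "(\<lambda>k. exp (- (inverse (real k * s)))) \<longlonglongrightarrow> exp (- 0)" by (intro tendsto_intros)
    then have "(\<lambda>k. exp (- (inverse (real k * s)))) \<longlonglongrightarrow> 1" by simp
    then show ?thesis
    proof (rule Lim_transform_eventually)
      show "\<forall>\<^sub>F k in sequentially. exp (- inverse (real k * s)) = exp_bump 1 (real k * s)"
        using eventually_gt_at_top[of 0] by eventually_elim (use s in \<open>auto simp: exp_bump_def divide_inverse\<close>)
    qed
  qed
  have "(\<lambda>k. box_bump k a b x) \<longlonglongrightarrow> (\<Prod>i\<in>(UNIV::'a set). 1 * 1)"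
    unfolding box_bump_def using True by (intro tendsto_prod tendsto_mult e) (auto simp: mem_box_cart)
  then show ?thesis using True by simp
next
  case False
  then have "box_bump k a b x = 0" for k using box_bump_bounds[of k a b x] by simp
  then show ?thesis using False by simp
qed

section \<open>The fundamental lemma of the calculus of variations\<close>

lemma integral_box_eq_0:
  fixes v :: "real ^ 'n \<Rightarrow> real"
  assumes v: "set_integrable lborel (cbox a b) v" and [measurable]: "v \<in> borel_measurable borel"
    and t: "\<And>\<phi>. test_function \<phi> \<Longrightarrow> (LINT x|lborel. \<phi> x * v x) = 0"
  shows "(LINT x|lborel. indicator (box a b) x * v x) = 0"
proof -
  have "(\<lambda>k. LINT x|lborel. box_bump k a b x * v x) \<longlonglongrightarrow> (LINT x|lborel. indicator (box a b) x * v x)"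
  proof (rule integral_dominated_convergence)
    show "integrable lborel (\<lambda>x. \<bar>indicator (cbox a b) x * v x\<bar>)"
      using v unfolding set_integrable_def by (intro integrable_abs) simp
    show "AE x in lborel. (\<lambda>k. box_bump k a b x * v x) \<longlonglongrightarrow> indicator (box a b) x * v x"
      by (intro AE_I2 tendsto_mult tendsto_const box_bump_tendsto)
    show "AE x in lborel. norm (box_bump k a b x * v x) \<le> \<bar>indicator (cbox a b) x * v x\<bar>" for k
    proof (intro AE_I2)
      fix x
      have "box_bump k a b x \<le> indicator (cbox a b) x"
      proof (rule order_trans[OF box_bump_bounds(2)])
        show "indicator (box a b) x \<le> (indicator (cbox a b) x :: real)"
          using subsetD[OF box_subset_cbox[of a b], of x] by (cases "x \<in> box a b") auto
      qed
      then show "norm (box_bump k a b x * v x) \<le> \<bar>indicator (cbox a b) x * v x\<bar>"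
        using box_bump_bounds(1)[of k a b x] by (auto simp: abs_mult intro!: mult_right_mono)
    qed
    show "(\<lambda>x. box_bump k a b x * v x) \<in> borel_measurable lborel" for k
      using test_function_meas[OF test_function_box_bump[of k a b]] by measurable
  qed measurable
  then show ?thesis using t[OF test_function_box_bump] by (simp add: LIMSEQ_const_iff)
qed

text \<open>Open boxes form an intersection stable generator of the Borel sets, so the vanishing of
  the integral spreads to all of them, the total integral handling complements. The sets where
  \<open>w\<close> is positive or negative then finish the argument.\<close>

lemma AE_eq_0_of_box_integrals:
  fixes w :: "'a::euclidean_space \<Rightarrow> real"
  assumes w: "integrable lborel w" and b: "\<And>a b. (LINT x|lborel. indicator (box a b) x * w x) = 0"
    and w0: "(LINT x|lborel. w x) = 0"
  shows "AE x in lborel. w x = 0"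
proof -
  have i: "integrable lborel (\<lambda>x. indicator A x * w x)" if "A \<in> sets borel" for A
    using integrable_mult_indicator[OF _ w, of A] that by simp
  have all: "(LINT x|lborel. indicator A x * w x) = 0" if A: "A \<in> sets borel" for A
  proof -
    have "Int_stable (range (\<lambda>(a, b). box a b :: 'a set))"
      by (auto simp: Int_stable_def box_Int_box)
    moreover have "(range (\<lambda>(a, b). box a b :: 'a set)) \<subseteq> Pow UNIV" by auto
    moreover have "A \<in> sigma_sets UNIV (range (\<lambda>(a, b). box a b))"
      using A unfolding borel_eq_box by simp
    ultimately show ?thesis
    proof (induction rule: sigma_sets_induct_disjoint)
      case (basic A)
      then show ?case using b by auto
    next
      case empty
      then show ?case by simp
    next
      case (compl A)
      then have "A \<in> sets borel" unfolding borel_eq_box by simp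
      have "(LINT x|lborel. indicator (UNIV - A) x * w x) = (LINT x|lborel. w x - indicator A x * w x)"
        by (intro Bochner_Integration.integral_cong) (auto simp: indicator_def)
      then show ?case using w i[OF \<open>A \<in> sets borel\<close>] compl w0 by simp
    next
      case (union A)
      then have A: "A n \<in> sets borel" for n unfolding borel_eq_box by auto
      have "(LINT x:(\<Union>i. A i)|lborel. w x) = (\<Sum>n. (LINT x:(A n)|lborel. w x))"
        using A union(1) i[of "\<Union>i. A i"]
        by (intro lebesgue_integral_countable_add) (auto simp: disjoint_family_on_def set_integrable_def)
      then show ?case using union(3) by (simp add: set_lebesgue_integral_def)
    qed
  qed
  have [measurable]: "w \<in> borel_measurable borel" using w by simp
  have "AE x in lborel. indicator {x. 0 < w x} x * w x = 0"
    using all[of "{x. 0 < w x}"] i[of "{x. 0 < w x}"]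
    by (subst integral_nonneg_eq_0_iff_AE[symmetric]) (auto simp: indicator_def)
  moreover have "AE x in lborel. - (indicator {x. w x < 0} x * w x) = 0"
    using all[of "{x. w x < 0}"] i[of "{x. w x < 0}"]
    by (subst integral_nonneg_eq_0_iff_AE[symmetric]) (auto simp: indicator_def)
  ultimately show ?thesis
    by eventually_elim (auto simp: indicator_def split: if_splits)
qed

text \<open>A locally integrable function is cut off to an exhausting sequence of boxes; the cut-off
  again has zero integral over each box, because two boxes intersect in a box.\<close>

lemma fundamental_lemma:
  fixes v :: "real ^ 'n \<Rightarrow> real"
  assumes vm [measurable]: "v \<in> borel_measurable borel" and v: "\<And>K. compact K \<Longrightarrow> set_integrable lborel K v"
    and t: "\<And>\<phi>. test_function \<phi> \<Longrightarrow> (LINT x|lborel. \<phi> x * v x) = 0"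
  shows "AE x in lborel. v x = 0"
proof -
  have "AE x in lborel. indicator (box (\<chi> i. - real m) (\<chi> i. real m)) x * v x = 0" for m :: nat
  proof (rule AE_eq_0_of_box_integrals)
    define l u where "l = (\<chi> i. - real m :: real ^ 'n)" and "u = (\<chi> i. real m :: real ^ 'n)"
    have z: "(LINT x|lborel. indicator (box a b) x * v x) = 0" for a b
      by (rule integral_box_eq_0[OF v[OF compact_cbox] vm t])
    have "set_integrable lborel (box l u) v"
      by (rule set_integrable_subset[OF v[OF compact_cbox[of l u]]]) (use subsetD[OF box_subset_cbox[of l u]] in auto)
    then show "integrable lborel (\<lambda>x. indicator (box (\<chi> i. - real m) (\<chi> i. real m)) x * v x)"
      by (simp add: set_integrable_def l_def u_def)
    show "(LINT x|lborel. indicator (box (\<chi> i. - real m) (\<chi> i. real m)) x * v x) = 0" by (rule z)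
    have e: "(\<lambda>x. indicator (box a b) x * (indicator (box l u) x * v x)) = (\<lambda>x. indicator (box a b \<inter> box l u) x * v x)" for a b
      by (simp add: indicator_inter_arith fun_eq_iff)
    show "(LINT x|lborel. indicator (box a b) x * (indicator (box (\<chi> i. - real m) (\<chi> i. real m)) x * v x)) = 0" for a b
      unfolding l_def[symmetric] u_def[symmetric] e box_Int_box by (rule z)
  qed
  then have "AE x in lborel. \<forall>m::nat. indicator (box (\<chi> i. - real m) (\<chi> i. real m)) x * v x = 0"
    unfolding AE_all_countable by blast
  then show ?thesis
  proof eventually_elim
    case (elim x)
    obtain m :: nat where m: "norm x < real m" using reals_Archimedean2 by blast
    have "x \<in> box (\<chi> i. - real m) (\<chi> i. real m)"
      unfolding mem_box_cart
    proof
      fix i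
      have "\<bar>x $ i\<bar> < real m" using component_le_norm_cart[of x i] m by linarith
      then show "(\<chi> i. - real m) $ i < x $ i \<and> x $ i < (\<chi> i. real m) $ i" by auto
    qed
    then show ?case using elim[rule_format, of m] by simp
  qed
qed

section \<open>Density of test functions in L^2\<close>

lemma integral_square_add_le:
  assumes "sq_integrable f" "sq_integrable g"
  shows "(LINT x|lborel. (f x + g x)\<^sup>2) \<le> 2 * (LINT x|lborel. (f x)\<^sup>2) + 2 * (LINT x|lborel. (g x)\<^sup>2)"
proof -
  have "(LINT x|lborel. (f x + g x)\<^sup>2) \<le> (LINT x|lborel. 2 * (f x)\<^sup>2 + 2 * (g x)\<^sup>2)"
  proof (rule integral_mono)
    show "(f x + g x)\<^sup>2 \<le> 2 * (f x)\<^sup>2 + 2 * (g x)\<^sup>2" for x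
      using zero_le_power2[of "f x - g x"] by (simp add: power2_sum power2_diff)
  qed (use assms sq_integrable_add[OF assms] in \<open>auto simp: sq_integrable_def\<close>)
  then show ?thesis using assms by (simp add: sq_integrable_square)
qed

lemma sq_dominated_convergence:
  fixes f w :: "'a::euclidean_space \<Rightarrow> real"
  assumes w: "sq_integrable w" and [measurable]: "f \<in> borel_measurable borel" "\<And>i. s i \<in> borel_measurable borel"
    and l: "AE x in lborel. (\<lambda>i. s i x) \<longlonglongrightarrow> f x" and b: "\<And>i. AE x in lborel. \<bar>s i x\<bar> \<le> w x"
  shows "sq_integrable f" "\<And>i. sq_integrable (s i)" "(\<lambda>i::nat. LINT x|lborel. (s i x - f x)\<^sup>2) \<longlonglongrightarrow> 0"
proof -
  have ball: "AE x in lborel. \<forall>i. \<bar>s i x\<bar> \<le> w x" using b by (simp add: AE_all_countable)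
  with l have fb: "AE x in lborel. \<bar>f x\<bar> \<le> w x"
  proof eventually_elim
    case (elim x)
    show ?case by (rule LIMSEQ_le_const2[OF tendsto_rabs[OF elim(1)]]) (use elim(2) in auto)
  qed
  show "sq_integrable f"
    by (rule sq_integrable_bound[where C = 1, OF w]) (use fb in \<open>auto elim!: eventually_mono\<close>)
  show "sq_integrable (s i)" for i
    by (rule sq_integrable_bound[where C = 1, OF w]) (use b[of i] in \<open>auto elim!: eventually_mono\<close>)
  have "(\<lambda>i. LINT x|lborel. (s i x - f x)\<^sup>2) \<longlonglongrightarrow> (LINT x::'a|lborel. (0::real))"
  proof (rule integral_dominated_convergence)
    show "integrable lborel (\<lambda>x. (2 * w x)\<^sup>2)" using sq_integrable_cmult[OF w] by (rule sq_integrable_square)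
    show "AE x in lborel. (\<lambda>i. (s i x - f x)\<^sup>2) \<longlonglongrightarrow> 0"
      using l
    proof eventually_elim
      case (elim x)
      have "(\<lambda>i. (s i x - f x)\<^sup>2) \<longlonglongrightarrow> (f x - f x)\<^sup>2" by (intro tendsto_intros elim)
      then show ?case by simp
    qed
    show "AE x in lborel. norm ((s i x - f x)\<^sup>2) \<le> (2 * w x)\<^sup>2" for i
      using fb b[of i]
    proof eventually_elim
      case (elim x)
      then have "\<bar>s i x - f x\<bar> \<le> 2 * w x" by linarith
      then have "\<bar>s i x - f x\<bar>\<^sup>2 \<le> (2 * w x)\<^sup>2" by (intro power_mono) auto
      then show ?case by simp
    qed
  qed auto
  then show "(\<lambda>i::nat. LINT x|lborel. (s i x - f x)\<^sup>2) \<longlonglongrightarrow> 0" by simp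
qed

definition test_approx :: "(real ^ 'n \<Rightarrow> real) \<Rightarrow> bool" where
  "test_approx f \<longleftrightarrow> sq_integrable f \<and> (\<forall>\<epsilon>>0. \<exists>\<phi>. test_function \<phi> \<and> (LINT x|lborel. (f x - \<phi> x)\<^sup>2) < \<epsilon>)"

lemma test_approx_limit:
  assumes f: "sq_integrable f" and s: "\<And>i::nat. test_approx (s i)"
    and l: "(\<lambda>i. LINT x|lborel. (s i x - f x)\<^sup>2) \<longlonglongrightarrow> 0"
  shows "test_approx f"
  unfolding test_approx_def
proof (intro conjI allI impI f)
  fix \<epsilon> :: real assume e: "0 < \<epsilon>"
  have "eventually (\<lambda>i. (LINT x|lborel. (s i x - f x)\<^sup>2) < \<epsilon> / 4) sequentially"
    using l e by (intro order_tendstoD) auto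
  then obtain i where i: "(LINT x|lborel. (s i x - f x)\<^sup>2) < \<epsilon> / 4"
    by (auto simp: eventually_sequentially)
  obtain \<phi> where \<phi>: "test_function \<phi>" "(LINT x|lborel. (s i x - \<phi> x)\<^sup>2) < \<epsilon> / 4"
    using s[of i] e unfolding test_approx_def by (meson divide_pos_pos zero_less_numeral)
  have si: "sq_integrable (s i)" using s[of i] by (simp add: test_approx_def)
  have "(LINT x|lborel. ((f x - s i x) + (s i x - \<phi> x))\<^sup>2) \<le> 2 * (LINT x|lborel. (f x - s i x)\<^sup>2) + 2 * (LINT x|lborel. (s i x - \<phi> x)\<^sup>2)"
    by (intro integral_square_add_le sq_integrable_diff f si test_function_sq_integrable \<phi>)
  also have "(LINT x|lborel. (f x - s i x)\<^sup>2) = (LINT x|lborel. (s i x - f x)\<^sup>2)"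
    by (simp add: power2_commute)
  finally have "(LINT x|lborel. (f x - \<phi> x)\<^sup>2) < \<epsilon>" using i \<phi> by simp
  with \<phi> show "\<exists>\<phi>. test_function \<phi> \<and> (LINT x|lborel. (f x - \<phi> x)\<^sup>2) < \<epsilon>" by blast
qed

lemma test_approx_test: "test_function \<phi> \<Longrightarrow> test_approx \<phi>"
  unfolding test_approx_def by (auto intro!: test_function_sq_integrable exI[of _ \<phi>])

lemma test_approx_add:
  assumes f: "test_approx f" and g: "test_approx g" shows "test_approx (\<lambda>x. f x + g x)"
  unfolding test_approx_def
proof (intro conjI allI impI)
  show s: "sq_integrable (\<lambda>x. f x + g x)" using f g by (auto simp: test_approx_def intro: sq_integrable_add)
  fix \<epsilon> :: real assume e: "0 < \<epsilon>"
  obtain \<phi> where \<phi>: "test_function \<phi>" "(LINT x|lborel. (f x - \<phi> x)\<^sup>2) < \<epsilon> / 4"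
    using f e unfolding test_approx_def by (meson divide_pos_pos zero_less_numeral)
  obtain \<psi> where \<psi>: "test_function \<psi>" "(LINT x|lborel. (g x - \<psi> x)\<^sup>2) < \<epsilon> / 4"
    using g e unfolding test_approx_def by (meson divide_pos_pos zero_less_numeral)
  have "(LINT x|lborel. ((f x - \<phi> x) + (g x - \<psi> x))\<^sup>2) \<le> 2 * (LINT x|lborel. (f x - \<phi> x)\<^sup>2) + 2 * (LINT x|lborel. (g x - \<psi> x)\<^sup>2)"
    using f g test_function_sq_integrable[OF \<phi>(1)] test_function_sq_integrable[OF \<psi>(1)]
    by (intro integral_square_add_le sq_integrable_diff) (auto simp: test_approx_def)
  moreover have "(\<lambda>x. ((f x - \<phi> x) + (g x - \<psi> x))\<^sup>2) = (\<lambda>x. (f x + g x - (\<phi> x + \<psi> x))\<^sup>2)"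
    by (simp add: algebra_simps)
  ultimately have "(LINT x|lborel. (f x + g x - (\<phi> x + \<psi> x))\<^sup>2) < \<epsilon>" using \<phi> \<psi> by simp
  with test_function_add[OF \<phi>(1) \<psi>(1)]
  show "\<exists>\<phi>. test_function \<phi> \<and> (LINT x|lborel. (f x + g x - \<phi> x)\<^sup>2) < \<epsilon>" by blast
qed

lemma test_approx_cmult:
  assumes f: "test_approx f" shows "test_approx (\<lambda>x. c * f x)"
  unfolding test_approx_def
proof (intro conjI allI impI)
  show s: "sq_integrable (\<lambda>x. c * f x)" using f by (auto simp: test_approx_def intro: sq_integrable_cmult)
  fix \<epsilon> :: real assume e: "0 < \<epsilon>"
  have p: "0 < c\<^sup>2 + 1" using zero_le_power2[of c] by linarith
  obtain \<phi> where \<phi>: "test_function \<phi>" "(LINT x|lborel. (f x - \<phi> x)\<^sup>2) < \<epsilon> / (c\<^sup>2 + 1)"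
    using f e p unfolding test_approx_def by (meson divide_pos_pos)
  have "(\<lambda>x. (c * f x - c * \<phi> x)\<^sup>2) = (\<lambda>x. c\<^sup>2 * (f x - \<phi> x)\<^sup>2)"
    by (simp add: power_mult_distrib flip: right_diff_distrib)
  then have "(LINT x|lborel. (c * f x - c * \<phi> x)\<^sup>2) = c\<^sup>2 * (LINT x|lborel. (f x - \<phi> x)\<^sup>2)" by simp
  also have "\<dots> \<le> (c\<^sup>2 + 1) * (LINT x|lborel. (f x - \<phi> x)\<^sup>2)" by (intro mult_right_mono) auto
  also have "\<dots> < \<epsilon>" using \<phi>(2) p by (simp add: pos_less_divide_eq mult.commute)
  finally show "\<exists>\<psi>. test_function \<psi> \<and> (LINT x|lborel. (c * f x - \<psi> x)\<^sup>2) < \<epsilon>"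
    using test_function_cmult[OF \<phi>(1), of c] by blast
qed

lemma test_approx_diff: "test_approx f \<Longrightarrow> test_approx g \<Longrightarrow> test_approx (\<lambda>x. f x - g x)"
  using test_approx_add[OF _ test_approx_cmult, of f g "-1"] by simp

lemma sq_integrable_indicator:
  assumes "A \<in> sets borel" "emeasure lborel A < \<infinity>" shows "sq_integrable (indicator A :: 'a::euclidean_space \<Rightarrow> real)"
proof -
  have "(\<lambda>x. (indicator A x :: real)\<^sup>2) = indicator A" by (auto simp: indicator_def fun_eq_iff)
  then show ?thesis using assms by (simp add: sq_integrable_def)
qed

lemma test_approx_box: "test_approx (indicator (box a b) :: real ^ 'n \<Rightarrow> real)"
proof (rule test_approx_limit)
  have w: "sq_integrable (indicator (box a b) :: real ^ 'n \<Rightarrow> real)"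
    by (intro sq_integrable_indicator) (simp_all add: emeasure_lborel_box_finite[unfolded infinity_ennreal_def])
  show "sq_integrable (indicator (box a b) :: real ^ 'n \<Rightarrow> real)" by fact
  show "test_approx (box_bump i a b)" for i by (intro test_approx_test test_function_box_bump)
  show "(\<lambda>i. LINT x|lborel. (box_bump i a b x - indicator (box a b) x)\<^sup>2) \<longlonglongrightarrow> 0"
  proof (rule sq_dominated_convergence(3)[OF w])
    show "AE x in lborel. \<bar>box_bump i a b x\<bar> \<le> indicator (box a b) x" for i
      using box_bump_bounds[of i a b] by (intro AE_I2) (simp del: indicator_simps)
  qed (use box_bump_tendsto test_function_meas[OF test_function_box_bump] in auto)
qed

text \<open>Intersecting with a fixed box keeps complements square integrable, so the induction over
  the sets generated by boxes can run inside L^2.\<close>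

lemma test_approx_indicator_box:
  fixes A :: "(real ^ 'n) set"
  assumes A: "A \<in> sets borel"
  shows "test_approx (indicator (A \<inter> box l u))"
proof -
  have w: "sq_integrable (indicator (box l u) :: real ^ 'n \<Rightarrow> real)"
    by (intro sq_integrable_indicator) (simp_all add: emeasure_lborel_box_finite[unfolded infinity_ennreal_def])
  have "Int_stable (range (\<lambda>(a, b). box a b :: (real ^ 'n) set))"
    by (auto simp: Int_stable_def box_Int_box)
  moreover have "(range (\<lambda>(a, b). box a b :: (real ^ 'n) set)) \<subseteq> Pow UNIV" by auto
  moreover have "A \<in> sigma_sets UNIV (range (\<lambda>(a, b). box a b))"
    using A unfolding borel_eq_box by simp
  ultimately show ?thesis
  proof (induction rule: sigma_sets_induct_disjoint)
    case (basic A)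
    then show ?case by (auto simp: box_Int_box test_approx_box)
  next
    case empty
    then show ?case using test_approx_cmult[OF test_approx_box, of 0] by simp
  next
    case (compl A)
    have "(indicator ((UNIV - A) \<inter> box l u) :: real ^ 'n \<Rightarrow> real) = (\<lambda>x. indicator (box l u) x - indicator (A \<inter> box l u) x)"
      by (auto simp: indicator_def fun_eq_iff)
    then show ?case using test_approx_diff[OF test_approx_box compl(2)] by simp
  next
    case (union A)
    then have A [measurable]: "A n \<in> sets borel" for n unfolding borel_eq_box by auto
    define s where "s m x = (\<Sum>n<m. indicator (A n \<inter> box l u) x :: real)" for m x
    have sa: "test_approx (s m)" for m
    proof (induction m)
      case 0
      then show ?case using test_approx_cmult[OF test_approx_box, of 0] by (simp add: s_def[abs_def])
    next
      case (Suc m)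
      have "s (Suc m) = (\<lambda>x. s m x + indicator (A m \<inter> box l u) x)" by (simp add: s_def[abs_def])
      then show ?case using test_approx_add[OF Suc union(3)] by simp
    qed
    have si: "s m x = indicator ((\<Union>n<m. A n) \<inter> box l u) x" for m x
    proof (induction m)
      case (Suc m)
      have "A n \<inter> A m = {}" if "n < m" for n
        using disjoint_family_onD[OF union.hyps(1), of n m] that by simp
      then have "(\<Union>n<m. A n) \<inter> A m = {}" by blast
      then have "indicator (\<Union>n<m. A n) x + indicator (A m) x = (indicator ((\<Union>n<m. A n) \<union> A m) x :: real)"
        by (rule indicator_add)
      moreover have "(\<Union>n<m. A n) \<union> A m = (\<Union>n<Suc m. A n)" by (simp add: lessThan_Suc Un_commute)
      moreover have "s (Suc m) x = s m x + indicator (A m \<inter> box l u) x" by (simp add: s_def)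
      ultimately show ?case unfolding Suc indicator_inter_arith by (simp flip: distrib_right)
    qed (simp add: s_def)
    show ?case
    proof (rule test_approx_limit[OF _ sa])
      have l: "AE x in lborel. (\<lambda>m. s m x) \<longlonglongrightarrow> indicator ((\<Union>i. A i) \<inter> box l u) x"
      proof (intro AE_I2)
        fix x
        have "(\<lambda>m. indicator (\<Union>n<m. A n) x :: real) \<longlonglongrightarrow> indicator (\<Union>i. A i) x"
          by (rule LIMSEQ_indicator_UN)
        from tendsto_mult[OF this tendsto_const[of "indicator (box l u) x"]]
        show "(\<lambda>m. s m x) \<longlonglongrightarrow> indicator ((\<Union>i. A i) \<inter> box l u) x"
          unfolding si by (simp add: indicator_inter_arith)
      qed
      have b: "AE x in lborel. \<bar>s m x\<bar> \<le> indicator (box l u) x" for m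
        unfolding si by (auto simp: indicator_def)
      have m: "s m \<in> borel_measurable borel" for m unfolding s_def[abs_def] by measurable
      have m': "(indicator ((\<Union>i. A i) \<inter> box l u) :: real ^ 'n \<Rightarrow> real) \<in> borel_measurable borel" by measurable
      show "sq_integrable (indicator ((\<Union>i. A i) \<inter> box l u) :: real ^ 'n \<Rightarrow> real)"
        by (rule sq_dominated_convergence(1)[OF w m' m l b])
      show "(\<lambda>i. LINT x|lborel. (s i x - indicator ((\<Union>i. A i) \<inter> box l u) x)\<^sup>2) \<longlonglongrightarrow> 0"
        by (rule sq_dominated_convergence(3)[OF w m' m l b])
    qed
  qed
qed

lemma box_exhaust: "\<forall>\<^sub>F m in sequentially. x \<in> box (\<chi> i. - real m) (\<chi> i. real m :: real ^ 'n)"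
proof -
  have "\<forall>\<^sub>F m in sequentially. norm x < real m"
    using filterlim_real_sequentially unfolding filterlim_at_top_dense by blast
  then show ?thesis
  proof eventually_elim
    case (elim m)
    show ?case unfolding mem_box_cart
    proof
      fix i
      have "\<bar>x $ i\<bar> < real m" using component_le_norm_cart[of x i] elim by linarith
      then show "(\<chi> i. - real m) $ i < x $ i \<and> x $ i < (\<chi> i. real m) $ i" by auto
    qed
  qed
qed

text \<open>Square integrability stands as a premise inside the conclusion because the induction
  runs over all nonnegative measurable functions; each case recovers it for the smaller functions by
  domination.\<close>

lemma test_approx_nonneg:
  fixes g :: "real ^ 'n \<Rightarrow> real"
  assumes "g \<in> borel_measurable borel" "\<And>x. 0 \<le> g x"
  shows "sq_integrable g \<longrightarrow> test_approx g"
  using assms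
proof (induction rule: borel_measurable_induct_real)
  case (set A)
  show ?case
  proof
    assume s: "sq_integrable (indicator A :: real ^ 'n \<Rightarrow> real)"
    define B where "B m = box (\<chi> i. - real m) (\<chi> i. real m :: real ^ 'n)" for m :: nat
    have m: "(indicator (A \<inter> B m) :: real ^ 'n \<Rightarrow> real) \<in> borel_measurable borel" for m
      using set unfolding B_def by measurable
    have l: "AE x in lborel. (\<lambda>m. indicator (A \<inter> B m) x :: real) \<longlonglongrightarrow> indicator A x"
      unfolding B_def
    proof (intro AE_I2 tendsto_eventually)
      fix x :: "real ^ 'n"
      show "\<forall>\<^sub>F m in sequentially. indicator (A \<inter> box (\<chi> i. - real m) (\<chi> i. real m)) x = (indicator A x :: real)"
        using box_exhaust[of x] by eventually_elim (auto simp: indicator_def)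
    qed
    have b: "AE x in lborel. \<bar>indicator (A \<inter> B m) x :: real\<bar> \<le> indicator A x" for m
      by (auto simp: indicator_def)
    show "test_approx (indicator A :: real ^ 'n \<Rightarrow> real)"
    proof (rule test_approx_limit[OF s])
      show "test_approx (indicator (A \<inter> B m) :: real ^ 'n \<Rightarrow> real)" for m
        unfolding B_def using set by (intro test_approx_indicator_box) simp
      show "(\<lambda>m. LINT x|lborel. (indicator (A \<inter> B m) x - (indicator A x :: real))\<^sup>2) \<longlonglongrightarrow> 0"
        by (rule sq_dominated_convergence(3)[OF s _ m l b]) (use s in measurable)
    qed
  qed
next
  case (mult u c)
  show ?case
  proof
    assume a: "sq_integrable (\<lambda>x. c * u x)"
    show "test_approx (\<lambda>x. c * u x)"
    proof (cases "c = 0")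
      case True
      then show ?thesis using test_approx_cmult[OF test_approx_box, of 0] by simp
    next
      case False
      then have "sq_integrable u" using sq_integrable_cmult[OF a, of "1 / c"] by simp
      then show ?thesis using mult by (intro test_approx_cmult) auto
    qed
  qed
next
  case (add u v)
  show ?case
  proof
    assume a: "sq_integrable (\<lambda>x. v x + u x)"
    have "sq_integrable u" "sq_integrable v"
      by (rule sq_integrable_bound[where C = 1, OF a]; use add in auto)+
    then show "test_approx (\<lambda>x. v x + u x)" using add by (intro test_approx_add) auto
  qed
next
  case (seq U)
  show ?case
  proof
    assume g: "sq_integrable g"
    have Um: "U i \<in> borel_measurable borel" for i using seq(1)[of i] by simp
    have le: "U i x \<le> g x" for i x
      using seq by (intro incseq_le[of "\<lambda>i. U i x"]) (auto simp: incseq_def le_fun_def)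
    have b: "AE x in lborel. \<bar>U i x\<bar> \<le> g x" for i using le seq(2) by auto
    have l: "AE x in lborel. (\<lambda>i. U i x) \<longlonglongrightarrow> g x" using seq by auto
    have gm: "g \<in> borel_measurable borel" using g by measurable
    show "test_approx g"
    proof (rule test_approx_limit[OF g])
      show "test_approx (U i)" for i
        using seq.IH[of i] sq_dominated_convergence(2)[OF g gm Um l b] by simp
      show "(\<lambda>i. LINT x|lborel. (U i x - g x)\<^sup>2) \<longlonglongrightarrow> 0"
        by (rule sq_dominated_convergence(3)[OF g gm Um l b])
    qed
  qed
qed

theorem test_functions_dense:
  fixes g :: "real ^ 'n \<Rightarrow> real"
  assumes g: "sq_integrable g"
  obtains \<phi> where "\<And>k::nat. test_function (\<phi> k)" "(\<lambda>k. LINT x|lborel. (\<phi> k x - g x)\<^sup>2) \<longlonglongrightarrow> 0"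
proof -
  have [measurable]: "g \<in> borel_measurable borel" using g by measurable
  have p: "sq_integrable (\<lambda>x. max 0 (g x))" "sq_integrable (\<lambda>x. max 0 (- g x))"
    by (rule sq_integrable_bound[where C = 1, OF g]; simp)+
  have "test_approx (\<lambda>x. max 0 (g x) - max 0 (- g x))"
    by (intro test_approx_diff test_approx_nonneg[THEN mp] p) auto
  moreover have "(\<lambda>x. max 0 (g x) - max 0 (- g x)) = g" by (auto simp: fun_eq_iff)
  ultimately have "test_approx g" by simp
  then have "\<exists>\<phi>. test_function \<phi> \<and> (LINT x|lborel. (g x - \<phi> x)\<^sup>2) < inverse (real (Suc k))" for k
    unfolding test_approx_def by simp
  then obtain \<phi> where \<phi>: "\<And>k. test_function (\<phi> k)" "\<And>k. (LINT x|lborel. (g x - \<phi> k x)\<^sup>2) < inverse (real (Suc k))"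
    by metis
  have "(\<lambda>k. LINT x|lborel. (\<phi> k x - g x)\<^sup>2) \<longlonglongrightarrow> 0"
  proof (rule tendsto_sandwich[OF _ _ tendsto_const LIMSEQ_inverse_real_of_nat])
    show "\<forall>\<^sub>F k in sequentially. (LINT x|lborel. (\<phi> k x - g x)\<^sup>2) \<le> inverse (real (Suc k))"
      using \<phi>(2) by (intro always_eventually allI) (simp add: power2_commute[of _ "g _"] less_imp_le)
  qed auto
  with \<phi>(1) that show ?thesis by blast
qed

section \<open>Weak derivatives and the energy\<close>

lemma (in even_kernel) kernel_form_shift_integrable:
  assumes f: "sq_integrable f" and g: "sq_integrable g"
  shows "integrable (lborel \<Otimes>\<^sub>M lborel) (\<lambda>(x, w). k w * (f x * g (x - w)))"
proof (rule integrableI_bounded)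
  have [measurable]: "f \<in> borel_measurable borel" "g \<in> borel_measurable borel" using f g by measurable
  show "(\<lambda>(x, w). k w * (f x * g (x - w))) \<in> borel_measurable (lborel \<Otimes>\<^sub>M lborel)" by measurable
  have "(\<integral>\<^sup>+z. ennreal (norm (case z of (x, w) \<Rightarrow> k w * (f x * g (x - w)))) \<partial>(lborel \<Otimes>\<^sub>M lborel))
      = (\<integral>\<^sup>+x. \<integral>\<^sup>+w. ennreal \<bar>k w * (f x * g (x - w))\<bar> \<partial>lborel \<partial>lborel)"
    by (subst lborel.nn_integral_fst[symmetric]) auto
  also have "\<dots> = (\<integral>\<^sup>+x. \<integral>\<^sup>+y. ennreal \<bar>k (x - y) * (f x * g y)\<bar> \<partial>lborel \<partial>lborel)"
  proof (rule nn_integral_cong)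
    fix x
    show "(\<integral>\<^sup>+w. ennreal \<bar>k w * (f x * g (x - w))\<bar> \<partial>lborel) = (\<integral>\<^sup>+y. ennreal \<bar>k (x - y) * (f x * g y)\<bar> \<partial>lborel)"
      using nn_integral_lborel_minus[of "\<lambda>w. ennreal \<bar>k w * (f x * g (x - w))\<bar>" x] by simp
  qed
  also have "\<dots> = (\<integral>\<^sup>+z. ennreal (norm (case z of (x, y) \<Rightarrow> k (x - y) * (f x * g y))) \<partial>(lborel \<Otimes>\<^sub>M lborel))"
    by (subst lborel.nn_integral_fst[symmetric]) auto
  also have "\<dots> < \<infinity>" using kernel_form_integrable[OF g f] by (simp add: integrable_iff_bounded)
  finally show "(\<integral>\<^sup>+z. ennreal (norm (case z of (x, w) \<Rightarrow> k w * (f x * g (x - w)))) \<partial>(lborel \<Otimes>\<^sub>M lborel)) < \<infinity>" .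
qed

text \<open>The pairing becomes an average over translations \<open>w\<close>. For fixed
  \<open>w\<close> the translate of a test function is again a test function, so weak derivatives
  can be used under the outer integral.\<close>

lemma (in even_kernel) integral_conv_shift:
  assumes f: "sq_integrable f" and g: "sq_integrable g"
  shows "(LINT x|lborel. f x * conv k g x) = (LINT w|lborel. k w * (LINT x|lborel. f x * g (x - w)))"
proof -
  have [measurable]: "g \<in> borel_measurable borel" using g by measurable
  have "f x * conv k g x = (LINT w|lborel. k w * (f x * g (x - w)))" for x
  proof -
    have "conv k g x = (LINT w|lborel. k w * g (x - w))"
      unfolding conv_def using integral_lborel_minus[of "\<lambda>y. k (x - y) * g y" x] by simp
    then have "f x * conv k g x = (LINT w|lborel. f x * (k w * g (x - w)))" by simp
    then show ?thesis by (simp add: mult.left_commute)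
  qed
  then have "(LINT x|lborel. f x * conv k g x) = (LINT x|lborel. LINT w|lborel. k w * (f x * g (x - w)))" by simp
  also have "\<dots> = (LINT w|lborel. LINT x|lborel. k w * (f x * g (x - w)))"
    using lborel_pair.Fubini_integral[of "\<lambda>x w. k w * (f x * g (x - w))"] kernel_form_shift_integrable[OF f g] by simp
  finally show ?thesis by simp
qed

definition sq_weak_deriv :: "'n \<Rightarrow> (real ^ 'n \<Rightarrow> real) \<Rightarrow> (real ^ 'n \<Rightarrow> real) \<Rightarrow> bool" where
  "sq_weak_deriv i u v \<longleftrightarrow> sq_integrable u \<and> sq_integrable v \<and>
    (\<forall>\<phi>. test_function \<phi> \<longrightarrow> (LINT x|lborel. pderiv_at i \<phi> x * u x) = - (LINT x|lborel. \<phi> x * v x))"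

lemma sq_weak_deriv_test:
  "test_function g \<Longrightarrow> sq_weak_deriv i g (pderiv_at i g)"
  unfolding sq_weak_deriv_def
  by (auto intro: test_function_sq_integrable test_function_pderiv_at integral_pderiv_at_by_parts)

text \<open>The convolution of a test function with \<open>k\<close> generally loses its compact
  support and cannot be inserted into the definition. Instead the definition is applied to all
  translates of the test function and averaged with \<open>k\<close>.\<close>

lemma sq_weak_deriv_conv:
  fixes k :: "real ^ 'n \<Rightarrow> real"
  assumes k: "even_kernel k" and w: "sq_weak_deriv i u v"
  shows "sq_weak_deriv i (conv k u) (conv k v)"
  unfolding sq_weak_deriv_def
proof (intro conjI allI impI)
  interpret even_kernel k by fact
  have u: "sq_integrable u" and v: "sq_integrable v" using w by (auto simp: sq_weak_deriv_def)
  show "sq_integrable (conv k u)" "sq_integrable (conv k v)" by (intro sq_integrable_conv u v)+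
  fix \<phi> :: "real ^ 'n \<Rightarrow> real" assume \<phi>: "test_function \<phi>"
  note s = test_function_sq_integrable[OF \<phi>] test_function_sq_integrable[OF test_function_pderiv_at[OF \<phi>, of i]]
  have "(LINT x|lborel. u x * pderiv_at i \<phi> (x - y)) = - (LINT x|lborel. v x * \<phi> (x - y))" for y
  proof -
    have "(LINT x|lborel. pderiv_at i (\<lambda>x. \<phi> (x + - y)) x * u x) = - (LINT x|lborel. \<phi> (x + - y) * v x)"
      using w test_function_shift[OF \<phi>, of "- y"] unfolding sq_weak_deriv_def by blast
    then show ?thesis by (simp only: pderiv_at_shift[OF \<phi>]) (simp add: mult.commute)
  qed
  then have "(LINT x|lborel. u x * conv k (pderiv_at i \<phi>) x) = - (LINT x|lborel. v x * conv k \<phi> x)"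
    by (simp add: integral_conv_shift[OF u s(2)] integral_conv_shift[OF v s(1)])
  then show "(LINT x|lborel. pderiv_at i \<phi> x * conv k u x) = - (LINT x|lborel. \<phi> x * conv k v x)"
    unfolding integral_conv_eq(2)[OF u s(2)] integral_conv_eq(2)[OF v s(1)] by (simp add: mult.commute)
qed

lemma conv_bessel_resolvent_test:
  fixes \<psi> :: "real ^ 'n \<Rightarrow> real"
  assumes b: "0 < b" and \<psi>: "test_function \<psi>"
  shows "conv (bessel b) (\<lambda>y. b * \<psi> y - (\<Sum>i\<in>UNIV. pderiv_at i (pderiv_at i \<psi>) y)) x = \<psi> x"
proof -
  \<comment> \<open>Recovers the coordinate index from a basis vector, to pass from sums over
    \<open>Basis\<close> to sums over the index type.\<close>
  define J where "J e = (SOME i. axis i 1 = e)" for e :: "real ^ 'n"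
  have J: "J (axis i 1) = i" for i
    unfolding J_def by (rule some_equality) (auto simp: axis_eq_axis)
  have B: "(Basis :: (real ^ 'n) set) = range (\<lambda>i. axis i 1)" by (auto simp: Basis_vec_def)
  have inj: "inj (\<lambda>i. axis i 1 :: real ^ 'n)" by (auto simp: inj_def axis_eq_axis)
  have "conv (bessel b) (\<lambda>y. b * \<psi> y - (\<Sum>e\<in>Basis. pderiv_at (J e) (pderiv_at (J e) \<psi>) y)) x = \<psi> x"
  proof (rule conv_bessel_resolvent[OF b])
    fix e :: "real ^ 'n" assume "e \<in> Basis"
    then obtain i where e: "e = axis i 1" using B by auto
    show "dir_deriv e \<psi> (pderiv_at (J e) \<psi>)"
      "dir_deriv e (pderiv_at (J e) \<psi>) (pderiv_at (J e) (pderiv_at (J e) \<psi>))"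
      unfolding e J by (intro test_function_dir_deriv test_function_pderiv_at \<psi>)+
    show "compactly_supported (pderiv_at (J e) \<psi>)" "compactly_supported (pderiv_at (J e) (pderiv_at (J e) \<psi>))"
      by (intro test_function_compactly_supported test_function_pderiv_at \<psi>)+
  qed (rule test_function_compactly_supported[OF \<psi>])
  then show ?thesis unfolding B by (simp add: sum.reindex[OF inj] J)
qed

lemma AE_conv_sum:
  assumes k: "even_kernel k" and "finite I" "\<And>i. i \<in> I \<Longrightarrow> sq_integrable (g i)"
  shows "AE x in lborel. conv k (\<lambda>y. \<Sum>i\<in>I. g i y) x = (\<Sum>i\<in>I. conv k (g i) x)"
  using assms(2,3)
proof (induction I rule: finite_induct)
  case empty
  then show ?case by (simp add: conv_def)
next
  case (insert j I)
  interpret even_kernel k by fact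
  have "AE x in lborel. conv k (\<lambda>y. g j y + (\<Sum>i\<in>I. g i y)) x = conv k (g j) x + conv k (\<lambda>y. \<Sum>i\<in>I. g i y) x"
    by (intro AE_conv_add sq_integrable_sum insert) auto
  moreover have "AE x in lborel. conv k (\<lambda>y. \<Sum>i\<in>I. g i y) x = (\<Sum>i\<in>I. conv k (g i) x)"
    by (rule insert.IH) (auto intro: insert.prems)
  ultimately show ?case by eventually_elim (use insert in simp)
qed

lemma sq_tendsto_mult:
  assumes f: "sq_integrable f" "\<And>k::nat. sq_integrable (F k)" "(\<lambda>k. LINT x|lborel. (F k x - f x)\<^sup>2) \<longlonglongrightarrow> 0"
    and g: "sq_integrable g" "\<And>k::nat. sq_integrable (G k)" "(\<lambda>k. LINT x|lborel. (G k x - g x)\<^sup>2) \<longlonglongrightarrow> 0"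
  shows "(\<lambda>k. LINT x|lborel. F k x * G k x) \<longlonglongrightarrow> (LINT x|lborel. f x * g x)"
proof -
  let ?A = "\<lambda>k. LINT x|lborel. (F k x - f x)\<^sup>2" and ?B = "\<lambda>k. LINT x|lborel. (G k x - g x)\<^sup>2"
  let ?f = "LINT x|lborel. (f x)\<^sup>2" and ?g = "LINT x|lborel. (g x)\<^sup>2"
  have cs: "\<bar>LINT x|lborel. u x * v x\<bar> \<le> sqrt ((LINT x|lborel. (u x)\<^sup>2) * (LINT x|lborel. (v x)\<^sup>2))"
    if "sq_integrable u" "sq_integrable v" for u v :: "'a \<Rightarrow> real"
    using sq_integrable_Cauchy_Schwarz[OF that] by (simp add: real_le_rsqrt)
  have b: "\<bar>(LINT x|lborel. F k x * G k x) - (LINT x|lborel. f x * g x)\<bar>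
      \<le> sqrt (?A k * ?B k) + sqrt (?A k * ?g) + sqrt (?f * ?B k)" for k
  proof -
    have d: "sq_integrable (\<lambda>x. F k x - f x)" "sq_integrable (\<lambda>x. G k x - g x)"
      using f g by (auto intro: sq_integrable_diff)
    note i = sq_integrable_mult[OF d] sq_integrable_mult[OF d(1) g(1)] sq_integrable_mult[OF f(1) d(2)] sq_integrable_mult[OF f(1) g(1)]
    \<comment> \<open>Both factors are expanded around their limits; Cauchy-Schwarz makes each term
      except the last tend to zero.\<close>
    have "F k x * G k x = (F k x - f x) * (G k x - g x) + (F k x - f x) * g x + f x * (G k x - g x) + f x * g x" for x
      by (simp add: algebra_simps)
    then have "(LINT x|lborel. F k x * G k x)
       = (LINT x|lborel. (F k x - f x) * (G k x - g x)) + (LINT x|lborel. (F k x - f x) * g x)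
        + (LINT x|lborel. f x * (G k x - g x)) + (LINT x|lborel. f x * g x)"
      using i by (simp only: Bochner_Integration.integral_add Bochner_Integration.integrable_add)
    then show ?thesis using cs[OF d] cs[OF d(1) g(1)] cs[OF f(1) d(2)] by linarith
  qed
  have "(\<lambda>k. sqrt (?A k * ?B k) + sqrt (?A k * ?g) + sqrt (?f * ?B k)) \<longlonglongrightarrow> sqrt (0 * 0) + sqrt (0 * ?g) + sqrt (?f * 0)"
    by (intro tendsto_intros f g)
  then have "(\<lambda>k. sqrt (?A k * ?B k) + sqrt (?A k * ?g) + sqrt (?f * ?B k)) \<longlonglongrightarrow> 0" by simp
  then have "(\<lambda>k. (LINT x|lborel. F k x * G k x) - (LINT x|lborel. f x * g x)) \<longlonglongrightarrow> 0"
    by (rule Lim_null_comparison[rotated]) (use b in auto)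
  then show ?thesis by (simp add: LIM_zero_iff)
qed

lemma (in even_kernel) sq_tendsto_conv:
  assumes f: "sq_integrable f" "\<And>j::nat. sq_integrable (F j)" "(\<lambda>j. LINT x|lborel. (F j x - f x)\<^sup>2) \<longlonglongrightarrow> 0"
  shows "(\<lambda>j. LINT x|lborel. (conv k (F j) x - conv k f x)\<^sup>2) \<longlonglongrightarrow> 0"
proof (rule tendsto_sandwich[OF _ _ tendsto_const])
  show "\<forall>\<^sub>F j in sequentially. (LINT x|lborel. (conv k (F j) x - conv k f x)\<^sup>2) \<le> (integral\<^sup>L lborel k)\<^sup>2 * (LINT x|lborel. (F j x - f x)\<^sup>2)"
  proof (intro always_eventually allI)
    fix j
    note d = sq_integrable_diff[OF f(2)[of j] f(1)]
    have [measurable]: "F j \<in> borel_measurable borel" "f \<in> borel_measurable borel" using f by auto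
    have "(LINT x|lborel. (conv k (F j) x - conv k f x)\<^sup>2) = (LINT x|lborel. (conv k (\<lambda>y. F j y - f y) x)\<^sup>2)"
      by (rule integral_cong_AE) (use AE_conv_diff[OF f(2)[of j] f(1)] in \<open>auto elim!: eventually_mono\<close>)
    also have "\<dots> \<le> (integral\<^sup>L lborel k)\<^sup>2 * (LINT x|lborel. (F j x - f x)\<^sup>2)"
      by (rule sq_integrable_conv(2)[OF d])
    finally show "(LINT x|lborel. (conv k (F j) x - conv k f x)\<^sup>2) \<le> (integral\<^sup>L lborel k)\<^sup>2 * (LINT x|lborel. (F j x - f x)\<^sup>2)" .
  qed
  show "(\<lambda>j. (integral\<^sup>L lborel k)\<^sup>2 * (LINT x|lborel. (F j x - f x)\<^sup>2)) \<longlonglongrightarrow> 0"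
    using tendsto_mult[OF tendsto_const f(3), of "(integral\<^sup>L lborel k)\<^sup>2"] by simp
qed auto

text \<open>Derivatives pass through the convolution, and the resolvent identity for the test
  function turns the convolution of its Laplacian into \<open>b * w - g\<close>. The second formula
  is Green's identity for \<open>w\<close>, which lacks compact support.\<close>

lemma test_conv_laplacian:
  fixes g :: "real ^ 'n \<Rightarrow> real"
  assumes b: "0 < b" and g: "test_function g"
  defines "w \<equiv> conv (bessel b) g"
  defines "w1 \<equiv> \<lambda>i. conv (bessel b) (pderiv_at i g)"
  defines "w2 \<equiv> \<lambda>i. conv (bessel b) (pderiv_at i (pderiv_at i g))"
  shows "AE x in lborel. (\<Sum>i\<in>UNIV. w2 i x) = b * w x - g x"
    and "(\<Sum>i\<in>UNIV. LINT x|lborel. (w1 i x)\<^sup>2) = - (LINT x|lborel. w x * (b * w x - g x))"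
proof -
  interpret even_kernel "bessel b :: real ^ 'n \<Rightarrow> real" by (rule even_kernel_bessel[OF b])
  note tg = g test_function_pderiv_at[OF g] test_function_pderiv_at[OF test_function_pderiv_at[OF g]]
  note sg = tg[THEN test_function_sq_integrable]
  have "AE x in lborel. conv (bessel b) (\<lambda>y. b * g y - (\<Sum>i\<in>UNIV. pderiv_at i (pderiv_at i g) y)) x
      = conv (bessel b) (\<lambda>y. b * g y) x - conv (bessel b) (\<lambda>y. \<Sum>i\<in>UNIV. pderiv_at i (pderiv_at i g) y) x"
    by (intro AE_conv_diff sq_integrable_cmult sq_integrable_sum sg)
  moreover have "AE x in lborel. conv (bessel b) (\<lambda>y. \<Sum>i\<in>UNIV. pderiv_at i (pderiv_at i g) y) x = (\<Sum>i\<in>UNIV. w2 i x)"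
    unfolding w2_def by (rule AE_conv_sum[OF even_kernel_axioms]) (auto intro: sg)
  ultimately show lap: "AE x in lborel. (\<Sum>i\<in>UNIV. w2 i x) = b * w x - g x"
    by eventually_elim (simp add: conv_bessel_resolvent_test[OF b g] conv_cmult w_def)
  have sw: "sq_integrable w" "\<And>i. sq_integrable (w1 i)" "\<And>i. sq_integrable (w2 i)"
    unfolding w_def w1_def w2_def by (intro sq_integrable_conv sg)+
  have 1: "(LINT x|lborel. (w1 i x)\<^sup>2) = - (LINT x|lborel. w x * w2 i x)" for i
  proof -
    \<comment> \<open>One of the two kernels in the square is moved to the other factor, so that the
      integration by parts is tested against \<open>g\<close> itself.\<close>
    have d: "sq_weak_deriv i (conv (bessel b) (w1 i)) (conv (bessel b) (w2 i))"
      unfolding w1_def w2_def by (intro sq_weak_deriv_conv even_kernel_axioms sq_weak_deriv_test tg)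
    have "(LINT x|lborel. (w1 i x)\<^sup>2) = (LINT x|lborel. conv (bessel b) (pderiv_at i g) x * w1 i x)"
      by (simp add: power2_eq_square w1_def)
    also have "\<dots> = (LINT x|lborel. pderiv_at i g x * conv (bessel b) (w1 i) x)"
      by (rule integral_conv_eq(2)[OF sw(2) sg(2), symmetric])
    also have "\<dots> = - (LINT x|lborel. g x * conv (bessel b) (w2 i) x)"
      using d g unfolding sq_weak_deriv_def by blast
    also have "(LINT x|lborel. g x * conv (bessel b) (w2 i) x) = (LINT x|lborel. w x * w2 i x)"
      unfolding w_def by (rule integral_conv_eq(2)[OF sw(3) sg(1)])
    finally show ?thesis .
  qed
  have "(\<Sum>i\<in>UNIV. LINT x|lborel. (w1 i x)\<^sup>2) = - (\<Sum>i\<in>UNIV. LINT x|lborel. w x * w2 i x)"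
    unfolding 1 by (rule sum_negf)
  also have "(\<Sum>i\<in>UNIV. LINT x|lborel. w x * w2 i x) = (LINT x|lborel. (\<Sum>i\<in>UNIV. w x * w2 i x))"
    by (intro Bochner_Integration.integral_sum[symmetric] sq_integrable_mult sw)
  also have "\<dots> = (LINT x|lborel. w x * (b * w x - g x))"
  proof (rule integral_cong_AE)
    show "AE x in lborel. (\<Sum>i\<in>UNIV. w x * w2 i x) = w x * (b * w x - g x)"
      using lap by eventually_elim (simp flip: sum_distrib_left)
    have [measurable]: "w \<in> borel_measurable borel" "\<And>i. w2 i \<in> borel_measurable borel" "g \<in> borel_measurable borel"
      using sw sg(1) by auto
    show "(\<lambda>x. \<Sum>i\<in>UNIV. w x * w2 i x) \<in> borel_measurable lborel"
      "(\<lambda>x. w x * (b * w x - g x)) \<in> borel_measurable lborel" by measurable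
  qed
  finally show "(\<Sum>i\<in>UNIV. LINT x|lborel. (w1 i x)\<^sup>2) = - (LINT x|lborel. w x * (b * w x - g x))" .
qed

text \<open>The derivatives are arguments, \<open>g i\<close> of first order and \<open>h i\<close>
  the repeated one in direction \<open>i\<close>. This avoids the choice hidden in
  \<open>weak_pderiv\<close>; \<open>J1_of_real\<close> and \<open>J1_parts\<close> give the link to
  \<open>J1\<close>.\<close>

definition energy :: "real \<Rightarrow> real \<Rightarrow> (real ^ 'n \<Rightarrow> real) \<Rightarrow> ('n \<Rightarrow> real ^ 'n \<Rightarrow> real) \<Rightarrow> ('n \<Rightarrow> real ^ 'n \<Rightarrow> real) \<Rightarrow> real" where
  "energy \<beta> \<alpha> w g h = (LINT x|lborel. (\<Sum>i\<in>UNIV. h i x)\<^sup>2) + \<beta> * (\<Sum>i\<in>UNIV. LINT x|lborel. (g i x)\<^sup>2)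
    + \<alpha> * (LINT x|lborel. (w x)\<^sup>2)"

text \<open>Here \<open>b * w - f\<close> plays the Laplacian of \<open>w\<close>, and minus its
  pairing with \<open>w\<close> plays the Dirichlet integral. The coefficient \<open>2 * b\<close>
  is the one for which the mixed terms \<open>w * f\<close> cancel.\<close>

lemma integral_square_resolvent:
  assumes w: "sq_integrable w" and f: "sq_integrable f"
  shows "(LINT x|lborel. (b * w x - f x)\<^sup>2) + 2 * b * (- (LINT x|lborel. w x * (b * w x - f x))) + \<alpha> * (LINT x|lborel. (w x)\<^sup>2)
    = (LINT x|lborel. (f x)\<^sup>2) - (b\<^sup>2 - \<alpha>) * (LINT x|lborel. (w x)\<^sup>2)"
proof -
  note i = sq_integrable_square[OF w] sq_integrable_square[OF f] sq_integrable_mult[OF w f]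
  have "(\<lambda>x. (b * w x - f x)\<^sup>2) = (\<lambda>x. b\<^sup>2 * (w x)\<^sup>2 - 2 * b * (w x * f x) + (f x)\<^sup>2)"
    by (simp add: power2_diff power_mult_distrib algebra_simps)
  then have 1: "(LINT x|lborel. (b * w x - f x)\<^sup>2) = b\<^sup>2 * (LINT x|lborel. (w x)\<^sup>2) - 2 * b * (LINT x|lborel. w x * f x) + (LINT x|lborel. (f x)\<^sup>2)"
    using i by simp
  have "(\<lambda>x. w x * (b * w x - f x)) = (\<lambda>x. b * (w x)\<^sup>2 - w x * f x)"
    by (simp add: power2_eq_square algebra_simps)
  then have 2: "(LINT x|lborel. w x * (b * w x - f x)) = b * (LINT x|lborel. (w x)\<^sup>2) - (LINT x|lborel. w x * f x)"
    using i by simp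
  show ?thesis unfolding 1 2 by (simp add: algebra_simps power2_eq_square)
qed

lemma energy_test:
  fixes g :: "real ^ 'n \<Rightarrow> real"
  assumes b: "0 < b" and g: "test_function g"
  shows "energy (2 * b) \<alpha> (conv (bessel b) g) (\<lambda>i. conv (bessel b) (pderiv_at i g))
      (\<lambda>i. conv (bessel b) (pderiv_at i (pderiv_at i g)))
    = (LINT x|lborel. (g x)\<^sup>2) - (b\<^sup>2 - \<alpha>) * (LINT x|lborel. (conv (bessel b) g x)\<^sup>2)"
proof -
  interpret even_kernel "bessel b :: real ^ 'n \<Rightarrow> real" by (rule even_kernel_bessel[OF b])
  note t = test_conv_laplacian[OF b g]
  have [measurable]: "g \<in> borel_measurable borel" using g by measurable
  have [measurable]: "pderiv_at i (pderiv_at i g) \<in> borel_measurable borel" for i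
    by (intro test_function_meas test_function_pderiv_at g)
  have "(LINT x|lborel. (\<Sum>i\<in>UNIV. conv (bessel b) (pderiv_at i (pderiv_at i g)) x)\<^sup>2) = (LINT x|lborel. (b * conv (bessel b) g x - g x)\<^sup>2)"
    by (rule integral_cong_AE) (use t(1) in \<open>auto elim!: eventually_mono\<close>)
  then show ?thesis
    using integral_square_resolvent[OF sq_integrable_conv(1) , OF test_function_sq_integrable test_function_sq_integrable, OF g g, of b \<alpha>] t(2)
    by (simp add: energy_def)
qed

text \<open>By duality: against a test function the kernel and then both derivatives move onto it,
  and \<open>test_conv_laplacian\<close> collapses the result to the pairing with
  \<open>w\<close>.\<close>

lemma resolvent_representation:
  fixes w :: "real ^ 'n \<Rightarrow> real"
  assumes b: "0 < b" and g: "\<And>i. sq_weak_deriv i w (g i)" and h: "\<And>i. sq_weak_deriv i (g i) (h i)"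
  defines "f \<equiv> \<lambda>x. b * w x - (\<Sum>i\<in>UNIV. h i x)"
  shows "AE x in lborel. w x = conv (bessel b) f x"
proof -
  interpret even_kernel "bessel b :: real ^ 'n \<Rightarrow> real" by (rule even_kernel_bessel[OF b])
  let ?G = "conv (bessel b) :: _ \<Rightarrow> real ^ 'n \<Rightarrow> real"
  have sw: "sq_integrable w" "\<And>i. sq_integrable (g i)" "\<And>i. sq_integrable (h i)"
    using g h by (auto simp: sq_weak_deriv_def)
  have sf: "sq_integrable f" unfolding f_def by (intro sq_integrable_diff sq_integrable_cmult sq_integrable_sum sw)
  have s: "sq_integrable (\<lambda>x. ?G f x - w x)" by (intro sq_integrable_diff sq_integrable_conv sf sw)
  have "AE x in lborel. ?G f x - w x = 0"
  proof (rule fundamental_lemma)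
    show [measurable]: "(\<lambda>x. ?G f x - w x) \<in> borel_measurable borel" using s by measurable
    show "set_integrable lborel K (\<lambda>x. ?G f x - w x)" if K: "compact K" for K
    proof -
      have "sq_integrable (indicator K :: real ^ 'n \<Rightarrow> real)"
        using K emeasure_bounded_finite[OF compact_imp_bounded[OF K]] by (intro sq_integrable_indicator) (auto simp: borel_compact)
      from sq_integrable_mult[OF this s] show ?thesis by (simp add: set_integrable_def)
    qed
    fix \<phi> :: "real ^ 'n \<Rightarrow> real" assume \<phi>: "test_function \<phi>"
    note t\<phi> = \<phi> test_function_pderiv_at[OF \<phi>] test_function_pderiv_at[OF test_function_pderiv_at[OF \<phi>]]
    note s\<phi> = t\<phi>[THEN test_function_sq_integrable]
    define D where "D i = pderiv_at i (pderiv_at i \<phi>)" for i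
    \<comment> \<open>The kernel is carried to \<open>h i\<close> before the two integrations by
      parts, so that these are tested against \<open>\<phi>\<close> and its derivative, and is
      carried back afterwards.\<close>
    have 1: "(LINT x|lborel. ?G \<phi> x * h i x) = (LINT x|lborel. ?G (D i) x * w x)" for i
    proof -
      have "(LINT x|lborel. ?G \<phi> x * h i x) = (LINT x|lborel. \<phi> x * ?G (h i) x)"
        by (rule integral_conv_eq(2)[OF sw(3) s\<phi>(1), symmetric])
      also have "\<dots> = - (LINT x|lborel. pderiv_at i \<phi> x * ?G (g i) x)"
        using sq_weak_deriv_conv[OF even_kernel_axioms h, of i] \<phi> unfolding sq_weak_deriv_def by simp
      also have "\<dots> = (LINT x|lborel. D i x * ?G w x)"
        using sq_weak_deriv_conv[OF even_kernel_axioms g, of i] t\<phi>(2)[of i] unfolding sq_weak_deriv_def D_def by simp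
      also have "\<dots> = (LINT x|lborel. ?G (D i) x * w x)"
        unfolding D_def by (rule integral_conv_eq(2)[OF sw(1) s\<phi>(3)])
      finally show ?thesis .
    qed
    have sD: "sq_integrable (D i)" for i unfolding D_def by (rule s\<phi>)
    have i1: "integrable lborel (\<lambda>x. ?G \<phi> x * w x)" "\<And>i. integrable lborel (\<lambda>x. ?G \<phi> x * h i x)"
      "\<And>i. integrable lborel (\<lambda>x. ?G (D i) x * w x)"
      by (intro sq_integrable_mult sq_integrable_conv s\<phi> sD sw)+
    have "(LINT x|lborel. \<phi> x * ?G f x) = (LINT x|lborel. ?G \<phi> x * f x)"
      by (rule integral_conv_eq(2)[OF sf s\<phi>(1)])
    also have "\<dots> = (LINT x|lborel. b * (?G \<phi> x * w x) - (\<Sum>i\<in>UNIV. ?G \<phi> x * h i x))"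
      unfolding f_def by (simp add: algebra_simps sum_distrib_left)
    also have "\<dots> = b * (LINT x|lborel. ?G \<phi> x * w x) - (\<Sum>i\<in>UNIV. LINT x|lborel. ?G \<phi> x * h i x)"
      using i1 by simp
    also have "\<dots> = (LINT x|lborel. b * (?G \<phi> x * w x) - (\<Sum>i\<in>UNIV. ?G (D i) x * w x))"
      unfolding 1 using i1 by simp
    also have "\<dots> = (LINT x|lborel. \<phi> x * w x)"
    proof (rule integral_cong_AE)
      show "AE x in lborel. b * (?G \<phi> x * w x) - (\<Sum>i\<in>UNIV. ?G (D i) x * w x) = \<phi> x * w x"
        using test_conv_laplacian(1)[OF b \<phi>]
      proof eventually_elim
        case (elim x)
        have "b * (?G \<phi> x * w x) - (\<Sum>i\<in>UNIV. ?G (D i) x * w x) = (b * ?G \<phi> x - (\<Sum>i\<in>UNIV. ?G (D i) x)) * w x"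
          by (simp add: sum_distrib_left algebra_simps)
        then show ?case using elim by (simp add: D_def)
      qed
      have [measurable]: "w \<in> borel_measurable borel" "\<phi> \<in> borel_measurable borel" "\<And>i. D i \<in> borel_measurable borel"
        using sw sD \<phi> by auto
      show "(\<lambda>x. b * (?G \<phi> x * w x) - (\<Sum>i\<in>UNIV. ?G (D i) x * w x)) \<in> borel_measurable lborel"
        "(\<lambda>x. \<phi> x * w x) \<in> borel_measurable lborel" by measurable
    qed
    finally have "(LINT x|lborel. \<phi> x * ?G f x) = (LINT x|lborel. \<phi> x * w x)" .
    moreover have "integrable lborel (\<lambda>x. \<phi> x * ?G f x)" "integrable lborel (\<lambda>x. \<phi> x * w x)"
      by (intro sq_integrable_mult sq_integrable_conv s\<phi> sf sw)+
    ultimately show "(LINT x|lborel. \<phi> x * (?G f x - w x)) = 0" by (simp add: right_diff_distrib)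
  qed
  then show ?thesis by eventually_elim simp
qed

text \<open>Expanding the square of \<open>g i - W1 k i\<close>, where \<open>W1 k\<close> is the
  gradient of the convolution with a test function close to \<open>f\<close>, bounds the Dirichlet
  integral of \<open>w\<close> from below. The one-sided bound suffices, since minimality supplies
  the opposite one.\<close>

lemma energy_ge:
  fixes w :: "real ^ 'n \<Rightarrow> real"
  assumes b: "0 < b" and g: "\<And>i. sq_weak_deriv i w (g i)" and h: "\<And>i. sq_weak_deriv i (g i) (h i)"
  defines "f \<equiv> \<lambda>x. b * w x - (\<Sum>i\<in>UNIV. h i x)"
  shows "(LINT x|lborel. (f x)\<^sup>2) - (b\<^sup>2 - \<alpha>) * (LINT x|lborel. (w x)\<^sup>2) \<le> energy (2 * b) \<alpha> w g h"
proof -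
  interpret even_kernel "bessel b :: real ^ 'n \<Rightarrow> real" by (rule even_kernel_bessel[OF b])
  let ?G = "conv (bessel b) :: _ \<Rightarrow> real ^ 'n \<Rightarrow> real"
  have sw: "sq_integrable w" "\<And>i. sq_integrable (g i)" "\<And>i. sq_integrable (h i)"
    using g h by (auto simp: sq_weak_deriv_def)
  have sf: "sq_integrable f" unfolding f_def by (intro sq_integrable_diff sq_integrable_cmult sq_integrable_sum sw)
  have wf: "AE x in lborel. w x = ?G f x" unfolding f_def by (rule resolvent_representation[OF b g h])
  have sL: "sq_integrable (\<lambda>x. \<Sum>i\<in>UNIV. h i x)" by (intro sq_integrable_sum sw)
  obtain F where F: "\<And>k::nat. test_function (F k)" "(\<lambda>k. LINT x|lborel. (F k x - f x)\<^sup>2) \<longlonglongrightarrow> 0"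
    using test_functions_dense[OF sf] by blast
  note sF = F(1)[THEN test_function_sq_integrable]
  define W where "W k = ?G (F k)" for k
  define W1 where "W1 k i = ?G (pderiv_at i (F k))" for k i
  have sW: "sq_integrable (W k)" "sq_integrable (W1 k i)" for k i
    unfolding W_def W1_def by (intro sq_integrable_conv sF test_function_sq_integrable test_function_pderiv_at F)+
  have Wl: "(\<lambda>k. LINT x|lborel. (W k x - w x)\<^sup>2) \<longlonglongrightarrow> 0"
  proof -
    have [measurable]: "W k \<in> borel_measurable borel" "w \<in> borel_measurable borel" "f \<in> borel_measurable borel" for k
      using sW sw sf by auto
    have "(LINT x|lborel. (W k x - w x)\<^sup>2) = (LINT x|lborel. (?G (F k) x - ?G f x)\<^sup>2)" for k
      by (rule integral_cong_AE) (use wf in \<open>auto simp flip: W_def elim!: eventually_mono\<close>)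
    then show ?thesis using sq_tendsto_conv[OF sf sF F(2)] by simp
  qed
  define L where "L x = (\<Sum>i\<in>UNIV. h i x)" for x
  have Lf: "L x = b * w x - f x" for x by (simp add: L_def f_def)
  have sL': "sq_integrable L" using sL by (simp add: L_def[abs_def])
  \<comment> \<open>Integration by parts is legitimate in the mixed term because the kernel can be
    moved away from the test function \<open>F k\<close>.\<close>
  have cross: "(\<Sum>i\<in>UNIV. LINT x|lborel. g i x * W1 k i x) = - (LINT x|lborel. L x * W k x)" for k
  proof -
    have "(LINT x|lborel. g i x * W1 k i x) = - (LINT x|lborel. h i x * W k x)" for i
    proof -
      have "(LINT x|lborel. g i x * W1 k i x) = (LINT x|lborel. ?G (g i) x * pderiv_at i (F k) x)"
        unfolding W1_def by (rule integral_conv_eq(2)) (intro sw test_function_sq_integrable test_function_pderiv_at F)+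
      also have "\<dots> = - (LINT x|lborel. F k x * ?G (h i) x)"
        using sq_weak_deriv_conv[OF even_kernel_axioms h, of i] F(1)[of k] unfolding sq_weak_deriv_def
        by (simp add: mult.commute)
      also have "(LINT x|lborel. F k x * ?G (h i) x) = (LINT x|lborel. W k x * h i x)"
        unfolding W_def by (rule integral_conv_eq(2)[OF sw(3) sF])
      finally show ?thesis by (simp add: mult.commute)
    qed
    then have "(\<Sum>i\<in>UNIV. LINT x|lborel. g i x * W1 k i x) = - (\<Sum>i\<in>UNIV. LINT x|lborel. h i x * W k x)"
      by (simp add: sum_negf)
    also have "(\<Sum>i\<in>UNIV. LINT x|lborel. h i x * W k x) = (LINT x|lborel. (\<Sum>i\<in>UNIV. h i x * W k x))"
      by (intro Bochner_Integration.integral_sum[symmetric] sq_integrable_mult sw sW)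
    finally show ?thesis by (simp add: L_def sum_distrib_right)
  qed
  have sq: "(\<Sum>i\<in>UNIV. LINT x|lborel. (W1 k i x)\<^sup>2) = - (LINT x|lborel. W k x * (b * W k x - F k x))" for k
    unfolding W_def W1_def by (rule test_conv_laplacian(2)[OF b F(1)])
  have nn: "0 \<le> (\<Sum>i\<in>UNIV. LINT x|lborel. (g i x)\<^sup>2) + 2 * (LINT x|lborel. L x * W k x) - (LINT x|lborel. W k x * (b * W k x - F k x))" for k
  proof -
    have "0 \<le> (\<Sum>i\<in>UNIV. LINT x|lborel. (g i x - W1 k i x)\<^sup>2)" by (intro sum_nonneg) simp
    also have "(LINT x|lborel. (g i x - W1 k i x)\<^sup>2) = (LINT x|lborel. (g i x)\<^sup>2) - 2 * (LINT x|lborel. g i x * W1 k i x) + (LINT x|lborel. (W1 k i x)\<^sup>2)" for i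
    proof -
      note i = sq_integrable_square[OF sw(2)[of i]] sq_integrable_square[OF sW(2)[of k i]] sq_integrable_mult[OF sw(2)[of i] sW(2)[of k i]]
      have "(\<lambda>x. (g i x - W1 k i x)\<^sup>2) = (\<lambda>x. (g i x)\<^sup>2 - 2 * (g i x * W1 k i x) + (W1 k i x)\<^sup>2)"
        by (simp add: power2_diff algebra_simps)
      then show ?thesis using i by simp
    qed
    then have "(\<Sum>i\<in>UNIV. LINT x|lborel. (g i x - W1 k i x)\<^sup>2) = (\<Sum>i\<in>UNIV. LINT x|lborel. (g i x)\<^sup>2)
        - 2 * (\<Sum>i\<in>UNIV. LINT x|lborel. g i x * W1 k i x) + (\<Sum>i\<in>UNIV. LINT x|lborel. (W1 k i x)\<^sup>2)"
      by (simp add: sum.distrib sum_subtractf sum_distrib_left)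
    finally show ?thesis unfolding cross sq by simp
  qed
  have l1: "(\<lambda>k. LINT x|lborel. L x * W k x) \<longlonglongrightarrow> (LINT x|lborel. L x * w x)"
    by (rule sq_tendsto_mult[OF sL' _ _ sw(1) sW(1) Wl]) (auto intro: sL')
  have l2: "(\<lambda>k. LINT x|lborel. W k x * (b * W k x - F k x)) \<longlonglongrightarrow> (LINT x|lborel. w x * L x)"
  proof -
    have "(\<lambda>k. b * (LINT x|lborel. W k x * W k x) - (LINT x|lborel. W k x * F k x)) \<longlonglongrightarrow> b * (LINT x|lborel. w x * w x) - (LINT x|lborel. w x * f x)"
      by (intro tendsto_intros sq_tendsto_mult sw sW Wl sf sF F)
    moreover have "b * (LINT x|lborel. u x * u x) - (LINT x|lborel. u x * v x) = (LINT x|lborel. u x * (b * u x - v x))"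
      if "sq_integrable u" "sq_integrable v" for u v :: "real ^ 'n \<Rightarrow> real"
      using sq_integrable_mult[OF that] sq_integrable_mult[OF that(1) that(1)] by (simp add: algebra_simps)
    ultimately show ?thesis using sW(1) sF sw(1) sf by (simp add: Lf)
  qed
  \<comment> \<open>In the limit two copies of the pairing of \<open>L\<close> with \<open>w\<close>
    enter with plus and one with minus; one copy survives.\<close>
  have "0 \<le> (\<Sum>i\<in>UNIV. LINT x|lborel. (g i x)\<^sup>2) + 2 * (LINT x|lborel. L x * w x) - (LINT x|lborel. w x * L x)"
    by (rule LIMSEQ_le_const[OF tendsto_diff[OF tendsto_add[OF tendsto_const tendsto_mult[OF tendsto_const l1]] l2]]) (use nn in auto)
  then have ge: "- (LINT x|lborel. w x * (b * w x - f x)) \<le> (\<Sum>i\<in>UNIV. LINT x|lborel. (g i x)\<^sup>2)"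
    by (simp add: Lf mult.commute)
  have "energy (2 * b) \<alpha> w g h = (LINT x|lborel. (b * w x - f x)\<^sup>2) + 2 * b * (\<Sum>i\<in>UNIV. LINT x|lborel. (g i x)\<^sup>2) + \<alpha> * (LINT x|lborel. (w x)\<^sup>2)"
    by (simp add: energy_def flip: L_def Lf)
  also have "\<dots> \<ge> (LINT x|lborel. (b * w x - f x)\<^sup>2) + 2 * b * (- (LINT x|lborel. w x * (b * w x - f x))) + \<alpha> * (LINT x|lborel. (w x)\<^sup>2)"
    using mult_left_mono[OF ge, of "2 * b"] b by simp
  finally show ?thesis using integral_square_resolvent[OF sw(1) sf, of b \<alpha>] by simp
qed

section \<open>Complex weak derivatives and the functional \<open>J1\<close>\<close>

lemma sq_integrable_imp_locally:
  assumes u: "sq_integrable (u :: real ^ 'n \<Rightarrow> real)" and K: "compact K"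
  shows "set_integrable lborel K u"
proof -
  have "sq_integrable (indicator K :: real ^ 'n \<Rightarrow> real)"
    using K emeasure_bounded_finite[OF compact_imp_bounded[OF K]] by (intro sq_integrable_indicator) (auto simp: borel_compact)
  from sq_integrable_mult[OF this u] show ?thesis by (simp add: set_integrable_def)
qed

lemma square_integrable_parts:
  assumes "square_integrable f"
  shows "sq_integrable (\<lambda>x. Re (f x))" "sq_integrable (\<lambda>x. Im (f x))" "sq_integrable (\<lambda>x. norm (f x))"
proof -
  have [measurable]: "f \<in> borel_measurable borel" using assms by (simp add: square_integrable_def)
  show n: "sq_integrable (\<lambda>x. norm (f x))" using assms by (simp add: square_integrable_def sq_integrable_def)
  show "sq_integrable (\<lambda>x. Re (f x))" "sq_integrable (\<lambda>x. Im (f x))"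
    by (rule sq_integrable_bound[where C = 1, OF n]; simp add: abs_Re_le_cmod abs_Im_le_cmod)+
qed

lemma square_integrable_of_real:
  assumes "sq_integrable u" shows "square_integrable (\<lambda>x. complex_of_real (u x))"
  using assms by (auto simp: square_integrable_def sq_integrable_def)

lemma test_mult_integrable:
  assumes g: "locally_integrable g" and \<phi>: "test_function \<phi>"
  shows "integrable lborel (\<lambda>x. \<phi> x *\<^sub>R g x)"
proof -
  obtain M where M: "0 \<le> M" "\<And>x. \<bar>\<phi> x\<bar> \<le> M"
    using compactly_supported_bounded[OF test_function_compactly_supported[OF \<phi>]] by blast
  define K where "K = closure {x. \<phi> x \<noteq> 0}"
  have K: "compact K" using \<phi> by (simp add: K_def test_function_def)
  have i: "integrable lborel (\<lambda>x. M *\<^sub>R (indicator K x *\<^sub>R g x))"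
  proof (rule integrable_scaleR_right)
    show "integrable lborel (\<lambda>x. indicator K x *\<^sub>R g x)"
      using g K unfolding locally_integrable_def set_integrable_def by blast
  qed
  show ?thesis
  proof (rule Bochner_Integration.integrable_bound[OF i])
    show "(\<lambda>x. \<phi> x *\<^sub>R g x) \<in> borel_measurable lborel"
    proof -
      have [measurable]: "\<phi> \<in> borel_measurable borel" "g \<in> borel_measurable borel"
        using test_function_meas[OF \<phi>] g by (simp_all add: locally_integrable_def)
      show ?thesis by measurable
    qed
    show "AE x in lborel. norm (\<phi> x *\<^sub>R g x) \<le> norm (M *\<^sub>R (indicator K x *\<^sub>R g x))"
    proof (intro AE_I2)
      fix x
      show "norm (\<phi> x *\<^sub>R g x) \<le> norm (M *\<^sub>R (indicator K x *\<^sub>R g x))"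
      proof (cases "\<phi> x = 0")
        case False
        then have "x \<in> K" unfolding K_def using closure_subset[of "{x. \<phi> x \<noteq> 0}"] by auto
        then show ?thesis using M by (simp add: mult_right_mono)
      qed simp
    qed
  qed
qed

lemma is_weak_pderiv_parts:
  assumes w: "is_weak_pderiv i f g" and f: "square_integrable f" and g: "square_integrable g"
  shows "sq_weak_deriv i (\<lambda>x. Re (f x)) (\<lambda>x. Re (g x))"
    and "sq_weak_deriv i (\<lambda>x. Im (f x)) (\<lambda>x. Im (g x))"
proof -
  have e: "(LINT x|lborel. pderiv_at i \<phi> x *\<^sub>R f x) = - (LINT x|lborel. \<phi> x *\<^sub>R g x)"
    and i: "integrable lborel (\<lambda>x. pderiv_at i \<phi> x *\<^sub>R f x)" "integrable lborel (\<lambda>x. \<phi> x *\<^sub>R g x)"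
    if "test_function \<phi>" for \<phi>
  proof -
    show "(LINT x|lborel. pderiv_at i \<phi> x *\<^sub>R f x) = - (LINT x|lborel. \<phi> x *\<^sub>R g x)"
      using w that unfolding is_weak_pderiv_def by blast
    have "locally_integrable f" "locally_integrable g" using w by (simp_all add: is_weak_pderiv_def)
    then show "integrable lborel (\<lambda>x. pderiv_at i \<phi> x *\<^sub>R f x)" "integrable lborel (\<lambda>x. \<phi> x *\<^sub>R g x)"
      using that test_function_pderiv_at[OF that] by (simp_all add: test_mult_integrable)
  qed
  have "(LINT x|lborel. pderiv_at i \<phi> x * Re (f x)) = - (LINT x|lborel. \<phi> x * Re (g x))"
    and "(LINT x|lborel. pderiv_at i \<phi> x * Im (f x)) = - (LINT x|lborel. \<phi> x * Im (g x))"
    if \<phi>: "test_function \<phi>" for \<phi>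
    using arg_cong[OF e[OF \<phi>], of Re] arg_cong[OF e[OF \<phi>], of Im] i[OF \<phi>]
    by (simp_all flip: integral_Re integral_Im)
  then show "sq_weak_deriv i (\<lambda>x. Re (f x)) (\<lambda>x. Re (g x))" "sq_weak_deriv i (\<lambda>x. Im (f x)) (\<lambda>x. Im (g x))"
    using square_integrable_parts[OF f] square_integrable_parts[OF g] by (auto simp: sq_weak_deriv_def)
qed

lemma is_weak_pderiv_of_real:
  assumes w: "sq_weak_deriv i u v"
  shows "is_weak_pderiv i (\<lambda>x. complex_of_real (u x)) (\<lambda>x. complex_of_real (v x))"
proof -
  have l: "locally_integrable (\<lambda>x. complex_of_real (u x))" if u: "sq_integrable u" for u :: "real ^ 'a \<Rightarrow> real"
  proof -
    have "set_integrable lborel K (\<lambda>x. complex_of_real (u x))" if "compact K" for K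
    proof -
      have "integrable lborel (\<lambda>x. complex_of_real (indicator K x * u x))"
        using sq_integrable_imp_locally[OF u that] by (intro integrable_of_real) (simp add: set_integrable_def)
      then show ?thesis by (simp add: set_integrable_def scaleR_conv_of_real)
    qed
    then show ?thesis using u by (auto simp: locally_integrable_def)
  qed
  have "(LINT x|lborel. pderiv_at i \<phi> x *\<^sub>R complex_of_real (u x)) = - (LINT x|lborel. \<phi> x *\<^sub>R complex_of_real (v x))"
    if "test_function \<phi>" for \<phi>
  proof -
    have "(LINT x|lborel. pderiv_at i \<phi> x * u x) = - (LINT x|lborel. \<phi> x * v x)"
      using w that by (simp add: sq_weak_deriv_def)
    then have "complex_of_real (LINT x|lborel. pderiv_at i \<phi> x * u x) = - complex_of_real (LINT x|lborel. \<phi> x * v x)"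
      by simp
    then show ?thesis by (simp add: scaleR_conv_of_real flip: integral_complex_of_real of_real_mult)
  qed
  then show ?thesis using w by (auto simp: is_weak_pderiv_def sq_weak_deriv_def intro: l)
qed

lemma AE_unique_weak_pderiv:
  assumes "is_weak_pderiv i f g" "is_weak_pderiv i f g'"
  shows "AE x in lborel. g x = g' x"
proof -
  have l: "locally_integrable g" "locally_integrable g'" using assms by (auto simp: is_weak_pderiv_def)
  have [measurable]: "g \<in> borel_measurable borel" "g' \<in> borel_measurable borel" using l by (auto simp: locally_integrable_def)
  have z: "(LINT x|lborel. \<phi> x *\<^sub>R (g x - g' x)) = 0" and i: "integrable lborel (\<lambda>x. \<phi> x *\<^sub>R (g x - g' x))"
    if \<phi>: "test_function \<phi>" for \<phi>
  proof -
    note ii = test_mult_integrable[OF l(1) \<phi>] test_mult_integrable[OF l(2) \<phi>]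
    have "- (LINT x|lborel. \<phi> x *\<^sub>R g x) = (LINT x|lborel. pderiv_at i \<phi> x *\<^sub>R f x)"
      using assms(1) \<phi> by (simp add: is_weak_pderiv_def)
    also have "\<dots> = - (LINT x|lborel. \<phi> x *\<^sub>R g' x)"
      using assms(2) \<phi> by (simp add: is_weak_pderiv_def)
    finally have "(LINT x|lborel. \<phi> x *\<^sub>R g x) = (LINT x|lborel. \<phi> x *\<^sub>R g' x)" by simp
    then show "(LINT x|lborel. \<phi> x *\<^sub>R (g x - g' x)) = 0" using ii by (simp add: scaleR_diff_right)
    show "integrable lborel (\<lambda>x. \<phi> x *\<^sub>R (g x - g' x))" using ii by (simp add: scaleR_diff_right)
  qed
  have s: "set_integrable lborel K (\<lambda>x. g x - g' x)" if "compact K" for K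
    using l that by (intro set_integral_diff) (auto simp: locally_integrable_def)
  have "AE x in lborel. Re (g x - g' x) = 0"
  proof (rule fundamental_lemma)
    show "set_integrable lborel K (\<lambda>x. Re (g x - g' x))" if "compact K" for K
      using integrable_Re[OF s[OF that, unfolded set_integrable_def]] by (simp add: set_integrable_def)
    show "(LINT x|lborel. \<phi> x * Re (g x - g' x)) = 0" if "test_function \<phi>" for \<phi>
      using arg_cong[OF z[OF that], of Re] i[OF that] by (simp flip: integral_Re)
  qed measurable
  moreover have "AE x in lborel. Im (g x - g' x) = 0"
  proof (rule fundamental_lemma)
    show "set_integrable lborel K (\<lambda>x. Im (g x - g' x))" if "compact K" for K
      using integrable_Im[OF s[OF that, unfolded set_integrable_def]] by (simp add: set_integrable_def)
    show "(LINT x|lborel. \<phi> x * Im (g x - g' x)) = 0" if "test_function \<phi>" for \<phi>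
      using arg_cong[OF z[OF that], of Im] i[OF that] by (simp flip: integral_Im)
  qed measurable
  ultimately show ?thesis by eventually_elim (simp add: complex_eq_iff)
qed

lemma is_weak_pderiv_weak_pderiv:
  "is_weak_pderiv i f g \<Longrightarrow> is_weak_pderiv i f (weak_pderiv i f)"
  unfolding weak_pderiv_def by (rule someI[of "is_weak_pderiv i f"])

lemma AE_weak_pderiv: "is_weak_pderiv i f g \<Longrightarrow> AE x in lborel. weak_pderiv i f x = g x"
  by (rule AE_unique_weak_pderiv[OF is_weak_pderiv_weak_pderiv])

lemma is_weak_pderiv_cong:
  assumes w: "is_weak_pderiv i f g" and f': "locally_integrable f'" and e: "AE x in lborel. f' x = f x"
  shows "is_weak_pderiv i f' g"
proof -
  have "(LINT x|lborel. pderiv_at i \<phi> x *\<^sub>R f' x) = (LINT x|lborel. pderiv_at i \<phi> x *\<^sub>R f x)"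
    if "test_function \<phi>" for \<phi>
  proof (rule integral_cong_AE)
    have [measurable]: "pderiv_at i \<phi> \<in> borel_measurable borel" "f \<in> borel_measurable borel" "f' \<in> borel_measurable borel"
      using test_function_meas[OF test_function_pderiv_at[OF that, of i]] w f' by (auto simp: is_weak_pderiv_def locally_integrable_def)
    show "(\<lambda>x. pderiv_at i \<phi> x *\<^sub>R f' x) \<in> borel_measurable lborel" "(\<lambda>x. pderiv_at i \<phi> x *\<^sub>R f x) \<in> borel_measurable lborel"
      by measurable
  qed (use e in \<open>auto elim!: eventually_mono\<close>)
  then show ?thesis using w f' by (simp add: is_weak_pderiv_def)
qed

text \<open>\<open>weak_pderiv\<close> is an unspecified choice, but weak derivatives agree almost
  everywhere and the integrals do not see null sets.\<close>

lemma J1_eq: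
  fixes u :: "real ^ 'n \<Rightarrow> complex"
  assumes g: "\<And>i. is_weak_pderiv i u (g i)" and h: "\<And>i. is_weak_pderiv i (g i) (h i)"
  shows "J1 \<beta> \<alpha> u = (LINT x|lborel. (norm (\<Sum>i\<in>UNIV. h i x))\<^sup>2)
    + \<beta> * (LINT x|lborel. (\<Sum>i\<in>UNIV. (norm (g i x))\<^sup>2)) + \<alpha> * (LINT x|lborel. (norm (u x))\<^sup>2)"
proof -
  have l: "locally_integrable f'" if "is_weak_pderiv i f f'" for i and f f' :: "real ^ 'n \<Rightarrow> complex"
    using that by (simp add: is_weak_pderiv_def)
  have [measurable]: "f' \<in> borel_measurable borel" if "is_weak_pderiv i f f'" for i and f f' :: "real ^ 'n \<Rightarrow> complex"
    using l[OF that] by (simp add: locally_integrable_def)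
  have w1: "is_weak_pderiv i u (weak_pderiv i u)" for i by (rule is_weak_pderiv_weak_pderiv[OF g])
  have e1: "AE x in lborel. weak_pderiv i u x = g i x" for i by (rule AE_weak_pderiv[OF g])
  \<comment> \<open>The second derivative is taken of the chosen first derivative, which agrees with
    \<open>g i\<close> only almost everywhere; a weak derivative depends on the function only up to
    null sets.\<close>
  have w2: "is_weak_pderiv i (weak_pderiv i u) (h i)" for i
    by (rule is_weak_pderiv_cong[OF h l[OF w1] e1])
  have e2: "AE x in lborel. weak_pderiv i (weak_pderiv i u) x = h i x" for i by (rule AE_weak_pderiv[OF w2])
  note w3 = is_weak_pderiv_weak_pderiv[OF w2]
  have m [measurable]: "weak_pderiv i u \<in> borel_measurable borel" "weak_pderiv i (weak_pderiv i u) \<in> borel_measurable borel"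
    "g i \<in> borel_measurable borel" "h i \<in> borel_measurable borel" for i
    using l[OF w1[of i]] l[OF w3[of i]] l[OF g[of i]] l[OF h[of i]] by (auto simp: locally_integrable_def)
  have E1: "AE x in lborel. \<forall>i\<in>UNIV. weak_pderiv i u x = g i x"
    using e1 by (intro AE_finite_allI) auto
  have E2: "AE x in lborel. \<forall>i\<in>UNIV. weak_pderiv i (weak_pderiv i u) x = h i x"
    using e2 by (intro AE_finite_allI) auto
  have "(LINT x|lborel. (norm (weak_laplacian u x))\<^sup>2) = (LINT x|lborel. (norm (\<Sum>i\<in>UNIV. h i x))\<^sup>2)"
    unfolding weak_laplacian_def by (rule integral_cong_AE) (use E2 in \<open>auto elim!: eventually_mono\<close>)
  moreover have "(LINT x|lborel. weak_grad_sq u x) = (LINT x|lborel. (\<Sum>i\<in>UNIV. (norm (g i x))\<^sup>2))"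
    unfolding weak_grad_sq_def by (rule integral_cong_AE) (use E1 in \<open>auto elim!: eventually_mono\<close>)
  ultimately show ?thesis by (simp add: J1_def)
qed

lemma J1_of_real:
  assumes g: "\<And>i. sq_weak_deriv i w (g i)" and h: "\<And>i. sq_weak_deriv i (g i) (h i)"
  shows "J1 \<beta> \<alpha> (\<lambda>x. complex_of_real (w x)) = energy \<beta> \<alpha> w g h"
proof -
  have sw: "sq_integrable w" "\<And>i. sq_integrable (g i)" "\<And>i. sq_integrable (h i)"
    using g h by (auto simp: sq_weak_deriv_def)
  have "J1 \<beta> \<alpha> (\<lambda>x. complex_of_real (w x)) = (LINT x|lborel. (norm (\<Sum>i\<in>UNIV. complex_of_real (h i x)))\<^sup>2)
    + \<beta> * (LINT x|lborel. (\<Sum>i\<in>UNIV. (norm (complex_of_real (g i x)))\<^sup>2)) + \<alpha> * (LINT x|lborel. (norm (complex_of_real (w x)))\<^sup>2)"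
    by (rule J1_eq) (intro is_weak_pderiv_of_real g h)+
  also have "\<dots> = energy \<beta> \<alpha> w g h"
    using sw by (simp add: energy_def sq_integrable_square flip: of_real_sum)
  finally show ?thesis .
qed

lemma integral_norm_square_parts:
  assumes "square_integrable f"
  shows "(LINT x|lborel. (norm (f x))\<^sup>2) = (LINT x|lborel. (Re (f x))\<^sup>2) + (LINT x|lborel. (Im (f x))\<^sup>2)"
  using square_integrable_parts[OF assms] by (simp add: cmod_power2 sq_integrable_square)

lemma J1_parts:
  assumes g: "\<And>i. is_weak_pderiv i u (g i)" and h: "\<And>i. is_weak_pderiv i (g i) (h i)"
    and s: "square_integrable u" "\<And>i. square_integrable (g i)" "\<And>i. square_integrable (h i)"
  shows "J1 \<beta> \<alpha> u = energy \<beta> \<alpha> (\<lambda>x. Re (u x)) (\<lambda>i x. Re (g i x)) (\<lambda>i x. Re (h i x))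
    + energy \<beta> \<alpha> (\<lambda>x. Im (u x)) (\<lambda>i x. Im (g i x)) (\<lambda>i x. Im (h i x))"
proof -
  note p = square_integrable_parts
  have "square_integrable (\<lambda>x. \<Sum>i\<in>UNIV. h i x)"
  proof -
    have [measurable]: "h i \<in> borel_measurable borel" for i using s by (simp add: square_integrable_def)
    have "sq_integrable (\<lambda>x. \<Sum>i\<in>UNIV. norm (h i x))" by (intro sq_integrable_sum p s)
    then have "sq_integrable (\<lambda>x. norm (\<Sum>i\<in>UNIV. h i x))"
      by (rule sq_integrable_bound[where C = 1]) (auto intro!: AE_I2 order_trans[OF norm_sum abs_ge_self])
    then show ?thesis by (simp add: square_integrable_def sq_integrable_def)
  qed
  from integral_norm_square_parts[OF this]
  have "(LINT x|lborel. (norm (\<Sum>i\<in>UNIV. h i x))\<^sup>2) = (LINT x|lborel. (\<Sum>i\<in>UNIV. Re (h i x))\<^sup>2) + (LINT x|lborel. (\<Sum>i\<in>UNIV. Im (h i x))\<^sup>2)"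
    by simp
  moreover have "(LINT x|lborel. (\<Sum>i\<in>UNIV. (norm (g i x))\<^sup>2)) = (\<Sum>i\<in>UNIV. LINT x|lborel. (norm (g i x))\<^sup>2)"
    using s by (intro Bochner_Integration.integral_sum) (simp add: square_integrable_def)
  ultimately show ?thesis
    unfolding J1_eq[OF g h] energy_def
    by (simp add: integral_norm_square_parts[OF s(1)] integral_norm_square_parts[OF s(2)] sum.distrib algebra_simps)
qed

lemma J1_nonneg: "0 \<le> \<beta> \<Longrightarrow> 0 \<le> \<alpha> \<Longrightarrow> \<alpha> * (LINT x|lborel. (norm (u x))\<^sup>2) \<le> J1 \<beta> \<alpha> u"
  unfolding J1_def weak_grad_sq_def by (auto intro!: add_nonneg_nonneg mult_nonneg_nonneg integral_nonneg_AE sum_nonneg AE_I2)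

section \<open>The dual minimization problem\<close>

locale minimizer =
  fixes \<sigma> \<beta> \<alpha> :: real and u :: "real ^ 'n \<Rightarrow> complex"
  assumes \<sigma>: "0 < \<sigma>" and \<alpha>: "0 < \<alpha>" and \<beta>: "2 * sqrt \<alpha> < \<beta>" and min: "is_minimizer \<sigma> \<beta> \<alpha> u"
begin

definition b where "b = \<beta> / 2"
definition \<gamma> where "\<gamma> = b\<^sup>2 - \<alpha>"
definition p where "p = 2 * \<sigma> + 2"
definition m where "m = J1 \<beta> \<alpha> u"

abbreviation R :: "(real ^ 'n \<Rightarrow> real) \<Rightarrow> real ^ 'n \<Rightarrow> real" where "R \<equiv> conv (bessel b)"

lemma b_pos: "0 < b" and \<gamma>_pos: "0 < \<gamma>" and p_gt_2: "2 < p" and \<beta>_pos: "0 < \<beta>"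
proof -
  have s: "0 < sqrt \<alpha>" using \<alpha> by simp
  then show "0 < \<beta>" using \<beta> by linarith
  then show "0 < b" by (simp add: b_def)
  have "sqrt \<alpha> < b" using \<beta> by (simp add: b_def)
  then have "(sqrt \<alpha>)\<^sup>2 < b\<^sup>2" using s by (intro power_strict_mono) auto
  then show "0 < \<gamma>" using \<alpha> by (simp add: \<gamma>_def)
  show "2 < p" using \<sigma> by (simp add: p_def)
qed

sublocale even_kernel "bessel b :: real ^ 'n \<Rightarrow> real"
  by (rule even_kernel_bessel[OF b_pos])

lemma u_Mbar: "u \<in> Mbar \<sigma>"
  using min by (simp add: is_minimizer_def)

text \<open>A real \<open>INF\<close> is a lower bound only for a family bounded below;
  nonnegativity of \<open>J1\<close> provides this.\<close>

lemma m_le: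
  fixes v :: "real ^ 'n \<Rightarrow> complex"
  assumes v: "v \<in> Mbar \<sigma>"
  shows "m \<le> J1 \<beta> \<alpha> v"
proof -
  have "bdd_below (J1 \<beta> \<alpha> ` (Mbar \<sigma> :: (real ^ 'n \<Rightarrow> complex) set))"
  proof (rule bdd_belowI2[of _ 0])
    fix v :: "real ^ 'n \<Rightarrow> complex"
    have "0 \<le> \<alpha> * (LINT x|lborel. (norm (v x))\<^sup>2)" using \<alpha> by simp
    then show "0 \<le> J1 \<beta> \<alpha> v" using J1_nonneg[of \<beta> \<alpha> v] \<alpha> \<beta>_pos by linarith
  qed
  from cINF_lower[OF this v] show ?thesis
    using min by (simp add: is_minimizer_def m_def)
qed

lemma u_square: "square_integrable u"
  using u_Mbar by (simp add: Mbar_def numeral_2_eq_2)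

lemma u_integral: "has_bochner_integral lborel (\<lambda>x. norm (u x) powr p) 1"
  using u_Mbar by (simp add: Mbar_def p_def)

text \<open>If the \<open>\<alpha>\<close> term vanished, \<open>u\<close> would be zero almost
  everywhere, against its normalization.\<close>

lemma m_pos: "0 < m"
proof -
  have [measurable]: "u \<in> borel_measurable borel" using u_square by (simp add: square_integrable_def)
  have i: "integrable lborel (\<lambda>x. (norm (u x))\<^sup>2)" using u_square by (simp add: square_integrable_def)
  have "(LINT x|lborel. (norm (u x))\<^sup>2) \<noteq> 0"
  proof
    assume "(LINT x|lborel. (norm (u x))\<^sup>2) = 0"
    then have "AE x in lborel. (norm (u x))\<^sup>2 = 0" using i by (simp add: integral_nonneg_eq_0_iff_AE)
    then have "AE x in lborel. norm (u x) powr p = 0" by eventually_elim simp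
    then have "(LINT x|lborel. norm (u x) powr p) = (LINT x::real ^ 'n|lborel. 0)" by (intro integral_cong_AE) auto
    then show False using u_integral by (simp add: has_bochner_integral_iff)
  qed
  moreover have "0 \<le> (LINT x|lborel. (norm (u x))\<^sup>2)" by simp
  ultimately have "0 < (LINT x|lborel. (norm (u x))\<^sup>2)" by (rule order.not_eq_order_implies_strict[OF not_sym])
  then have "0 < \<alpha> * (LINT x|lborel. (norm (u x))\<^sup>2)" using \<alpha> by (intro mult_pos_pos)
  then show ?thesis using J1_nonneg[of \<beta> \<alpha> u] \<alpha> \<beta>_pos by (simp add: m_def)
qed

lemma powr_integrable_bounded:
  fixes w :: "real ^ 'n \<Rightarrow> real"
  assumes w: "sq_integrable w" and M: "\<And>x. \<bar>w x\<bar> \<le> M" and q: "2 \<le> q"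
  shows "integrable lborel (\<lambda>x. \<bar>w x\<bar> powr q)"
proof (rule Bochner_Integration.integrable_bound)
  have [measurable]: "w \<in> borel_measurable borel" using w by measurable
  show "integrable lborel (\<lambda>x. M powr (q - 2) * (w x)\<^sup>2)" using sq_integrable_square[OF w] by simp
  show "(\<lambda>x. \<bar>w x\<bar> powr q) \<in> borel_measurable lborel" by measurable
  show "AE x in lborel. norm (\<bar>w x\<bar> powr q) \<le> norm (M powr (q - 2) * (w x)\<^sup>2)"
  proof (intro AE_I2)
    fix x
    have "\<bar>w x\<bar> powr (q - 2 + 2) = \<bar>w x\<bar> powr (q - 2) * \<bar>w x\<bar> powr 2" by (rule powr_add)
    moreover have "\<bar>w x\<bar> powr 2 = (w x)\<^sup>2" by (cases "w x = 0") auto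
    ultimately have "\<bar>w x\<bar> powr q = \<bar>w x\<bar> powr (q - 2) * (w x)\<^sup>2" by simp
    also have "\<dots> \<le> M powr (q - 2) * (w x)\<^sup>2" using M[of x] q by (intro mult_right_mono powr_mono2) auto
    finally show "norm (\<bar>w x\<bar> powr q) \<le> norm (M powr (q - 2) * (w x)\<^sup>2)" by simp
  qed
qed

lemma R_test_bounded:
  assumes "test_function g" obtains M where "\<And>x. \<bar>R g x\<bar> \<le> M"
proof -
  obtain M where "\<And>x. \<bar>g x\<bar> \<le> M"
    using compactly_supported_bounded[OF test_function_compactly_supported[OF assms]] by blast
  then show ?thesis using conv_bounded[of g M] that test_function_meas[OF assms] by blast
qed

text \<open>The weak derivatives of \<open>R g\<close> are the convolutions with the derivatives of
  \<open>g\<close>, so \<open>R g\<close> is an admissible competitor, and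
  \<open>energy_test\<close> evaluates its energy.\<close>

lemma R_test_Mbar:
  assumes g: "test_function g" and N: "(LINT x|lborel. \<bar>R g x\<bar> powr p) = 1"
  shows "m \<le> (LINT x|lborel. (g x)\<^sup>2) - \<gamma> * (LINT x|lborel. (R g x)\<^sup>2)"
proof -
  define w1 where "w1 i = R (pderiv_at i g)" for i
  define w2 where "w2 i j = R (pderiv_at j (pderiv_at i g))" for i j
  have d1: "sq_weak_deriv i (R g) (w1 i)" and d2: "sq_weak_deriv j (w1 i) (w2 i j)" for i j
    unfolding w1_def w2_def
    by (intro sq_weak_deriv_conv even_kernel_axioms sq_weak_deriv_test test_function_pderiv_at g)+
  have sw: "sq_integrable (R g)" "sq_integrable (w1 i)" "sq_integrable (w2 i j)" for i j
    using d1 d2 by (auto simp: sq_weak_deriv_def)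
  let ?v = "\<lambda>x. complex_of_real (R g x)"
  have "sobolev_H 2 ?v"
    unfolding numeral_2_eq_2 sobolev_H.simps
  proof (intro conjI allI exI)
    show "square_integrable ?v" by (intro square_integrable_of_real sw)
    fix i
    show "is_weak_pderiv i ?v (\<lambda>x. complex_of_real (w1 i x))" by (intro is_weak_pderiv_of_real d1)
    show "square_integrable (\<lambda>x. complex_of_real (w1 i x))" by (intro square_integrable_of_real sw)
    fix j
    show "is_weak_pderiv j (\<lambda>x. complex_of_real (w1 i x)) (\<lambda>x. complex_of_real (w2 i j x))" by (intro is_weak_pderiv_of_real d2)
    show "square_integrable (\<lambda>x. complex_of_real (w2 i j x))" by (intro square_integrable_of_real sw)
  qed
  moreover have "integrable lborel (\<lambda>x. \<bar>R g x\<bar> powr p)"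
  proof -
    obtain M where "\<And>x. \<bar>R g x\<bar> \<le> M" using R_test_bounded[OF g] by blast
    then show ?thesis using p_gt_2 by (intro powr_integrable_bounded[OF sw(1)]) auto
  qed
  ultimately have "?v \<in> Mbar \<sigma>" using N by (simp add: Mbar_def has_bochner_integral_iff p_def)
  then have "m \<le> J1 \<beta> \<alpha> ?v" by (rule m_le)
  also have "\<dots> = energy \<beta> \<alpha> (R g) w1 (\<lambda>i. w2 i i)" by (rule J1_of_real) (intro d1 d2)+
  also have "\<dots> = (LINT x|lborel. (g x)\<^sup>2) - \<gamma> * (LINT x|lborel. (R g x)\<^sup>2)"
    using energy_test[OF b_pos g, of \<alpha>] by (simp add: w1_def[abs_def] w2_def b_def \<gamma>_def)
  finally show ?thesis .
qed

lemma energy_nonneg: "0 \<le> energy \<beta> \<alpha> w g h"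
  unfolding energy_def using \<alpha> \<beta>_pos
  by (auto intro!: add_nonneg_nonneg mult_nonneg_nonneg integral_nonneg_AE sum_nonneg AE_I2)

lemma test_inequality:
  assumes g: "test_function g"
  shows "integrable lborel (\<lambda>x. \<bar>R g x\<bar> powr p)"
    and "0 \<le> (LINT x|lborel. (g x)\<^sup>2) - \<gamma> * (LINT x|lborel. (R g x)\<^sup>2)"
    and "m * (LINT x|lborel. \<bar>R g x\<bar> powr p) powr (2 / p) \<le> (LINT x|lborel. (g x)\<^sup>2) - \<gamma> * (LINT x|lborel. (R g x)\<^sup>2)"
proof -
  have sg: "sq_integrable g" by (rule test_function_sq_integrable[OF g])
  obtain M where "\<And>x. \<bar>R g x\<bar> \<le> M" using R_test_bounded[OF g] by blast
  then show i: "integrable lborel (\<lambda>x. \<bar>R g x\<bar> powr p)"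
    using p_gt_2 by (intro powr_integrable_bounded sq_integrable_conv sg) auto
  let ?E = "(LINT x|lborel. (g x)\<^sup>2) - \<gamma> * (LINT x|lborel. (R g x)\<^sup>2)"
  show E: "0 \<le> ?E"
    using energy_test[OF b_pos g, of \<alpha>]
      energy_nonneg[of "R g" "\<lambda>i. R (pderiv_at i g)" "\<lambda>i. R (pderiv_at i (pderiv_at i g))"] by (simp add: b_def \<gamma>_def)
  define N where "N = (LINT x|lborel. \<bar>R g x\<bar> powr p)"
  have "0 \<le> N" unfolding N_def by simp
  have "m * N powr (2 / p) \<le> ?E"
  proof (cases "N = 0")
    case True
    then show ?thesis using E p_gt_2 by simp
  next
    case False
    then have N: "0 < N" using \<open>0 \<le> N\<close> by simp
    \<comment> \<open>Normalizes the constraint: the integral scales with \<open>c powr p\<close>,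
      the energy with the square of \<open>c\<close>.\<close>
    define c where "c = N powr (- 1 / p)"
    have c: "0 < c" using N by (simp add: c_def)
    have "c powr p = N powr (- 1)" using p_gt_2 by (simp add: c_def powr_powr)
    then have cp: "c powr p * N = 1" using N by (simp add: powr_minus)
    have Rc: "R (\<lambda>x. c * g x) = (\<lambda>x. c * R g x)" by (rule conv_cmult)
    have "(LINT x|lborel. \<bar>R (\<lambda>x. c * g x) x\<bar> powr p) = (LINT x|lborel. c powr p * \<bar>R g x\<bar> powr p)"
      unfolding Rc using c by (simp add: abs_mult powr_mult)
    also have "\<dots> = 1" using cp by (simp add: N_def)
    finally have "m \<le> (LINT x|lborel. (c * g x)\<^sup>2) - \<gamma> * (LINT x|lborel. (R (\<lambda>x. c * g x) x)\<^sup>2)"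
      by (rule R_test_Mbar[OF test_function_cmult[OF g]])
    also have "\<dots> = c\<^sup>2 * ?E" unfolding Rc by (simp add: power_mult_distrib algebra_simps)
    finally have "m * N powr (2 / p) \<le> c\<^sup>2 * ?E * N powr (2 / p)" by (simp add: mult_right_mono)
    also have "\<dots> = ?E * (c\<^sup>2 * N powr (2 / p))" by simp
    also have "c\<^sup>2 * N powr (2 / p) = 1"
    proof -
      have "c\<^sup>2 = N powr (- 2 / p)" using N by (simp add: c_def powr_powr flip: powr_numeral)
      then show ?thesis using N by (simp flip: powr_add)
    qed
    finally show ?thesis by simp
  qed
  then show "m * (LINT x|lborel. \<bar>R g x\<bar> powr p) powr (2 / p) \<le> ?E" by (simp add: N_def)
qed

end

lemma AE_lborel_ex:
  assumes "AE x in (lborel :: 'a::euclidean_space measure). P x" shows "\<exists>x. P x"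
proof (rule ccontr)
  assume "\<nexists>x. P x"
  then have "AE x in (lborel :: 'a measure). x \<notin> UNIV" using assms by auto
  then have "emeasure lborel (UNIV :: 'a set) = 0"
    by (subst (asm) AE_iff_measurable[where N = UNIV]) auto
  then show False by (simp add: emeasure_lborel_UNIV)
qed

lemma powr_young:
  fixes a s p :: real
  assumes p: "1 < p" and a: "0 \<le> a" and s: "0 \<le> s"
  shows "p * a powr (p - 1) * s \<le> (p - 1) * a powr p + s powr p"
proof -
  have "a powr (p - 1) * s \<le> (a powr (p - 1)) powr (p / (p - 1)) / (p / (p - 1)) + s powr p / p"
    by (rule Youngs_inequality) (use p s in \<open>auto simp: field_simps\<close>)
  moreover have "(a powr (p - 1)) powr (p / (p - 1)) = a powr p" using p by (simp add: powr_powr)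
  ultimately have "a powr (p - 1) * s \<le> ((p - 1) * a powr p + s powr p) / p"
    by (simp add: add_divide_distrib mult.commute)
  then show ?thesis using p by (simp add: pos_le_divide_eq mult_ac)
qed

text \<open>The tangent line of the convex power at \<open>a\<close>, derived from Young's
  inequality so that it also covers \<open>a = 0\<close> and negative \<open>a + c\<close>.\<close>

lemma powr_tangent:
  fixes a c p :: real
  assumes p: "1 < p" and a: "0 \<le> a"
  shows "a powr p + p * (a powr (p - 1) * c) \<le> \<bar>a + c\<bar> powr p"
proof -
  have "p * a powr (p - 1) * (a + c) \<le> p * a powr (p - 1) * \<bar>a + c\<bar>"
    using p by (intro mult_left_mono) auto
  also have "\<dots> \<le> (p - 1) * a powr p + \<bar>a + c\<bar> powr p" by (rule powr_young) (use p a in auto)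
  finally have "p * (a powr (p - 1) * a) + p * (a powr (p - 1) * c) \<le> (p - 1) * a powr p + \<bar>a + c\<bar> powr p"
    by (simp add: algebra_simps)
  moreover have "a powr (p - 1) * a = a powr p"
    using a by (cases "a = 0") (use p in \<open>auto simp: powr_mult_base mult.commute\<close>)
  ultimately have "p * a powr p + p * (a powr (p - 1) * c) \<le> (p - 1) * a powr p + \<bar>a + c\<bar> powr p" by simp
  moreover have "(p - 1) * a powr p = p * a powr p - a powr p" by (simp add: left_diff_distrib)
  ultimately show ?thesis by linarith
qed

context minimizer
begin

text \<open>The dual functional: \<open>E g\<close> is the functional of the theorem at
  \<open>R g\<close>, expressed without derivatives.\<close>

definition E where "E g = (LINT x|lborel. (g x)\<^sup>2) - \<gamma> * (LINT x|lborel. (R g x)\<^sup>2)"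

text \<open>The energies of approximating test functions converge because \<open>R\<close> is
  continuous on L^2. The constraint integral is only lower semicontinuous, by Fatou's lemma, which
  is the direction required and also yields its finiteness.\<close>

theorem inequality:
  assumes g: "sq_integrable g"
  shows "integrable lborel (\<lambda>x. \<bar>R g x\<bar> powr p)"
    and "m * (LINT x|lborel. \<bar>R g x\<bar> powr p) powr (2 / p) \<le> E g"
proof -
  obtain g' where g': "\<And>k::nat. test_function (g' k)" "(\<lambda>k. LINT x|lborel. (g' k x - g x)\<^sup>2) \<longlonglongrightarrow> 0"
    using test_functions_dense[OF g] by blast
  note sg' = g'(1)[THEN test_function_sq_integrable]
  note sR = sq_integrable_conv(1)[OF g] sq_integrable_conv(1)[OF sg']
  have Rl: "(\<lambda>k. LINT x|lborel. (R (g' k) x - R g x)\<^sup>2) \<longlonglongrightarrow> 0"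
    by (rule sq_tendsto_conv[OF g sg' g'(2)])
  \<comment> \<open>Fatou's lemma needs pointwise convergence, which L^2 convergence provides along
    a subsequence.\<close>
  obtain r :: "nat \<Rightarrow> nat" where r: "strict_mono r"
    and ae: "AE x in lborel. (\<lambda>k. (R (g' (r k)) x - R g x)\<^sup>2) \<longlonglongrightarrow> 0"
  proof -
    have "\<exists>r::nat\<Rightarrow>nat. strict_mono r \<and> (AE x in lborel. (\<lambda>k. (R (g' (r k)) x - R g x)\<^sup>2) \<longlonglongrightarrow> 0)"
      using Rl by (intro tendsto_L1_AE_subseq sq_integrable_square sq_integrable_diff sR) simp
    then show ?thesis using that by blast
  qed
  define e where "e k = E (g' (r k))" for k
  have e0: "0 \<le> e k" for k using test_inequality(2)[OF g'(1)[of "r k"]] by (simp add: e_def E_def)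
  have el: "e \<longlonglongrightarrow> E g"
  proof -
    have "(\<lambda>k. (LINT x|lborel. g' k x * g' k x) - \<gamma> * (LINT x|lborel. R (g' k) x * R (g' k) x)) \<longlonglongrightarrow>
        (LINT x|lborel. g x * g x) - \<gamma> * (LINT x|lborel. R g x * R g x)"
      by (intro tendsto_intros sq_tendsto_mult g sg' g' sR Rl)
    then have "(\<lambda>k. E (g' k)) \<longlonglongrightarrow> E g" by (simp add: E_def power2_eq_square)
    from LIMSEQ_subseq_LIMSEQ[OF this r] show ?thesis by (simp add: e_def[abs_def] o_def)
  qed
  define N where "N k = (LINT x|lborel. \<bar>R (g' (r k)) x\<bar> powr p)" for k
  have N0: "0 \<le> N k" for k unfolding N_def by simp
  have Nle: "N k \<le> (e k / m) powr (p / 2)" for k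
  proof -
    have "m * N k powr (2 / p) \<le> e k" using test_inequality(3)[OF g'(1)[of "r k"]] by (simp add: N_def e_def E_def)
    then have "N k powr (2 / p) \<le> e k / m" using m_pos by (simp add: pos_le_divide_eq mult.commute)
    then have "(N k powr (2 / p)) powr (p / 2) \<le> (e k / m) powr (p / 2)" using p_gt_2 by (intro powr_mono2) auto
    then show ?thesis using p_gt_2 N0[of k] by (simp add: powr_powr)
  qed
  have bl: "(\<lambda>k. (e k / m) powr (p / 2)) \<longlonglongrightarrow> (E g / m) powr (p / 2)"
  proof (rule tendsto_powr'[OF tendsto_divide[OF el tendsto_const] tendsto_const])
    have "\<forall>\<^sub>F k in sequentially. 0 \<le> e k / m" by (intro always_eventually allI divide_nonneg_pos e0 m_pos)
    then show "E g / m \<noteq> 0 \<or> (0 < p / 2 \<and> (\<forall>\<^sub>F k in sequentially. 0 \<le> e k / m))" using p_gt_2 by simp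
  qed (use m_pos in simp)
  have Eg0: "0 \<le> E g" by (rule LIMSEQ_le_const[OF el]) (use e0 in auto)
  have [measurable]: "R g \<in> borel_measurable borel" "R (g' k) \<in> borel_measurable borel" for k using sR by auto
  have "(\<integral>\<^sup>+x. ennreal (\<bar>R g x\<bar> powr p) \<partial>lborel) = (\<integral>\<^sup>+x. liminf (\<lambda>k. ennreal (\<bar>R (g' (r k)) x\<bar> powr p)) \<partial>lborel)"
  proof (rule nn_integral_cong_AE)
    show "AE x in lborel. ennreal (\<bar>R g x\<bar> powr p) = liminf (\<lambda>k. ennreal (\<bar>R (g' (r k)) x\<bar> powr p))"
      using ae
    proof eventually_elim
      case (elim x)
      have "(\<lambda>k. sqrt ((R (g' (r k)) x - R g x)\<^sup>2)) \<longlonglongrightarrow> sqrt 0" by (intro tendsto_intros elim)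
      then have "(\<lambda>k. \<bar>R (g' (r k)) x - R g x\<bar>) \<longlonglongrightarrow> 0" by simp
      then have "(\<lambda>k. R (g' (r k)) x - R g x) \<longlonglongrightarrow> 0"
        by (rule tendsto_rabs_zero_cancel)
      then have "(\<lambda>k. R (g' (r k)) x) \<longlonglongrightarrow> R g x" by (simp add: LIM_zero_iff)
      then have "(\<lambda>k. \<bar>R (g' (r k)) x\<bar> powr p) \<longlonglongrightarrow> \<bar>R g x\<bar> powr p"
        by (intro tendsto_powr'[OF tendsto_rabs tendsto_const]) (use p_gt_2 in auto)
      then have "(\<lambda>k. ennreal (\<bar>R (g' (r k)) x\<bar> powr p)) \<longlonglongrightarrow> ennreal (\<bar>R g x\<bar> powr p)"
        by (intro tendsto_ennrealI)
      then show ?case by (intro lim_imp_Liminf[symmetric]) auto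
    qed
  qed
  also have "\<dots> \<le> liminf (\<lambda>k. \<integral>\<^sup>+x. ennreal (\<bar>R (g' (r k)) x\<bar> powr p) \<partial>lborel)"
    by (rule nn_integral_liminf) measurable
  also have "(\<lambda>k. \<integral>\<^sup>+x. ennreal (\<bar>R (g' (r k)) x\<bar> powr p) \<partial>lborel) = (\<lambda>k. ennreal (N k))"
    using test_inequality(1)[OF g'(1)] by (simp add: N_def nn_integral_eq_integral)
  also have "liminf (\<lambda>k. ennreal (N k)) \<le> liminf (\<lambda>k. ennreal ((e k / m) powr (p / 2)))"
    by (rule Liminf_mono) (use Nle in \<open>auto intro!: always_eventually ennreal_leI\<close>)
  also have "\<dots> = ennreal ((E g / m) powr (p / 2))"
    by (rule lim_imp_Liminf) (auto intro!: tendsto_ennrealI bl)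
  finally have le: "(\<integral>\<^sup>+x. ennreal (\<bar>R g x\<bar> powr p) \<partial>lborel) \<le> ennreal ((E g / m) powr (p / 2))" .
  then show i: "integrable lborel (\<lambda>x. \<bar>R g x\<bar> powr p)"
    by (intro integrableI_bounded) (auto intro: le_less_trans)
  define M where "M = (LINT x|lborel. \<bar>R g x\<bar> powr p)"
  have "0 \<le> M" unfolding M_def by simp
  have "ennreal M \<le> ennreal ((E g / m) powr (p / 2))"
    using le i by (simp add: nn_integral_eq_integral M_def)
  then have "M \<le> (E g / m) powr (p / 2)" by simp
  then have "M powr (2 / p) \<le> ((E g / m) powr (p / 2)) powr (2 / p)" using \<open>0 \<le> M\<close> p_gt_2 by (intro powr_mono2) auto
  also have "\<dots> = E g / m" using p_gt_2 Eg0 m_pos by (simp add: powr_powr)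
  finally show "m * (LINT x|lborel. \<bar>R g x\<bar> powr p) powr (2 / p) \<le> E g"
    using m_pos by (simp add: M_def pos_le_divide_eq mult.commute)
qed

section \<open>From the complex minimizer to a nonnegative dual density\<close>

lemma representation:
  obtains f1 f2 where "sq_integrable f1" "sq_integrable f2"
    "AE x in lborel. u x = Complex (R f1 x) (R f2 x)"
    "(LINT x|lborel. (f1 x)\<^sup>2) + (LINT x|lborel. (f2 x)\<^sup>2) - \<gamma> * (LINT x|lborel. (norm (u x))\<^sup>2) \<le> m"
proof -
  have "sobolev_H 2 u" using u_Mbar by (simp add: Mbar_def)
  then have "\<forall>i. \<exists>g. is_weak_pderiv i u g \<and> square_integrable g \<and> (\<forall>j. \<exists>h. is_weak_pderiv j g h \<and> square_integrable h)"
    by (simp add: numeral_2_eq_2)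
  then have "\<forall>i. \<exists>g h. is_weak_pderiv i u g \<and> square_integrable g \<and> is_weak_pderiv i g h \<and> square_integrable h"
    by blast
  then obtain g h where gh: "\<And>i. is_weak_pderiv i u (g i)" "\<And>i. square_integrable (g i)"
    "\<And>i. is_weak_pderiv i (g i) (h i)" "\<And>i. square_integrable (h i)" by metis
  define f1 where "f1 x = b * Re (u x) - (\<Sum>i\<in>UNIV. Re (h i x))" for x
  define f2 where "f2 x = b * Im (u x) - (\<Sum>i\<in>UNIV. Im (h i x))" for x
  note parts = is_weak_pderiv_parts[OF gh(1) u_square gh(2)] is_weak_pderiv_parts[OF gh(3) gh(2) gh(4)]
  have s: "sq_integrable f1" "sq_integrable f2"
    unfolding f1_def f2_def
    by (intro sq_integrable_diff sq_integrable_cmult sq_integrable_sum square_integrable_parts u_square gh)+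
  have 1: "AE x in lborel. Re (u x) = R f1 x"
    unfolding f1_def by (rule resolvent_representation[OF b_pos parts(1) parts(3)])
  have 2: "AE x in lborel. Im (u x) = R f2 x"
    unfolding f2_def by (rule resolvent_representation[OF b_pos parts(2) parts(4)])
  have "AE x in lborel. u x = Complex (R f1 x) (R f2 x)"
    using 1 2 by eventually_elim (simp add: complex_eq_iff)
  moreover have "(LINT x|lborel. (f1 x)\<^sup>2) + (LINT x|lborel. (f2 x)\<^sup>2) - \<gamma> * (LINT x|lborel. (norm (u x))\<^sup>2) \<le> m"
    using energy_ge[OF b_pos parts(1) parts(3), of \<alpha>] energy_ge[OF b_pos parts(2) parts(4), of \<alpha>]
    unfolding m_def J1_parts[OF gh(1) gh(3) u_square gh(2) gh(4)] integral_norm_square_parts[OF u_square]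
    by (simp add: f1_def f2_def \<gamma>_def b_def algebra_simps)
  ultimately show ?thesis using that s by blast
qed

lemma positive_profile:
  obtains f \<tau> where "sq_integrable f" "\<And>x. 0 \<le> f x" "\<not> (AE x in lborel. f x = 0)"
    "AE x in lborel. u x = exp (\<i> * of_real \<tau>) * of_real (R f x)"
    "(LINT x|lborel. \<bar>R f x\<bar> powr p) = 1" "E f = m"
proof -
  obtain f1 f2 where f: "sq_integrable f1" "sq_integrable f2"
    and u: "AE x in lborel. u x = Complex (R f1 x) (R f2 x)"
    and le: "(LINT x|lborel. (f1 x)\<^sup>2) + (LINT x|lborel. (f2 x)\<^sup>2) - \<gamma> * (LINT x|lborel. (norm (u x))\<^sup>2) \<le> m"
    by (rule representation)
  have [measurable]: "f1 \<in> borel_measurable borel" "f2 \<in> borel_measurable borel" using f by auto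
  define F where "F x = sqrt ((f1 x)\<^sup>2 + (f2 x)\<^sup>2)" for x
  have F0: "0 \<le> F x" for x by (simp add: F_def)
  have F2: "(F x)\<^sup>2 = (f1 x)\<^sup>2 + (f2 x)\<^sup>2" for x by (simp add: F_def)
  have [measurable]: "F \<in> borel_measurable borel" unfolding F_def by measurable
  have F: "sq_integrable F"
    using f by (simp add: sq_integrable_def F2)
  \<comment> \<open>The component of the plane vector \<open>(f1 y, f2 y)\<close> in direction
    \<open>\<theta>\<close> is at most its length. All later comparisons use this with one fixed
    direction.\<close>
  have dir: "cos \<theta> * f1 y + sin \<theta> * f2 y \<le> F y" for \<theta> y
  proof -
    have "(C * s + S * t)\<^sup>2 + (S * s - C * t)\<^sup>2 = (S\<^sup>2 + C\<^sup>2) * (s\<^sup>2 + t\<^sup>2)" for C S s t :: real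
      by (simp add: power2_eq_square algebra_simps)
    from this[of "cos \<theta>" "f1 y" "sin \<theta>" "f2 y"]
    have "(cos \<theta> * f1 y + sin \<theta> * f2 y)\<^sup>2 + (sin \<theta> * f1 y - cos \<theta> * f2 y)\<^sup>2 = (f1 y)\<^sup>2 + (f2 y)\<^sup>2" by simp
    then have "(cos \<theta> * f1 y + sin \<theta> * f2 y)\<^sup>2 \<le> (f1 y)\<^sup>2 + (f2 y)\<^sup>2"
      using zero_le_power2[of "sin \<theta> * f1 y - cos \<theta> * f2 y"] by linarith
    then show ?thesis unfolding F_def by (rule real_le_rsqrt)
  qed
  have good: "AE x in lborel. integrable lborel (\<lambda>y. bessel b (x - y) * f1 y) \<and>
      integrable lborel (\<lambda>y. bessel b (x - y) * f2 y) \<and> integrable lborel (\<lambda>y. bessel b (x - y) * F y)"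
    using AE_conv_integrable[OF f(1)] AE_conv_integrable[OF f(2)] AE_conv_integrable[OF F] by eventually_elim auto
  have diff: "R F x - (cos \<theta> * R f1 x + sin \<theta> * R f2 x) = (LINT y|lborel. bessel b (x - y) * (F y - (cos \<theta> * f1 y + sin \<theta> * f2 y)))"
    and diff_i: "integrable lborel (\<lambda>y. bessel b (x - y) * (F y - (cos \<theta> * f1 y + sin \<theta> * f2 y)))"
    if "integrable lborel (\<lambda>y. bessel b (x - y) * f1 y) \<and>
      integrable lborel (\<lambda>y. bessel b (x - y) * f2 y) \<and> integrable lborel (\<lambda>y. bessel b (x - y) * F y)" for x \<theta>
  proof -
    have e: "(\<lambda>y. bessel b (x - y) * (F y - (cos \<theta> * f1 y + sin \<theta> * f2 y)))
       = (\<lambda>y. bessel b (x - y) * F y - (cos \<theta> * (bessel b (x - y) * f1 y) + sin \<theta> * (bessel b (x - y) * f2 y)))"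
      by (simp add: algebra_simps)
    show "R F x - (cos \<theta> * R f1 x + sin \<theta> * R f2 x) = (LINT y|lborel. bessel b (x - y) * (F y - (cos \<theta> * f1 y + sin \<theta> * f2 y)))"
      unfolding e using that by (simp add: conv_def)
    show "integrable lborel (\<lambda>y. bessel b (x - y) * (F y - (cos \<theta> * f1 y + sin \<theta> * f2 y)))"
      unfolding e using that by simp
  qed
  have polar: "\<exists>\<theta>. s = norm (Complex s t) * cos \<theta> \<and> t = norm (Complex s t) * sin \<theta>" for s t
  proof -
    have "Complex s t = rcis (norm (Complex s t)) (Arg (Complex s t))" by (simp add: rcis_cmod_Arg)
    then show ?thesis by (metis Re_rcis Im_rcis complex.sel)
  qed
  have polar': "cos \<theta> * s + sin \<theta> * t = norm (Complex s t)"
    if "s = norm (Complex s t) * cos \<theta>" "t = norm (Complex s t) * sin \<theta>" for s t \<theta>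
  proof -
    define n where "n = norm (Complex s t)"
    have "cos \<theta> * s + sin \<theta> * t = cos \<theta> * (n * cos \<theta>) + sin \<theta> * (n * sin \<theta>)"
      using that unfolding n_def by metis
    also have "\<dots> = n * ((sin \<theta>)\<^sup>2 + (cos \<theta>)\<^sup>2)" by (simp only: power2_eq_square distrib_left mult_ac add.commute)
    also have "\<dots> = n" by simp
    finally show ?thesis by (simp add: n_def)
  qed
  have uF: "AE x in lborel. norm (u x) \<le> R F x"
    using good u
  proof eventually_elim
    case (elim x)
    obtain \<theta> where \<theta>: "R f1 x = norm (Complex (R f1 x) (R f2 x)) * cos \<theta>" "R f2 x = norm (Complex (R f1 x) (R f2 x)) * sin \<theta>"
      using polar by blast
    have "0 \<le> R F x - (cos \<theta> * R f1 x + sin \<theta> * R f2 x)"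
      unfolding diff[OF elim(1)] using dir bessel_nonneg by (intro integral_nonneg_AE AE_I2 mult_nonneg_nonneg) auto
    then show ?case using polar'[OF \<theta>] elim(2) by simp
  qed
  note ineq = inequality[OF F]
  have sRF: "sq_integrable (R F)" by (rule sq_integrable_conv(1)[OF F])
  have [measurable]: "u \<in> borel_measurable borel" using u_square by (simp add: square_integrable_def)
  have iu: "integrable lborel (\<lambda>x. (norm (u x))\<^sup>2)" using u_square by (simp add: square_integrable_def)
  have N: "1 \<le> (LINT x|lborel. \<bar>R F x\<bar> powr p)"
  proof -
    have "(LINT x|lborel. norm (u x) powr p) \<le> (LINT x|lborel. \<bar>R F x\<bar> powr p)"
    proof (rule integral_mono_AE)
      show "integrable lborel (\<lambda>x. norm (u x) powr p)" using u_integral by (simp add: has_bochner_integral_iff)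
      show "AE x in lborel. norm (u x) powr p \<le> \<bar>R F x\<bar> powr p"
        using uF by eventually_elim (use p_gt_2 in \<open>auto intro!: powr_mono2\<close>)
    qed (rule ineq)
    then show ?thesis using u_integral by (simp add: has_bochner_integral_iff)
  qed
  \<comment> \<open>As \<open>R F\<close> dominates the modulus of \<open>u\<close>, its constraint
    integral is at least 1, so its energy is at least \<open>m\<close>.\<close>
  have "m * 1 \<le> m * (LINT x|lborel. \<bar>R F x\<bar> powr p) powr (2 / p)"
    using N m_pos p_gt_2 by (intro mult_left_mono ge_one_powr_ge_zero) auto
  then have mE: "m \<le> E F" using ineq(2) by simp
  have EF: "E F = (LINT x|lborel. (f1 x)\<^sup>2) + (LINT x|lborel. (f2 x)\<^sup>2) - \<gamma> * (LINT x|lborel. (R F x)\<^sup>2)"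
    unfolding E_def F2 using f by (simp add: sq_integrable_square)
  \<comment> \<open>The upper bound from \<open>representation\<close> and \<open>E F\<close> differ
    only in the last term. Since \<open>\<gamma> > 0\<close>, the square norm of \<open>R F\<close>
    does not exceed that of \<open>u\<close>, although \<open>R F\<close> dominates pointwise; hence
    both agree almost everywhere.\<close>
  have "\<gamma> * (LINT x|lborel. (R F x)\<^sup>2) \<le> \<gamma> * (LINT x|lborel. (norm (u x))\<^sup>2)" using mE EF le by simp
  then have le2: "(LINT x|lborel. (R F x)\<^sup>2) \<le> (LINT x|lborel. (norm (u x))\<^sup>2)" using \<gamma>_pos by simp
  have sq: "AE x in lborel. 0 \<le> (R F x)\<^sup>2 - (norm (u x))\<^sup>2"
    using uF by eventually_elim (simp add: power_mono)
  have "(LINT x|lborel. (R F x)\<^sup>2 - (norm (u x))\<^sup>2) = 0"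
  proof (rule antisym)
    show "(LINT x|lborel. (R F x)\<^sup>2 - (norm (u x))\<^sup>2) \<le> 0"
      using le2 iu sq_integrable_square[OF sRF] by simp
    show "0 \<le> (LINT x|lborel. (R F x)\<^sup>2 - (norm (u x))\<^sup>2)" by (rule integral_nonneg_AE[OF sq])
  qed
  then have "AE x in lborel. (R F x)\<^sup>2 - (norm (u x))\<^sup>2 = 0"
    using iu sq_integrable_square[OF sRF] by (subst (asm) integral_nonneg_eq_0_iff_AE[OF _ sq]) auto
  with uF have eq: "AE x in lborel. norm (u x) = R F x"
  proof eventually_elim
    case (elim x)
    have "norm (u x) \<ge> 0" by simp
    then have "0 \<le> R F x" using elim by linarith
    moreover have "(norm (u x))\<^sup>2 = (R F x)\<^sup>2" using elim(2) by simp
    ultimately show ?case by (simp add: power2_eq_iff_nonneg)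
  qed
  have "(LINT x|lborel. \<bar>R F x\<bar> powr p) = (LINT x|lborel. norm (u x) powr p)"
  proof (intro integral_cong_AE)
    show "AE x in lborel. \<bar>R F x\<bar> powr p = norm (u x) powr p"
      using eq by eventually_elim (metis abs_norm_cancel)
  qed auto
  then have N1: "(LINT x|lborel. \<bar>R F x\<bar> powr p) = 1" using u_integral by (simp add: has_bochner_integral_iff)
  have "(LINT x|lborel. (R F x)\<^sup>2) = (LINT x|lborel. (norm (u x))\<^sup>2)"
    using eq by (intro integral_cong_AE) (auto elim!: eventually_mono)
  then have EFm: "E F = m" using mE EF le by simp
  \<comment> \<open>One point where all convolutions exist and the modulus identity holds is enough:
    its phase \<open>\<theta>\<close> turns the comparison into equality there, and the positive
    kernel transports this phase to almost every \<open>y\<close>.\<close>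
  have "AE x in lborel. (integrable lborel (\<lambda>y. bessel b (x - y) * f1 y) \<and>
      integrable lborel (\<lambda>y. bessel b (x - y) * f2 y) \<and> integrable lborel (\<lambda>y. bessel b (x - y) * F y)) \<and>
      norm (Complex (R f1 x) (R f2 x)) = R F x"
    using good u eq by eventually_elim auto
  from AE_lborel_ex[OF this] obtain x where x: "integrable lborel (\<lambda>y. bessel b (x - y) * f1 y) \<and>
      integrable lborel (\<lambda>y. bessel b (x - y) * f2 y) \<and> integrable lborel (\<lambda>y. bessel b (x - y) * F y)"
      "norm (Complex (R f1 x) (R f2 x)) = R F x" by blast
  obtain \<theta> where \<theta>: "R f1 x = norm (Complex (R f1 x) (R f2 x)) * cos \<theta>" "R f2 x = norm (Complex (R f1 x) (R f2 x)) * sin \<theta>"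
    using polar by blast
  have "(LINT y|lborel. bessel b (x - y) * (F y - (cos \<theta> * f1 y + sin \<theta> * f2 y))) = 0"
    using diff[OF x(1), of \<theta>] polar'[OF \<theta>] x(2) by simp
  then have "AE y in lborel. bessel b (x - y) * (F y - (cos \<theta> * f1 y + sin \<theta> * f2 y)) = 0"
    using diff_i[OF x(1), of \<theta>] dir bessel_nonneg
    by (subst (asm) integral_nonneg_eq_0_iff_AE) (auto intro!: AE_I2 mult_nonneg_nonneg)
  then have al: "AE y in lborel. f1 y = cos \<theta> * F y \<and> f2 y = sin \<theta> * F y"
    using AE_lborel_singleton[of x]
  proof eventually_elim
    case (elim y)
    have "0 < bessel b (x - y)" using elim(2) by (intro bessel_pos[OF b_pos]) simp
    then have Fy: "F y = cos \<theta> * f1 y + sin \<theta> * f2 y" using elim(1) by simp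
    \<comment> \<open>A plane vector whose component in direction \<open>\<theta>\<close> equals its
      length is parallel to that direction; the identity shows that the difference has zero square
      length.\<close>
    have "(a1 - C * n)\<^sup>2 + (a2 - S * n)\<^sup>2 = (a1\<^sup>2 + a2\<^sup>2) - 2 * n * (C * a1 + S * a2) + (S\<^sup>2 + C\<^sup>2) * n\<^sup>2" for a1 a2 C S n :: real
      by (simp add: power2_eq_square algebra_simps)
    from this[of "f1 y" "cos \<theta>" "F y" "f2 y" "sin \<theta>"]
    have "(f1 y - cos \<theta> * F y)\<^sup>2 + (f2 y - sin \<theta> * F y)\<^sup>2 = (F y)\<^sup>2 - 2 * F y * F y + (F y)\<^sup>2"
      by (simp add: F2[symmetric] Fy[symmetric])
    also have "\<dots> = 0" by (simp add: power2_eq_square)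
    finally show ?case using sum_power2_eq_zero_iff[of "f1 y - cos \<theta> * F y" "f2 y - sin \<theta> * F y"] by auto
  qed
  have "R f1 = R (\<lambda>y. cos \<theta> * F y)" by (rule conv_cong_AE) (use al in \<open>auto elim!: eventually_mono\<close>)
  then have r1: "R f1 = (\<lambda>x. cos \<theta> * R F x)" by (simp add: conv_cmult)
  have "R f2 = R (\<lambda>y. sin \<theta> * F y)" by (rule conv_cong_AE) (use al in \<open>auto elim!: eventually_mono\<close>)
  then have r2: "R f2 = (\<lambda>x. sin \<theta> * R F x)" by (simp add: conv_cmult)
  have "AE x in lborel. u x = exp (\<i> * of_real \<theta>) * of_real (R F x)"
    using u by eventually_elim (simp add: r1 r2 complex_eq_iff Re_exp Im_exp)
  moreover have "\<not> (AE x in lborel. F x = 0)"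
  proof
    assume "AE x in lborel. F x = 0"
    then have "R F = R (\<lambda>x. 0)" by (intro conv_cong_AE) auto
    then have "R F = (\<lambda>x. 0)" by (simp add: conv_def fun_eq_iff)
    then show False using N1 by simp
  qed
  ultimately show ?thesis using that F F0 N1 EFm by blast
qed

text \<open>Differentiating the constraint integral is avoided: the tangent inequality bounds it
  from below by an affine function of \<open>s\<close>, and only this explicit bound is
  differentiated.\<close>

lemma Euler_Lagrange_weak:
  assumes f: "sq_integrable f" "\<And>x. 0 \<le> f x" and N: "(LINT x|lborel. \<bar>R f x\<bar> powr p) = 1" and Ef: "E f = m"
    and \<psi>: "sq_integrable \<psi>"
  shows "integrable lborel (\<lambda>x. R f x powr (p - 1) * R \<psi> x)"
    and "(LINT x|lborel. f x * \<psi> x) = (LINT x|lborel. (\<gamma> * R f x + m * R f x powr (p - 1)) * R \<psi> x)"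
proof -
  define U where "U = R f"
  define \<eta> where "\<eta> = R \<psi>"
  have U0: "0 \<le> U x" for x
    unfolding U_def conv_def using bessel_nonneg f by (intro integral_nonneg_AE AE_I2 mult_nonneg_nonneg) auto
  have sU: "sq_integrable U" "sq_integrable \<eta>" unfolding U_def \<eta>_def by (intro sq_integrable_conv f \<psi>)+
  have [measurable]: "U \<in> borel_measurable borel" "\<eta> \<in> borel_measurable borel" using sU by auto
  have iU: "integrable lborel (\<lambda>x. U x powr p)" and NU: "(LINT x|lborel. U x powr p) = 1"
    using inequality(1)[OF f(1)] N U0 by (simp_all add: abs_of_nonneg flip: U_def)
  have i\<eta>: "integrable lborel (\<lambda>x. \<bar>\<eta> x\<bar> powr p)" using inequality(1)[OF \<psi>] by (simp add: \<eta>_def)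
  have p1: "1 < p" using p_gt_2 by simp
  show ic: "integrable lborel (\<lambda>x. R f x powr (p - 1) * R \<psi> x)"
    unfolding U_def[symmetric] \<eta>_def[symmetric]
  proof (rule Bochner_Integration.integrable_bound)
    show "integrable lborel (\<lambda>x. (p - 1) * U x powr p + \<bar>\<eta> x\<bar> powr p)" using iU i\<eta> by simp
    show "AE x in lborel. norm (U x powr (p - 1) * \<eta> x) \<le> norm ((p - 1) * U x powr p + \<bar>\<eta> x\<bar> powr p)"
    proof (intro AE_I2)
      fix x
      have "1 * (U x powr (p - 1) * \<bar>\<eta> x\<bar>) \<le> p * (U x powr (p - 1) * \<bar>\<eta> x\<bar>)" using p1 by (intro mult_right_mono) auto
      also have "\<dots> \<le> (p - 1) * U x powr p + \<bar>\<eta> x\<bar> powr p"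
        using powr_young[OF p1 U0[of x], of "\<bar>\<eta> x\<bar>"] by (simp add: mult.assoc)
      finally show "norm (U x powr (p - 1) * \<eta> x) \<le> norm ((p - 1) * U x powr p + \<bar>\<eta> x\<bar> powr p)"
        using p1 by (simp add: abs_mult)
    qed
  qed measurable
  define c where "c = (LINT x|lborel. U x powr (p - 1) * \<eta> x)"
  define A where "A = (LINT x|lborel. f x * \<psi> x) - \<gamma> * (LINT x|lborel. U x * \<eta> x)"
  \<comment> \<open>Energy of the perturbation minus \<open>m\<close> times the lower bound for its
    constraint term. It is nonnegative near 0 by \<open>inequality\<close> and vanishes at
    0.\<close>
  define \<phi> where "\<phi> s = m + 2 * s * A + s\<^sup>2 * E \<psi> - m * (1 + p * s * c) powr (2 / p)" for s
  have pos: "0 \<le> \<phi> s" if s: "0 < 1 + p * s * c" for s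
  proof -
    have sg: "sq_integrable (\<lambda>x. f x + s * \<psi> x)" by (intro sq_integrable_add sq_integrable_cmult f \<psi>)
    have Rg: "AE x in lborel. R (\<lambda>x. f x + s * \<psi> x) x = U x + s * \<eta> x"
      using AE_conv_add[OF f(1) sq_integrable_cmult[OF \<psi>, of s]] by (simp add: conv_cmult U_def \<eta>_def)
    have [measurable]: "R (\<lambda>x. f x + s * \<psi> x) \<in> borel_measurable borel" using sg by auto
    note iq = inequality[OF sg]
    have E: "E (\<lambda>x. f x + s * \<psi> x) = m + 2 * s * A + s\<^sup>2 * E \<psi>"
    proof -
      have ex: "(LINT x|lborel. (v x + s * w x)\<^sup>2) = (LINT x|lborel. (v x)\<^sup>2) + 2 * s * (LINT x|lborel. v x * w x) + s\<^sup>2 * (LINT x|lborel. (w x)\<^sup>2)"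
        if "sq_integrable v" "sq_integrable w" for v w :: "real ^ 'n \<Rightarrow> real"
      proof -
        have "(\<lambda>x. (v x + s * w x)\<^sup>2) = (\<lambda>x. (v x)\<^sup>2 + 2 * s * (v x * w x) + s\<^sup>2 * (w x)\<^sup>2)"
          by (simp add: power2_sum power_mult_distrib algebra_simps)
        then show ?thesis using sq_integrable_square[OF that(1)] sq_integrable_square[OF that(2)] sq_integrable_mult[OF that] by simp
      qed
      have "(LINT x|lborel. (R (\<lambda>x. f x + s * \<psi> x) x)\<^sup>2) = (LINT x|lborel. (U x + s * \<eta> x)\<^sup>2)"
        by (rule integral_cong_AE) (use Rg in \<open>auto elim!: eventually_mono\<close>)
      then show ?thesis
        using Ef unfolding E_def by (simp add: ex[OF f(1) \<psi>] ex[OF sU] A_def algebra_simps flip: U_def \<eta>_def)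
    qed
    have "1 + p * s * c = (LINT x|lborel. U x powr p + p * s * (U x powr (p - 1) * \<eta> x))"
      using iU ic by (simp add: NU c_def flip: U_def \<eta>_def)
    also have "\<dots> \<le> (LINT x|lborel. \<bar>R (\<lambda>x. f x + s * \<psi> x) x\<bar> powr p)"
    proof (rule integral_mono_AE)
      show "integrable lborel (\<lambda>x. U x powr p + p * s * (U x powr (p - 1) * \<eta> x))"
        using iU ic by (simp flip: U_def \<eta>_def)
      show "AE x in lborel. U x powr p + p * s * (U x powr (p - 1) * \<eta> x) \<le> \<bar>R (\<lambda>x. f x + s * \<psi> x) x\<bar> powr p"
        using Rg
      proof eventually_elim
        case (elim x)
        show ?case unfolding elim using powr_tangent[OF p1 U0[of x], of "s * \<eta> x"] by (simp add: mult_ac)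
      qed
    qed (rule iq)
    finally have "(1 + p * s * c) powr (2 / p) \<le> (LINT x|lborel. \<bar>R (\<lambda>x. f x + s * \<psi> x) x\<bar> powr p) powr (2 / p)"
      using s p1 by (intro powr_mono2) auto
    then have "m * (1 + p * s * c) powr (2 / p) \<le> m + 2 * s * A + s\<^sup>2 * E \<psi>"
      using iq(2) m_pos unfolding E by (meson mult_left_mono less_imp_le order_trans)
    then show ?thesis by (simp add: \<phi>_def)
  qed
  \<comment> \<open>The exponent \<open>2 / p\<close> cancels the factor \<open>p\<close> of the
    tangent line, so the derivative is \<open>2 * A - 2 * m * c\<close>, which must be 0 at an
    interior minimum.\<close>
  have d: "(\<phi> has_real_derivative 2 * A - 2 * m * c) (at 0)"
    unfolding \<phi>_def using p1 by (auto intro!: derivative_eq_intros)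
  have ev: "\<exists>\<delta>>0. \<forall>s. \<bar>0 - s\<bar> < \<delta> \<longrightarrow> \<phi> 0 \<le> \<phi> s"
  proof -
    have "((\<lambda>s. 1 + p * s * c) \<longlongrightarrow> 1 + p * 0 * c) (at 0)" by (intro tendsto_intros)
    then have "eventually (\<lambda>s. 0 < 1 + p * s * c) (at 0)" by (intro order_tendstoD(1)) auto
    then obtain \<delta> where \<delta>: "0 < \<delta>" "\<And>s. s \<noteq> 0 \<Longrightarrow> dist s 0 < \<delta> \<Longrightarrow> 0 < 1 + p * s * c"
      unfolding eventually_at by auto
    have "\<phi> 0 \<le> \<phi> s" if "\<bar>0 - s\<bar> < \<delta>" for s
      using pos[of s] \<delta>(2)[of s] that by (cases "s = 0") (auto simp: \<phi>_def dist_real_def)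
    then show ?thesis using \<delta>(1) by blast
  qed
  then obtain \<delta> where \<delta>: "0 < \<delta>" "\<forall>s. \<bar>0 - s\<bar> < \<delta> \<longrightarrow> \<phi> 0 \<le> \<phi> s" by blast
  have "2 * A - 2 * m * c = 0" by (rule DERIV_local_min[OF d \<delta>])
  then have "A = m * c" by simp
  then have "(LINT x|lborel. f x * \<psi> x) = \<gamma> * (LINT x|lborel. U x * \<eta> x) + m * c" by (simp add: A_def)
  also have "\<dots> = (LINT x|lborel. \<gamma> * (U x * \<eta> x) + m * (U x powr (p - 1) * \<eta> x))"
    using sq_integrable_mult[OF sU] ic by (simp add: c_def flip: U_def \<eta>_def)
  also have "\<dots> = (LINT x|lborel. (\<gamma> * U x + m * U x powr (p - 1)) * \<eta> x)"
    by (simp add: algebra_simps)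
  finally show "(LINT x|lborel. f x * \<psi> x) = (LINT x|lborel. (\<gamma> * R f x + m * R f x powr (p - 1)) * R \<psi> x)"
    by (simp add: U_def \<eta>_def)
qed

end

section \<open>The Euler--Lagrange equation and boundedness\<close>

text \<open>Before boundedness is known, \<open>h (U y)\<close> need not be square integrable, and
  the Bochner integral in \<open>conv\<close> could return its default value. The extended
  nonnegative version is meaningful everywhere and obeys Tonelli's theorem.\<close>

definition nn_conv :: "('a::euclidean_space \<Rightarrow> real) \<Rightarrow> ('a \<Rightarrow> ennreal) \<Rightarrow> 'a \<Rightarrow> ennreal" where
  "nn_conv k g x = (\<integral>\<^sup>+y. ennreal (k (x - y)) * g y \<partial>lborel)"

context even_kernel
begin

lemma nn_conv_meas [measurable]:
  assumes [measurable]: "g \<in> borel_measurable borel"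
  shows "nn_conv k g \<in> borel_measurable borel"
  unfolding nn_conv_def by measurable

lemma nn_conv_mono: "(\<And>y. g y \<le> h y) \<Longrightarrow> nn_conv k g x \<le> nn_conv k h x"
  unfolding nn_conv_def by (intro nn_integral_mono mult_left_mono) auto

lemma nn_conv_add:
  assumes [measurable]: "g \<in> borel_measurable borel" "h \<in> borel_measurable borel"
  shows "nn_conv k (\<lambda>y. g y + h y) x = nn_conv k g x + nn_conv k h x"
  unfolding nn_conv_def distrib_left by (rule nn_integral_add) auto

lemma nn_conv_cmult:
  assumes [measurable]: "g \<in> borel_measurable borel"
  shows "nn_conv k (\<lambda>y. c * g y) x = c * nn_conv k g x"
  unfolding nn_conv_def mult.left_commute[of _ c] by (rule nn_integral_cmult) auto

lemma nn_conv_const: "nn_conv k (\<lambda>y. c) x = c * ennreal (integral\<^sup>L lborel k)"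
proof -
  have "nn_conv k (\<lambda>y. c) x = (\<integral>\<^sup>+y. ennreal (k (x - y)) \<partial>lborel) * c"
    unfolding nn_conv_def by (rule nn_integral_multc) auto
  also have "(\<integral>\<^sup>+y. ennreal (k (x - y)) \<partial>lborel) = (\<integral>\<^sup>+y. ennreal (k y) \<partial>lborel)"
    by (rule nn_integral_lborel_minus) auto
  also have "\<dots> = ennreal (integral\<^sup>L lborel k)"
    using k_int k_nonneg by (intro nn_integral_eq_integral) auto
  finally show ?thesis by (simp add: mult.commute)
qed

lemma nn_conv_sym:
  assumes [measurable]: "g \<in> borel_measurable borel" "h \<in> borel_measurable borel"
  shows "(\<integral>\<^sup>+x. h x * nn_conv k g x \<partial>lborel) = (\<integral>\<^sup>+x. nn_conv k h x * g x \<partial>lborel)"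
proof -
  have "(\<integral>\<^sup>+x. h x * nn_conv k g x \<partial>lborel) = (\<integral>\<^sup>+x. \<integral>\<^sup>+y. h x * (ennreal (k (x - y)) * g y) \<partial>lborel \<partial>lborel)"
    unfolding nn_conv_def by (subst nn_integral_cmult) auto
  also have "\<dots> = (\<integral>\<^sup>+y. \<integral>\<^sup>+x. h x * (ennreal (k (x - y)) * g y) \<partial>lborel \<partial>lborel)"
    by (rule lborel_pair.Fubini'[symmetric]) measurable
  also have "\<dots> = (\<integral>\<^sup>+y. nn_conv k h y * g y \<partial>lborel)"
  proof (rule nn_integral_cong)
    fix y
    have "(\<integral>\<^sup>+x. h x * (ennreal (k (x - y)) * g y) \<partial>lborel) = (\<integral>\<^sup>+x. (ennreal (k (y - x)) * h x) * g y \<partial>lborel)"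
      by (intro nn_integral_cong) (simp add: k_commute[of y] mult_ac)
    also have "\<dots> = nn_conv k h y * g y" unfolding nn_conv_def by (rule nn_integral_multc) auto
    finally show "(\<integral>\<^sup>+x. h x * (ennreal (k (x - y)) * g y) \<partial>lborel) = nn_conv k h y * g y" .
  qed
  finally show ?thesis .
qed

lemma nn_conv_cong_AE:
  assumes "AE x in lborel. g x = h x"
  shows "nn_conv k g = nn_conv k h"
proof
  fix x
  show "nn_conv k g x = nn_conv k h x"
    unfolding nn_conv_def by (rule nn_integral_cong_AE) (use assms in \<open>auto elim!: eventually_mono\<close>)
qed

lemma ennreal_conv:
  assumes i: "integrable lborel (\<lambda>y. k (x - y) * g y)" and nn: "\<And>y. 0 \<le> g y"
  shows "ennreal (conv k g x) = nn_conv k (\<lambda>y. ennreal (g y)) x"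
proof -
  have "(\<integral>\<^sup>+y. ennreal (k (x - y) * g y) \<partial>lborel) = ennreal (conv k g x)"
    unfolding conv_def by (rule nn_integral_eq_integral[OF i]) (auto simp: k_nonneg nn)
  then show ?thesis by (simp add: nn_conv_def ennreal_mult k_nonneg nn)
qed

end

section \<open>Smoothing by two applications of the Bessel kernel\<close>

lemma nn_conv_bessel:
  fixes g :: "'a::euclidean_space \<Rightarrow> ennreal"
  assumes b: "0 < b" and [measurable]: "g \<in> borel_measurable borel"
  shows "nn_conv (bessel b) g x = (\<integral>\<^sup>+t. \<integral>\<^sup>+y. ennreal (res_heat b t (x - y)) * g y \<partial>lborel \<partial>lborel)"
proof -
  have "nn_conv (bessel b) g x = (\<integral>\<^sup>+y. \<integral>\<^sup>+t. ennreal (res_heat b t (x - y)) * g y \<partial>lborel \<partial>lborel)"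
    unfolding nn_conv_def
  proof (rule nn_integral_cong_AE)
    show "AE y in lborel. ennreal (bessel b (x - y)) * g y = (\<integral>\<^sup>+t. ennreal (res_heat b t (x - y)) * g y \<partial>lborel)"
      using AE_lborel_singleton[of x]
      by eventually_elim (simp add: ennreal_bessel[OF b] nn_integral_multc)
  qed
  also have "\<dots> = (\<integral>\<^sup>+t. \<integral>\<^sup>+y. ennreal (res_heat b t (x - y)) * g y \<partial>lborel \<partial>lborel)"
    by (rule lborel_pair.Fubini') measurable
  finally show ?thesis .
qed

lemma res_heat_semigroup:
  fixes x y :: "'a::euclidean_space"
  shows "(\<integral>\<^sup>+w. ennreal (res_heat b s (x - w)) * ennreal (res_heat b t (w - y)) \<partial>lborel)
    = ennreal (indicator {0<..} s * indicator {0<..} t * (exp (- (b * (s + t))) * heat (s + t) (x - y)))"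
proof (cases "0 < s \<and> 0 < t")
  case True
  then have s: "0 < s" and t: "0 < t" by auto
  have "(\<integral>\<^sup>+w. ennreal (res_heat b s (x - w)) * ennreal (res_heat b t (w - y)) \<partial>lborel)
    = (\<integral>\<^sup>+w. ennreal (exp (- (b * s)) * exp (- (b * t))) * (ennreal (heat s ((x - y) - (w - y))) * ennreal (heat t (w - y))) \<partial>lborel)"
    using s t by (intro nn_integral_cong) (simp add: res_heat_def heat_nonneg mult_ac flip: ennreal_mult)
  also have "\<dots> = ennreal (exp (- (b * s)) * exp (- (b * t))) * (\<integral>\<^sup>+w. ennreal (heat s ((x - y) - (w - y))) * ennreal (heat t (w - y)) \<partial>lborel)"
    by (rule nn_integral_cmult) measurable
  also have "(\<integral>\<^sup>+w. ennreal (heat s ((x - y) - (w - y))) * ennreal (heat t (w - y)) \<partial>lborel) = (\<integral>\<^sup>+v. ennreal (heat s ((x - y) - v)) * ennreal (heat t v) \<partial>lborel)"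
    using nn_integral_lborel_plus[of "\<lambda>v. ennreal (heat s ((x - y) - v)) * ennreal (heat t v)" "- y"] by (simp add: algebra_simps)
  also have "\<dots> = ennreal (heat (s + t) (x - y))" by (rule heat_semigroup[OF s t])
  finally show ?thesis
    using s t by (simp add: heat_nonneg exp_add[symmetric] algebra_simps flip: ennreal_mult)
qed (auto simp: res_heat_def)

text \<open>The semigroup law merges the two heat kernels into one at time \<open>s + t\<close>. A
  singularity \<open>(s + t) powr (- D)\<close> is integrable near zero in the two times when
  \<open>D < 2\<close>, whereas a single kernel would demand \<open>D < 1\<close>.\<close>

lemma nn_conv_bessel_twice:
  fixes g :: "'a::euclidean_space \<Rightarrow> ennreal"
  assumes b: "0 < b" and [measurable]: "g \<in> borel_measurable borel"
  shows "nn_conv (bessel b) (nn_conv (bessel b) g) x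
    = (\<integral>\<^sup>+s. \<integral>\<^sup>+t. ennreal (indicator {0<..} s * indicator {0<..} t * exp (- (b * (s + t)))) *
        (\<integral>\<^sup>+y. ennreal (heat (s + t) (x - y)) * g y \<partial>lborel) \<partial>lborel \<partial>lborel)"
proof -
  interpret even_kernel "bessel b :: 'a \<Rightarrow> real" by (rule even_kernel_bessel[OF b])
  have "nn_conv (bessel b) (nn_conv (bessel b) g) x
     = (\<integral>\<^sup>+s. \<integral>\<^sup>+w. ennreal (res_heat b s (x - w)) * nn_conv (bessel b) g w \<partial>lborel \<partial>lborel)"
    by (rule nn_conv_bessel[OF b]) measurable
  also have "\<dots> = (\<integral>\<^sup>+s. \<integral>\<^sup>+w. \<integral>\<^sup>+t. \<integral>\<^sup>+y. ennreal (res_heat b s (x - w)) * (ennreal (res_heat b t (w - y)) * g y) \<partial>lborel \<partial>lborel \<partial>lborel \<partial>lborel)"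
    unfolding nn_conv_bessel[OF b assms(2)] by (simp add: nn_integral_cmult)
  also have "\<dots> = (\<integral>\<^sup>+s. \<integral>\<^sup>+t. \<integral>\<^sup>+w. \<integral>\<^sup>+y. ennreal (res_heat b s (x - w)) * (ennreal (res_heat b t (w - y)) * g y) \<partial>lborel \<partial>lborel \<partial>lborel \<partial>lborel)"
    by (intro nn_integral_cong lborel_pair.Fubini') measurable
  also have "\<dots> = (\<integral>\<^sup>+s. \<integral>\<^sup>+t. \<integral>\<^sup>+y. \<integral>\<^sup>+w. ennreal (res_heat b s (x - w)) * (ennreal (res_heat b t (w - y)) * g y) \<partial>lborel \<partial>lborel \<partial>lborel \<partial>lborel)"
    by (intro nn_integral_cong lborel_pair.Fubini') measurable
  also have "\<dots> = (\<integral>\<^sup>+s. \<integral>\<^sup>+t. \<integral>\<^sup>+y. ennreal (indicator {0<..} s * indicator {0<..} t * exp (- (b * (s + t)))) * (ennreal (heat (s + t) (x - y)) * g y) \<partial>lborel \<partial>lborel \<partial>lborel)"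
  proof (intro nn_integral_cong)
    fix s t :: real and y :: 'a
    have "(\<integral>\<^sup>+w. ennreal (res_heat b s (x - w)) * (ennreal (res_heat b t (w - y)) * g y) \<partial>lborel)
       = (\<integral>\<^sup>+w. ennreal (res_heat b s (x - w)) * ennreal (res_heat b t (w - y)) \<partial>lborel) * g y"
      by (subst nn_integral_multc[symmetric]) (auto simp: mult_ac)
    also have "\<dots> = ennreal (indicator {0<..} s * indicator {0<..} t * exp (- (b * (s + t)))) * (ennreal (heat (s + t) (x - y)) * g y)"
      unfolding res_heat_semigroup
      by (cases "0 < s \<and> 0 < t") (auto simp: ennreal_mult heat_nonneg mult_ac)
    finally show "(\<integral>\<^sup>+w. ennreal (res_heat b s (x - w)) * (ennreal (res_heat b t (w - y)) * g y) \<partial>lborel) = \<dots>" .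
  qed
  also have "\<dots> = (\<integral>\<^sup>+s. \<integral>\<^sup>+t. ennreal (indicator {0<..} s * indicator {0<..} t * exp (- (b * (s + t)))) *
        (\<integral>\<^sup>+y. ennreal (heat (s + t) (x - y)) * g y \<partial>lborel) \<partial>lborel \<partial>lborel)"
    by (intro nn_integral_cong nn_integral_cmult) measurable
  finally show ?thesis .
qed

text \<open>Young's inequality with the weight \<open>\<mu> * r powr (D / q')\<close> balances the two terms.\<close>

lemma heat_Hoelder:
  fixes W :: "'a::euclidean_space \<Rightarrow> real"
  assumes q: "1 < q" and \<mu>: "0 < \<mu>" and r: "0 < r"
    and W [measurable]: "W \<in> borel_measurable borel" "\<And>x. 0 \<le> W x"
    and \<epsilon>: "(\<integral>\<^sup>+x. ennreal (W x powr (q / (q - 1))) \<partial>lborel) \<le> ennreal \<epsilon>" "0 \<le> \<epsilon>"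
  defines "D \<equiv> DIM('a) / 2 * (1 - 1 / q)"
  shows "(\<integral>\<^sup>+y. ennreal (heat r (x - y)) * ennreal (W y) \<partial>lborel)
    \<le> ennreal (r powr (- D) * (\<mu> powr q + \<mu> powr (- (q / (q - 1))) * \<epsilon>))"
proof -
  define q' where "q' = q / (q - 1)"
  have q': "1 < q'" "1 / q + 1 / q' = 1" using q by (auto simp: q'_def field_simps)
  define l where "l = \<mu> * r powr (D / q')"
  have l: "0 < l" using \<mu> r by (simp add: l_def)
  have lq: "l powr q = \<mu> powr q * r powr (D * q - D)"
  proof -
    have "1 / q' = 1 - 1 / q" using q'(2) by simp
    then have "D / q' * q = D * (1 - 1 / q) * q" by (metis divide_inverse inverse_eq_divide times_divide_eq_right mult.right_neutral)
    also have "\<dots> = D * q - D" using q by (simp add: field_simps)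
    finally show ?thesis using \<mu> r by (simp add: l_def powr_mult powr_powr)
  qed
  have lq': "l powr (- q') = \<mu> powr (- q') * r powr (- D)"
    using \<mu> r q' by (simp add: l_def powr_mult powr_powr)
  \<comment> \<open>All but one power of the kernel are estimated by its supremum, and the remaining
    factor has mass one.\<close>
  have hq: "heat r z powr q \<le> r powr (- (D * q)) * heat r z" for z :: 'a
  proof -
    have h: "0 < heat r z" by (rule heat_pos[OF r])
    have "heat r z \<le> 1 / sqrt (4 * pi * r) ^ DIM('a)" by (rule heat_le[OF r])
    also have "\<dots> \<le> 1 / sqrt r ^ DIM('a)"
    proof (intro divide_left_mono power_mono)
      have "1 * r \<le> 4 * pi * r" using r pi_gt3 by (intro mult_right_mono) auto
      then show "sqrt r \<le> sqrt (4 * pi * r)" by simp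
    qed (use r in auto)
    also have "\<dots> = r powr (- (DIM('a) / 2))"
    proof -
      have "sqrt r ^ DIM('a) = r powr (DIM('a) / 2)"
        using r by (simp add: powr_half_sqrt[symmetric] powr_powr powr_realpow[symmetric])
      then show ?thesis by (simp only: powr_minus divide_inverse mult_1)
    qed
    finally have "heat r z powr (q - 1) \<le> (r powr (- (DIM('a) / 2))) powr (q - 1)"
      using q h by (intro powr_mono2) auto
    also have "\<dots> = r powr (- (D * q))"
    proof -
      have "- (DIM('a) / 2) * (q - 1) = - (D * q)" using q by (simp add: D_def field_simps)
      then show ?thesis by (simp only: powr_powr)
    qed
    finally have "heat r z powr (q - 1) * heat r z \<le> r powr (- (D * q)) * heat r z" using h by (intro mult_right_mono) auto
    moreover have "heat r z powr (q - 1) * heat r z = heat r z powr q"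
      using h powr_mult_base[of "heat r z" "q - 1"] by (simp add: mult.commute)
    ultimately show ?thesis by simp
  qed
  have pw: "heat r (x - y) * W y \<le> r powr (- D) * \<mu> powr q * heat r (x - y) + l powr (- q') * W y powr q'" for y
  proof -
    have h: "0 \<le> heat r (x - y)" by (rule heat_nonneg[OF r])
    have "heat r (x - y) * W y = (l * heat r (x - y)) * (W y / l)" using l by simp
    also have "\<dots> \<le> (l * heat r (x - y)) powr q / q + (W y / l) powr q' / q'"
      using q q' l h W by (intro Youngs_inequality) auto
    also have "\<dots> \<le> (l * heat r (x - y)) powr q + (W y / l) powr q'"
    proof (intro add_mono)
      show "(l * heat r (x - y)) powr q / q \<le> (l * heat r (x - y)) powr q" using q by (simp add: divide_le_eq mult_le_cancel_left1)
      show "(W y / l) powr q' / q' \<le> (W y / l) powr q'" using q' by (simp add: divide_le_eq mult_le_cancel_left1)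
    qed
    also have "(l * heat r (x - y)) powr q = l powr q * heat r (x - y) powr q" using l h by (simp add: powr_mult)
    also have "(W y / l) powr q' = W y powr q' / l powr q'" by (rule powr_divide)
    also have "W y powr q' / l powr q' = l powr (- q') * W y powr q'" by (simp add: powr_minus divide_inverse mult.commute)
    also have "l powr q * heat r (x - y) powr q \<le> l powr q * (r powr (- (D * q)) * heat r (x - y))"
      by (intro mult_left_mono hq) simp
    also have "l powr q * (r powr (- (D * q)) * heat r (x - y)) = r powr (- D) * \<mu> powr q * heat r (x - y)"
    proof -
      have "r powr (D * q - D) * r powr (- (D * q)) = r powr (- D)" using r by (simp flip: powr_add)
      then show ?thesis unfolding lq by (simp add: mult_ac)
    qed
    finally show ?thesis by simp
  qed
  have "(\<integral>\<^sup>+y. ennreal (heat r (x - y)) * ennreal (W y) \<partial>lborel)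
     \<le> (\<integral>\<^sup>+y. ennreal (r powr (- D) * \<mu> powr q) * ennreal (heat r (x - y)) + ennreal (l powr (- q')) * ennreal (W y powr q') \<partial>lborel)"
  proof (rule nn_integral_mono)
    fix y
    show "ennreal (heat r (x - y)) * ennreal (W y) \<le> ennreal (r powr (- D) * \<mu> powr q) * ennreal (heat r (x - y)) + ennreal (l powr (- q')) * ennreal (W y powr q')"
      using pw[of y] heat_nonneg[OF r, of "x - y"] W by (simp add: ennreal_mult[symmetric] ennreal_plus[symmetric] ennreal_leI del: ennreal_plus)
  qed
  also have "\<dots> = ennreal (r powr (- D) * \<mu> powr q) * (\<integral>\<^sup>+y. ennreal (heat r (x - y)) \<partial>lborel) + ennreal (l powr (- q')) * (\<integral>\<^sup>+y. ennreal (W y powr q') \<partial>lborel)"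
    by (simp add: nn_integral_add nn_integral_cmult)
  also have "(\<integral>\<^sup>+y. ennreal (heat r (x - y)) \<partial>lborel) = 1"
    using nn_integral_lborel_minus[of "\<lambda>y. ennreal (heat r y)" x] nn_integral_heat[OF r, where 'a='a] by simp
  also have "ennreal (r powr (- D) * \<mu> powr q) * 1 + ennreal (l powr (- q')) * (\<integral>\<^sup>+y. ennreal (W y powr q') \<partial>lborel)
     \<le> ennreal (r powr (- D) * \<mu> powr q) * 1 + ennreal (l powr (- q')) * ennreal \<epsilon>"
    using \<epsilon>(1) by (intro add_left_mono mult_left_mono) (auto simp: q'_def)
  also have "\<dots> = ennreal (r powr (- D) * (\<mu> powr q + \<mu> powr (- q') * \<epsilon>))"
    unfolding lq' using \<epsilon>(2) by (simp add: ennreal_mult[symmetric] ennreal_plus[symmetric] algebra_simps del: ennreal_plus)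
  finally show ?thesis by (simp add: q'_def)
qed

text \<open>A bound from L^q', with \<open>q' = q / (q - 1)\<close>, to bounded functions for the
  squared resolvent, stated as smallness: that is how it is used on the part of the potential where
  \<open>U\<close> is large.\<close>

lemma nn_conv_bessel_twice_small:
  fixes dummy :: "'a::euclidean_space itself"
  assumes b: "0 < b" and q: "1 < q" and D: "DIM('a) / 2 * (1 - 1 / q) < 2" and \<eta>: "0 < \<eta>"
  obtains \<epsilon> where "0 < \<epsilon>" "\<And>(W :: 'a \<Rightarrow> real) x. W \<in> borel_measurable borel \<Longrightarrow> (\<And>x. 0 \<le> W x) \<Longrightarrow>
      (\<integral>\<^sup>+x. ennreal (W x powr (q / (q - 1))) \<partial>lborel) \<le> ennreal \<epsilon> \<Longrightarrow>
      nn_conv (bessel b) (nn_conv (bessel b) (\<lambda>x. ennreal (W x))) x \<le> ennreal \<eta>"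
proof -
  define d where "d = DIM('a) / 2 * (1 - 1 / q)"
  have d0: "0 \<le> d" using q by (simp add: d_def)
  have d2: "d < 2" using D by (simp add: d_def)
  \<comment> \<open>\<open>s + t\<close> is at least the geometric mean of \<open>s\<close> and
    \<open>t\<close>, so \<open>(s + t) powr (- d)\<close> splits into two factors of exponent
    \<open>- (d / 2) > -1\<close>, each integrable at zero.\<close>
  define P where "P s = indicator {0<..} s * (s powr (- (d / 2)) * exp (- (b * s)))" for s :: real
  have P0: "0 \<le> P s" for s by (simp add: P_def)
  have [measurable]: "P \<in> borel_measurable borel" unfolding P_def by measurable
  have iP: "integrable lborel P" unfolding P_def using d2 b by (intro power_exp_integrable) auto
  define K where "K = (LINT s|lborel. P s)"
  have K0: "0 \<le> K" unfolding K_def by (simp add: P0)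
  have nP: "(\<integral>\<^sup>+s. ennreal (P s) \<partial>lborel) = ennreal K" using iP P0 by (simp add: nn_integral_eq_integral K_def)
  \<comment> \<open>The final bound is \<open>\<delta> * K * K\<close>; adding 1 in the denominator
    covers \<open>K = 0\<close>.\<close>
  define \<delta> where "\<delta> = \<eta> / (K\<^sup>2 + 1)"
  have K1: "0 < K\<^sup>2 + 1" using zero_le_power2[of K] by linarith
  have \<delta>: "0 < \<delta>" using \<eta> K1 by (simp add: \<delta>_def)
  \<comment> \<open>\<open>\<mu>\<close> and \<open>\<epsilon>\<close> are chosen so that the two
    terms of \<open>heat_Hoelder\<close> contribute \<open>\<delta> / 2\<close> each.\<close>
  define \<mu> where "\<mu> = (\<delta> / 2) powr (1 / q)"
  have \<mu>: "0 < \<mu>" "\<mu> powr q = \<delta> / 2" using \<delta> q by (auto simp: \<mu>_def powr_powr)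
  define \<epsilon> where "\<epsilon> = (\<delta> / 2) / \<mu> powr (- (q / (q - 1)))"
  have \<epsilon>: "0 < \<epsilon>" "\<mu> powr (- (q / (q - 1))) * \<epsilon> = \<delta> / 2" using \<delta> \<mu>(1) by (auto simp: \<epsilon>_def)
  show ?thesis
  proof (rule that[OF \<epsilon>(1)])
    fix W :: "'a \<Rightarrow> real" and x
    assume W [measurable]: "W \<in> borel_measurable borel" "\<And>x. 0 \<le> W x"
      and We: "(\<integral>\<^sup>+x. ennreal (W x powr (q / (q - 1))) \<partial>lborel) \<le> ennreal \<epsilon>"
    have "nn_conv (bessel b) (nn_conv (bessel b) (\<lambda>x. ennreal (W x))) x
      = (\<integral>\<^sup>+s. \<integral>\<^sup>+t. ennreal (indicator {0<..} s * indicator {0<..} t * exp (- (b * (s + t)))) *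
        (\<integral>\<^sup>+y. ennreal (heat (s + t) (x - y)) * ennreal (W y) \<partial>lborel) \<partial>lborel \<partial>lborel)"
      by (rule nn_conv_bessel_twice[OF b]) measurable
    also have "\<dots> \<le> (\<integral>\<^sup>+s. \<integral>\<^sup>+t. ennreal \<delta> * ennreal (P s) * ennreal (P t) \<partial>lborel \<partial>lborel)"
    proof (intro nn_integral_mono)
      fix s t :: real
      show "ennreal (indicator {0<..} s * indicator {0<..} t * exp (- (b * (s + t)))) *
        (\<integral>\<^sup>+y. ennreal (heat (s + t) (x - y)) * ennreal (W y) \<partial>lborel) \<le> ennreal \<delta> * ennreal (P s) * ennreal (P t)"
      proof (cases "0 < s \<and> 0 < t")
        case True
        then have s: "0 < s" and t: "0 < t" by auto
        have "(\<integral>\<^sup>+y. ennreal (heat (s + t) (x - y)) * ennreal (W y) \<partial>lborel)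
           \<le> ennreal ((s + t) powr (- d) * (\<mu> powr q + \<mu> powr (- (q / (q - 1))) * \<epsilon>))"
          unfolding d_def by (rule heat_Hoelder[OF q \<mu>(1) _ W We]) (use s t \<epsilon> in auto)
        also have "\<dots> = ennreal ((s + t) powr (- d) * \<delta>)" unfolding \<mu>(2) \<epsilon>(2) by simp
        also have "\<dots> \<le> ennreal (s powr (- (d / 2)) * t powr (- (d / 2)) * \<delta>)"
        proof (intro ennreal_leI mult_right_mono)
          have "sqrt (s * t) \<le> s + t"
          proof (rule real_le_lsqrt)
            have "s * t \<le> s\<^sup>2 + 2 * s * t + t\<^sup>2" using s t by (simp add: add_nonneg_nonneg)
            then show "s * t \<le> (s + t)\<^sup>2" by (simp add: power2_sum)
          qed (use s t in auto)
          then have "(s + t) powr (- d) \<le> sqrt (s * t) powr (- d)" using s t d0 by (intro powr_mono2') auto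
          also have "\<dots> = (s * t) powr (- (d / 2))" using s t by (simp add: powr_half_sqrt[symmetric] powr_powr)
          also have "\<dots> = s powr (- (d / 2)) * t powr (- (d / 2))" using s t by (simp add: powr_mult)
          finally show "(s + t) powr (- d) \<le> s powr (- (d / 2)) * t powr (- (d / 2))" .
        qed (use \<delta> in auto)
        finally have "ennreal (exp (- (b * (s + t)))) * (\<integral>\<^sup>+y. ennreal (heat (s + t) (x - y)) * ennreal (W y) \<partial>lborel)
           \<le> ennreal (exp (- (b * (s + t)))) * ennreal (s powr (- (d / 2)) * t powr (- (d / 2)) * \<delta>)"
          by (rule mult_left_mono) simp
        also have "\<dots> = ennreal \<delta> * ennreal (P s) * ennreal (P t)"
          using s t \<delta> by (simp add: P_def ennreal_mult[symmetric] exp_add[symmetric] distrib_left mult_ac)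
        finally show ?thesis using s t by simp
      qed (auto simp: P_def)
    qed
    also have "\<dots> = (\<integral>\<^sup>+s. ennreal \<delta> * ennreal (P s) * ennreal K \<partial>lborel)"
      by (intro nn_integral_cong) (simp add: nn_integral_cmult nP)
    also have "\<dots> = ennreal \<delta> * ennreal K * ennreal K"
      by (simp add: nn_integral_cmult nn_integral_multc nP)
    also have "\<dots> = ennreal (\<delta> * K * K)" using \<delta> K0 by (simp add: ennreal_mult)
    also have "\<delta> * K * K = \<eta> * (K\<^sup>2 / (K\<^sup>2 + 1))" by (simp add: \<delta>_def power2_eq_square)
    also have "\<dots> \<le> ennreal (\<eta> * 1)"
      using \<eta> K1 by (intro ennreal_leI mult_left_mono) (auto simp: divide_le_eq)
    finally show "nn_conv (bessel b) (nn_conv (bessel b) (\<lambda>x. ennreal (W x))) x \<le> ennreal \<eta>" by simp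
  qed
qed

text \<open>Restricted to bounded sets because their indicators are square integrable and hence
  admissible in \<open>Euler_Lagrange_weak\<close>. Uniqueness of densities on balls gives the
  result.\<close>

lemma AE_eq_of_nn_integral_bounded_sets:
  fixes f g :: "'a::euclidean_space \<Rightarrow> ennreal"
  assumes [measurable]: "f \<in> borel_measurable borel" "g \<in> borel_measurable borel"
    and eq: "\<And>A. A \<in> sets borel \<Longrightarrow> bounded A \<Longrightarrow> (\<integral>\<^sup>+x. f x * indicator A x \<partial>lborel) = (\<integral>\<^sup>+x. g x * indicator A x \<partial>lborel)"
  shows "AE x in lborel. f x = g x"
proof -
  have "AE x in lborel. f x * indicator (ball 0 (real n)) x = g x * indicator (ball 0 (real n)) x" for n :: nat
  proof -
    have [measurable]: "ball (0::'a) (real n) \<in> sets borel" by simp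
    have mf: "(\<lambda>x. f x * indicator (ball 0 (real n)) x) \<in> borel_measurable lborel"
      "(\<lambda>x. g x * indicator (ball 0 (real n)) x) \<in> borel_measurable lborel" by (measurable, measurable)
    have "density lborel (\<lambda>x. f x * indicator (ball 0 (real n)) x) = density lborel (\<lambda>x. g x * indicator (ball 0 (real n)) x)"
    proof (rule measure_eqI)
      fix A assume "A \<in> sets (density lborel (\<lambda>x. f x * indicator (ball 0 (real n)) x))"
      then have A [measurable]: "A \<in> sets borel" by simp
      have "(\<integral>\<^sup>+x. f x * indicator (ball 0 (real n) \<inter> A) x \<partial>lborel) = (\<integral>\<^sup>+x. g x * indicator (ball 0 (real n) \<inter> A) x \<partial>lborel)"
        by (intro eq) (auto intro: bounded_subset)
      then show "emeasure (density lborel (\<lambda>x. f x * indicator (ball 0 (real n)) x)) A = emeasure (density lborel (\<lambda>x. g x * indicator (ball 0 (real n)) x)) A"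
        using mf A by (simp add: emeasure_density indicator_inter_arith mult.assoc)
    qed simp
    then show ?thesis by (subst (asm) sigma_finite_measure.density_unique_iff[OF lborel.sigma_finite_measure_axioms mf])
  qed
  then have "AE x in lborel. \<forall>n::nat. f x * indicator (ball 0 (real n)) x = g x * indicator (ball 0 (real n)) x"
    unfolding AE_all_countable by blast
  then show ?thesis
  proof eventually_elim
    case (elim x)
    obtain n :: nat where "norm x < real n" using reals_Archimedean2 by blast
    then show ?case using elim[rule_format, of n] by simp
  qed
qed

section \<open>Euler-Lagrange equation and boundedness for a nonnegative dual minimizer\<close>

locale profile = minimizer \<sigma> \<beta> \<alpha> u for \<sigma> \<beta> \<alpha> :: real and u :: "real ^ 'n \<Rightarrow> complex" +
  fixes f :: "real ^ 'n \<Rightarrow> real"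
  assumes sub: "5 \<le> CARD('n) \<longrightarrow> \<sigma> < 4 / (real CARD('n) - 4)"
    and f_sq: "sq_integrable f" and f_nonneg: "0 \<le> f x" and f_nz: "\<not> (AE x in lborel. f x = 0)"
    and f_norm: "(LINT x|lborel. \<bar>R f x\<bar> powr p) = 1" and f_min: "E f = m"
begin

definition U where "U = R f"
definition h where "h s = \<gamma> * s + m * s powr (p - 1)"

lemma f_meas [measurable]: "f \<in> borel_measurable borel" using f_sq by auto
lemma U_meas [measurable]: "U \<in> borel_measurable borel" unfolding U_def by measurable
lemma h_meas [measurable]: "h \<in> borel_measurable borel" unfolding h_def[abs_def] by measurable

lemma U_nonneg: "0 \<le> U x"
  unfolding U_def conv_def using bessel_nonneg f_nonneg by (intro integral_nonneg_AE AE_I2 mult_nonneg_nonneg) auto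

lemma U_sq: "sq_integrable U" unfolding U_def by (rule sq_integrable_conv(1)[OF f_sq])

lemma h_nonneg: "0 \<le> s \<Longrightarrow> 0 \<le> h s"
  using \<gamma>_pos m_pos by (simp add: h_def)

lemma h_strict_mono: assumes "0 \<le> s" "s < t" shows "h s < h t"
proof -
  have "\<gamma> * s < \<gamma> * t" using assms \<gamma>_pos by simp
  moreover have "m * s powr (p - 1) \<le> m * t powr (p - 1)"
    using assms m_pos p_gt_2 by (intro mult_left_mono powr_mono2) auto
  ultimately show ?thesis by (simp add: h_def)
qed

lemma h_mono: "0 \<le> s \<Longrightarrow> s \<le> t \<Longrightarrow> h s \<le> h t"
  using h_strict_mono[of s t] by (cases "s = t") auto

lemma U_powr_integrable: "integrable lborel (\<lambda>x. U x powr p)"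
  using inequality(1)[OF f_sq] U_nonneg by (simp add: U_def[symmetric])

lemma AE_U: "AE x in lborel. ennreal (U x) = nn_conv (bessel b) (\<lambda>y. ennreal (f y)) x"
  using AE_conv_integrable[OF f_sq] by eventually_elim (simp add: U_def ennreal_conv f_nonneg)

text \<open>In the weak equation, tested with indicators of bounded sets, the kernel is moved from
  the test function to \<open>h (U y)\<close> by \<open>nn_conv_sym\<close>.\<close>

lemma Euler_Lagrange: "AE x in lborel. ennreal (f x) = nn_conv (bessel b) (\<lambda>y. ennreal (h (U y))) x"
proof (rule AE_eq_of_nn_integral_bounded_sets)
  fix A :: "(real ^ 'n) set" assume A [measurable]: "A \<in> sets borel" and bd: "bounded A"
  define \<psi> where "\<psi> = (indicator A :: real ^ 'n \<Rightarrow> real)"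
  have \<psi>0: "0 \<le> \<psi> x" for x by (simp add: \<psi>_def)
  have \<psi>: "sq_integrable \<psi>" unfolding \<psi>_def
    using emeasure_bounded_finite[OF bd] by (intro sq_integrable_indicator) auto
  have [measurable]: "\<psi> \<in> borel_measurable borel" using \<psi> by auto
  have "\<bar>\<psi> x\<bar> \<le> 1" for x by (simp add: \<psi>_def indicator_def)
  then have R\<psi>: "ennreal (R \<psi> x) = nn_conv (bessel b) (\<lambda>y. ennreal (\<psi> y)) x" for x
    by (intro ennreal_conv \<psi>0 conv_bounded_integrable[where M = 1]) auto
  have R\<psi>0: "0 \<le> R \<psi> x" for x
    unfolding conv_def using bessel_nonneg \<psi>0 by (intro integral_nonneg_AE AE_I2 mult_nonneg_nonneg) auto
  note EL = Euler_Lagrange_weak[OF f_sq f_nonneg f_norm f_min \<psi>, folded U_def]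
  have eq: "(LINT x|lborel. f x * \<psi> x) = (LINT x|lborel. h (U x) * R \<psi> x)"
    using EL(2) by (simp add: h_def)
  have hi: "integrable lborel (\<lambda>x. h (U x) * R \<psi> x)"
  proof -
    have "integrable lborel (\<lambda>x. \<gamma> * (U x * R \<psi> x) + m * (U x powr (p - 1) * R \<psi> x))"
      using EL(1) sq_integrable_mult[OF U_sq sq_integrable_conv(1)[OF \<psi>]] by simp
    then show ?thesis by (simp add: h_def algebra_simps)
  qed
  have "(\<integral>\<^sup>+x. ennreal (f x) * indicator A x \<partial>lborel) = (\<integral>\<^sup>+x. ennreal (f x * \<psi> x) \<partial>lborel)"
    by (intro nn_integral_cong) (auto simp: \<psi>_def indicator_def)
  also have "\<dots> = ennreal (LINT x|lborel. f x * \<psi> x)"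
    by (rule nn_integral_eq_integral[OF sq_integrable_mult[OF f_sq \<psi>]]) (auto simp: f_nonneg \<psi>0)
  also have "\<dots> = (\<integral>\<^sup>+x. ennreal (h (U x) * R \<psi> x) \<partial>lborel)"
    unfolding eq by (rule nn_integral_eq_integral[symmetric, OF hi]) (auto simp: h_nonneg U_nonneg R\<psi>0)
  also have "\<dots> = (\<integral>\<^sup>+x. ennreal (h (U x)) * nn_conv (bessel b) (\<lambda>y. ennreal (\<psi> y)) x \<partial>lborel)"
    by (simp add: ennreal_mult h_nonneg U_nonneg R\<psi>0 R\<psi>)
  also have "\<dots> = (\<integral>\<^sup>+x. nn_conv (bessel b) (\<lambda>y. ennreal (h (U y))) x * ennreal (\<psi> x) \<partial>lborel)"
    by (rule nn_conv_sym) measurable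
  also have "\<dots> = (\<integral>\<^sup>+x. nn_conv (bessel b) (\<lambda>y. ennreal (h (U y))) x * indicator A x \<partial>lborel)"
    by (intro nn_integral_cong) (auto simp: \<psi>_def indicator_def)
  finally show "(\<integral>\<^sup>+x. ennreal (f x) * indicator A x \<partial>lborel) = (\<integral>\<^sup>+x. nn_conv (bessel b) (\<lambda>y. ennreal (h (U y))) x * indicator A x \<partial>lborel)" .
qed measurable

text \<open>With \<open>p / 2 = \<sigma> + 1\<close> the claim is that \<open>\<sigma>\<close> times
  the dimension is less than \<open>4 * (\<sigma> + 1)\<close>. In dimension at most four this is
  automatic, and above it is the hypothesis on \<open>\<sigma>\<close>.\<close>

lemma subcritical: "CARD('n) / 2 * (1 - 1 / (p / 2)) < 2"
proof -
  let ?n = "real CARD('n)"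
  have s: "0 < \<sigma> + 1" using \<sigma> by simp
  have "1 - 1 / (p / 2) = \<sigma> / (\<sigma> + 1)" using s by (simp add: p_def field_simps)
  moreover have "?n * \<sigma> < 4 * (\<sigma> + 1)"
  proof (cases "5 \<le> CARD('n)")
    case True
    then have "0 < ?n - 4" by simp
    then have "\<sigma> * (?n - 4) < 4" using sub True by (simp add: pos_less_divide_eq)
    then show ?thesis by (simp add: algebra_simps)
  next
    case False
    then have "?n * \<sigma> \<le> 4 * \<sigma>" using \<sigma> by (intro mult_right_mono) auto
    then show ?thesis by simp
  qed
  ultimately show ?thesis using s by (simp add: divide_less_eq)
qed

lemma U_powr_tail:
  assumes "0 < \<epsilon>"
  obtains k where "1 \<le> k" "(\<integral>\<^sup>+x. ennreal (indicator {x. k < U x} x * U x powr p) \<partial>lborel) \<le> ennreal \<epsilon>"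
proof -
  have "(\<lambda>k. LINT x|lborel. indicator {x. real k < U x} x * U x powr p) \<longlonglongrightarrow> (LINT x::real ^ 'n|lborel. (0::real))"
  proof (rule integral_dominated_convergence[OF _ _ U_powr_integrable])
    show "AE x in lborel. (\<lambda>k. indicator {x. real k < U x} x * U x powr p) \<longlonglongrightarrow> 0"
    proof (intro AE_I2 tendsto_eventually)
      fix x
      have "\<forall>\<^sub>F k in sequentially. U x \<le> real k"
        using filterlim_real_sequentially unfolding filterlim_at_top by blast
      then show "\<forall>\<^sub>F k in sequentially. indicator {x. real k < U x} x * U x powr p = 0"
        by eventually_elim (auto simp: indicator_def)
    qed
    show "AE x in lborel. norm (indicator {x. real k < U x} x * U x powr p) \<le> U x powr p" for k
      by (auto simp: indicator_def)
  qed measurable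
  then have "(\<lambda>k. LINT x|lborel. indicator {x. real k < U x} x * U x powr p) \<longlonglongrightarrow> 0" by simp
  then have "\<forall>\<^sub>F k in sequentially. (LINT x|lborel. indicator {x. real k < U x} x * U x powr p) < \<epsilon>"
    using assms by (rule order_tendstoD(2))
  then have "\<forall>\<^sub>F k in sequentially. 1 \<le> k \<and> (LINT x|lborel. indicator {x. real k < U x} x * U x powr p) < \<epsilon>"
    using eventually_ge_at_top[of 1] by eventually_elim auto
  then obtain k :: nat where k: "1 \<le> k" "(LINT x|lborel. indicator {x. real k < U x} x * U x powr p) < \<epsilon>"
    unfolding eventually_sequentially by blast
  have "integrable lborel (\<lambda>x. indicator {x. real k < U x} x * U x powr p)"
    using integrable_mult_indicator[OF _ U_powr_integrable, of "{x. real k < U x}"] by simp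
  then have "(\<integral>\<^sup>+x. ennreal (indicator {x. real k < U x} x * U x powr p) \<partial>lborel) = ennreal (LINT x|lborel. indicator {x. real k < U x} x * U x powr p)"
    by (rule nn_integral_eq_integral) simp
  also have "\<dots> \<le> ennreal \<epsilon>" using k(2) by (intro ennreal_leI) simp
  finally show ?thesis using that[of "real k"] k(1) by simp
qed

text \<open>Testing with the excess over \<open>2 * B\<close> absorbs the part of the potential where \<open>U\<close> is large.\<close>

lemma U_AE_bounded: obtains C where "0 \<le> C" "AE x in lborel. U x \<le> C"
proof -
  \<comment> \<open>The conjugate exponent is \<open>p / (p - 2)\<close>, so for a potential of size
    \<open>U powr (p - 2)\<close> its \<open>q'\<close>-th power is comparable to
    \<open>U powr p\<close>, whose integral over large values of \<open>U\<close> is small.\<close>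
  define q where "q = p / 2"
  have q: "1 < q" using p_gt_2 by (simp add: q_def)
  obtain \<epsilon> where \<epsilon>: "0 < \<epsilon>" "\<And>(W :: real ^ 'n \<Rightarrow> real) x. W \<in> borel_measurable borel \<Longrightarrow> (\<And>x. 0 \<le> W x) \<Longrightarrow>
      (\<integral>\<^sup>+x. ennreal (W x powr (q / (q - 1))) \<partial>lborel) \<le> ennreal \<epsilon> \<Longrightarrow>
      nn_conv (bessel b) (nn_conv (bessel b) (\<lambda>x. ennreal (W x))) x \<le> ennreal (1 / 2)"
    by (rule nn_conv_bessel_twice_small[OF b_pos q, where 'a="real ^ 'n" and \<eta> = "1 / 2"])
       (use subcritical in \<open>auto simp: q_def\<close>)
  define c where "c = \<gamma> + m"
  have c: "0 < c" using \<gamma>_pos m_pos by (simp add: c_def)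
  define q' where "q' = q / (q - 1)"
  have q': "(p - 2) * q' = p" using p_gt_2 by (simp add: q'_def q_def field_simps)
  obtain k where k: "1 \<le> k" "(\<integral>\<^sup>+x. ennreal (indicator {x. k < U x} x * U x powr p) \<partial>lborel) \<le> ennreal (\<epsilon> / c powr q')"
    using U_powr_tail[of "\<epsilon> / c powr q'"] \<epsilon>(1) c by auto
  define W where "W x = c * (indicator {x. k < U x} x * U x powr (p - 2))" for x
  have W0: "0 \<le> W x" for x using c by (simp add: W_def)
  have [measurable]: "W \<in> borel_measurable borel" unfolding W_def by measurable
  define T where "T g = nn_conv (bessel b :: real ^ 'n \<Rightarrow> real) (nn_conv (bessel b) g)" for g :: "real ^ 'n \<Rightarrow> ennreal"
  have T_meas [measurable]: "T g \<in> borel_measurable borel" if [measurable]: "g \<in> borel_measurable borel" for g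
    unfolding T_def by measurable
  have TW: "T (\<lambda>x. ennreal (W x)) x \<le> ennreal (1 / 2)" for x
    unfolding T_def
  proof (rule \<epsilon>(2)[OF _ W0])
    have "W x powr q' = c powr q' * (indicator {x. k < U x} x * U x powr p)" for x
      using c U_nonneg[of x] by (auto simp: W_def indicator_def powr_mult powr_powr q')
    then have "(\<integral>\<^sup>+x. ennreal (W x powr q') \<partial>lborel) = ennreal (c powr q') * (\<integral>\<^sup>+x. ennreal (indicator {x. k < U x} x * U x powr p) \<partial>lborel)"
      by (subst nn_integral_cmult[symmetric]) (auto simp: ennreal_mult)
    also have "\<dots> \<le> ennreal (c powr q') * ennreal (\<epsilon> / c powr q')" by (intro mult_left_mono k) simp
    also have "\<dots> = ennreal \<epsilon>" using c \<epsilon>(1) by (simp add: ennreal_mult[symmetric])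
    finally show "(\<integral>\<^sup>+x. ennreal (W x powr (q / (q - 1))) \<partial>lborel) \<le> ennreal \<epsilon>" by (simp add: q'_def)
  qed measurable
  \<comment> \<open>The value of \<open>T\<close> on the constant \<open>h k\<close>: each kernel
    has mass \<open>1 / b\<close>.\<close>
  define B where "B = h k / b\<^sup>2"
  have B0: "0 \<le> B" using h_nonneg[of k] k(1) by (simp add: B_def)
  define v where "v x = max 0 (U x - 2 * B)" for x
  have v0: "0 \<le> v x" for x by (simp add: v_def)
  have [measurable]: "v \<in> borel_measurable borel" unfolding v_def by measurable
  have hle: "h (U x) \<le> h k + W x * U x" for x
  proof (cases "k < U x")
    case True
    then have U1: "1 \<le> U x" using k(1) by simp
    have e: "U x powr (p - 1) = U x powr (p - 2) * U x"
      using U1 powr_mult_base[of "U x" "p - 2"] by (simp add: mult.commute)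
    have "1 * U x \<le> U x powr (p - 2) * U x"
      using U1 p_gt_2 by (intro mult_right_mono ge_one_powr_ge_zero) auto
    then have "\<gamma> * U x \<le> \<gamma> * (U x powr (p - 2) * U x)" using \<gamma>_pos by (intro mult_left_mono) auto
    then have "h (U x) \<le> W x * U x" using True by (simp add: h_def e W_def c_def algebra_simps)
    then show ?thesis using h_nonneg[of k] k(1) by simp
  next
    case False
    then show ?thesis using h_mono[of "U x" k] U_nonneg[of x] by (simp add: W_def)
  qed
  have AE1: "AE x in lborel. ennreal (U x) = T (\<lambda>y. ennreal (h (U y))) x"
    using AE_U unfolding T_def nn_conv_cong_AE[OF Euler_Lagrange] .
  have Tadd: "T (\<lambda>y. g y + g' y) x = T g x + T g' x"
    if [measurable]: "g \<in> borel_measurable borel" "g' \<in> borel_measurable borel" for g g' x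
  proof -
    have "nn_conv (bessel b) (\<lambda>y. g y + g' y) = (\<lambda>x. nn_conv (bessel b) g x + nn_conv (bessel b) g' x)"
      by (rule ext, rule nn_conv_add) auto
    then show ?thesis unfolding T_def by (simp add: nn_conv_add)
  qed
  have Tmono: "T g x \<le> T g' x" if "\<And>y. g y \<le> g' y" for g g' x
    unfolding T_def by (intro nn_conv_mono that)
  have Tcm: "T (\<lambda>y. c * g y) x = c * T g x" if [measurable]: "g \<in> borel_measurable borel" for g c x
  proof -
    have "nn_conv (bessel b) (\<lambda>y. c * g y) = (\<lambda>x. c * nn_conv (bessel b) g x)"
      by (rule ext, rule nn_conv_cmult) auto
    then show ?thesis unfolding T_def by (simp add: nn_conv_cmult)
  qed
  have Tconst: "T (\<lambda>y. ennreal (h k)) x = ennreal B" for x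
    unfolding T_def nn_conv_const using b_pos h_nonneg[of k] k(1)
    by (simp add: nn_conv_const bessel_integrable(2) B_def ennreal_mult[symmetric] power2_eq_square)
  \<comment> \<open>From \<open>U \<le> 2 * B + v\<close>: the bounded part of the nonlinearity
    contributes \<open>B\<close>, and \<open>2 * B\<close> times \<open>T W\<close>, which is at
    most 1/2, contributes another \<open>B\<close>. Hence the threshold
    \<open>2 * B\<close>.\<close>
  have AE2: "AE x in lborel. ennreal (U x) \<le> ennreal (2 * B) + T (\<lambda>y. ennreal (W y * v y)) x"
    using AE1
  proof eventually_elim
    case (elim x)
    have "h (U y) \<le> h k + (2 * B * W y + W y * v y)" for y
    proof -
      have "W y * U y \<le> W y * (2 * B + v y)" using W0[of y] by (intro mult_left_mono) (auto simp: v_def)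
      then show ?thesis using hle[of y] by (simp add: algebra_simps)
    qed
    then have "T (\<lambda>y. ennreal (h (U y))) x \<le> T (\<lambda>y. ennreal (h k) + (ennreal (2 * B) * ennreal (W y) + ennreal (W y * v y))) x"
      using W0 v0 B0 h_nonneg[of k] k(1)
      by (intro Tmono) (simp add: ennreal_mult[symmetric] ennreal_plus[symmetric] ennreal_leI del: ennreal_plus)
    also have "\<dots> = ennreal B + (ennreal (2 * B) * T (\<lambda>y. ennreal (W y)) x + T (\<lambda>y. ennreal (W y * v y)) x)"
      by (simp add: Tadd Tcm Tconst)
    also have "\<dots> \<le> ennreal B + (ennreal (2 * B) * ennreal (1 / 2) + T (\<lambda>y. ennreal (W y * v y)) x)"
      by (intro add_left_mono add_right_mono mult_left_mono TW) simp
    also have "ennreal (2 * B) * ennreal (1 / 2) = ennreal (2 * B * (1 / 2))"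
      using B0 by (intro ennreal_mult[symmetric]) auto
    also have "ennreal B + (ennreal (2 * B * (1 / 2)) + T (\<lambda>y. ennreal (W y * v y)) x) = ennreal (2 * B) + T (\<lambda>y. ennreal (W y * v y)) x"
      using B0 by (simp add: add.assoc[symmetric] ennreal_plus[symmetric] del: ennreal_plus)
    finally show ?case using elim by simp
  qed
  have AE3: "AE x in lborel. ennreal (v x) \<le> T (\<lambda>y. ennreal (W y * v y)) x"
    using AE2
  proof eventually_elim
    case (elim x)
    have "ennreal (U x - 2 * B) \<le> T (\<lambda>y. ennreal (W y * v y)) x"
    proof -
      have "ennreal (U x - 2 * B) = ennreal (U x) - ennreal (2 * B)" using B0 by (simp add: ennreal_minus)
      also have "\<dots> \<le> T (\<lambda>y. ennreal (W y * v y)) x" using elim by (simp add: ennreal_minus_le_iff)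
      finally show ?thesis .
    qed
    then show ?case by (auto simp: v_def max_def ennreal_neg)
  qed
  \<comment> \<open>Pairing the inequality for \<open>v\<close> with \<open>W\<close> and moving
    \<open>T\<close> to the other side gives \<open>I \<le> I / 2\<close>, so a finite
    \<open>I\<close> is zero.\<close>
  define I where "I = (\<integral>\<^sup>+x. ennreal (W x * v x) \<partial>lborel)"
  have "I \<le> ennreal (1 / 2) * I"
  proof -
    have "I = (\<integral>\<^sup>+x. ennreal (W x) * ennreal (v x) \<partial>lborel)" by (simp add: I_def ennreal_mult W0 v0)
    also have "\<dots> \<le> (\<integral>\<^sup>+x. ennreal (W x) * T (\<lambda>y. ennreal (W y * v y)) x \<partial>lborel)"
      by (intro nn_integral_mono_AE) (use AE3 in \<open>auto elim!: eventually_mono intro: mult_left_mono\<close>)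
    also have "\<dots> = (\<integral>\<^sup>+x. T (\<lambda>y. ennreal (W y)) x * ennreal (W x * v x) \<partial>lborel)"
      unfolding T_def by (simp add: nn_conv_sym)
    also have "\<dots> \<le> (\<integral>\<^sup>+x. ennreal (1 / 2) * ennreal (W x * v x) \<partial>lborel)"
      by (intro nn_integral_mono mult_right_mono TW) simp
    also have "\<dots> = ennreal (1 / 2) * I" unfolding I_def by (rule nn_integral_cmult) measurable
    finally show ?thesis .
  qed
  \<comment> \<open>On the support of \<open>W\<close> one has \<open>U > k \<ge> 1\<close>, so the
    integrand is at most \<open>c * U powr p\<close>.\<close>
  moreover have "I < \<infinity>"
  proof -
    have "I \<le> (\<integral>\<^sup>+x. ennreal (c * U x powr p) \<partial>lborel)"
      unfolding I_def
    proof (intro nn_integral_mono ennreal_leI)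
      fix x
      show "W x * v x \<le> c * U x powr p"
      proof (cases "k < U x")
        case True
        then have U1: "1 \<le> U x" using k(1) by simp
        have "U x powr (p - 2) * v x \<le> U x powr (p - 2) * (U x * U x)"
        proof (intro mult_left_mono)
          have "v x \<le> U x" using B0 U1 by (simp add: v_def)
          also have "U x * 1 \<le> U x * U x" using U1 by (intro mult_left_mono) auto
          finally show "v x \<le> U x * U x" by simp
        qed simp
        also have "\<dots> = U x powr p"
          using U1 powr_mult_base[of "U x" "p - 2"] powr_mult_base[of "U x" "p - 1"] by (simp add: mult_ac)
        finally show ?thesis using True c by (simp add: W_def mult.assoc)
      qed (use c in \<open>simp add: W_def\<close>)
    qed
    also have "\<dots> < \<infinity>"
      using U_powr_integrable c by (subst nn_integral_eq_integral) auto
    finally show ?thesis .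
  qed
  ultimately have I0: "I = 0"
  proof -
    obtain r where r: "I = ennreal r" "0 \<le> r" using \<open>I < \<infinity>\<close> by (cases I) auto
    have "ennreal (1 / 2) * ennreal r = ennreal (1 / 2 * r)" using r by (intro ennreal_mult[symmetric]) auto
    then have "ennreal r \<le> ennreal (1 / 2 * r)" using \<open>I \<le> ennreal (1 / 2) * I\<close> r by metis
    then have "r \<le> 1 / 2 * r" using r by (subst (asm) ennreal_le_iff) auto
    then show ?thesis using r by simp
  qed
  then have "AE x in lborel. ennreal (W x * v x) = 0"
    unfolding I_def by (subst (asm) nn_integral_0_iff_AE) auto
  then have "AE x in lborel. U x \<le> max k (2 * B)"
  proof eventually_elim
    case (elim x)
    have Wv: "W x * v x = 0" using elim W0[of x] v0[of x] mult_nonneg_nonneg[OF W0[of x] v0[of x]] by (simp add: ennreal_eq_0_iff)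
    show ?case
    proof (cases "k < U x")
      case True
      then have "W x \<noteq> 0" using c k(1) by (simp add: W_def)
      then have "v x = 0" using Wv by simp
      then show ?thesis by (simp add: v_def max_def split: if_splits)
    qed simp
  qed
  then show ?thesis using that[of "max k (2 * B)"] k(1) by simp
qed

end

section \<open>Hyperplane reflections\<close>

definition reflect :: "'a::real_inner \<Rightarrow> real \<Rightarrow> 'a \<Rightarrow> 'a" where
  "reflect e c x = x - (2 * (x \<bullet> e - c)) *\<^sub>R e"

lemma reflect_continuous: "continuous_on UNIV (reflect e c)"
  unfolding reflect_def[abs_def] by (intro continuous_intros)

lemma reflect_meas [measurable (raw)]:
  fixes e :: "'a::euclidean_space"
  assumes [measurable]: "f \<in> borel_measurable M"
  shows "(\<lambda>x. reflect e c (f x)) \<in> borel_measurable M"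
  unfolding reflect_def by measurable

lemma reflect_inner: "norm e = 1 \<Longrightarrow> reflect e c x \<bullet> e - c = - (x \<bullet> e - c)"
  by (simp add: reflect_def inner_diff_left norm_eq_1)

lemma reflect_reflect: "norm e = 1 \<Longrightarrow> reflect e c (reflect e c x) = x"
proof -
  assume e: "norm e = 1"
  have "reflect e c (reflect e c x) = reflect e c x - (2 * (reflect e c x \<bullet> e - c)) *\<^sub>R e" by (rule reflect_def)
  also have "\<dots> = x" unfolding reflect_inner[OF e] by (simp add: reflect_def scaleR_left_diff_distrib)
  finally show ?thesis .
qed

text \<open>Shows that the signed distances to the hyperplane decide whether \<open>x\<close> is
  closer to \<open>y\<close> or to its mirror image; every comparison of kernel values rests on
  this.\<close>

lemma norm_diff_reflect_square:
  assumes "norm e = 1"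
  shows "(norm (x - reflect e c y))\<^sup>2 = (norm (x - y))\<^sup>2 + 4 * (x \<bullet> e - c) * (y \<bullet> e - c)"
proof -
  have ee: "e \<bullet> e = 1" using assms by (simp add: norm_eq_1)
  define d where "d = y \<bullet> e - c"
  have "(norm (z + (2 * d) *\<^sub>R e))\<^sup>2 = (norm z)\<^sup>2 + 4 * d * (z \<bullet> e) + 4 * d * d" for z
    unfolding power2_norm_eq_inner by (simp add: inner_add_left inner_add_right inner_commute[of e z] ee algebra_simps)
  moreover have "x - reflect e c y = (x - y) + (2 * d) *\<^sub>R e" by (simp add: reflect_def d_def)
  ultimately have "(norm (x - reflect e c y))\<^sup>2 = (norm (x - y))\<^sup>2 + 4 * d * ((x - y) \<bullet> e) + 4 * d * d"
    by metis
  also have "(x - y) \<bullet> e = (x \<bullet> e - c) - d" by (simp add: inner_diff_left d_def)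
  finally show ?thesis by (simp add: d_def algebra_simps)
qed

lemma norm_less_reflect_iff:
  assumes "norm e = 1"
  shows "norm (x - y) < norm (x - reflect e c y) \<longleftrightarrow> 0 < (x \<bullet> e - c) * (y \<bullet> e - c)"
    and "norm (x - reflect e c y) < norm (x - y) \<longleftrightarrow> (x \<bullet> e - c) * (y \<bullet> e - c) < 0"
proof -
  have s: "a < b \<longleftrightarrow> a\<^sup>2 < b\<^sup>2" if "0 \<le> a" "0 \<le> b" for a b :: real
    using that by (meson power_less_imp_less_base power_strict_mono zero_less_numeral)
  note q = norm_diff_reflect_square[OF assms, of x c y, unfolded mult.assoc]
  show "norm (x - y) < norm (x - reflect e c y) \<longleftrightarrow> 0 < (x \<bullet> e - c) * (y \<bullet> e - c)"
    unfolding s[OF norm_ge_zero norm_ge_zero] q by linarith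
  show "norm (x - reflect e c y) < norm (x - y) \<longleftrightarrow> (x \<bullet> e - c) * (y \<bullet> e - c) < 0"
    unfolding s[OF norm_ge_zero norm_ge_zero] q by linarith
qed

lemma norm_reflect_diff:
  assumes "norm e = 1" shows "norm (reflect e c x - y) = norm (x - reflect e c y)"
proof -
  have "(norm (reflect e c x - y))\<^sup>2 = (norm (x - reflect e c y))\<^sup>2"
    using norm_diff_reflect_square[OF assms, of y c x] norm_diff_reflect_square[OF assms, of x c y]
    unfolding norm_minus_commute[of y] by (simp only: mult_ac)
  then show ?thesis by simp
qed

text \<open>Both integrals are multiplied by the volume of the unit ball. Translation invariance and
  Fubini then transfer the reflection to the indicator of the ball, which is invariant under
  it.\<close>

lemma nn_integral_reflect_0:
  fixes e :: "'a::euclidean_space" and g :: "'a \<Rightarrow> ennreal"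
  assumes e: "norm e = 1" and [measurable]: "g \<in> borel_measurable borel"
  shows "(\<integral>\<^sup>+x. g (reflect e 0 x) \<partial>lborel) = (\<integral>\<^sup>+x. g x \<partial>lborel)"
proof -
  define \<phi> where "\<phi> = (indicator (ball (0::'a) 1) :: 'a \<Rightarrow> ennreal)"
  define V where "V = (\<integral>\<^sup>+x. \<phi> x \<partial>lborel)"
  have [measurable]: "\<phi> \<in> borel_measurable borel" unfolding \<phi>_def by (intro borel_measurable_indicator) simp
  have V: "0 < V" "V < \<infinity>"
    by (simp_all add: V_def \<phi>_def emeasure_ball)
  let ?r = "reflect e 0"
  have lin: "?r (x + y) = ?r x + ?r y" for x y :: 'a
    by (simp add: reflect_def inner_add_left algebra_simps)
  have \<phi>r: "\<phi> (y - ?r x) = \<phi> (?r y - x)" for x y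
    using norm_reflect_diff[OF e, of 0 y x] by (simp add: \<phi>_def indicator_def)
  have "(\<integral>\<^sup>+x. g x \<partial>lborel) * V = (\<integral>\<^sup>+y. (\<integral>\<^sup>+x. g (?r y + x) \<partial>lborel) * \<phi> y \<partial>lborel)"
    by (subst nn_integral_lborel_plus) (auto simp: V_def nn_integral_cmult)
  also have "\<dots> = (\<integral>\<^sup>+y. (\<integral>\<^sup>+x. g (?r y + x) * \<phi> y \<partial>lborel) \<partial>lborel)"
    by (simp add: nn_integral_multc)
  also have "\<dots> = (\<integral>\<^sup>+x. (\<integral>\<^sup>+y. g (?r y + x) * \<phi> y \<partial>lborel) \<partial>lborel)"
    by (rule lborel_pair.Fubini') measurable
  also have "\<dots> = (\<integral>\<^sup>+x. (\<integral>\<^sup>+y. g (?r y) * \<phi> (y - ?r x) \<partial>lborel) \<partial>lborel)"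
  proof (rule nn_integral_cong)
    fix x
    have "(\<integral>\<^sup>+y. g (?r y) * \<phi> (y - ?r x) \<partial>lborel) = (\<integral>\<^sup>+y. g (?r (?r x + y)) * \<phi> (?r x + y - ?r x) \<partial>lborel)"
      by (rule nn_integral_lborel_plus[symmetric]) measurable
    moreover have "?r (?r x + y) = ?r y + x" for y
      using lin[of "?r x" y] reflect_reflect[OF e, of 0 x] by simp
    ultimately show "(\<integral>\<^sup>+y. g (?r y + x) * \<phi> y \<partial>lborel) = (\<integral>\<^sup>+y. g (?r y) * \<phi> (y - ?r x) \<partial>lborel)" by simp
  qed
  also have "\<dots> = (\<integral>\<^sup>+y. (\<integral>\<^sup>+x. g (?r y) * \<phi> (y - ?r x) \<partial>lborel) \<partial>lborel)"
    by (rule lborel_pair.Fubini') measurable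
  also have "\<dots> = (\<integral>\<^sup>+y. g (?r y) * V \<partial>lborel)"
    unfolding \<phi>r by (simp add: nn_integral_cmult nn_integral_lborel_minus V_def)
  also have "\<dots> = (\<integral>\<^sup>+y. g (?r y) \<partial>lborel) * V" by (rule nn_integral_multc) measurable
  finally show ?thesis using V by (metis ennreal_mult_divide_eq infinity_ennreal_def less_irrefl)
qed

lemma distr_lborel_reflect:
  fixes e :: "'a::euclidean_space"
  assumes e: "norm e = 1"
  shows "distr lborel borel (reflect e c) = lborel"
proof -
  have "distr lborel borel (reflect e 0) = (lborel :: 'a measure)"
  proof (rule measure_eqI)
    fix A assume "A \<in> sets (distr lborel borel (reflect e 0))"
    then have [measurable]: "A \<in> sets borel" by simp
    have "emeasure (distr lborel borel (reflect e 0)) A = (\<integral>\<^sup>+x. indicator A (reflect e 0 x) \<partial>lborel)"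
      by (subst nn_integral_distr[where M' = borel and f = "indicator A", symmetric]) auto
    then show "emeasure (distr lborel borel (reflect e 0)) A = emeasure lborel A"
      by (simp add: nn_integral_reflect_0[OF e])
  qed simp
  moreover have "reflect e c = (\<lambda>x. (2 * c) *\<^sub>R e + reflect e 0 x)"
    by (auto simp: reflect_def fun_eq_iff algebra_simps)
  then have "distr lborel borel (reflect e c) = distr (distr lborel borel (reflect e 0)) borel (\<lambda>x. (2 * c) *\<^sub>R e + x)"
    by (simp add: distr_distr comp_def)
  ultimately show ?thesis by (simp add: distr_lborel_plus)
qed

lemma integral_reflect:
  fixes e :: "'a::euclidean_space" and f :: "'a \<Rightarrow> real"
  assumes "norm e = 1" "f \<in> borel_measurable borel"
  shows "(LINT x|lborel. f (reflect e c x)) = (LINT x|lborel. f x)"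
  using assms by (subst distr_lborel_reflect[OF assms(1), of c, symmetric]) (simp add: integral_distr)

lemma integrable_reflect:
  fixes e :: "'a::euclidean_space" and f :: "'a \<Rightarrow> real"
  assumes e: "norm e = 1" and f: "integrable lborel f"
  shows "integrable lborel (\<lambda>x. f (reflect e c x))"
proof (rule integrable_distr[where M' = borel and f = f and T = "reflect e c"])
  show "integrable (distr lborel borel (reflect e c)) f" using f by (simp add: distr_lborel_reflect[OF e])
qed simp

lemma distr_pair_reflect:
  fixes e :: "'a::euclidean_space"
  assumes e: "norm e = 1"
  shows "distr (lborel \<Otimes>\<^sub>M lborel) (borel \<Otimes>\<^sub>M borel) (\<lambda>(x :: 'b::euclidean_space, y). (x, reflect e c y)) = lborel \<Otimes>\<^sub>M lborel"
    and "distr (lborel \<Otimes>\<^sub>M lborel) (borel \<Otimes>\<^sub>M borel) (\<lambda>(x, y :: 'b). (reflect e c x, y)) = lborel \<Otimes>\<^sub>M lborel"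
proof -
  have i: "distr lborel borel (\<lambda>x. x) = (lborel :: 'b measure)"
    using distr_id2[of borel "lborel :: 'b measure"] by simp
  note s = lborel.sigma_finite_measure_axioms
  have s': "sigma_finite_measure (distr lborel borel (reflect e c))" unfolding distr_lborel_reflect[OF e] by (rule s)
  have s'': "sigma_finite_measure (distr lborel borel (\<lambda>x::'b. x))" unfolding i by (rule s)
  have "distr lborel borel (\<lambda>x::'b. x) \<Otimes>\<^sub>M distr lborel borel (reflect e c) = distr (lborel \<Otimes>\<^sub>M lborel) (borel \<Otimes>\<^sub>M borel) (\<lambda>(x, y). (x, reflect e c y))"
    by (rule pair_measure_distr[OF _ _ s']) auto
  then show "distr (lborel \<Otimes>\<^sub>M lborel) (borel \<Otimes>\<^sub>M borel) (\<lambda>(x :: 'b, y). (x, reflect e c y)) = lborel \<Otimes>\<^sub>M lborel"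
    unfolding i distr_lborel_reflect[OF e] by (rule sym)
  have "distr lborel borel (reflect e c) \<Otimes>\<^sub>M distr lborel borel (\<lambda>x::'b. x) = distr (lborel \<Otimes>\<^sub>M lborel) (borel \<Otimes>\<^sub>M borel) (\<lambda>(x, y). (reflect e c x, y))"
    by (rule pair_measure_distr[OF _ _ s'']) auto
  then show "distr (lborel \<Otimes>\<^sub>M lborel) (borel \<Otimes>\<^sub>M borel) (\<lambda>(x, y :: 'b). (reflect e c x, y)) = lborel \<Otimes>\<^sub>M lborel"
    unfolding i distr_lborel_reflect[OF e] by (rule sym)
qed

lemma integral_pair_reflect_snd:
  fixes e :: "'a::euclidean_space" and \<Phi> :: "'b::euclidean_space \<times> 'a \<Rightarrow> real"
  assumes e: "norm e = 1" and [measurable]: "\<Phi> \<in> borel_measurable (borel \<Otimes>\<^sub>M borel)"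
  shows "(LINT z|(lborel \<Otimes>\<^sub>M lborel). \<Phi> (fst z, reflect e c (snd z))) = (LINT z|(lborel \<Otimes>\<^sub>M lborel). \<Phi> z)"
    and "integrable (lborel \<Otimes>\<^sub>M lborel) \<Phi> \<Longrightarrow> integrable (lborel \<Otimes>\<^sub>M lborel) (\<lambda>z. \<Phi> (fst z, reflect e c (snd z)))"
proof -
  have T: "(\<lambda>z. (fst z, reflect e c (snd z))) = (\<lambda>(x::'b, y). (x, reflect e c y))" by auto
  have m: "(\<lambda>z. (fst z, reflect e c (snd z))) \<in> (lborel :: 'b measure) \<Otimes>\<^sub>M lborel \<rightarrow>\<^sub>M borel \<Otimes>\<^sub>M borel" by measurable
  note d = distr_pair_reflect(1)[OF e, of c, where 'b='b, folded T]
  show "(LINT z|(lborel \<Otimes>\<^sub>M lborel). \<Phi> (fst z, reflect e c (snd z))) = (LINT z|(lborel \<Otimes>\<^sub>M lborel). \<Phi> z)"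
    using integral_distr[OF m, of \<Phi>] by (simp add: d)
  show "integrable (lborel \<Otimes>\<^sub>M lborel) (\<lambda>z. \<Phi> (fst z, reflect e c (snd z)))" if "integrable (lborel \<Otimes>\<^sub>M lborel) \<Phi>"
    by (rule integrable_distr[OF m, of \<Phi>]) (simp add: d that)
qed

lemma integral_pair_reflect_fst:
  fixes e :: "'a::euclidean_space" and \<Phi> :: "'a \<times> 'b::euclidean_space \<Rightarrow> real"
  assumes e: "norm e = 1" and [measurable]: "\<Phi> \<in> borel_measurable (borel \<Otimes>\<^sub>M borel)"
  shows "(LINT z|(lborel \<Otimes>\<^sub>M lborel). \<Phi> (reflect e c (fst z), snd z)) = (LINT z|(lborel \<Otimes>\<^sub>M lborel). \<Phi> z)"
    and "integrable (lborel \<Otimes>\<^sub>M lborel) \<Phi> \<Longrightarrow> integrable (lborel \<Otimes>\<^sub>M lborel) (\<lambda>z. \<Phi> (reflect e c (fst z), snd z))"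
proof -
  have T: "(\<lambda>z. (reflect e c (fst z), snd z)) = (\<lambda>(x, y::'b). (reflect e c x, y))" by auto
  have m: "(\<lambda>z. (reflect e c (fst z), snd z)) \<in> lborel \<Otimes>\<^sub>M (lborel :: 'b measure) \<rightarrow>\<^sub>M borel \<Otimes>\<^sub>M borel" by measurable
  note d = distr_pair_reflect(2)[OF e, of c, where 'b='b, folded T]
  show "(LINT z|(lborel \<Otimes>\<^sub>M lborel). \<Phi> (reflect e c (fst z), snd z)) = (LINT z|(lborel \<Otimes>\<^sub>M lborel). \<Phi> z)"
    using integral_distr[OF m, of \<Phi>] by (simp add: d)
  show "integrable (lborel \<Otimes>\<^sub>M lborel) (\<lambda>z. \<Phi> (reflect e c (fst z), snd z))" if "integrable (lborel \<Otimes>\<^sub>M lborel) \<Phi>"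
    by (rule integrable_distr[OF m, of \<Phi>]) (simp add: d that)
qed

lemma emeasure_lborel_open_nonzero:
  fixes S :: "'a::euclidean_space set"
  assumes S: "open S" "S \<noteq> {}"
  shows "emeasure lborel S \<noteq> 0"
proof -
  obtain x r where r: "0 < r" "ball x r \<subseteq> S" using S unfolding open_contains_ball by blast
  have "0 < unit_ball_vol (real DIM('a)) * r ^ DIM('a)" using r by simp
  then have "0 < emeasure lborel (ball x r)" using r(1) by (simp add: emeasure_ball)
  also have "\<dots> \<le> emeasure lborel S" using S r(2) by (intro emeasure_mono) auto
  finally show ?thesis by simp
qed

text \<open>A violation would persist on a nonempty open set, which has positive measure.\<close>

lemma continuous_AE_nonneg:
  fixes g :: "'a::euclidean_space \<Rightarrow> real"
  assumes g: "continuous_on UNIV g" and S: "open S" and ae: "AE x in lborel. x \<in> S \<longrightarrow> 0 \<le> g x" and x: "x \<in> S"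
  shows "0 \<le> g x"
proof (rule ccontr)
  assume n: "\<not> 0 \<le> g x"
  let ?A = "S \<inter> {x. g x < 0}"
  have o: "open ?A" using g S by (intro open_Int open_Collect_less) auto
  have "AE y in lborel. y \<notin> ?A" using ae by eventually_elim auto
  then have "emeasure lborel ?A = 0"
    using o by (subst (asm) AE_iff_measurable[where N = ?A]) auto
  moreover have "x \<in> ?A" using n x by simp
  ultimately show False using emeasure_lborel_open_nonzero[OF o] by blast
qed

lemma continuous_AE_eq:
  fixes f g :: "'a::euclidean_space \<Rightarrow> real"
  assumes f: "continuous_on UNIV f" and g: "continuous_on UNIV g" and ae: "AE x in lborel. f x = g x"
  shows "f = g"
proof
  fix x
  have c: "continuous_on UNIV (\<lambda>x. f x - g x)" "continuous_on UNIV (\<lambda>x. g x - f x)" by (intro continuous_intros f g)+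
  have "0 \<le> f x - g x"
    by (rule continuous_AE_nonneg[OF c(1), of UNIV]) (use ae in \<open>auto elim!: eventually_mono\<close>)
  moreover have "0 \<le> g x - f x"
    by (rule continuous_AE_nonneg[OF c(2), of UNIV]) (use ae in \<open>auto elim!: eventually_mono\<close>)
  ultimately show "f x = g x" by simp
qed

section \<open>Regularity and decay of the minimizer\<close>

context profile
begin

text \<open>The continuous representative of \<open>f\<close>; the reflection arguments compare
  values at points and therefore work with \<open>F\<close>.\<close>

definition F where "F = R (\<lambda>y. h (U y))"

lemma regularity:
  shows F_cont: "uniformly_continuous_on UNIV F" and U_cont: "uniformly_continuous_on UNIV U"
    and U_eq: "U = R F" and AE_f_F: "AE x in lborel. f x = F x"
    and bounded_ex: "\<exists>M. \<forall>x. \<bar>U x\<bar> \<le> M \<and> \<bar>F x\<bar> \<le> M \<and> \<bar>h (U x)\<bar> \<le> M"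
proof -
  obtain C where C: "0 \<le> C" "AE x in lborel. U x \<le> C" by (rule U_AE_bounded)
  \<comment> \<open>\<open>U\<close> is so far bounded only almost everywhere. The truncation is
    bounded at every point and differs from \<open>h (U y)\<close> on a null set, so it has the same
    convolution.\<close>
  define g where "g y = h (min (U y) C)" for y
  have [measurable]: "g \<in> borel_measurable borel" unfolding g_def by measurable
  have g0: "0 \<le> g y" for y using h_nonneg U_nonneg C by (simp add: g_def)
  have gb: "\<bar>g y\<bar> \<le> h C" for y using g0[of y] h_mono[of "min (U y) C" C] U_nonneg[of y] C by (simp add: g_def)
  have ge: "AE y in lborel. g y = h (U y)" using C(2) by eventually_elim (simp add: g_def min_def)
  have Fg: "F = R g" unfolding F_def by (rule conv_cong_AE) (use ge in auto)
  show Fc: "uniformly_continuous_on UNIV F" unfolding Fg by (rule conv_bessel_continuous[OF b_pos _ gb]) measurable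
  have F0: "0 \<le> F x" for x
    unfolding Fg conv_def using bessel_nonneg g0 by (intro integral_nonneg_AE AE_I2 mult_nonneg_nonneg) auto
  have Fb: "\<bar>F x\<bar> \<le> h C * integral\<^sup>L lborel (bessel b :: real ^ 'n \<Rightarrow> real)" for x unfolding Fg by (rule conv_bounded) (auto simp: gb)
  have "AE y in lborel. ennreal (g y) = ennreal (h (U y))" using ge by eventually_elim simp
  then have "nn_conv (bessel b) (\<lambda>y. ennreal (g y)) = nn_conv (bessel b) (\<lambda>y. ennreal (h (U y)))"
    by (rule nn_conv_cong_AE)
  moreover have "ennreal (F x) = nn_conv (bessel b) (\<lambda>y. ennreal (g y)) x" for x
    unfolding Fg by (intro ennreal_conv conv_bounded_integrable[where M = "h C"] g0 gb) measurable
  ultimately show fF: "AE x in lborel. f x = F x"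
    using Euler_Lagrange
  proof -
    assume a: "nn_conv (bessel b) (\<lambda>y. ennreal (g y)) = nn_conv (bessel b) (\<lambda>y. ennreal (h (U y)))"
      "\<And>x. ennreal (F x) = nn_conv (bessel b) (\<lambda>y. ennreal (g y)) x"
    show ?thesis using Euler_Lagrange
    proof eventually_elim
      case (elim x)
      then have "ennreal (f x) = ennreal (F x)" using a by simp
      then show ?case using f_nonneg[of x] F0[of x] by simp
    qed
  qed
  have [measurable]: "F \<in> borel_measurable borel" unfolding Fg by measurable
  show Ue: "U = R F" unfolding U_def by (rule conv_cong_AE) (use fF in auto)
  show Uc: "uniformly_continuous_on UNIV U" unfolding Ue by (rule conv_bessel_continuous[OF b_pos _ Fb]) measurable
  define M where "M = h C * integral\<^sup>L lborel (bessel b :: real ^ 'n \<Rightarrow> real)"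
  have Ub: "\<bar>U x\<bar> \<le> M * integral\<^sup>L lborel (bessel b :: real ^ 'n \<Rightarrow> real)" for x
    unfolding Ue by (rule conv_bounded) (auto simp: Fb M_def)
  define M' where "M' = M * integral\<^sup>L lborel (bessel b :: real ^ 'n \<Rightarrow> real)"
  have "\<bar>h (U x)\<bar> \<le> h M'" for x
    using h_mono[of "U x" M'] h_nonneg[of "U x"] U_nonneg[of x] Ub[of x] by (simp add: M'_def)
  then show "\<exists>M. \<forall>x. \<bar>U x\<bar> \<le> M \<and> \<bar>F x\<bar> \<le> M \<and> \<bar>h (U x)\<bar> \<le> M"
    using Ub Fb by (intro exI[of _ "max (h M') (max M M')"] allI conjI) (auto simp: M'_def M_def le_max_iff_disj)
qed

lemma F_continuous: "continuous_on UNIV F" and U_continuous: "continuous_on UNIV U"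
  using F_cont U_cont by (auto intro: uniformly_continuous_imp_continuous)

lemma F_meas [measurable]: "F \<in> borel_measurable borel"
  by (rule borel_measurable_continuous_onI[OF F_continuous])

lemma F_nonneg: "0 \<le> F x"
  unfolding F_def conv_def using bessel_nonneg h_nonneg U_nonneg by (intro integral_nonneg_AE AE_I2 mult_nonneg_nonneg) auto

lemma F_sq: "sq_integrable F"
  by (rule sq_integrable_cong_AE[OF f_sq F_meas]) (use AE_f_F in \<open>auto elim!: eventually_mono\<close>)

lemma E_F: "E F = m" and norm_F: "(LINT x|lborel. \<bar>R F x\<bar> powr p) = 1"
proof -
  have e: "R F = R f" using U_eq by (simp add: U_def)
  have "(LINT x|lborel. (F x)\<^sup>2) = (LINT x|lborel. (f x)\<^sup>2)"
    by (rule integral_cong_AE) (use AE_f_F in \<open>auto elim!: eventually_mono\<close>)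
  then show "E F = m" using f_min by (simp add: E_def e)
  show "(LINT x|lborel. \<bar>R F x\<bar> powr p) = 1" using f_norm by (simp add: e)
qed

text \<open>A single zero would force \<open>F\<close> to vanish almost everywhere, because the
  kernel is positive off the origin.\<close>

lemma U_pos: "0 < U x"
proof -
  obtain M where M: "\<And>x. \<bar>F x\<bar> \<le> M" using bounded_ex by blast
  have "U x \<noteq> 0"
  proof
    assume "U x = 0"
    then have "(LINT y|lborel. bessel b (x - y) * F y) = 0" by (simp add: U_eq conv_def)
    then have "AE y in lborel. bessel b (x - y) * F y = 0"
      using conv_bounded_integrable[OF F_meas M, of x] bessel_nonneg F_nonneg
      by (subst (asm) integral_nonneg_eq_0_iff_AE) (auto intro!: AE_I2 mult_nonneg_nonneg)
    then have "AE y in lborel. F y = 0"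
      using AE_lborel_singleton[of x]
    proof eventually_elim
      case (elim y)
      have "0 < bessel b (x - y)" using elim(2) by (intro bessel_pos[OF b_pos]) simp
      then show ?case using elim(1) by simp
    qed
    then have "AE y in lborel. f y = 0" using AE_f_F by eventually_elim simp
    then show False using f_nz by simp
  qed
  then show ?thesis using U_nonneg[of x] by simp
qed

text \<open>Uniform continuity keeps \<open>U\<close> above \<open>\<epsilon> / 2\<close> on a ball
  of fixed radius around any point with value at least \<open>\<epsilon>\<close>; far out, the tail
  of the square integral is too small for this.\<close>

lemma U_vanishes:
  assumes \<epsilon>: "0 < \<epsilon>"
  obtains r where "\<And>x. r < norm x \<Longrightarrow> U x < \<epsilon>"
proof -
  obtain \<delta> where \<delta>: "0 < \<delta>" "\<And>x y. dist y x < \<delta> \<Longrightarrow> dist (U y) (U x) < \<epsilon> / 2"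
    using U_cont \<epsilon> unfolding uniformly_continuous_on_def by (metis UNIV_I half_gt_zero)
  define V where "V = measure lborel (ball (0 :: real ^ 'n) \<delta>)"
  have V: "0 < V"
    using \<delta>(1) unfolding V_def by (simp add: emeasure_ball measure_def)
  have "(\<lambda>k. LINT x|lborel. indicator {x :: real ^ 'n. real k < norm x} x * (U x)\<^sup>2) \<longlonglongrightarrow> (LINT x::real ^ 'n|lborel. (0::real))"
  proof (rule integral_dominated_convergence[OF _ _ sq_integrable_square[OF U_sq]])
    show "AE x in lborel. (\<lambda>k. indicator {x :: real ^ 'n. real k < norm x} x * (U x)\<^sup>2) \<longlonglongrightarrow> 0"
    proof (intro AE_I2 tendsto_eventually)
      fix x :: "real ^ 'n"
      have "\<forall>\<^sub>F k in sequentially. norm x \<le> real k"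
        using filterlim_real_sequentially unfolding filterlim_at_top by blast
      then show "\<forall>\<^sub>F k in sequentially. indicator {x :: real ^ 'n. real k < norm x} x * (U x)\<^sup>2 = 0"
        by eventually_elim (auto simp: indicator_def)
    qed
    show "AE x in lborel. norm (indicator {x :: real ^ 'n. real k < norm x} x * (U x)\<^sup>2) \<le> (U x)\<^sup>2" for k
      by (auto simp: indicator_def)
  qed measurable
  then have "(\<lambda>k. LINT x|lborel. indicator {x :: real ^ 'n. real k < norm x} x * (U x)\<^sup>2) \<longlonglongrightarrow> 0" by simp
  then have "\<forall>\<^sub>F k in sequentially. (LINT x|lborel. indicator {x :: real ^ 'n. real k < norm x} x * (U x)\<^sup>2) < (\<epsilon> / 2)\<^sup>2 * V"
    using \<epsilon> V by (intro order_tendstoD(2)) auto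
  then obtain k :: nat where k: "(LINT x|lborel. indicator {x :: real ^ 'n. real k < norm x} x * (U x)\<^sup>2) < (\<epsilon> / 2)\<^sup>2 * V"
    unfolding eventually_sequentially by blast
  show ?thesis
  proof (rule that[of "real k + \<delta>"], rule ccontr)
    fix x :: "real ^ 'n" assume x: "real k + \<delta> < norm x" "\<not> U x < \<epsilon>"
    \<comment> \<open>\<open>V\<close> was defined with a ball at the origin; here it is the volume
      of the ball of the same radius around \<open>x\<close>.\<close>
    have "(\<epsilon> / 2)\<^sup>2 * V = (LINT y|lborel. (\<epsilon> / 2)\<^sup>2 * indicator (ball x \<delta>) y)"
      unfolding V_def using content_ball_conv_unit_ball[of \<delta> x] content_ball_conv_unit_ball[of \<delta> "0::real ^ 'n"] \<delta>(1) by simp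
    also have "\<dots> \<le> (LINT y|lborel. indicator {x :: real ^ 'n. real k < norm x} y * (U y)\<^sup>2)"
    proof (rule integral_mono)
      show "integrable lborel (\<lambda>y. (\<epsilon> / 2)\<^sup>2 * indicator (ball x \<delta>) y)"
        by (intro integrable_mult_right integrable_real_indicator) (simp_all add: emeasure_lborel_ball_finite[unfolded infinity_ennreal_def])
      show "integrable lborel (\<lambda>y. indicator {x :: real ^ 'n. real k < norm x} y * (U y)\<^sup>2)"
        using integrable_mult_indicator[OF _ sq_integrable_square[OF U_sq], of "{x :: real ^ 'n. real k < norm x}"] by simp
      fix y
      show "(\<epsilon> / 2)\<^sup>2 * indicator (ball x \<delta>) y \<le> indicator {x :: real ^ 'n. real k < norm x} y * (U y)\<^sup>2"
      proof (cases "y \<in> ball x \<delta>")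
        case True
        then have d: "dist x y < \<delta>" by simp
        have "norm x \<le> norm y + dist x y" by (simp add: dist_norm norm_triangle_sub)
        then have "real k < norm y" using d x(1) by simp
        moreover have "\<epsilon> / 2 \<le> U y"
          using \<delta>(2)[of x y] d x(2) unfolding dist_real_def dist_commute[of x y] by linarith
        then have "(\<epsilon> / 2)\<^sup>2 \<le> (U y)\<^sup>2" using \<epsilon> by (intro power_mono) auto
        ultimately show ?thesis using True by simp
      qed simp
    qed
    finally show False using k by simp
  qed
qed

lemma U_max: obtains x0 where "\<And>x. U x \<le> U x0"
proof -
  obtain r where r: "\<And>x. r < norm x \<Longrightarrow> U x < U 0" using U_vanishes[OF U_pos[of 0]] by blast
  have "\<exists>x0\<in>cball 0 (max r 0). \<forall>x\<in>cball 0 (max r 0). U x \<le> U x0"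
    using U_continuous by (intro continuous_attains_sup) (auto intro: continuous_on_subset)
  then obtain x0 where x0: "\<And>x. norm x \<le> max r 0 \<Longrightarrow> U x \<le> U x0" unfolding mem_cball_0 Ball_def by blast
  have "U x \<le> U x0" for x
  proof (cases "norm x \<le> max r 0")
    case False
    then have "U x < U 0" by (intro r) simp
    also have "U 0 \<le> U x0" by (intro x0) simp
    finally show ?thesis by simp
  qed (rule x0)
  then show ?thesis using that by blast
qed

end

section \<open>Polarization\<close>

text \<open>Two-point rearrangement: of the two values at mirror points the larger goes to the open
  half space. On the hyperplane itself both values coincide.\<close>

definition polarize :: "'a::real_inner \<Rightarrow> real \<Rightarrow> ('a \<Rightarrow> real) \<Rightarrow> 'a \<Rightarrow> real" where
  "polarize e c g x = (if c < x \<bullet> e then max (g x) (g (reflect e c x)) else min (g x) (g (reflect e c x)))"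

lemma polarize_meas [measurable]:
  fixes g :: "'a::euclidean_space \<Rightarrow> real"
  assumes [measurable]: "g \<in> borel_measurable borel"
  shows "polarize e c g \<in> borel_measurable borel"
  unfolding polarize_def by measurable

lemma polarize_cases:
  assumes e: "norm e = 1"
  shows "polarize e c g x = g x \<and> polarize e c g (reflect e c x) = g (reflect e c x) \<or>
    polarize e c g x = g (reflect e c x) \<and> polarize e c g (reflect e c x) = g x"
proof -
  have "x \<bullet> e = c \<Longrightarrow> reflect e c x = x" by (simp add: reflect_def)
  then show ?thesis
    using reflect_inner[OF e, of c x] reflect_reflect[OF e, of c x]
    by (cases "x \<bullet> e" c rule: linorder_cases) (auto simp: polarize_def max_def min_def)
qed

lemma polarize_nonneg: "(\<And>x. 0 \<le> g x) \<Longrightarrow> 0 \<le> polarize e c g x"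
  by (simp add: polarize_def le_max_iff_disj)

lemma polarize_mono:
  assumes "\<And>x y. g x \<le> g y \<Longrightarrow> \<phi> (g x) \<le> \<phi> (g y)"
  shows "polarize e c (\<lambda>x. \<phi> (g x)) x = \<phi> (polarize e c g x)"
  using assms[of x "reflect e c x"] assms[of "reflect e c x" x]
  by (auto simp: polarize_def max_def min_def intro: antisym)

text \<open>Polarization only permutes the values at mirror points, so the integrand summed with its
  reflection is unchanged.\<close>

lemma integral_polarize:
  fixes g :: "'a::euclidean_space \<Rightarrow> real" and \<phi> :: "real \<Rightarrow> real"
  assumes e: "norm e = 1" and [measurable]: "g \<in> borel_measurable borel" "\<phi> \<in> borel_measurable borel"
    and i: "integrable lborel (\<lambda>x. \<phi> (g x))"
  shows "integrable lborel (\<lambda>x. \<phi> (polarize e c g x))"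
    and "(LINT x|lborel. \<phi> (polarize e c g x)) = (LINT x|lborel. \<phi> (g x))"
proof -
  note ir = integrable_reflect[OF e i, of c]
  show ip: "integrable lborel (\<lambda>x. \<phi> (polarize e c g x))"
  proof (rule Bochner_Integration.integrable_bound)
    show "integrable lborel (\<lambda>x. \<bar>\<phi> (g x)\<bar> + \<bar>\<phi> (g (reflect e c x))\<bar>)" using i ir by simp
    show "AE x in lborel. norm (\<phi> (polarize e c g x)) \<le> norm (\<bar>\<phi> (g x)\<bar> + \<bar>\<phi> (g (reflect e c x))\<bar>)"
      using polarize_cases[OF e, of c g] by (intro AE_I2) (smt (verit) real_norm_def)
  qed measurable
  have "2 * (LINT x|lborel. \<phi> (polarize e c g x)) = (LINT x|lborel. \<phi> (polarize e c g x) + \<phi> (polarize e c g (reflect e c x)))"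
    using ip integrable_reflect[OF e ip, of c] integral_reflect[OF e, of "\<lambda>x. \<phi> (polarize e c g x)" c] by simp
  also have "\<dots> = (LINT x|lborel. \<phi> (g x) + \<phi> (g (reflect e c x)))"
    using polarize_cases[OF e, of c g] by (intro Bochner_Integration.integral_cong) (smt (verit))+
  also have "\<dots> = 2 * (LINT x|lborel. \<phi> (g x))"
    using i ir integral_reflect[OF e, of "\<lambda>x. \<phi> (g x)" c] by simp
  finally show "(LINT x|lborel. \<phi> (polarize e c g x)) = (LINT x|lborel. \<phi> (g x))" by simp
qed

lemma sq_integrable_polarize:
  fixes g :: "'a::euclidean_space \<Rightarrow> real"
  assumes "norm e = 1" "sq_integrable g"
  shows "sq_integrable (polarize e c g)"
  using integral_polarize(1)[of e g "\<lambda>s. s\<^sup>2" c] assms by (auto simp: sq_integrable_def)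

section \<open>The rearrangement inequality for one polarization\<close>

lemma AE_lborel_pair_neq:
  fixes T :: "'a::euclidean_space \<Rightarrow> 'a"
  assumes [measurable]: "T \<in> borel_measurable borel"
  shows "AE z in lborel \<Otimes>\<^sub>M lborel. snd z \<noteq> T (fst z)"
proof (rule lborel_pair.AE_pair_measure)
  show "{z \<in> space (lborel \<Otimes>\<^sub>M lborel). snd z \<noteq> T (fst z)} \<in> sets (lborel \<Otimes>\<^sub>M lborel)" by measurable
  show "AE x in lborel. AE y in lborel. snd (x, y) \<noteq> T (fst (x, y))"
    by (rule AE_I2) (simp add: AE_lborel_singleton)
qed

lemma bessel_reflect_less:
  fixes x y :: "'a::euclidean_space"
  assumes e: "norm e = 1" and b: "0 < b"
  shows "x \<noteq> y \<Longrightarrow> 0 < (x \<bullet> e - c) * (y \<bullet> e - c) \<Longrightarrow> bessel b (x - reflect e c y) < bessel b (x - y)"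
    and "x \<noteq> reflect e c y \<Longrightarrow> (x \<bullet> e - c) * (y \<bullet> e - c) < 0 \<Longrightarrow> bessel b (x - y) < bessel b (x - reflect e c y)"
  using norm_less_reflect_iff[OF e, where x = x and y = y and c = c] by (auto intro!: bessel_strict_antimono b)

lemma bessel_reflect_eq:
  fixes x y :: "'a::euclidean_space"
  assumes e: "norm e = 1"
  shows "bessel b (reflect e c x - y) = bessel b (x - reflect e c y)"
    and "bessel b (reflect e c x - reflect e c y) = bessel b (x - y)"
proof -
  show "bessel b (reflect e c x - y) = bessel b (x - reflect e c y)" for y :: 'a
    by (intro bessel_cong_norm norm_reflect_diff e)
  from this[of "reflect e c y"] show "bessel b (reflect e c x - reflect e c y) = bessel b (x - y)"
    by (simp add: reflect_reflect[OF e])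
qed

text \<open>The integrand is summed over the four pairs obtained by reflecting either variable. The
  sum factors into a kernel difference and a gain of the rearrangement, both positive or zero on the
  same side and of opposite orientation across; equality forces the gain to vanish.\<close>

lemma polarize_form:
  fixes F G :: "'a::euclidean_space \<Rightarrow> real" and c :: real
  assumes e: "norm e = 1" and b: "0 < b" and F: "sq_integrable F" and G: "sq_integrable G"
  defines "PF \<equiv> polarize e c F" and "PG \<equiv> polarize e c G"
  shows "(LINT x|lborel. F x * conv (bessel b) G x) \<le> (LINT x|lborel. PF x * conv (bessel b) PG x)"
    and "(LINT x|lborel. F x * conv (bessel b) G x) = (LINT x|lborel. PF x * conv (bessel b) PG x) \<Longrightarrow>
      AE z in lborel \<Otimes>\<^sub>M lborel. c < fst z \<bullet> e \<and> c < snd z \<bullet> e \<longrightarrow>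
        0 \<le> (F (fst z) - F (reflect e c (fst z))) * (G (snd z) - G (reflect e c (snd z)))"
proof -
  interpret k: even_kernel "bessel b :: 'a \<Rightarrow> real" by (rule even_kernel_bessel[OF b])
  let ?k = "bessel b :: 'a \<Rightarrow> real" and ?s = "reflect e c"
  have PF: "sq_integrable PF" and PG: "sq_integrable PG"
    unfolding PF_def PG_def by (rule sq_integrable_polarize[OF e F], rule sq_integrable_polarize[OF e G])
  have [measurable]: "F \<in> borel_measurable borel" "G \<in> borel_measurable borel" "PF \<in> borel_measurable borel" "PG \<in> borel_measurable borel"
    using F G PF PG by auto
  define W where "W z = ?k (fst z - snd z) * (PF (fst z) * PG (snd z) - F (fst z) * G (snd z))" for z
  have Wm [measurable]: "W \<in> borel_measurable (borel \<Otimes>\<^sub>M borel)" unfolding W_def by measurable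
  note i1 = k.kernel_form_integrable[OF PG PF] and i2 = k.kernel_form_integrable[OF G F]
  have W_eq: "W = (\<lambda>z. (case z of (x, y) \<Rightarrow> ?k (x - y) * (PF x * PG y)) - (case z of (x, y) \<Rightarrow> ?k (x - y) * (F x * G y)))"
    by (auto simp: W_def fun_eq_iff right_diff_distrib)
  have Wi: "integrable (lborel \<Otimes>\<^sub>M lborel) W" unfolding W_eq by (rule Bochner_Integration.integrable_diff[OF i1 i2])
  define T where "T = (LINT x|lborel. PF x * conv ?k PG x) - (LINT x|lborel. F x * conv ?k G x)"
  have T: "T = integral\<^sup>L (lborel \<Otimes>\<^sub>M lborel) W"
    unfolding T_def k.integral_conv_eq(1)[OF PG PF] k.integral_conv_eq(1)[OF G F] W_eq
    by (rule Bochner_Integration.integral_diff[OF i1 i2, symmetric])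
  define W2 where "W2 z = W (fst z, ?s (snd z))" for z
  have [measurable]: "W2 \<in> borel_measurable (borel \<Otimes>\<^sub>M borel)" unfolding W2_def by measurable
  have W2: "integrable (lborel \<Otimes>\<^sub>M lborel) W2" "integral\<^sup>L (lborel \<Otimes>\<^sub>M lborel) W2 = T"
    unfolding W2_def T using integral_pair_reflect_snd[OF e Wm, of c] Wi by auto
  \<comment> \<open>All four summands have the same integral, so \<open>Q\<close> integrates to
    \<open>4 * T\<close>, and unlike \<open>W\<close> it has a sign.\<close>
  define Q where "Q z = W z + W (?s (fst z), snd z) + (W2 z + W2 (?s (fst z), snd z))" for z
  note r = integral_pair_reflect_fst[OF e, of W c] integral_pair_reflect_fst[OF e, of W2 c]
  have Qi: "integrable (lborel \<Otimes>\<^sub>M lborel) Q" and Q: "integral\<^sup>L (lborel \<Otimes>\<^sub>M lborel) Q = 4 * T"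
    unfolding Q_def using r Wi W2 T by auto
  have Q_eq: "Q (x, y) = (?k (x - y) - ?k (x - ?s y)) *
      (PF x * PG y + PF (?s x) * PG (?s y) - (F x * G y + F (?s x) * G (?s y)))" for x y
  proof -
    \<comment> \<open>Polarization preserves the sum over a mirror pair, so the gain of the crossed
      products is the negative of the gain of the parallel ones.\<close>
    have "PF x + PF (?s x) = F x + F (?s x)" "PG y + PG (?s y) = G y + G (?s y)"
      using polarize_cases[OF e, of c F x] polarize_cases[OF e, of c G y] by (auto simp: PF_def PG_def)
    then have "(PF x + PF (?s x)) * (PG y + PG (?s y)) = (F x + F (?s x)) * (G y + G (?s y))" by simp
    then have z: "PF x * PG (?s y) + PF (?s x) * PG y - (F x * G (?s y) + F (?s x) * G y)
        = - (PF x * PG y + PF (?s x) * PG (?s y) - (F x * G y + F (?s x) * G (?s y)))"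
      by (simp add: algebra_simps)
    have "Q (x, y) = ?k (x - y) * (PF x * PG y + PF (?s x) * PG (?s y) - (F x * G y + F (?s x) * G (?s y)))
      + ?k (x - ?s y) * (PF x * PG (?s y) + PF (?s x) * PG y - (F x * G (?s y) + F (?s x) * G y))"
      by (simp add: Q_def W2_def W_def bessel_reflect_eq[OF e] reflect_reflect[OF e] algebra_simps)
    then show ?thesis unfolding z by (simp add: algebra_simps)
  qed
  define D where "D x y = (F x - F (?s x)) * (G y - G (?s y))" for x y
  \<comment> \<open>On the same side the larger values are paired with each other. The gain is zero
    when both functions are already ordered alike and the negative of the product of differences
    otherwise.\<close>
  have S: "PF x * PG y + PF (?s x) * PG (?s y) - (F x * G y + F (?s x) * G (?s y)) = max 0 (- D x y)"
    if "0 < (x \<bullet> e - c) * (y \<bullet> e - c)" for x y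
  proof -
    have xy: "c < x \<bullet> e \<and> c < y \<bullet> e \<or> x \<bullet> e < c \<and> y \<bullet> e < c"
      using that by (auto simp: zero_less_mult_iff)
    have o: "c < ?s x \<bullet> e \<longleftrightarrow> x \<bullet> e < c" "c < ?s y \<bullet> e \<longleftrightarrow> y \<bullet> e < c"
      using reflect_inner[OF e, of c x] reflect_inner[OF e, of c y] by auto
    have m: "max a a' * max g g' + min a a' * min g g' - (a * g + a' * g') = max 0 (- ((a - a') * (g - g')))" for a a' g g' :: real
    proof -
      have "max a a' * max g g' + min a a' * min g g' - (a * g + a' * g') = (if a \<le> a' \<longleftrightarrow> g \<le> g' then 0 else - ((a - a') * (g - g')))"
        by (auto simp: max_def min_def algebra_simps)
      moreover have "a \<le> a' \<longleftrightarrow> g \<le> g' \<Longrightarrow> 0 \<le> (a - a') * (g - g')" "\<not> (a \<le> a' \<longleftrightarrow> g \<le> g') \<Longrightarrow> (a - a') * (g - g') \<le> 0"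
        by (auto simp: zero_le_mult_iff mult_le_0_iff)
      ultimately show ?thesis by (cases "a \<le> a' \<longleftrightarrow> g \<le> g'") simp_all
    qed
    show ?thesis using xy m[of "F x" "F (?s x)" "G y" "G (?s y)"]
      by (auto simp: PF_def PG_def polarize_def reflect_reflect[OF e] o D_def max.commute min.commute algebra_simps)
  qed
  \<comment> \<open>Across the hyperplane a larger value meets a smaller one, and the kernel
    difference has the opposite sign as well.\<close>
  have S': "PF x * PG y + PF (?s x) * PG (?s y) - (F x * G y + F (?s x) * G (?s y)) \<le> 0"
    if "(x \<bullet> e - c) * (y \<bullet> e - c) < 0" for x y
  proof -
    have xy: "c < x \<bullet> e \<and> y \<bullet> e < c \<or> x \<bullet> e < c \<and> c < y \<bullet> e"
      using that by (auto simp: mult_less_0_iff)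
    have o: "c < ?s x \<bullet> e \<longleftrightarrow> x \<bullet> e < c" "c < ?s y \<bullet> e \<longleftrightarrow> y \<bullet> e < c"
      using reflect_inner[OF e, of c x] reflect_inner[OF e, of c y] by auto
    have m: "max a a' * min g g' + min a a' * max g g' \<le> a * g + a' * g'" for a a' g g' :: real
      using mult_nonneg_nonneg[of "a - a'" "g - g'"] mult_nonneg_nonneg[of "a' - a" "g' - g"]
      by (cases "a \<le> a'"; cases "g \<le> g'") (auto simp: max_def min_def algebra_simps)
    show ?thesis using xy m[of "F x" "F (?s x)" "G y" "G (?s y)"]
      by (auto simp: PF_def PG_def polarize_def reflect_reflect[OF e] o max.commute min.commute algebra_simps)
  qed
  have Q0: "0 \<le> Q (x, y)" if "x \<noteq> y" "x \<noteq> ?s y" for x y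
  proof (cases "(x \<bullet> e - c) * (y \<bullet> e - c)" "0 :: real" rule: linorder_cases)
    case less
    then show ?thesis unfolding Q_eq using S'[OF less] bessel_reflect_less(2)[OF e b that(2) less]
      by (intro mult_nonpos_nonpos) auto
  next
    case equal
    then have "?k (x - y) = ?k (x - ?s y)"
      using norm_less_reflect_iff[OF e, where x = x and y = y and c = c] by (intro bessel_cong_norm) auto
    then show ?thesis by (simp add: Q_eq)
  next
    case greater
    then show ?thesis unfolding Q_eq S[OF greater] using bessel_reflect_less(1)[OF e b that(1) greater]
      by (intro mult_nonneg_nonneg) auto
  qed
  \<comment> \<open>The diagonal and its mirror image are null sets; they are removed because the
    kernel at the origin may carry its default value.\<close>
  have ae: "AE z in lborel \<Otimes>\<^sub>M lborel. fst z \<noteq> snd z \<and> fst z \<noteq> ?s (snd z)"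
    using AE_lborel_pair_neq[of "\<lambda>x. x :: 'a", simplified] AE_lborel_pair_neq[of ?s, OF reflect_meas]
    by (auto elim!: eventually_elim2 simp: reflect_reflect[OF e])
  then have Qae: "AE z in lborel \<Otimes>\<^sub>M lborel. 0 \<le> Q z"
    by eventually_elim (metis Q0 prod.collapse)
  then have "0 \<le> 4 * T" unfolding Q[symmetric] by (rule integral_nonneg_AE)
  then show "(LINT x|lborel. F x * conv ?k G x) \<le> (LINT x|lborel. PF x * conv ?k PG x)" by (simp add: T_def)
  assume "(LINT x|lborel. F x * conv ?k G x) = (LINT x|lborel. PF x * conv ?k PG x)"
  then have "integral\<^sup>L (lborel \<Otimes>\<^sub>M lborel) Q = 0" unfolding Q by (simp add: T_def)
  then have "AE z in lborel \<Otimes>\<^sub>M lborel. Q z = 0" using integral_nonneg_eq_0_iff_AE[OF Qi Qae] by simp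
  then show "AE z in lborel \<Otimes>\<^sub>M lborel. c < fst z \<bullet> e \<and> c < snd z \<bullet> e \<longrightarrow>
        0 \<le> (F (fst z) - F (?s (fst z))) * (G (snd z) - G (?s (snd z)))"
    using ae
  proof eventually_elim
    case (elim z)
    show ?case
    proof
      assume "c < fst z \<bullet> e \<and> c < snd z \<bullet> e"
      then have g: "0 < (fst z \<bullet> e - c) * (snd z \<bullet> e - c)" by simp
      have "fst z \<noteq> snd z" using elim by simp
      then have "max 0 (- D (fst z) (snd z)) = 0"
        using bessel_reflect_less(1)[OF e b _ g] elim(1) Q_eq[of "fst z" "snd z"] S[OF g] by auto
      then show "0 \<le> (F (fst z) - F (?s (fst z))) * (G (snd z) - G (?s (snd z)))"
        unfolding D_def by linarith
    qed
  qed
qed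

text \<open>A strong maximum principle in integral form: one point of strict inequality in the half
  space gives, by continuity, an open set of them, and the strictly decreasing kernel transmits this
  to every \<open>x\<close> of the half space.\<close>

lemma conv_bessel_reflect_less:
  fixes V :: "'a::euclidean_space \<Rightarrow> real" and c :: real
  assumes e: "norm e = 1" and b: "0 < b" and V: "continuous_on UNIV V" and M: "\<And>x. \<bar>V x\<bar> \<le> M"
    and le: "\<And>y. c < y \<bullet> e \<Longrightarrow> V (reflect e c y) \<le> V y" and x: "c < x \<bullet> e" and y: "c < y \<bullet> e" "V (reflect e c y) < V y"
  shows "conv (bessel b) V (reflect e c x) < conv (bessel b) V x"
proof -
  interpret k: even_kernel "bessel b :: 'a \<Rightarrow> real" by (rule even_kernel_bessel[OF b])
  let ?k = "bessel b :: 'a \<Rightarrow> real" and ?s = "reflect e c"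
  have [measurable]: "V \<in> borel_measurable borel" by (rule borel_measurable_continuous_onI[OF V])
  note ss = reflect_reflect[OF e]
  have i1: "integrable lborel (\<lambda>y. ?k (x - y) * V y)" and i2: "integrable lborel (\<lambda>y. ?k (x - ?s y) * V y)"
    using k.conv_bounded_integrable[of V M x] k.conv_bounded_integrable[of V M "?s x"] M
    by (simp_all add: bessel_reflect_eq[OF e])
  note j1 = integrable_reflect[OF e i1, of c] and j2 = integrable_reflect[OF e i2, of c, unfolded ss]
  \<comment> \<open>Folding the integral over mirror pairs makes both factors change sign together
    across the hyperplane, so the product is nonnegative off \<open>x\<close> and its mirror
    image.\<close>
  define g where "g y = (?k (x - y) - ?k (x - ?s y)) * (V y - V (?s y))" for y
  have gi: "integrable lborel g" and g: "2 * (conv ?k V x - conv ?k V (?s x)) = integral\<^sup>L lborel g"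
  proof -
    have ge: "g = (\<lambda>y. (?k (x - y) * V y + ?k (x - ?s y) * V (?s y)) - (?k (x - ?s y) * V y + ?k (x - y) * V (?s y)))"
      by (auto simp: g_def fun_eq_iff algebra_simps)
    show "integrable lborel g" unfolding ge
      by (intro Bochner_Integration.integrable_diff Bochner_Integration.integrable_add i1 i2 j1 j2)
    have "integral\<^sup>L lborel g = ((LINT y|lborel. ?k (x - y) * V y) + (LINT y|lborel. ?k (x - ?s y) * V (?s y)))
        - ((LINT y|lborel. ?k (x - ?s y) * V y) + (LINT y|lborel. ?k (x - y) * V (?s y)))"
      unfolding ge using i1 i2 j1 j2 by simp
    also have "(LINT y|lborel. ?k (x - ?s y) * V (?s y)) = (LINT y|lborel. ?k (x - y) * V y)"
      using integral_reflect[OF e, of "\<lambda>y. ?k (x - y) * V y" c] by simp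
    also have "(LINT y|lborel. ?k (x - y) * V (?s y)) = (LINT y|lborel. ?k (x - ?s y) * V y)"
      using integral_reflect[OF e, of "\<lambda>y. ?k (x - ?s y) * V y" c] by (simp add: ss)
    finally show "2 * (conv ?k V x - conv ?k V (?s x)) = integral\<^sup>L lborel g"
      by (simp add: conv_def bessel_reflect_eq[OF e])
  qed
  have g0: "0 \<le> g y" if n: "y \<noteq> x" "y \<noteq> ?s x" for y
  proof (cases "y \<bullet> e" c rule: linorder_cases)
    case less
    then have n: "(x \<bullet> e - c) * (y \<bullet> e - c) < 0" using x by (simp add: mult_less_0_iff)
    have "x \<noteq> ?s y" using that(2) ss by metis
    moreover have "V y \<le> V (?s y)" using le[of "?s y"] less reflect_inner[OF e, of c y] by (simp add: ss)
    ultimately show ?thesis unfolding g_def using bessel_reflect_less(2)[OF e b _ n] by (intro mult_nonpos_nonpos) auto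
  next
    case equal
    then show ?thesis by (simp add: g_def reflect_def)
  next
    case greater
    then have "0 < (x \<bullet> e - c) * (y \<bullet> e - c)" using x by simp
    then show ?thesis unfolding g_def using bessel_reflect_less(1)[OF e b, where x = x and y = y and c = c] n(1) le[OF greater]
      by (intro mult_nonneg_nonneg) auto
  qed
  have ae: "AE y in lborel. 0 \<le> g y"
    using AE_lborel_singleton[of x] AE_lborel_singleton[of "?s x"] by eventually_elim (rule g0)
  \<comment> \<open>The point \<open>x\<close> is removed since the kernel comparison fails at the
    origin. The open set stays nonempty, as a singleton is not open.\<close>
  define A where "A = ({y. c < y \<bullet> e} \<inter> {y. V (?s y) < V y}) - {x}"
  have "open {y. V (?s y) < V y}"
    by (intro open_Collect_less V continuous_on_compose2[OF V reflect_continuous]) auto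
  moreover have "open {y. c < y \<bullet> e}" by (intro open_Collect_less continuous_intros)
  ultimately have o: "open ({y. c < y \<bullet> e} \<inter> {y. V (?s y) < V y})" by (rule open_Int[rotated])
  then have oA: "open A" unfolding A_def by (rule open_delete)
  have "A \<noteq> {}"
  proof
    assume "A = {}"
    then have "{y. c < y \<bullet> e} \<inter> {y. V (?s y) < V y} = {x}" using y by (auto simp: A_def)
    then show False using o not_open_singleton by metis
  qed
  have "emeasure lborel A \<noteq> 0"
    by (rule emeasure_lborel_open_nonzero[OF oA \<open>A \<noteq> {}\<close>])
  moreover have "0 < g y" if "y \<in> A" for y
    using that bessel_reflect_less(1)[OF e b, where x = x and y = y and c = c] x by (auto simp: g_def A_def)
  ultimately have "0 < integral\<^sup>L lborel g" using oA by (intro integral_pos_of_pos_on[OF gi ae]) auto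
  then show ?thesis using g by simp
qed

text \<open>Changing both signs keeps the hyperplane and exchanges its sides, so statements about
  one half space apply to the other.\<close>

lemma reflect_uminus: "reflect (- e) (- c) = reflect e c"
  by (simp add: reflect_def fun_eq_iff flip: scaleR_minus_left)

lemma conv_bessel_reflect:
  fixes V :: "'a::euclidean_space \<Rightarrow> real"
  assumes e: "norm e = 1" and [measurable]: "V \<in> borel_measurable borel"
  shows "conv (bessel b) V (reflect e c x) = conv (bessel b) (\<lambda>y. V (reflect e c y)) x"
  using integral_reflect[OF e, of "\<lambda>y. bessel b (x - y) * V (reflect e c y)" c]
  by (simp add: conv_def bessel_reflect_eq[OF e] reflect_reflect[OF e])

section \<open>Reflections of the minimizer and radial monotonicity\<close>

context profile
begin

lemma U_powr_sq: "sq_integrable (\<lambda>x. U x powr (p - 1))"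
proof -
  obtain M where M: "\<And>x. \<bar>U x\<bar> \<le> M" using bounded_ex by blast
  show ?thesis
  proof (rule sq_integrable_bound[OF U_sq, where C = "M powr (p - 2)"])
    show "AE x in lborel. \<bar>U x powr (p - 1)\<bar> \<le> M powr (p - 2) * \<bar>U x\<bar>"
    proof (rule AE_I2)
      fix x
      have "U x powr (p - 1) = U x powr (p - 2) * U x"
        using U_nonneg[of x] powr_mult_base[of "U x" "p - 2"] by (simp add: mult.commute)
      also have "\<dots> \<le> M powr (p - 2) * U x"
        using M[of x] U_nonneg[of x] p_gt_2 by (intro mult_right_mono powr_mono2) auto
      finally show "\<bar>U x powr (p - 1)\<bar> \<le> M powr (p - 2) * \<bar>U x\<bar>" using U_nonneg[of x] by simp
    qed
  qed measurable
qed

text \<open>Polarizing \<open>F\<close> cannot decrease the constraint functional, so by minimality the polarized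
  kernel form equals the original one, and the pointwise inequality behind it is an equality.\<close>

lemma reflect_same_sign:
  assumes e: "norm e = 1" and x: "c < x \<bullet> e" and y: "c < y \<bullet> e"
  shows "0 \<le> (U x - U (reflect e c x)) * (F y - F (reflect e c y))"
proof -
  let ?s = "reflect e c"
  define PU where "PU = polarize e c U"
  define PF where "PF = polarize e c F"
  have PF: "sq_integrable PF" and PU: "sq_integrable PU"
    unfolding PF_def PU_def by (rule sq_integrable_polarize[OF e F_sq], rule sq_integrable_polarize[OF e U_sq])
  have [measurable]: "PF \<in> borel_measurable borel" using PF by auto
  have PF0: "0 \<le> PF x" for x unfolding PF_def by (rule polarize_nonneg) (rule F_nonneg)
  have PU0: "0 \<le> PU x" for x unfolding PU_def by (rule polarize_nonneg) (rule U_nonneg)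
  define v where "v = R PF"
  have v0: "0 \<le> v x" for x
    unfolding v_def conv_def using bessel_nonneg PF0 by (intro integral_nonneg_AE AE_I2 mult_nonneg_nonneg) auto
  have v: "sq_integrable v" unfolding v_def by (rule sq_integrable_conv(1)[OF PF])
  note ineq = inequality[OF PF, folded v_def]
  have vp: "integrable lborel (\<lambda>x. v x powr p)" using ineq(1) v0 by simp
  have PUp: "integrable lborel (\<lambda>x. PU x powr p)" "(LINT x|lborel. PU x powr p) = 1"
    using integral_polarize[OF e U_meas, of "\<lambda>s. s powr p" c] U_powr_integrable norm_F
    by (simp_all add: PU_def U_nonneg flip: U_eq)
  have pol: "polarize e c (\<lambda>x. U x powr (p - 1)) = (\<lambda>x. PU x powr (p - 1))"
    unfolding PU_def using p_gt_2
    by (intro ext polarize_mono[where \<phi> = "\<lambda>s. s powr (p - 1)"] powr_mono2) (auto simp: U_nonneg)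
  have PV: "sq_integrable (\<lambda>x. PU x powr (p - 1))"
    using sq_integrable_polarize[OF e U_powr_sq, of c] by (simp add: pol)
  \<comment> \<open>The constraint is written as a pairing with \<open>R F\<close>, the form to
    which \<open>polarize_form\<close> applies.\<close>
  have "1 = (LINT x|lborel. U x powr (p - 1) * R F x)"
  proof -
    have "U x powr (p - 1) * R F x = \<bar>R F x\<bar> powr p" for x
      using U_pos[of x] powr_mult_base[of "U x" "p - 1"] by (simp add: mult.commute flip: U_eq)
    then show ?thesis using norm_F by simp
  qed
  also have "\<dots> \<le> (LINT x|lborel. PU x powr (p - 1) * v x)"
    using polarize_form(1)[OF e b_pos U_powr_sq F_sq, of c] by (simp add: pol PF_def v_def)
  finally have 1: "1 \<le> (LINT x|lborel. PU x powr (p - 1) * v x)" .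
  \<comment> \<open>Young's inequality together with the unit constraint integral of
    \<open>PU\<close> converts the lower bound for the pairing into one for the constraint integral
    of \<open>v\<close>.\<close>
  have "p * (LINT x|lborel. PU x powr (p - 1) * v x) = (LINT x|lborel. p * PU x powr (p - 1) * v x)"
    by (simp add: mult.assoc)
  also have "\<dots> \<le> (LINT x|lborel. (p - 1) * PU x powr p + v x powr p)"
    using sq_integrable_mult[OF PV v] PUp(1) vp p_gt_2 PU0 v0
    by (intro integral_mono) (auto simp: mult.assoc intro!: powr_young[unfolded mult.assoc])
  also have "\<dots> = (p - 1) + (LINT x|lborel. v x powr p)" using PUp vp by simp
  finally have "p * (LINT x|lborel. PU x powr (p - 1) * v x) \<le> (p - 1) + (LINT x|lborel. v x powr p)" .
  moreover have "p * 1 \<le> p * (LINT x|lborel. PU x powr (p - 1) * v x)" using 1 p_gt_2 by (intro mult_left_mono) auto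
  ultimately have "1 \<le> (LINT x|lborel. v x powr p)" by simp
  then have "1 \<le> (LINT x|lborel. v x powr p) powr (2 / p)" using p_gt_2 by (intro ge_one_powr_ge_zero) auto
  then have "m * 1 \<le> m * (LINT x|lborel. v x powr p) powr (2 / p)" using m_pos by (intro mult_left_mono) auto
  \<comment> \<open>\<open>F\<close> and \<open>PF\<close> have the same square norm, so the
    comparison concerns only the subtracted terms and bounds the square norm of \<open>v\<close> by
    that of \<open>U\<close>.\<close>
  then have "E F \<le> E PF" using ineq(2) v0 E_F by simp
  moreover have "(LINT x|lborel. (PF x)\<^sup>2) = (LINT x|lborel. (F x)\<^sup>2)" "(LINT x|lborel. (PU x)\<^sup>2) = (LINT x|lborel. (U x)\<^sup>2)"
    unfolding PF_def PU_def using integral_polarize(2)[OF e, of _ "\<lambda>s. s\<^sup>2" c] sq_integrable_square[OF F_sq] sq_integrable_square[OF U_sq]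
    by simp_all
  ultimately have vU: "(LINT x|lborel. (v x)\<^sup>2) \<le> (LINT x|lborel. (U x)\<^sup>2)" and PU2: "(LINT x|lborel. (PU x)\<^sup>2) = (LINT x|lborel. (U x)\<^sup>2)"
    using \<gamma>_pos by (simp_all add: E_def v_def flip: U_eq)
  \<comment> \<open>This chain ends at the unpolarized form and is the reverse of the rearrangement
    inequality for \<open>U\<close> and \<open>F\<close>; its equality case applies.\<close>
  have "(LINT x|lborel. PU x * v x) \<le> (LINT x|lborel. ((PU x)\<^sup>2 + (v x)\<^sup>2) / 2)"
    using sq_integrable_mult[OF PU v] sq_integrable_square[OF PU] sq_integrable_square[OF v]
    by (intro integral_mono) (use sum_squares_bound[of "PU _" "v _"] in \<open>simp_all add: mult_ac\<close>)
  also have "\<dots> \<le> (LINT x|lborel. (U x)\<^sup>2)"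
    using sq_integrable_square[OF PU] sq_integrable_square[OF v] vU PU2 by simp
  also have "\<dots> = (LINT x|lborel. U x * R F x)" by (simp add: power2_eq_square flip: U_eq)
  finally have "(LINT x|lborel. U x * R F x) = (LINT x|lborel. PU x * R PF x)"
    using polarize_form(1)[OF e b_pos U_sq F_sq, of c] by (simp add: PU_def PF_def v_def)
  then have "AE z in lborel \<Otimes>\<^sub>M lborel. c < fst z \<bullet> e \<and> c < snd z \<bullet> e \<longrightarrow>
        0 \<le> (U (fst z) - U (?s (fst z))) * (F (snd z) - F (?s (snd z)))"
    unfolding PU_def PF_def by (rule polarize_form(2)[OF e b_pos U_sq F_sq])
  then have ae: "AE x in lborel. AE y in lborel. c < x \<bullet> e \<and> c < y \<bullet> e \<longrightarrow> 0 \<le> (U x - U (?s x)) * (F y - F (?s y))"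
    using lborel_pair.AE_pair[of "\<lambda>z. c < fst z \<bullet> e \<and> c < snd z \<bullet> e \<longrightarrow> 0 \<le> (U (fst z) - U (?s (fst z))) * (F (snd z) - F (?s (snd z)))"] by simp
  have cs: "continuous_on UNIV (\<lambda>x. g (?s x))" if "continuous_on UNIV g" for g :: "real ^ 'n \<Rightarrow> real"
    by (rule continuous_on_compose2[OF that reflect_continuous]) auto
  have oH: "open {y. c < y \<bullet> e}" by (intro open_Collect_less continuous_intros)
  \<comment> \<open>Continuity removes the exceptional null sets one variable at a time, first in
    \<open>y\<close> and then in \<open>x\<close>.\<close>
  from ae have "AE x in lborel. c < x \<bullet> e \<longrightarrow> 0 \<le> (U x - U (?s x)) * (F y - F (?s y))"
  proof eventually_elim
    case (elim x)
    show ?case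
    proof
      assume x: "c < x \<bullet> e"
      have "continuous_on UNIV (\<lambda>y. (U x - U (?s x)) * (F y - F (?s y)))"
        by (intro continuous_on_mult continuous_on_diff continuous_on_const F_continuous cs[OF F_continuous])
      then show "0 \<le> (U x - U (?s x)) * (F y - F (?s y))"
        by (rule continuous_AE_nonneg[OF _ oH]) (use elim x y in auto)
    qed
  qed
  moreover have "continuous_on UNIV (\<lambda>x. (U x - U (?s x)) * (F y - F (?s y)))"
    by (intro continuous_on_mult continuous_on_diff continuous_on_const U_continuous cs[OF U_continuous])
  ultimately show ?thesis using continuous_AE_nonneg[OF _ oH, of "\<lambda>x. (U x - U (?s x)) * (F y - F (?s y))" x] x by simp
qed

lemma h_U_continuous: "continuous_on UNIV (\<lambda>x. h (U x))"
  unfolding h_def using U_pos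
  by (intro continuous_on_add continuous_on_mult continuous_on_const U_continuous continuous_on_powr) (auto simp: less_imp_neq[symmetric])

text \<open>Each function is a convolution of an expression in the other, and convolution with the
  radial kernel commutes with reflections.\<close>

lemma U_symmetric_F_symmetric:
  assumes e: "norm e = 1"
  shows "(\<forall>x. U (reflect e c x) = U x) \<longleftrightarrow> (\<forall>x. F (reflect e c x) = F x)"
proof
  assume "\<forall>x. U (reflect e c x) = U x"
  then have "(\<lambda>y. h (U (reflect e c y))) = (\<lambda>y. h (U y))" by simp
  moreover have "R (\<lambda>y. h (U y)) (reflect e c x) = R (\<lambda>y. h (U (reflect e c y))) x" for x
    by (rule conv_bessel_reflect[OF e]) measurable
  ultimately show "\<forall>x. F (reflect e c x) = F x" by (simp add: F_def)
next
  assume "\<forall>x. F (reflect e c x) = F x"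
  then have "(\<lambda>y. F (reflect e c y)) = F" by auto
  moreover have "R F (reflect e c x) = R (\<lambda>y. F (reflect e c y)) x" for x
    by (rule conv_bessel_reflect[OF e]) measurable
  ultimately show "\<forall>x. U (reflect e c x) = U x" by (simp add: U_eq)
qed

text \<open>One strict inequality for \<open>U\<close> orders \<open>F\<close> on the half space by
  \<open>reflect_same_sign\<close>. Since \<open>F\<close> is not symmetric, it is strict somewhere;
  the kernel spreads strictness to \<open>U\<close> everywhere, then monotone \<open>h\<close> and
  the kernel carry it back to \<open>F\<close>.\<close>

lemma reflect_less:
  assumes e: "norm e = 1" and x1: "c < x1 \<bullet> e" "U (reflect e c x1) < U x1" and x: "c < x \<bullet> e"
  shows "U (reflect e c x) < U x" and "F (reflect e c x) < F x"
proof -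
  let ?s = "reflect e c"
  obtain M where M: "\<And>x. \<bar>U x\<bar> \<le> M" "\<And>x. \<bar>F x\<bar> \<le> M" "\<And>x. \<bar>h (U x)\<bar> \<le> M" using bounded_ex by blast
  have Fle: "F (?s y) \<le> F y" if "c < y \<bullet> e" for y
    using reflect_same_sign[OF e x1(1) that] x1(2) by (simp add: zero_le_mult_iff)
  have "\<exists>y. c < y \<bullet> e \<and> F (?s y) < F y"
  proof (rule ccontr)
    assume "\<nexists>y. c < y \<bullet> e \<and> F (?s y) < F y"
    then have eq: "F (?s y) = F y" if "c < y \<bullet> e" for y using Fle[OF that] that by force
    have "F (?s y) = F y" for y
    proof (cases "y \<bullet> e" c rule: linorder_cases)
      case less
      then show ?thesis using eq[of "?s y"] reflect_inner[OF e, of c y] reflect_reflect[OF e, of c y] by simp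
    next
      case equal
      then show ?thesis by (simp add: reflect_def)
    qed (rule eq)
    then have "U (?s x1) = U x1" using U_symmetric_F_symmetric[OF e, of c] by blast
    then show False using x1 by simp
  qed
  then obtain y where y: "c < y \<bullet> e" "F (?s y) < F y" by blast
  have Ul: "U (?s x) < U x" if "c < x \<bullet> e" for x
    using conv_bessel_reflect_less[OF e b_pos F_continuous M(2) Fle that y] by (simp flip: U_eq)
  then show "U (?s x) < U x" using x .
  have "h (U (?s y)) < h (U y)" if "c < y \<bullet> e" for y using Ul[OF that] U_nonneg by (intro h_strict_mono) auto
  then show "F (?s x) < F x"
    using conv_bessel_reflect_less[OF e b_pos h_U_continuous M(3) _ x y(1)] y(1) unfolding F_def by (simp add: less_imp_le)
qed

text \<open>The position of the maximum point decides which half space carries the larger values,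
  once symmetry is excluded.\<close>

lemma reflect_max:
  assumes e: "norm e = 1" and max: "\<And>x. U x \<le> U x0" and x0: "c < x0 \<bullet> e" and ns: "U (reflect e c y) \<noteq> U y" and x: "c < x \<bullet> e"
  shows "U (reflect e c x) < U x" and "F (reflect e c x) < F x"
proof -
  let ?s = "reflect e c"
  have pos: "\<exists>z. c < z \<bullet> e \<and> U (?s z) \<noteq> U z"
  proof (cases "y \<bullet> e" c rule: linorder_cases)
    case less
    then show ?thesis using ns reflect_inner[OF e, of c y] reflect_reflect[OF e, of c y] by (intro exI[of _ "?s y"]) auto
  next
    case equal
    then show ?thesis using ns by (simp add: reflect_def)
  qed (use ns in auto)
  then obtain z where z: "c < z \<bullet> e" "U (?s z) \<noteq> U z" by blast
  \<comment> \<open>With the opposite order, \<open>reflect_less\<close> for the other half space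
    would make \<open>U\<close> at the mirror image of \<open>x0\<close> exceed the maximum.\<close>
  have "U (?s z) < U z"
  proof (rule ccontr)
    assume "\<not> U (?s z) < U z"
    then have "U (reflect (- e) (- c) (?s z)) < U (?s z)"
      using z by (simp add: reflect_uminus reflect_reflect[OF e])
    then have "U (reflect (- e) (- c) (?s x0)) < U (?s x0)"
      by (rule reflect_less(1)[of "- e" "- c" "?s z" "?s x0", rotated 2])
         (use e z(1) x0 reflect_inner[OF e, of c z] reflect_inner[OF e, of c x0] in auto)
    then show False using max[of "?s x0"] by (simp add: reflect_uminus reflect_reflect[OF e])
  qed
  then show "U (?s x) < U x" "F (?s x) < F x" using reflect_less[OF e z(1) _ x] by auto
qed

text \<open>Symmetry in a hyperplane not through the maximum point \<open>x0\<close> produces a second maximum point,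
  hence symmetry in all parallel hyperplanes between the two, hence a period.\<close>

lemma symmetric_at_max:
  assumes e: "norm e = 1" and max: "\<And>x. U x \<le> U x0" and sym: "\<And>x. U (reflect e c x) = U x"
  shows "\<not> c < x0 \<bullet> e"
proof
  assume x0: "c < x0 \<bullet> e"
  define d where "d = x0 \<bullet> e - c"
  \<comment> \<open>Along \<open>e\<close>, the second maximum point \<open>x1\<close> lies at
    \<open>c - d\<close> and \<open>x0\<close> at \<open>c + d\<close>, so the hyperplane at height
    \<open>t\<close> separates them and differs from the one at \<open>c\<close>.\<close>
  define t where "t = c + d / 2"
  have d: "0 < d" using x0 by (simp add: d_def)
  have ee: "e \<bullet> e = 1" using e by (simp add: norm_eq_1)
  define x1 where "x1 = reflect e c x0"
  have x1: "U x1 = U x0" using sym by (simp add: x1_def)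
  have x1e: "x1 \<bullet> e < t" using reflect_inner[OF e, of c x0] d by (simp add: x1_def t_def d_def)
  have x0t: "t < x0 \<bullet> e" using d by (simp add: t_def d_def field_simps)
  \<comment> \<open>Without symmetry the side of \<open>x0\<close> would be strictly larger, whereas
    the mirror image of the maximum point \<open>x1\<close> lies on that side.\<close>
  have symt: "U (reflect e t y) = U y" for y
  proof (rule ccontr)
    assume ns: "U (reflect e t y) \<noteq> U y"
    have "t < reflect e t x1 \<bullet> e" using reflect_inner[OF e, of t x1] x1e by simp
    from reflect_max(1)[OF e max x0t ns this]
    show False using x1 max[of "reflect e t x1"] by (simp add: reflect_reflect[OF e])
  qed
  \<comment> \<open>Two reflections in parallel hyperplanes at distance \<open>d / 2\<close> compose
    to a translation by \<open>d\<close>.\<close>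
  have per: "U (x + d *\<^sub>R e) = U x" for x
  proof -
    have "reflect e t (reflect e c x) = x + d *\<^sub>R e"
      using ee by (simp add: reflect_def t_def inner_diff_left algebra_simps flip: scaleR_add_left)
    then show ?thesis using symt[of "reflect e c x"] sym[of x] by simp
  qed
  have "U ((real n * d) *\<^sub>R e) = U 0" for n
  proof (induction n)
    case (Suc n)
    have "(real (Suc n) * d) *\<^sub>R e = (real n * d) *\<^sub>R e + d *\<^sub>R e" by (simp add: algebra_simps)
    then show ?case using per[of "(real n * d) *\<^sub>R e"] Suc by simp
  qed simp
  moreover obtain r where r: "\<And>x. r < norm x \<Longrightarrow> U x < U 0" using U_vanishes[OF U_pos[of 0]] by blast
  obtain n :: nat where "r / d < real n" using reals_Archimedean2 by blast
  then have "r < norm ((real n * d) *\<^sub>R e)" using d e by (simp add: pos_divide_less_eq)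
  ultimately show False using r[of "(real n * d) *\<^sub>R e"] by simp
qed

lemma radially_decreasing:
  assumes max: "\<And>x. U x \<le> U x0" and lt: "norm (x - x0) < norm (y - x0)"
  shows "U y < U x" and "F y < F x"
proof -
  define e where "e = (x - y) /\<^sub>R norm (x - y)"
  have n: "0 < norm (x - y)" using lt by auto
  have e: "norm e = 1" using n by (simp add: e_def)
  \<comment> \<open>The hyperplane through the midpoint orthogonal to \<open>x - y\<close>, so that
    reflection takes \<open>x\<close> to \<open>y\<close>; \<open>x0\<close>, being closer to
    \<open>x\<close>, lies on the side of \<open>x\<close>.\<close>
  define c where "c = ((x + y) /\<^sub>R 2) \<bullet> e"
  have xc: "x \<bullet> e - c = norm (x - y) / 2"
  proof -
    have "x \<bullet> e - c = ((x - y) \<bullet> e) / 2" by (simp add: c_def inner_add_left inner_diff_left field_simps)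
    also have "(x - y) \<bullet> e = norm (x - y)"
      using n by (simp add: e_def power2_norm_eq_inner[symmetric] power2_eq_square)
    finally show ?thesis .
  qed
  have s: "reflect e c x = y" unfolding reflect_def xc using n by (simp add: e_def)
  have x: "c < x \<bullet> e" using xc n by linarith
  have "norm (x0 - x) < norm (x0 - reflect e c x)" using lt by (simp add: s norm_minus_commute)
  then have "0 < (x0 \<bullet> e - c) * (x \<bullet> e - c)" using norm_less_reflect_iff(1)[OF e, where x = x0 and y = x and c = c] by simp
  then have x0: "c < x0 \<bullet> e" using x by (simp add: zero_less_mult_iff)
  obtain z where z: "U (reflect e c z) \<noteq> U z" using symmetric_at_max[OF e max, of c] x0 by blast
  show "U y < U x" "F y < F x" using reflect_max[OF e max x0 z x] by (simp_all add: s)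
qed

text \<open>Strict monotonicity compares only different distances. Pushing \<open>y\<close> slightly
  outward and letting the factor decrease to 1 gives one inequality by continuity, and exchanging
  the points gives the other.\<close>

lemma U_radial:
  assumes max: "\<And>x. U x \<le> U x0" and eq: "norm (x - x0) = norm (y - x0)"
  shows "U x = U y"
proof -
  have le: "U y \<le> U x" if eq: "norm (x - x0) = norm (y - x0)" and y: "y \<noteq> x0" for x y
  proof -
    have "continuous_on UNIV (\<lambda>r. U (x0 + r *\<^sub>R (y - x0)))"
      by (rule continuous_on_compose2[OF U_continuous]) (auto intro!: continuous_intros)
    then have "isCont (\<lambda>r. U (x0 + r *\<^sub>R (y - x0))) 1" by (simp add: continuous_on_eq_continuous_at)
    then have "((\<lambda>r. U (x0 + r *\<^sub>R (y - x0))) \<longlongrightarrow> U y) (at_right 1)"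
      using filterlim_at_split[of _ _ "1 :: real"] by (auto simp: isCont_def)
    moreover have "\<forall>\<^sub>F r in at_right 1. U (x0 + r *\<^sub>R (y - x0)) \<le> U x"
      using eventually_at_right_less[of 1]
    proof eventually_elim
      case (elim r)
      have "1 * norm (y - x0) < r * norm (y - x0)" using y elim by (intro mult_strict_right_mono) auto
      then have "norm (x - x0) < norm (x0 + r *\<^sub>R (y - x0) - x0)" using elim eq by simp
      then show ?case using radially_decreasing(1)[OF max] by (simp add: less_imp_le)
    qed
    ultimately show ?thesis by (rule tendsto_upperbound) simp
  qed
  show ?thesis
  proof (cases "y = x0")
    case False
    then show ?thesis using le[of x y] le[of y x] eq by (metis antisym eq_iff_diff_eq_0 norm_eq_zero)
  qed (use eq in simp)
qed

end

section \<open>Schwarz symmetrization and the radial derivative\<close>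

text \<open>The gradient kernel is odd under reflection in the hyperplane through 0 orthogonal to
  \<open>e\<close>. Pairing mirror points leaves a difference of two values of \<open>G\<close>, and
  the point \<open>r *\<^sub>R e\<close> sees the nearer side with the larger value.\<close>

lemma grad_conv_neg:
  fixes G :: "'a::euclidean_space \<Rightarrow> real"
  assumes e: "norm e = 1" and b: "0 < b" and r: "0 < r" and [measurable]: "G \<in> borel_measurable borel" and M: "\<And>x. \<bar>G x\<bar> \<le> M"
    and dec: "\<And>x y. norm x < norm y \<Longrightarrow> G y < G x"
  shows "grad_conv b e G (r *\<^sub>R e) < 0"
proof -
  let ?s = "reflect e 0" and ?x = "r *\<^sub>R e"
  define \<Phi> where "\<Phi> z = grad_heat b e z * G (?x - snd z)" for z
  have [measurable]: "\<Phi> \<in> borel_measurable (borel \<Otimes>\<^sub>M borel)" unfolding \<Phi>_def by measurable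
  have i: "integrable (lborel \<Otimes>\<^sub>M lborel) \<Phi>" unfolding \<Phi>_def by (rule grad_conv_integrable[OF e b _ M]) measurable
  note \<Phi>r = integral_pair_reflect_snd[OF e, of \<Phi> 0]
  \<comment> \<open>The Gaussian factor is invariant under the reflection and the factor
    \<open>w \<bullet> e\<close> changes sign.\<close>
  have gr: "grad_heat b e (t, ?s w) = - grad_heat b e (t, w)" for t w
  proof -
    have "norm (?s w) = norm w" using norm_reflect_diff[OF e, of 0 w 0] by (simp add: reflect_def)
    then have "res_heat b t (?s w) = res_heat b t w" by (simp add: res_heat_def heat_def)
    then show ?thesis using reflect_inner[OF e, of 0 w] by (simp add: grad_heat_def)
  qed
  define H where "H z = - (\<Phi> z + \<Phi> (fst z, ?s (snd z)))" for z
  have H_eq: "H (t, w) = - grad_heat b e (t, w) * (G (?x - w) - G (?x - ?s w))" for t w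
    by (simp add: H_def \<Phi>_def gr algebra_simps)
  have g_neg: "grad_heat b e (t, w) < 0" if "0 < t" "0 < w \<bullet> e" for t w
  proof -
    have "0 < res_heat b t w" using that(1) heat_pos[of t w] by (simp add: res_heat_def)
    then show ?thesis using that by (simp add: grad_heat_def divide_less_0_iff mult_less_0_iff)
  qed
  have G_less: "G (?x - ?s w) < G (?x - w)" if "0 < w \<bullet> e" for w
    using norm_less_reflect_iff(1)[OF e, where x = ?x and y = w and c = 0] that r e
    by (intro dec) (simp add: norm_eq_1)
  have pos: "0 < H (t, w)" if "0 < t" "0 < w \<bullet> e" for t w
    unfolding H_eq using g_neg[OF that] G_less[OF that(2)] by (intro mult_pos_pos) auto
  have nn: "0 \<le> H (t, w)" for t w
  proof (cases "w \<bullet> e" "0 :: real" rule: linorder_cases)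
    case equal
    then show ?thesis by (simp add: H_eq reflect_def)
  next
    case greater
    then show ?thesis using pos[of t w] by (cases "0 < t") (auto simp: H_eq grad_heat_def res_heat_def)
  next
    case less
    have "H (t, ?s w) = H (t, w)" by (simp add: H_eq gr reflect_reflect[OF e] algebra_simps)
    moreover have "0 < ?s w \<bullet> e" using less reflect_inner[OF e, of 0 w] by simp
    then have "0 \<le> H (t, ?s w)"
      using pos[of t "?s w"] by (cases "0 < t") (simp add: less_imp_le, simp add: H_eq grad_heat_def res_heat_def)
    ultimately show ?thesis by simp
  qed
  have Hi: "integrable (lborel \<Otimes>\<^sub>M lborel) H" unfolding H_def using i \<Phi>r by simp
  \<comment> \<open>An open set of space-time on which \<open>H\<close> is strictly positive; it
    contains \<open>(1, e)\<close> and hence has positive measure.\<close>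
  define A where "A = {z :: real \<times> 'a. 0 < fst z} \<inter> {z. 0 < snd z \<bullet> e}"
  have A: "open A" unfolding A_def by (intro open_Int open_Collect_less continuous_intros)
  have "(1, e) \<in> A" using e by (simp add: A_def norm_eq_1)
  then have "emeasure (lborel \<Otimes>\<^sub>M lborel) A \<noteq> 0"
    using emeasure_lborel_open_nonzero[OF A] by (auto simp: lborel_prod)
  moreover have "A \<in> sets (lborel \<Otimes>\<^sub>M lborel)" unfolding lborel_prod using A by simp
  ultimately have "0 < integral\<^sup>L (lborel \<Otimes>\<^sub>M lborel) H"
    using pos nn by (intro integral_pos_of_pos_on[OF Hi]) (auto simp: A_def)
  also have "integral\<^sup>L (lborel \<Otimes>\<^sub>M lborel) H = - 2 * integral\<^sup>L (lborel \<Otimes>\<^sub>M lborel) \<Phi>"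
    unfolding H_def using i \<Phi>r by simp
  finally show ?thesis by (simp add: grad_conv_def flip: \<Phi>_def)
qed

text \<open>Superlevel sets of \<open>V\<close> are open and radial, so comparing their volume with
  that of the ball through \<open>x\<close> decides membership of \<open>x\<close>. Openness gives
  the strict inequality that \<open>ball_rearrangement\<close> asks for.\<close>

lemma schwarz_symmetrization_radially_decreasing:
  fixes V :: "real ^ 'n \<Rightarrow> real"
  assumes V: "continuous_on UNIV V" and V0: "\<And>x. 0 < V x"
    and dec: "\<And>x y. norm x < norm y \<Longrightarrow> V y < V x" and rad: "\<And>x y. norm x = norm y \<Longrightarrow> V x = V y"
  shows "schwarz_symmetrization V x = ennreal (V x)"
proof -
  have Vm: "V \<in> borel_measurable borel" by (rule borel_measurable_continuous_onI[OF V])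
  have iff: "ennreal t < schwarz_symmetrization V x \<longleftrightarrow> t < V x" if t: "0 \<le> t" for t
    unfolding less_schwarz_symmetrization_iff[OF Vm t]
  proof
    let ?A = "{y. t < V y}"
    have A: "open ?A" by (intro open_Collect_less V continuous_intros)
    assume tV: "t < V x"
    then obtain d where d: "0 < d" "ball x d \<subseteq> ?A" using A unfolding open_contains_ball by blast
    \<comment> \<open>An outward direction at \<open>x\<close>, any unit vector at the origin;
      moving \<open>d / 2\<close> along it reaches a larger norm without leaving the superlevel
      set.\<close>
    obtain e where e: "norm e = 1" "norm (x + (d / 2) *\<^sub>R e) = norm x + d / 2"
    proof (cases "x = 0")
      case True
      then show ?thesis using that[of "axis undefined 1"] d(1) by simp
    next
      case False
      have "x + (d / 2) *\<^sub>R sgn x = (1 + d / 2 / norm x) *\<^sub>R x"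
        by (simp only: sgn_div_norm scaleR_scaleR scaleR_add_left scaleR_one divide_inverse)
      also have "norm \<dots> = norm x + d / 2" using False d(1) by (simp add: field_simps)
      finally show ?thesis using that[of "sgn x"] False by (simp add: norm_sgn)
    qed
    define y where "y = x + (d / 2) *\<^sub>R e"
    have ny: "norm x < norm y" using e d(1) by (simp add: y_def)
    have "y \<in> ball x d" using e(1) d(1) by (simp add: y_def dist_norm)
    then have "t < V y" using d(2) by blast
    then have "t < V z" if "norm z < norm y" for z using dec[OF that] by simp
    then have "ball 0 (norm y) \<subseteq> ?A" by auto
    then have "emeasure lborel (ball (0 :: real ^ 'n) (norm y)) \<le> emeasure lborel ?A"
      using A by (intro emeasure_mono) auto
    moreover have "unit_ball_vol (real CARD('n)) * norm x ^ CARD('n) < unit_ball_vol (real CARD('n)) * norm y ^ CARD('n)"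
      using ny by (intro mult_strict_left_mono power_strict_mono) auto
    then have "emeasure lborel (ball (0 :: real ^ 'n) (norm x)) < emeasure lborel (ball (0 :: real ^ 'n) (norm y))"
      by (simp add: emeasure_ball ennreal_less_iff)
    ultimately show "x \<in> ball_rearrangement ?A" by (simp add: ball_rearrangement_def)
  next
    assume x: "x \<in> ball_rearrangement {y. t < V y}"
    show "t < V x"
    proof (rule ccontr)
      assume n: "\<not> t < V x"
      have "{y. t < V y} \<subseteq> ball 0 (norm x)"
      proof
        fix y assume "y \<in> {y. t < V y}"
        then have "V x < V y" using n by simp
        then have "\<not> norm x < norm y" "norm x \<noteq> norm y" using dec[of x y] rad[of x y] by auto
        then show "y \<in> ball 0 (norm x)" by simp
      qed
      then have "emeasure lborel {y. t < V y} \<le> emeasure lborel (ball (0 :: real ^ 'n) (norm x))"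
        by (intro emeasure_mono) auto
      then show False using x by (simp add: ball_rearrangement_def)
    qed
  qed
  show ?thesis
  proof (cases "schwarz_symmetrization V x" "ennreal (V x)" rule: linorder_cases)
    case less
    then obtain t where t: "0 \<le> t" "schwarz_symmetrization V x = ennreal t"
      by (cases "schwarz_symmetrization V x") auto
    then have "t < V x" using less by (simp add: ennreal_less_iff)
    then show ?thesis using iff[OF t(1)] t(2) by simp
  next
    case greater
    then show ?thesis using iff[of "V x"] V0[of x] by simp
  qed
qed

context profile
begin

text \<open>Translation makes \<open>x0\<close> the origin and commutes with the convolution, so the
  translate of \<open>U\<close> is the convolution of the kernel with the translate of
  \<open>F\<close>, strictly radially decreasing about 0.\<close>

lemma radial_derivative:
  assumes max: "\<And>x. U x \<le> U x0" and x: "x \<noteq> 0"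
  shows "\<exists>D<0. has_radial_derivative (\<lambda>y. U (y + x0)) D x"
proof -
  obtain M where M: "\<And>x. \<bar>F x\<bar> \<le> M" using bounded_ex by blast
  define G where "G y = F (y + x0)" for y
  have G: "continuous_on UNIV G" unfolding G_def
    by (rule continuous_on_compose2[OF F_continuous]) (auto intro!: continuous_intros)
  have [measurable]: "G \<in> borel_measurable borel" by (rule borel_measurable_continuous_onI[OF G])
  have GM: "\<bar>G x\<bar> \<le> M" for x by (simp add: G_def M)
  have UG: "U (y + x0) = R G y" for y
    using integral_lborel_plus[of "\<lambda>z. bessel b (y + x0 - z) * F z" x0]
    by (simp add: U_eq conv_def G_def add.commute)
  have e: "norm (sgn x) = 1" using x by (simp add: norm_sgn)
  have "((\<lambda>s. R G (s *\<^sub>R sgn x)) has_real_derivative grad_conv b (sgn x) G (norm x *\<^sub>R sgn x)) (at (norm x))"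
    using x by (intro conv_bessel_deriv[OF e b_pos G GM]) auto
  moreover have "G z < G y" if "norm y < norm z" for y z
    unfolding G_def using that by (intro radially_decreasing(2)[OF max]) simp
  then have "grad_conv b (sgn x) G (norm x *\<^sub>R sgn x) < 0"
    using x by (intro grad_conv_neg[OF e b_pos _ _ GM]) auto
  ultimately show ?thesis unfolding has_radial_derivative_def UG by blast
qed

end

text \<open>The middle conjunct ensures that the last one, which quantifies over every normalized
  profile, is not vacuous.\<close>

theorem theorem3p9:
  fixes \<sigma> \<alpha> \<beta> :: real and u :: "real ^ 'n \<Rightarrow> complex"
  assumes "\<sigma> > 0"
    and "CARD('n) \<ge> 5 \<longrightarrow> \<sigma> < 4 / (real CARD('n) - 4)"
    and "\<alpha> > 0"
    and "\<beta> > 2 * sqrt \<alpha>"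
    and "is_minimizer \<sigma> \<beta> \<alpha> u"
  shows "(\<exists>\<tau> (U :: real ^ 'n \<Rightarrow> real).
            (AE x in lborel. u x = exp (\<i> * of_real \<tau>) * of_real (U x)) \<and>
            ((\<forall>x. 0 \<le> U x) \<or> (\<forall>x. U x \<le> 0))) \<and>
         (\<exists>\<tau> x\<^sub>0 U. normalized_profile u \<tau> x\<^sub>0 U) \<and>
         (\<forall>\<tau> x\<^sub>0 U. normalized_profile u \<tau> x\<^sub>0 U \<longrightarrow>
            (\<forall>x. ennreal (U x) = schwarz_symmetrization U x) \<and>
            (\<forall>x. x \<noteq> 0 \<longrightarrow> (\<exists>D<0. has_radial_derivative U D x)))"
proof -
  interpret minimizer \<sigma> \<beta> \<alpha> u by unfold_locales fact+
  obtain f \<tau> where f: "sq_integrable f" "\<And>x. 0 \<le> f x" "\<not> (AE x in lborel. f x = 0)"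
    and u: "AE x in lborel. u x = exp (\<i> * of_real \<tau>) * of_real (R f x)"
    and f': "(LINT x|lborel. \<bar>R f x\<bar> powr p) = 1" "E f = m"
    by (rule positive_profile) blast
  interpret profile \<sigma> \<beta> \<alpha> u f by unfold_locales (use assms(2) f f' in auto)
  have u: "AE x in lborel. u x = exp (\<i> * of_real \<tau>) * of_real (U x)" using u by (simp add: U_def)
  obtain x0 where x0: "\<And>x. U x \<le> U x0" using U_max by blast
  have sh: "continuous_on UNIV (\<lambda>x. V (x + a))" if "continuous_on UNIV V" for V :: "real ^ 'n \<Rightarrow> real" and a
    by (rule continuous_on_compose2[OF that]) (auto intro!: continuous_intros)
  have "normalized_profile u \<tau> x0 (\<lambda>x. U (x + x0))"
    unfolding normalized_profile_def using u x0 U_pos sh[OF U_continuous] by simp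
  moreover have "(\<forall>x. ennreal (V x) = schwarz_symmetrization V x) \<and>
      (\<forall>x. x \<noteq> 0 \<longrightarrow> (\<exists>D<0. has_radial_derivative V D x))" if np: "normalized_profile u \<tau>' x1 V" for \<tau>' x1 V
  proof -
    have V: "continuous_on UNIV V" "\<And>x. 0 < V x" "\<And>x. V x \<le> V 0"
      and uV: "AE x in lborel. u x = exp (\<i> * of_real \<tau>') * of_real (V (x - x1))"
      using np by (auto simp: normalized_profile_def)
    \<comment> \<open>Taking moduli removes both phases, so any normalized profile is a translate of
      \<open>U\<close>, first almost everywhere and then everywhere by continuity. Its centre
      \<open>x1\<close> is thereby a maximum point of \<open>U\<close>, and the symmetry results
      apply about it.\<close>
    have "AE x in lborel. V (x - x1) = U x"
      using u uV
    proof eventually_elim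
      case (elim x)
      then have "norm (exp (\<i> * of_real \<tau>) * complex_of_real (U x)) = norm (exp (\<i> * of_real \<tau>') * complex_of_real (V (x - x1)))" by simp
      then show ?case using U_nonneg[of x] V(2)[of "x - x1"] by (simp add: norm_mult)
    qed
    then have eq: "(\<lambda>x. V (x - x1)) = U"
      by (rule continuous_AE_eq[OF sh[OF V(1), of "- x1", simplified] U_continuous])
    then have UV: "U x = V (x - x1)" for x by (simp add: fun_eq_iff)
    have max: "U x \<le> U x1" for x using V(3) by (simp add: UV)
    have VU: "V = (\<lambda>x. U (x + x1))" by (simp add: UV)
    have dec: "V y < V x" if "norm x < norm y" for x y
      unfolding VU using that by (intro radially_decreasing(1)[OF max]) simp
    have rad: "V x = V y" if "norm x = norm y" for x y
      unfolding VU using that by (intro U_radial[OF max]) simp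
    show ?thesis
      using schwarz_symmetrization_radially_decreasing[OF V(1,2) dec rad] radial_derivative[OF max]
      unfolding VU by simp
  qed
  ultimately show ?thesis using u U_nonneg by blast
qed

end
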